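(* Let $\theta$ be an irrational real number, $q=e^{2\pi i\theta}$, and let $\tau$ be a complex number in the lower half plane. The base change functor $\psi_*:\mathcal{B}_q^\tau\to\mathsf{Vect}(\mathbb{T}_\theta^\tau)$ induced by the homomorphism $\psi:\mathcal{O}(\mathbb{C}^* )\to\mathcal{A}_\theta$, $\sum_nf_nz^n\mapsto\sum_nf_nU_1^n$, is exact and faithful.
   Context: $\mathcal{O}(\mathbb{C}^* )$ is the ring of holomorphic functions on $\mathbb{C}^*$. It carries the action $\alpha$ of $\theta\mathbb{Z}\simeq\mathbb{Z}$ whose generator acts by $\alpha(f)(z)=f(qz)$, and the derivation $\delta=\tau z\frac{d}{dz}$. The category $\mathcal{B}_q^\tau$ has as objects triples $(M,\sigma,\nabla)$ where $M$ is a finitely presentable $\mathcal{O}(\mathbb{C}^* )$-module; $\sigma$ is a representation of $\theta\mathbb{Z}$ on $M$ (given by an invertible operator $\sigma$ for the generator) with $\sigma(mf)=\sigma(m)\alpha(f)$; $\nabla:M\to M$ is a $\mathbb{C}$-linear map with $\nabla(mf)=\nabla(m)f+m\,\delta(f)$ and $\nabla\sigma=\sigma\nabla$; and $\nabla$ is regular singular: there is a module basis $\{e_i\}$ of $M$ for which the functions $z^{-1}A_{ij}$, where $\nabla(e_i)=\sum_jA_{ij}e_j$, have at most simple poles at $0$. (The modules $M$ are automatically free.) Morphisms are $\mathcal{O}(\mathbb{C}^* )$-module maps commuting with the $\sigma$'s and $\nabla$'s. $\mathcal{A}_\theta$ is the algebra of sums $\sum_{(n_1,n_2)\in\mathbb{Z}^2}a_{n_1,n_2}U_1^{n_1}U_2^{n_2}$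 with rapidly decreasing complex coefficients, $U_1,U_2$ unitaries with $U_2U_1=e^{2\pi i\theta}U_1U_2$. Its basic derivations are determined by $\delta_j(U_i)=2\pi i\,\delta_{ij}U_i$ (Kronecker delta on the right), and $\delta_\tau=\tau\delta_1+\delta_2$. $\mathsf{Vect}(\mathbb{T}_\theta^\tau)$ is the category of pairs $(E,\nabla)$ with $E$ a finitely generated projective right $\mathcal{A}_\theta$-module and $\nabla:E\to E$ $\mathbb{C}$-linear with $\nabla(ea)=\nabla(e)a+e\,\delta_\tau(a)$; morphisms are module maps commuting with the $\nabla$'s (this category is known to be abelian). The functor $\psi_*$ sends $(M,\sigma,\nabla)$ to $(M\otimes_{\mathcal{O}(\mathbb{C}^* )}\mathcal{A}_\theta,\ 2\pi i\,\nabla\otimes1+1\otimes\delta_\tau)$, where $\mathcal{A}_\theta$ is an $\mathcal{O}(\mathbb{C}^* )$-module via $\psi$, and a morphism $\phi$ to $\phi\otimes1$. *)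

theory Defs
  imports
    "HOL-Complex_Analysis.Complex_Analysis"
    "HOL-Algebra.Free_Abelian_Groups"
    "HOL-Algebra.Generated_Groups"
    "HOL-Algebra.Module"
begin

section \<open>Preadditive categories and exact functors\<close>

record ('o, 'f) precat =
  obj :: "'o set"
  mor :: "'o \<Rightarrow> 'o \<Rightarrow> 'f set"
  idm :: "'o \<Rightarrow> 'f"
  cmp :: "'o \<Rightarrow> 'o \<Rightarrow> 'o \<Rightarrow> 'f \<Rightarrow> 'f \<Rightarrow> 'f"
  zerom :: "'o \<Rightarrow> 'o \<Rightarrow> 'f"
  addm :: "'o \<Rightarrow> 'o \<Rightarrow> 'f \<Rightarrow> 'f \<Rightarrow> 'f"

text \<open>The composite \<open>cmp C X Y Z g f\<close> is ``first \<open>f : X \<rightarrow> Y\<close>, then \<open>g : Y \<rightarrow> Z\<close>''.\<close>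

definition mor_group :: "('o, 'f) precat \<Rightarrow> 'o \<Rightarrow> 'o \<Rightarrow> 'f monoid" where
  "mor_group C X Y = \<lparr>carrier = mor C X Y, monoid.mult = addm C X Y, one = zerom C X Y\<rparr>"

locale preadditive_category =
  fixes C :: "('o, 'f) precat"
  assumes idm_mor: "X \<in> obj C \<Longrightarrow> idm C X \<in> mor C X X"
    and cmp_mor: "\<lbrakk>X \<in> obj C; Y \<in> obj C; Z \<in> obj C; f \<in> mor C X Y; g \<in> mor C Y Z\<rbrakk>
      \<Longrightarrow> cmp C X Y Z g f \<in> mor C X Z"
    and cmp_idm_right: "\<lbrakk>X \<in> obj C; Y \<in> obj C; f \<in> mor C X Y\<rbrakk> \<Longrightarrow> cmp C X X Y f (idm C X) = f"
    and cmp_idm_left: "\<lbrakk>X \<in> obj C; Y \<in> obj C; f \<in> mor C X Y\<rbrakk> \<Longrightarrow> cmp C X Y Y (idm C Y) f = f"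
    and cmp_assoc: "\<lbrakk>W \<in> obj C; X \<in> obj C; Y \<in> obj C; Z \<in> obj C;
        f \<in> mor C W X; g \<in> mor C X Y; h \<in> mor C Y Z\<rbrakk>
      \<Longrightarrow> cmp C W Y Z h (cmp C W X Y g f) = cmp C W X Z (cmp C X Y Z h g) f"
    and mor_comm_group: "\<lbrakk>X \<in> obj C; Y \<in> obj C\<rbrakk> \<Longrightarrow> comm_group (mor_group C X Y)"
    and cmp_add_left: "\<lbrakk>X \<in> obj C; Y \<in> obj C; Z \<in> obj C;
        f \<in> mor C X Y; g \<in> mor C Y Z; g' \<in> mor C Y Z\<rbrakk>
      \<Longrightarrow> cmp C X Y Z (addm C Y Z g g') f = addm C X Z (cmp C X Y Z g f) (cmp C X Y Z g' f)"
    and cmp_add_right: "\<lbrakk>X \<in> obj C; Y \<in> obj C; Z \<in> obj C;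
        f \<in> mor C X Y; f' \<in> mor C X Y; g \<in> mor C Y Z\<rbrakk>
      \<Longrightarrow> cmp C X Y Z g (addm C X Y f f') = addm C X Z (cmp C X Y Z g f) (cmp C X Y Z g f')"

definition is_kernel :: "('o, 'f) precat \<Rightarrow> 'o \<Rightarrow> 'o \<Rightarrow> 'o \<Rightarrow> 'f \<Rightarrow> 'f \<Rightarrow> bool" where
  "is_kernel C X Y Z f g \<longleftrightarrow>
     f \<in> mor C X Y \<and> g \<in> mor C Y Z \<and> cmp C X Y Z g f = zerom C X Z \<and>
     (\<forall>W\<in>obj C. \<forall>h\<in>mor C W Y. cmp C W Y Z g h = zerom C W Z \<longrightarrow>
        (\<exists>!k. k \<in> mor C W X \<and> cmp C W X Y f k = h))"

definition is_cokernel :: "('o, 'f) precat \<Rightarrow> 'o \<Rightarrow> 'o \<Rightarrow> 'o \<Rightarrow> 'f \<Rightarrow> 'f \<Rightarrow> bool" where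
  "is_cokernel C X Y Z f g \<longleftrightarrow>
     f \<in> mor C X Y \<and> g \<in> mor C Y Z \<and> cmp C X Y Z g f = zerom C X Z \<and>
     (\<forall>W\<in>obj C. \<forall>h\<in>mor C Y W. cmp C X Y W h f = zerom C X W \<longrightarrow>
        (\<exists>!k. k \<in> mor C Z W \<and> cmp C Y Z W k g = h))"

text \<open>\<open>0 \<rightarrow> X \<rightarrow> Y \<rightarrow> Z \<rightarrow> 0\<close> is exact, in the sense internal to the category.\<close>

definition short_exact :: "('o, 'f) precat \<Rightarrow> 'o \<Rightarrow> 'o \<Rightarrow> 'o \<Rightarrow> 'f \<Rightarrow> 'f \<Rightarrow> bool" where
  "short_exact C X Y Z f g \<longleftrightarrow>
     X \<in> obj C \<and> Y \<in> obj C \<and> Z \<in> obj C \<and> is_kernel C X Y Z f g \<and> is_cokernel C X Y Z f g"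

locale additive_functor =
  C: preadditive_category C + D: preadditive_category D
  for C :: "('o, 'f) precat" and D :: "('p, 'g) precat" +
  fixes Fo :: "'o \<Rightarrow> 'p" and Fm :: "'o \<Rightarrow> 'o \<Rightarrow> 'f \<Rightarrow> 'g"
  assumes Fo_obj: "X \<in> obj C \<Longrightarrow> Fo X \<in> obj D"
    and Fm_mor: "\<lbrakk>X \<in> obj C; Y \<in> obj C; f \<in> mor C X Y\<rbrakk> \<Longrightarrow> Fm X Y f \<in> mor D (Fo X) (Fo Y)"
    and Fm_idm: "X \<in> obj C \<Longrightarrow> Fm X X (idm C X) = idm D (Fo X)"
    and Fm_cmp: "\<lbrakk>X \<in> obj C; Y \<in> obj C; Z \<in> obj C; f \<in> mor C X Y; g \<in> mor C Y Z\<rbrakk>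
      \<Longrightarrow> Fm X Z (cmp C X Y Z g f) = cmp D (Fo X) (Fo Y) (Fo Z) (Fm Y Z g) (Fm X Y f)"
    and Fm_add: "\<lbrakk>X \<in> obj C; Y \<in> obj C; f \<in> mor C X Y; g \<in> mor C X Y\<rbrakk>
      \<Longrightarrow> Fm X Y (addm C X Y f g) = addm D (Fo X) (Fo Y) (Fm X Y f) (Fm X Y g)"

definition exact_functor ::
  "('o, 'f) precat \<Rightarrow> ('p, 'g) precat \<Rightarrow> ('o \<Rightarrow> 'p) \<Rightarrow> ('o \<Rightarrow> 'o \<Rightarrow> 'f \<Rightarrow> 'g) \<Rightarrow> bool" where
  "exact_functor C D Fo Fm \<longleftrightarrow> additive_functor C D Fo Fm \<and>
     (\<forall>X Y Z f g. short_exact C X Y Z f g \<longrightarrow>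
        short_exact D (Fo X) (Fo Y) (Fo Z) (Fm X Y f) (Fm Y Z g))"

definition faithful_functor ::
  "('o, 'f) precat \<Rightarrow> ('o \<Rightarrow> 'o \<Rightarrow> 'f \<Rightarrow> 'g) \<Rightarrow> bool" where
  "faithful_functor C Fm \<longleftrightarrow> (\<forall>X\<in>obj C. \<forall>Y\<in>obj C. inj_on (Fm X Y) (mor C X Y))"


section \<open>Modules with connections\<close>

text \<open>The library's \<open>module\<close> locale requires a commutative base ring. For right modules over a
  noncommutative ring we reuse the same record type, writing \<open>r \<odot> x\<close> for the
  product usually written \<open>x r\<close>.\<close>

locale right_module = R?: ring R + M?: abelian_group M
  for R (structure) and M (structure) +
  assumes rsmult_closed: "\<lbrakk>r \<in> carrier R; x \<in> carrier M\<rbrakk> \<Longrightarrow> r \<odot>\<^bsub>M\<^esub> x \<in> carrier M"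
    and rsmult_l_distr: "\<lbrakk>r \<in> carrier R; s \<in> carrier R; x \<in> carrier M\<rbrakk>
      \<Longrightarrow> (r \<oplus>\<^bsub>R\<^esub> s) \<odot>\<^bsub>M\<^esub> x = (r \<odot>\<^bsub>M\<^esub> x) \<oplus>\<^bsub>M\<^esub> (s \<odot>\<^bsub>M\<^esub> x)"
    and rsmult_r_distr: "\<lbrakk>r \<in> carrier R; x \<in> carrier M; y \<in> carrier M\<rbrakk>
      \<Longrightarrow> r \<odot>\<^bsub>M\<^esub> (x \<oplus>\<^bsub>M\<^esub> y) = (r \<odot>\<^bsub>M\<^esub> x) \<oplus>\<^bsub>M\<^esub> (r \<odot>\<^bsub>M\<^esub> y)"
    and rsmult_assoc: "\<lbrakk>r \<in> carrier R; s \<in> carrier R; x \<in> carrier M\<rbrakk>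
      \<Longrightarrow> (r \<otimes>\<^bsub>R\<^esub> s) \<odot>\<^bsub>M\<^esub> x = s \<odot>\<^bsub>M\<^esub> (r \<odot>\<^bsub>M\<^esub> x)"
    and rsmult_one: "x \<in> carrier M \<Longrightarrow> \<one>\<^bsub>R\<^esub> \<odot>\<^bsub>M\<^esub> x = x"

definition additive_map :: "('m, 'x) ring_scheme \<Rightarrow> ('n, 'y) ring_scheme \<Rightarrow> ('m \<Rightarrow> 'n) \<Rightarrow> bool" where
  "additive_map M N f \<longleftrightarrow> f \<in> carrier M \<rightarrow> carrier N \<and>
     (\<forall>x\<in>carrier M. \<forall>y\<in>carrier M. f (x \<oplus>\<^bsub>M\<^esub> y) = f x \<oplus>\<^bsub>N\<^esub> f y)"

definition module_map :: "('a, 'w) ring_scheme \<Rightarrow> ('a, 'm, 'x) module_scheme \<Rightarrow>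
    ('a, 'n, 'y) module_scheme \<Rightarrow> ('m \<Rightarrow> 'n) \<Rightarrow> bool" where
  "module_map R M N f \<longleftrightarrow> additive_map M N f \<and>
     (\<forall>r\<in>carrier R. \<forall>x\<in>carrier M. f (r \<odot>\<^bsub>M\<^esub> x) = r \<odot>\<^bsub>N\<^esub> f x)"

text \<open>The right module \<open>R\<^sup>n\<close>; the ring multiplication and unit that the record type
  carries along have no meaning for a module.\<close>

definition free_rmod :: "('a, 'w) ring_scheme \<Rightarrow> nat \<Rightarrow> ('a, nat \<Rightarrow> 'a) module" where
  "free_rmod R n = \<lparr>carrier = {..<n} \<rightarrow>\<^sub>E carrier R,
     monoid.mult = undefined, one = undefined,
     zero = (\<lambda>i\<in>{..<n}. \<zero>\<^bsub>R\<^esub>),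
     add = (\<lambda>x y. \<lambda>i\<in>{..<n}. x i \<oplus>\<^bsub>R\<^esub> y i),
     smult = (\<lambda>r x. \<lambda>i\<in>{..<n}. x i \<otimes>\<^bsub>R\<^esub> r)\<rparr>"

text \<open>Exactness of \<open>R\<^sup>k \<rightarrow> R\<^sup>n \<rightarrow> M \<rightarrow> 0\<close>.\<close>

definition finitely_presentable :: "('a, 'w) ring_scheme \<Rightarrow> ('a, 'm, 'x) module_scheme \<Rightarrow> bool" where
  "finitely_presentable R M \<longleftrightarrow> (\<exists>k n u p.
     module_map R (free_rmod R k) (free_rmod R n) u \<and>
     module_map R (free_rmod R n) M p \<and>
     p ` carrier (free_rmod R n) = carrier M \<and>
     u ` carrier (free_rmod R k) = {x \<in> carrier (free_rmod R n). p x = \<zero>\<^bsub>M\<^esub>})"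

text \<open>A direct summand of some \<open>R\<^sup>n\<close>.\<close>

definition fg_projective :: "('a, 'w) ring_scheme \<Rightarrow> ('a, 'm, 'x) module_scheme \<Rightarrow> bool" where
  "fg_projective R M \<longleftrightarrow> (\<exists>n s p.
     module_map R M (free_rmod R n) s \<and> module_map R (free_rmod R n) M p \<and>
     (\<forall>x\<in>carrier M. p (s x) = x))"

definition module_basis ::
  "('a, 'w) ring_scheme \<Rightarrow> ('a, 'm, 'x) module_scheme \<Rightarrow> nat \<Rightarrow> (nat \<Rightarrow> 'm) \<Rightarrow> bool" where
  "module_basis R M n e \<longleftrightarrow> e \<in> {..<n} \<rightarrow> carrier M \<and>
     (\<forall>x\<in>carrier M. \<exists>!c. c \<in> {..<n} \<rightarrow>\<^sub>E carrier R \<and>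
        x = (\<Oplus>\<^bsub>M\<^esub> j\<in>{..<n}. c j \<odot>\<^bsub>M\<^esub> e j))"

text \<open>\<open>\<iota>\<close> embeds the constants \<open>\<complex>\<close> into the base ring and \<open>\<delta>\<close> is a derivation of it.\<close>

definition is_connection :: "('a, 'w) ring_scheme \<Rightarrow> (complex \<Rightarrow> 'a) \<Rightarrow> ('a \<Rightarrow> 'a) \<Rightarrow>
    ('a, 'm, 'x) module_scheme \<Rightarrow> ('m \<Rightarrow> 'm) \<Rightarrow> bool" where
  "is_connection R \<iota> \<delta> M D \<longleftrightarrow> additive_map M M D \<and>
     (\<forall>c. \<forall>x\<in>carrier M. D (\<iota> c \<odot>\<^bsub>M\<^esub> x) = \<iota> c \<odot>\<^bsub>M\<^esub> D x) \<and>
     (\<forall>r\<in>carrier R. \<forall>x\<in>carrier M. D (r \<odot>\<^bsub>M\<^esub> x) = (r \<odot>\<^bsub>M\<^esub> D x) \<oplus>\<^bsub>M\<^esub> (\<delta> r \<odot>\<^bsub>M\<^esub> x))"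

record ('a, 'm) conn_module = "('a, 'm) module" +
  nabla :: "'m \<Rightarrow> 'm"

record ('a, 'm) equiv_conn_module = "('a, 'm) conn_module" +
  sigma :: "'m \<Rightarrow> 'm"

text \<open>Morphisms are functions restricted to the carrier of their source, so that equality of
  morphisms is equality of functions.\<close>

definition concrete_precat :: "('m, 'x) ring_scheme set \<Rightarrow>
    (('m, 'x) ring_scheme \<Rightarrow> ('m, 'x) ring_scheme \<Rightarrow> ('m \<Rightarrow> 'm) \<Rightarrow> bool) \<Rightarrow>
    (('m, 'x) ring_scheme, 'm \<Rightarrow> 'm) precat" where
  "concrete_precat Ob P = \<lparr>obj = Ob,
     mor = (\<lambda>X Y. {f \<in> extensional (carrier X). P X Y f}),
     idm = (\<lambda>X. \<lambda>x\<in>carrier X. x),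
     cmp = (\<lambda>X Y Z g f. compose (carrier X) g f),
     zerom = (\<lambda>X Y. \<lambda>x\<in>carrier X. \<zero>\<^bsub>Y\<^esub>),
     addm = (\<lambda>X Y f g. \<lambda>x\<in>carrier X. f x \<oplus>\<^bsub>Y\<^esub> g x)\<rparr>"


section \<open>Holomorphic functions on the punctured plane\<close>

text \<open>A function on \<open>\<complex>\<^sup>*\<close> is represented by its extension taking the value \<open>undefined\<close> at \<open>0\<close>.\<close>

definition hol_ring :: "(complex \<Rightarrow> complex) ring" where
  "hol_ring = \<lparr>carrier = {f. f holomorphic_on (-{0})} \<inter> extensional (-{0}),
     monoid.mult = (\<lambda>f g. \<lambda>z\<in>-{0}. f z * g z),
     one = (\<lambda>z\<in>-{0}. 1),
     zero = (\<lambda>z\<in>-{0}. 0),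
     add = (\<lambda>f g. \<lambda>z\<in>-{0}. f z + g z)\<rparr>"

definition hol_const :: "complex \<Rightarrow> (complex \<Rightarrow> complex)" where
  "hol_const c = (\<lambda>z\<in>-{0}. c)"

definition hol_alpha :: "complex \<Rightarrow> (complex \<Rightarrow> complex) \<Rightarrow> (complex \<Rightarrow> complex)" where
  "hol_alpha q f = (\<lambda>z\<in>-{0}. f (q * z))"

definition hol_delta :: "complex \<Rightarrow> (complex \<Rightarrow> complex) \<Rightarrow> (complex \<Rightarrow> complex)" where
  "hol_delta \<tau> f = (\<lambda>z\<in>-{0}. \<tau> * z * deriv f z)"

definition laurent_coeffs :: "(complex \<Rightarrow> complex) \<Rightarrow> int \<Rightarrow> complex" where
  "laurent_coeffs f = (THE c. \<forall>z\<in>-{0}. ((\<lambda>n. c n * z powi n) has_sum f z) UNIV)"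

text \<open>Either a removable singularity or a pole of order one.\<close>

definition at_most_simple_pole :: "(complex \<Rightarrow> complex) \<Rightarrow> complex \<Rightarrow> bool" where
  "at_most_simple_pole f z0 \<longleftrightarrow> isolated_singularity_at f z0 \<and>
     ((\<exists>c. (f \<longlongrightarrow> c) (at z0)) \<or> (is_pole f z0 \<and> zorder f z0 = -1))"

definition regular_singular :: "(complex \<Rightarrow> complex, 'm, 'x) module_scheme \<Rightarrow> ('m \<Rightarrow> 'm) \<Rightarrow> bool" where
  "regular_singular M D \<longleftrightarrow> (\<exists>n e A. module_basis hol_ring M n e \<and>
     (\<forall>i<n. \<forall>j<n. A i j \<in> carrier hol_ring \<and> at_most_simple_pole (\<lambda>z. inverse z * A i j z) 0) \<and>
     (\<forall>i<n. D (e i) = (\<Oplus>\<^bsub>M\<^esub> j\<in>{..<n}. A i j \<odot>\<^bsub>M\<^esub> e j)))"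

type_synonym 'm B_object = "(complex \<Rightarrow> complex, 'm) equiv_conn_module"

definition B_objects :: "complex \<Rightarrow> complex \<Rightarrow> 'm B_object set" where
  "B_objects q \<tau> = {M. module hol_ring M \<and> finitely_presentable hol_ring M \<and>
     bij_betw (sigma M) (carrier M) (carrier M) \<and> additive_map M M (sigma M) \<and>
     (\<forall>f\<in>carrier hol_ring. \<forall>x\<in>carrier M. sigma M (f \<odot>\<^bsub>M\<^esub> x) = hol_alpha q f \<odot>\<^bsub>M\<^esub> sigma M x) \<and>
     is_connection hol_ring hol_const (hol_delta \<tau>) M (nabla M) \<and>
     (\<forall>x\<in>carrier M. nabla M (sigma M x) = sigma M (nabla M x)) \<and>
     regular_singular M (nabla M)}"

definition B_cat :: "complex \<Rightarrow> complex \<Rightarrow> ('m B_object, 'm \<Rightarrow> 'm) precat" where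
  "B_cat q \<tau> = concrete_precat (B_objects q \<tau>) (\<lambda>M N f. module_map hol_ring M N f \<and>
     (\<forall>x\<in>carrier M. f (sigma M x) = sigma N (f x)) \<and>
     (\<forall>x\<in>carrier M. f (nabla M x) = nabla N (f x)))"


section \<open>The smooth noncommutative torus\<close>

text \<open>The coefficient function \<open>a\<close> stands for the sum of the \<open>a (n1, n2) U\<^sub>1\<^sup>n\<^sup>1 U\<^sub>2\<^sup>n\<^sup>2\<close>.
  As \<open>U\<^sub>2 U\<^sub>1 = \<lambda> U\<^sub>1 U\<^sub>2\<close> with \<open>\<lambda> = e\<^sup>2\<^sup>\<pi>\<^sup>i\<^sup>\<theta>\<close>, moving \<open>U\<^sub>2\<^sup>n\<^sup>2\<close> past \<open>U\<^sub>1\<^sup>m\<^sup>1\<close> costs the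
  factor \<open>\<lambda>\<close> to the power \<open>n2 * m1\<close>.\<close>

definition nc_torus :: "real \<Rightarrow> (int \<times> int \<Rightarrow> complex) ring" where
  "nc_torus \<theta> = \<lparr>
     carrier = {a. \<forall>k::nat. \<exists>C. \<forall>n1 n2.
        (1 + \<bar>real_of_int n1\<bar> + \<bar>real_of_int n2\<bar>) ^ k * norm (a (n1, n2)) \<le> C},
     monoid.mult = (\<lambda>a b (k1, k2). \<Sum>\<^sub>\<infinity>(n1, n2)\<in>UNIV.
        a (n1, n2) * b (k1 - n1, k2 - n2) * exp (2 * pi * \<i> * \<theta>) powi (n2 * (k1 - n1))),
     one = (\<lambda>n. if n = (0, 0) then 1 else 0),
     zero = (\<lambda>n. 0),
     add = (\<lambda>a b n. a n + b n)\<rparr>"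

definition torus_monom :: "int \<Rightarrow> int \<Rightarrow> (int \<times> int \<Rightarrow> complex)" where
  "torus_monom m1 m2 = (\<lambda>n. if n = (m1, m2) then 1 else 0)"

text \<open>The multiplication is the one prescribed by the commutation relation: this lemma gives
  \<open>U\<^sub>1\<^sup>n\<^sup>1 U\<^sub>2\<^sup>n\<^sup>2 = torus_monom n1 n2\<close> as well as \<open>U\<^sub>2 U\<^sub>1 = e\<^sup>2\<^sup>\<pi>\<^sup>i\<^sup>\<theta> U\<^sub>1 U\<^sub>2\<close>.\<close>

lemma torus_monom_mult:
  "torus_monom m1 m2 \<otimes>\<^bsub>nc_torus \<theta>\<^esub> torus_monom l1 l2 =
     (\<lambda>n. exp (2 * pi * \<i> * \<theta>) powi (m2 * l1) * torus_monom (m1 + l1) (m2 + l2) n)"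
proof (rule ext, clarify)
  fix k1 k2 :: int
  let ?f = "\<lambda>(n1, n2). torus_monom m1 m2 (n1, n2) * torus_monom l1 l2 (k1 - n1, k2 - n2)
    * exp (2 * pi * \<i> * \<theta>) powi (n2 * (k1 - n1))"
  have "infsum ?f UNIV = infsum ?f {(m1, m2)}"
    by (rule infsum_cong_neutral) (auto simp: torus_monom_def split: if_splits)
  also have "\<dots> = exp (2 * pi * \<i> * \<theta>) powi (m2 * l1) * torus_monom (m1 + l1) (m2 + l2) (k1, k2)"
    by (auto simp: torus_monom_def)
  finally show "(torus_monom m1 m2 \<otimes>\<^bsub>nc_torus \<theta>\<^esub> torus_monom l1 l2) (k1, k2) =
     exp (2 * pi * \<i> * \<theta>) powi (m2 * l1) * torus_monom (m1 + l1) (m2 + l2) (k1, k2)"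
    by (simp add: nc_torus_def)
qed

definition torus_const :: "complex \<Rightarrow> (int \<times> int \<Rightarrow> complex)" where
  "torus_const c = (\<lambda>n. if n = (0, 0) then c else 0)"

definition torus_delta1 :: "(int \<times> int \<Rightarrow> complex) \<Rightarrow> (int \<times> int \<Rightarrow> complex)" where
  "torus_delta1 a = (\<lambda>(n1, n2). 2 * pi * \<i> * of_int n1 * a (n1, n2))"

definition torus_delta2 :: "(int \<times> int \<Rightarrow> complex) \<Rightarrow> (int \<times> int \<Rightarrow> complex)" where
  "torus_delta2 a = (\<lambda>(n1, n2). 2 * pi * \<i> * of_int n2 * a (n1, n2))"

definition torus_delta :: "complex \<Rightarrow> (int \<times> int \<Rightarrow> complex) \<Rightarrow> (int \<times> int \<Rightarrow> complex)" where
  "torus_delta \<tau> a = (\<lambda>n. \<tau> * torus_delta1 a n + torus_delta2 a n)"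

type_synonym 'e Vect_object = "(int \<times> int \<Rightarrow> complex, 'e) conn_module"

definition Vect_objects :: "real \<Rightarrow> complex \<Rightarrow> 'e Vect_object set" where
  "Vect_objects \<theta> \<tau> = {E. right_module (nc_torus \<theta>) E \<and> fg_projective (nc_torus \<theta>) E \<and>
     is_connection (nc_torus \<theta>) torus_const (torus_delta \<tau>) E (nabla E)}"

definition Vect_cat :: "real \<Rightarrow> complex \<Rightarrow> ('e Vect_object, 'e \<Rightarrow> 'e) precat" where
  "Vect_cat \<theta> \<tau> = concrete_precat (Vect_objects \<theta> \<tau>) (\<lambda>E F f. module_map (nc_torus \<theta>) E F f \<and>
     (\<forall>x\<in>carrier E. f (nabla E x) = nabla F (f x)))"


section \<open>Tensor products and the base change functor\<close>

text \<open>For a ring homomorphism \<open>h : R \<rightarrow> S\<close> with \<open>R\<close> commutative and an \<open>R\<close>-module \<open>M\<close>, the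
  tensor product \<open>M \<otimes>\<^sub>R S\<close>, where \<open>R\<close> acts on \<open>S\<close> by left multiplication via \<open>h\<close>, is the
  free abelian group on \<open>M \<times> S\<close> modulo the usual relations.\<close>

definition tensor_relations :: "('r, 'w) ring_scheme \<Rightarrow> ('s, 'v) ring_scheme \<Rightarrow> ('r \<Rightarrow> 's) \<Rightarrow>
    ('r, 'm, 'x) module_scheme \<Rightarrow> ('m \<times> 's \<Rightarrow>\<^sub>0 int) set" where
  "tensor_relations R S h M =
     {frag_of (x \<oplus>\<^bsub>M\<^esub> y, a) - frag_of (x, a) - frag_of (y, a) | x y a.
        x \<in> carrier M \<and> y \<in> carrier M \<and> a \<in> carrier S} \<union>
     {frag_of (x, a \<oplus>\<^bsub>S\<^esub> b) - frag_of (x, a) - frag_of (x, b) | x a b.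
        x \<in> carrier M \<and> a \<in> carrier S \<and> b \<in> carrier S} \<union>
     {frag_of (r \<odot>\<^bsub>M\<^esub> x, a) - frag_of (x, h r \<otimes>\<^bsub>S\<^esub> a) | r x a.
        r \<in> carrier R \<and> x \<in> carrier M \<and> a \<in> carrier S}"

definition tensor_null :: "('r, 'w) ring_scheme \<Rightarrow> ('s, 'v) ring_scheme \<Rightarrow> ('r \<Rightarrow> 's) \<Rightarrow>
    ('r, 'm, 'x) module_scheme \<Rightarrow> ('m \<times> 's \<Rightarrow>\<^sub>0 int) set" where
  "tensor_null R S h M =
     generate (free_Abelian_group (carrier M \<times> carrier S)) (tensor_relations R S h M)"

text \<open>The quotient group is written multiplicatively.\<close>

definition tensor_group :: "('r, 'w) ring_scheme \<Rightarrow> ('s, 'v) ring_scheme \<Rightarrow> ('r \<Rightarrow> 's) \<Rightarrow>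
    ('r, 'm, 'x) module_scheme \<Rightarrow> ('m \<times> 's \<Rightarrow>\<^sub>0 int) set monoid" where
  "tensor_group R S h M =
     free_Abelian_group (carrier M \<times> carrier S) Mod tensor_null R S h M"

definition tens :: "('r, 'w) ring_scheme \<Rightarrow> ('s, 'v) ring_scheme \<Rightarrow> ('r \<Rightarrow> 's) \<Rightarrow>
    ('r, 'm, 'x) module_scheme \<Rightarrow> 'm \<Rightarrow> 's \<Rightarrow> ('m \<times> 's \<Rightarrow>\<^sub>0 int) set" where
  "tens R S h M x a =
     tensor_null R S h M #>\<^bsub>free_Abelian_group (carrier M \<times> carrier S)\<^esub> frag_of (x, a)"

text \<open>The additive map from \<open>M \<otimes>\<^sub>R S\<close> to the abelian group \<open>G\<close> sending \<open>x \<otimes> a\<close> to \<open>t x a\<close>.\<close>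

definition tensor_map :: "('r, 'w) ring_scheme \<Rightarrow> ('s, 'v) ring_scheme \<Rightarrow> ('r \<Rightarrow> 's) \<Rightarrow>
    ('r, 'm, 'x) module_scheme \<Rightarrow> 'g monoid \<Rightarrow> ('m \<Rightarrow> 's \<Rightarrow> 'g) \<Rightarrow>
    (('m \<times> 's \<Rightarrow>\<^sub>0 int) set \<Rightarrow> 'g)" where
  "tensor_map R S h M G t = (THE D.
     D \<in> hom (tensor_group R S h M) G \<and> D \<in> extensional (carrier (tensor_group R S h M)) \<and>
     (\<forall>x\<in>carrier M. \<forall>a\<in>carrier S. D (tens R S h M x a) = t x a))"

definition base_change :: "('r, 'w) ring_scheme \<Rightarrow> ('s, 'v) ring_scheme \<Rightarrow> ('r \<Rightarrow> 's) \<Rightarrow>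
    ('r, 'm, 'x) module_scheme \<Rightarrow> ('s, ('m \<times> 's \<Rightarrow>\<^sub>0 int) set) module" where
  "base_change R S h M = (let T = tensor_group R S h M in
     \<lparr>carrier = carrier T, monoid.mult = undefined, one = undefined,
      zero = \<one>\<^bsub>T\<^esub>, add = (\<otimes>\<^bsub>T\<^esub>),
      smult = (\<lambda>b. tensor_map R S h M T (\<lambda>x a. tens R S h M x (a \<otimes>\<^bsub>S\<^esub> b)))\<rparr>)"

definition psi :: "(complex \<Rightarrow> complex) \<Rightarrow> (int \<times> int \<Rightarrow> complex)" where
  "psi f = (\<lambda>(n1, n2). if n2 = 0 then laurent_coeffs f n1 else 0)"

type_synonym 'm psi_carrier = "('m \<times> (int \<times> int \<Rightarrow> complex) \<Rightarrow>\<^sub>0 int) set"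

text \<open>The connection is \<open>2\<pi>i \<nabla> \<otimes> 1 + 1 \<otimes> \<delta>\<^sub>\<tau>\<close>.\<close>

definition psi_obj :: "real \<Rightarrow> complex \<Rightarrow> 'm B_object \<Rightarrow> 'm psi_carrier Vect_object" where
  "psi_obj \<theta> \<tau> M = (let T = tensor_group hol_ring (nc_torus \<theta>) psi M;
       t = tens hol_ring (nc_torus \<theta>) psi M in
     module.extend (base_change hol_ring (nc_torus \<theta>) psi M)
       (conn_module.fields (tensor_map hol_ring (nc_torus \<theta>) psi M T
         (\<lambda>x a. t (hol_const (2 * pi * \<i>) \<odot>\<^bsub>M\<^esub> nabla M x) a \<otimes>\<^bsub>T\<^esub> t x (torus_delta \<tau> a)))))"

definition psi_mor :: "real \<Rightarrow> 'm B_object \<Rightarrow> 'm B_object \<Rightarrow> ('m \<Rightarrow> 'm) \<Rightarrow>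
    ('m psi_carrier \<Rightarrow> 'm psi_carrier)" where
  "psi_mor \<theta> M N f = tensor_map hol_ring (nc_torus \<theta>) psi M
     (tensor_group hol_ring (nc_torus \<theta>) psi N)
     (\<lambda>x a. tens hol_ring (nc_torus \<theta>) psi N (f x) a)"

end

theory Submission
  imports Defs "Jordan_Normal_Form.Schur_Decomposition"
begin

text \<open>By the Frobenius method a regular singular connection has a basis over \<open>\<O>(\<complex>\<^sup>*)\<close> in which it is
  given by a constant triangular matrix whose eigenvalues \<open>\<lambda>\<close> satisfy \<open>0 \<le> Re (\<lambda> / \<tau>) < 1\<close>, so that no
  two of them differ by a nonzero integral multiple of \<open>\<tau>\<close>. Comparing Laurent coefficients in such
  bases shows that a linear map commuting with the connections has a constant matrix; a constant change
  of bases therefore brings it into the form \<open>diag(1, \<dots>, 1, 0, \<dots>, 0)\<close>. Hence the kernel and the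
  cokernel of the underlying module map are free with constant connection matrices, and are themselves
  objects of the source category. It follows that a short exact sequence of that category is exact as a
  sequence of modules. As its last term is free, it splits \<open>\<O>(\<complex>\<^sup>*)\<close>-linearly and so remains exact
  after base change. Faithfulness holds because \<open>\<psi>\<close> is injective and the modules are free, which
  makes \<open>x \<mapsto> x \<otimes> 1\<close> injective.\<close>

section \<open>The ring of the noncommutative torus\<close>

text \<open>The obstacle is that exactness is meant inside the source category: kernels and
  cokernels are tested only against its objects, whose modules have a finite basis. Over the
  holomorphic functions on the punctured plane the cokernel of a map of free modules may have
  torsion, so categorical exactness says nothing about modules until the cokernels of morphisms are
  known to be free. What rescues this is that the coefficient of \<open>z^l\<close> in the matrix of
  a morphism lies in the kernel of the Sylvester operator
  \<open>X |-> \<tau> l X + X B' - B X\<close>, with eigenvalues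
  \<open>\<tau> l + \<mu> - \<lambda>\<close>. Source and target are normalized to the same strip,
  so only \<open>l = 0\<close> survives. The operator \<sigma> passes to kernel and cokernel because
  it is bijective and commutes with the morphism. The cokernel cannot be a set of cosets, since all
  objects have their carriers in one type; it is realized as the span of the complementary basis
  vectors, with both operators compressed to it. The factor 2\<pi>i in the base change matches the
  derivations: \<open>torus_delta\<close> multiplies \<open>U_1^n\<close> by
  \<open>2 \<pi> i \<tau> n\<close>, whereas \<open>hol_delta\<close> multiplies \<open>z^n\<close>
  by \<open>\<tau> n\<close>.\<close>

definition wt :: "int \<times> int \<Rightarrow> real" where
  "wt n = 1 + \<bar>real_of_int (fst n)\<bar> + \<bar>real_of_int (snd n)\<bar>"

lemma wt_ge_1: "wt n \<ge> 1"
  by (simp add: wt_def)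

lemma wt_pow_pos: "wt n ^ k > 0"
  using wt_ge_1[of n] by simp

text \<open>The weight of an index of a convolution can thus be distributed over the two factors,
  which is how rapid decay survives multiplication.\<close>

lemma wt_submult: "wt n \<le> wt m * wt (n - m)"
proof -
  have "wt n \<le> 1 + (\<bar>real_of_int (fst m)\<bar> + \<bar>real_of_int (snd m)\<bar>)
      + (\<bar>real_of_int (fst (n - m))\<bar> + \<bar>real_of_int (snd (n - m))\<bar>)"
    unfolding wt_def by (simp add: fst_diff snd_diff)
  also have "\<dots> \<le> wt m * wt (n - m)"
    unfolding wt_def by (simp add: algebra_simps)
  finally show ?thesis .
qed

lemma torus_carrier_iff:
  "a \<in> carrier (nc_torus \<theta>) \<longleftrightarrow> (\<forall>k. \<exists>C. \<forall>n. wt n ^ k * norm (a n) \<le> C)"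
  by (simp add: nc_torus_def wt_def)

lemma torus_zero: "\<zero>\<^bsub>nc_torus \<theta>\<^esub> = (\<lambda>n. 0)"
  and torus_add: "a \<oplus>\<^bsub>nc_torus \<theta>\<^esub> b = (\<lambda>n. a n + b n)"
  by (simp_all add: nc_torus_def)

text \<open>The scalar that arises when the power of \<open>U_2\<close> in the first monomial is
  moved past the power of \<open>U_1\<close> in the second. The algebra is the group algebra of the
  lattice twisted by this bicharacter.\<close>

definition twist :: "real \<Rightarrow> int \<times> int \<Rightarrow> int \<times> int \<Rightarrow> complex" where
  "twist \<theta> n m = exp (2 * pi * \<i> * \<theta>) powi (snd n * fst m)"

lemma norm_twist [simp]: "norm (twist \<theta> n m) = 1"
  by (simp add: twist_def norm_power_int norm_exp_eq_Re)

lemma twist_nonzero [simp]: "twist \<theta> n m \<noteq> 0"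
  using norm_twist[of \<theta> n m] by force

text \<open>The exponent is bilinear in the two lattice points, so both sides have exponent
  \<open>n2 m1 + n2 l1 + m2 l1\<close>. This is associativity on monomials.\<close>

lemma twist_cocycle: "twist \<theta> n m * twist \<theta> (n + m) l = twist \<theta> m l * twist \<theta> n (m + l)"
  by (simp add: twist_def fst_add snd_add algebra_simps flip: power_int_add)

lemma torus_mult:
  "(a \<otimes>\<^bsub>nc_torus \<theta>\<^esub> b) k = (\<Sum>\<^sub>\<infinity>n. a n * b (k - n) * twist \<theta> n (k - n))"
proof -
  obtain k1 k2 where k: "k = (k1, k2)" by fastforce
  show ?thesis
    unfolding k nc_torus_def twist_def
    by (simp, rule infsum_cong) (auto simp: minus_prod_def)
qed

lemma int_inverse_square_summable: "(\<lambda>n::int. inverse ((1 + \<bar>real_of_int n\<bar>)^2)) summable_on UNIV"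
proof -
  let ?f = "\<lambda>n::int. inverse ((1 + \<bar>real_of_int n\<bar>)^2)"
  have "summable (\<lambda>n::nat. inverse (real n ^ 2))"
    by (rule inverse_power_summable) simp
  then have "summable (\<lambda>n::nat. inverse (real (Suc n) ^ 2))"
    by (subst summable_Suc_iff)
  then have s: "(\<lambda>n::nat. inverse ((1 + real n) ^ 2)) summable_on UNIV"
    by (intro summable_nonneg_imp_summable_on) (simp_all add: add.commute)
  have 1: "?f summable_on (range int)"
    by (subst summable_on_reindex) (use s in \<open>simp_all add: o_def\<close>)
  have 2: "?f summable_on (range (\<lambda>n. - int n))"
    by (subst summable_on_reindex) (use s in \<open>simp_all add: o_def inj_on_def\<close>)
  have "(UNIV :: int set) = range int \<union> range (\<lambda>n. - int n)"
    by (auto simp: image_iff) (metis int_cases2)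
  then show ?thesis using summable_on_union[OF 1 2] by simp
qed

text \<open>The fourth power dominates the product of the squares of the one-variable weights, so
  the double series is bounded by a product of two convergent series.\<close>

lemma wt_inverse_summable: "(\<lambda>n. inverse (wt n ^ 4)) summable_on UNIV"
proof -
  let ?f = "\<lambda>n::int. inverse ((1 + \<bar>real_of_int n\<bar>)^2)"
  have "(\<lambda>n. ?f (fst n) * ?f (snd n)) summable_on (UNIV \<times> UNIV)"
    unfolding case_prod_unfold[symmetric]
    apply (rule summable_on_SigmaI[where g = "\<lambda>x. ?f x * infsum ?f UNIV"])
    using int_inverse_square_summable
    by (auto intro!: has_sum_cmult_right summable_on_cmult_left)
  moreover have "norm (inverse (wt n ^ 4)) \<le> ?f (fst n) * ?f (snd n)" for n
  proof -
    have "(1 + \<bar>real_of_int (fst n)\<bar>)^2 * (1 + \<bar>real_of_int (snd n)\<bar>)^2 \<le> wt n ^ 2 * wt n ^ 2"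
      by (intro mult_mono power_mono) (auto simp: wt_def)
    also have "\<dots> = wt n ^ 4" by (simp flip: power_add)
    finally have "inverse (wt n ^ 4) \<le> inverse ((1 + \<bar>real_of_int (fst n)\<bar>)^2 * (1 + \<bar>real_of_int (snd n)\<bar>)^2)"
      by (intro le_imp_inverse_le) auto
    then show ?thesis using wt_pow_pos[of n 4] by (simp add: inverse_mult_distrib)
  qed
  ultimately have "(\<lambda>n. norm (inverse (wt n ^ 4))) summable_on UNIV"
    by (intro Infinite_Sum.abs_summable_on_comparison_test'[where g = "\<lambda>n. ?f (fst n) * ?f (snd n)"]) simp_all
  then show ?thesis using wt_pow_pos by (simp add: less_imp_le)
qed

text \<open>Decay of order \<open>k + 4\<close> leaves the summable factor
  \<open>wt n ^ (-4)\<close> after \<open>k\<close> powers of the weight are spent.\<close>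

lemma torus_weighted_summable:
  assumes "a \<in> carrier (nc_torus \<theta>)"
  shows "(\<lambda>n. wt n ^ k * norm (a n)) summable_on UNIV"
proof -
  obtain C where C: "\<And>n. wt n ^ (k + 4) * norm (a n) \<le> C"
    using assms unfolding torus_carrier_iff by blast
  have "norm (wt n ^ k * norm (a n)) \<le> C * inverse (wt n ^ 4)" for n
    using C[of n] wt_pow_pos[of n 4] wt_pow_pos[of n k]
    by (simp add: field_simps power_add)
  then have "(\<lambda>n. norm (wt n ^ k * norm (a n))) summable_on UNIV"
    by (intro Infinite_Sum.abs_summable_on_comparison_test'[OF summable_on_cmult_right[OF wt_inverse_summable]]) auto
  then show ?thesis using wt_pow_pos by (simp add: less_imp_le abs_mult)
qed

lemma torus_abs_summable:
  "a \<in> carrier (nc_torus \<theta>) \<Longrightarrow> (\<lambda>n. norm (a n)) summable_on UNIV"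
  using torus_weighted_summable[of a \<theta> 0] by simp

lemma torus_bounded:
  assumes "a \<in> carrier (nc_torus \<theta>)"
  obtains C where "C \<ge> 0" "\<And>n. norm (a n) \<le> C"
proof -
  obtain C where C: "\<And>n. wt n ^ 0 * norm (a n) \<le> C"
    using assms unfolding torus_carrier_iff by blast
  then have "\<And>n. norm (a n) \<le> C" by simp
  moreover from this[of 0] have "C \<ge> 0" using norm_ge_zero order_trans by blast
  ultimately show ?thesis using that by blast
qed

lemma torus_mult_abs_summable:
  assumes "a \<in> carrier (nc_torus \<theta>)" "b \<in> carrier (nc_torus \<theta>)"
  shows "(\<lambda>n. norm (a n * b (k - n) * twist \<theta> n (k - n))) summable_on UNIV"
proof -
  obtain C where C: "C \<ge> 0" "\<And>n. norm (b n) \<le> C" using torus_bounded[OF assms(2)] by blast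
  show ?thesis
    by (rule Infinite_Sum.abs_summable_on_comparison_test'[OF summable_on_cmult_left[OF torus_abs_summable[OF assms(1)], of C]])
      (simp add: norm_mult mult_left_mono C(2))
qed

lemmas torus_mult_summable = abs_summable_summable[OF torus_mult_abs_summable]

text \<open>The weight is split by \<open>wt_submult\<close>; the share of \<open>a\<close> is
  summable and the share of \<open>b\<close> is bounded, so the weighted convolution is bounded by a
  sum that does not involve the index \<open>k\<close>.\<close>

lemma torus_mult_closed:
  assumes a: "a \<in> carrier (nc_torus \<theta>)" and b: "b \<in> carrier (nc_torus \<theta>)"
  shows "a \<otimes>\<^bsub>nc_torus \<theta>\<^esub> b \<in> carrier (nc_torus \<theta>)"
  unfolding torus_carrier_iff
proof
  fix p
  obtain C where C: "\<And>n. wt n ^ p * norm (b n) \<le> C" using b unfolding torus_carrier_iff by blast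
  have s: "(\<lambda>n. wt n ^ p * norm (a n) * C) summable_on UNIV"
    by (rule summable_on_cmult_left[OF torus_weighted_summable[OF a]])
  have "wt k ^ p * norm ((a \<otimes>\<^bsub>nc_torus \<theta>\<^esub> b) k) \<le> (\<Sum>\<^sub>\<infinity>n. wt n ^ p * norm (a n) * C)" for k
  proof -
    have "norm ((a \<otimes>\<^bsub>nc_torus \<theta>\<^esub> b) k) \<le> (\<Sum>\<^sub>\<infinity>n. norm (a n * b (k - n) * twist \<theta> n (k - n)))"
      unfolding torus_mult by (rule norm_infsum_bound[OF torus_mult_abs_summable[OF a b]])
    then have "wt k ^ p * norm ((a \<otimes>\<^bsub>nc_torus \<theta>\<^esub> b) k) \<le>
       wt k ^ p * (\<Sum>\<^sub>\<infinity>n. norm (a n * b (k - n) * twist \<theta> n (k - n)))"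
      using wt_pow_pos[of k p] by (intro mult_left_mono) auto
    also have "\<dots> = (\<Sum>\<^sub>\<infinity>n. wt k ^ p * norm (a n * b (k - n) * twist \<theta> n (k - n)))"
      by (rule infsum_cmult_right'[symmetric])
    also have "\<dots> \<le> (\<Sum>\<^sub>\<infinity>n. wt n ^ p * norm (a n) * C)"
    proof (rule infsum_mono[OF summable_on_cmult_right[OF torus_mult_abs_summable[OF a b]] s])
      fix n
      have "wt k ^ p \<le> wt n ^ p * wt (k - n) ^ p"
        unfolding power_mult_distrib[symmetric]
        using wt_submult[of k n] wt_ge_1[of k] by (intro power_mono) auto
      then have "wt k ^ p * (norm (a n) * norm (b (k - n)))
          \<le> wt n ^ p * wt (k - n) ^ p * (norm (a n) * norm (b (k - n)))"
        by (intro mult_right_mono) auto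
      also have "\<dots> = (wt n ^ p * norm (a n)) * (wt (k - n) ^ p * norm (b (k - n)))" by simp
      also have "\<dots> \<le> (wt n ^ p * norm (a n)) * C"
        using C[of "k - n"] wt_pow_pos[of n p] by (intro mult_left_mono) auto
      finally show "wt k ^ p * norm (a n * b (k - n) * twist \<theta> n (k - n)) \<le> wt n ^ p * norm (a n) * C"
        by (simp add: norm_mult)
    qed
    finally show ?thesis .
  qed
  then show "\<exists>C. \<forall>n. wt n ^ p * norm ((a \<otimes>\<^bsub>nc_torus \<theta>\<^esub> b) n) \<le> C" by blast
qed

lemma torus_add_closed:
  assumes a: "a \<in> carrier (nc_torus \<theta>)" and b: "b \<in> carrier (nc_torus \<theta>)"
  shows "a \<oplus>\<^bsub>nc_torus \<theta>\<^esub> b \<in> carrier (nc_torus \<theta>)"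
  unfolding torus_carrier_iff
proof
  fix p
  obtain A B where "\<And>n. wt n ^ p * norm (a n) \<le> A" "\<And>n. wt n ^ p * norm (b n) \<le> B"
    using a b unfolding torus_carrier_iff by meson
  moreover have "wt n ^ p * norm (a n + b n) \<le> wt n ^ p * norm (a n) + wt n ^ p * norm (b n)" for n
    using wt_pow_pos[of n p] by (simp add: norm_triangle_ineq flip: distrib_left)
  ultimately have "wt n ^ p * norm (a n + b n) \<le> A + B" for n by (meson add_mono order_trans)
  then show "\<exists>C. \<forall>n. wt n ^ p * norm ((a \<oplus>\<^bsub>nc_torus \<theta>\<^esub> b) n) \<le> C"
    unfolding torus_add by blast
qed

lemma torus_finite_support_closed:
  assumes "finite {n. a n \<noteq> 0}"
  shows "a \<in> carrier (nc_torus \<theta>)"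
  unfolding torus_carrier_iff
proof
  fix k
  have "wt n ^ k * norm (a n) \<le> (\<Sum>m\<in>{n. a n \<noteq> 0}. wt m ^ k * norm (a m))" for n
  proof (cases "a n = 0")
    case False
    then show ?thesis
      by (intro member_le_sum) (use assms wt_pow_pos[THEN less_imp_le] in auto)
  qed (use wt_pow_pos[THEN less_imp_le] in \<open>auto intro!: sum_nonneg\<close>)
  then show "\<exists>C. \<forall>n. wt n ^ k * norm (a n) \<le> C" by blast
qed

lemma torus_scale_closed:
  assumes "a \<in> carrier (nc_torus \<theta>)"
  shows "(\<lambda>n. c * a n) \<in> carrier (nc_torus \<theta>)"
  unfolding torus_carrier_iff
proof
  fix k
  obtain C where "\<And>n. wt n ^ k * norm (a n) \<le> C" using assms unfolding torus_carrier_iff by blast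
  then have "norm c * (wt n ^ k * norm (a n)) \<le> norm c * C" for n
    by (intro mult_left_mono) auto
  then have "wt n ^ k * norm (c * a n) \<le> norm c * C" for n by (simp add: norm_mult mult_ac)
  then show "\<exists>C. \<forall>n. wt n ^ k * norm (c * a n) \<le> C" by blast
qed

text \<open>Both bracketings are iterated sums of one double family \<open>F\<close>. As
  \<open>a\<close> and \<open>b\<close> are summable and \<open>c\<close> is bounded,
  \<open>F\<close> is absolutely summable and the sums may be interchanged; the substitution
  \<open>m = l + n\<close> and the cocycle identity then match the terms.\<close>

lemma torus_mult_assoc:
  assumes a: "a \<in> carrier (nc_torus \<theta>)" and b: "b \<in> carrier (nc_torus \<theta>)"
    and c: "c \<in> carrier (nc_torus \<theta>)"
  shows "(a \<otimes>\<^bsub>nc_torus \<theta>\<^esub> b) \<otimes>\<^bsub>nc_torus \<theta>\<^esub> c = a \<otimes>\<^bsub>nc_torus \<theta>\<^esub> (b \<otimes>\<^bsub>nc_torus \<theta>\<^esub> c)"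
proof
  fix k
  define F where "F = (\<lambda>m n. a n * b (m - n) * c (k - m) * (twist \<theta> n (m - n) * twist \<theta> m (k - m)))"
  obtain C where C: "C \<ge> 0" "\<And>n. norm (c n) \<le> C" using torus_bounded[OF c] by blast
  have "((\<lambda>m. norm (a n) * norm (b (m - n)) * C) has_sum norm (a n) * (\<Sum>\<^sub>\<infinity>m. norm (b m)) * C) UNIV" for n
  proof (intro has_sum_cmult_left has_sum_cmult_right)
    show "((\<lambda>m. norm (b (m - n))) has_sum (\<Sum>\<^sub>\<infinity>m. norm (b m))) UNIV"
      using has_sum_infsum[OF torus_abs_summable[OF b]]
      by (subst has_sum_reindex_bij_witness[of _ "\<lambda>m. m + n" "\<lambda>m. m - n" UNIV "\<lambda>m. norm (b m)" _ _ "\<Sum>\<^sub>\<infinity>m. norm (b m)"]) auto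
  qed
  then have "(\<lambda>(n, m). norm (a n) * norm (b (m - n)) * C) summable_on (UNIV \<times> UNIV)"
    by (intro summable_on_SigmaI[where g = "\<lambda>n. norm (a n) * (\<Sum>\<^sub>\<infinity>m. norm (b m)) * C"])
      (use C torus_abs_summable[OF a] in \<open>auto intro!: summable_on_cmult_left\<close>)
  then have "(\<lambda>x. norm (case x of (n, m) \<Rightarrow> F m n)) summable_on (UNIV \<times> UNIV)"
    by (rule Infinite_Sum.abs_summable_on_comparison_test')
      (clarsimp simp: F_def norm_mult, intro mult_left_mono C(2), simp)
  then have sF: "(\<lambda>(n, m). F m n) summable_on (UNIV \<times> UNIV)"
    by (rule abs_summable_summable)
  have "((a \<otimes>\<^bsub>nc_torus \<theta>\<^esub> b) \<otimes>\<^bsub>nc_torus \<theta>\<^esub> c) k = (\<Sum>\<^sub>\<infinity>m. \<Sum>\<^sub>\<infinity>n. F m n)"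
    unfolding torus_mult F_def
    by (intro infsum_cong) (simp add: mult_ac flip: infsum_cmult_left' infsum_cmult_right')
  also have "\<dots> = (\<Sum>\<^sub>\<infinity>n. \<Sum>\<^sub>\<infinity>m. F m n)"
    by (rule infsum_swap_banach[symmetric]) (use sF in simp)
  also have "\<dots> = (a \<otimes>\<^bsub>nc_torus \<theta>\<^esub> (b \<otimes>\<^bsub>nc_torus \<theta>\<^esub> c)) k"
    unfolding torus_mult
  proof (intro infsum_cong)
    fix n
    have "a n * (\<Sum>\<^sub>\<infinity>l. b l * c (k - n - l) * twist \<theta> l (k - n - l)) * twist \<theta> n (k - n)
      = (\<Sum>\<^sub>\<infinity>l. a n * (b l * c (k - n - l) * twist \<theta> l (k - n - l)) * twist \<theta> n (k - n))"
      by (simp flip: infsum_cmult_left' infsum_cmult_right')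
    also have "\<dots> = (\<Sum>\<^sub>\<infinity>m. F m n)"
    proof (rule infsum_reindex_bij_witness[of _ "\<lambda>m. m - n" "\<lambda>l. l + n"])
      fix l
      have "twist \<theta> n l * twist \<theta> (n + l) (k - n - l) = twist \<theta> l (k - n - l) * twist \<theta> n (k - n)"
        using twist_cocycle[of \<theta> n l "k - n - l"] by simp
      then show "F (l + n) n = a n * (b l * c (k - n - l) * twist \<theta> l (k - n - l)) * twist \<theta> n (k - n)"
        by (simp add: F_def algebra_simps)
    qed auto
    finally show "(\<Sum>\<^sub>\<infinity>m. F m n) = a n * (\<Sum>\<^sub>\<infinity>l. b l * c (k - n - l) * twist \<theta> l (k - n - l)) * twist \<theta> n (k - n)"
      by simp
  qed
  finally show "((a \<otimes>\<^bsub>nc_torus \<theta>\<^esub> b) \<otimes>\<^bsub>nc_torus \<theta>\<^esub> c) k = (a \<otimes>\<^bsub>nc_torus \<theta>\<^esub> (b \<otimes>\<^bsub>nc_torus \<theta>\<^esub> c)) k" .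
qed

lemma torus_const_mult: "torus_const c \<otimes>\<^bsub>nc_torus \<theta>\<^esub> a = (\<lambda>n. c * a n)"
proof
  fix k
  have "(\<Sum>\<^sub>\<infinity>n. torus_const c n * a (k - n) * twist \<theta> n (k - n))
      = (\<Sum>\<^sub>\<infinity>n\<in>{(0,0)}. torus_const c n * a (k - n) * twist \<theta> n (k - n))"
    by (rule infsum_cong_neutral) (auto simp: torus_const_def split: if_splits)
  then show "(torus_const c \<otimes>\<^bsub>nc_torus \<theta>\<^esub> a) k = c * a k"
    by (simp add: torus_mult torus_const_def twist_def flip: zero_prod_def)
qed

lemma mult_torus_const: "a \<otimes>\<^bsub>nc_torus \<theta>\<^esub> torus_const c = (\<lambda>n. c * a n)"
proof
  fix k
  have "(\<Sum>\<^sub>\<infinity>n. a n * torus_const c (k - n) * twist \<theta> n (k - n))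
      = (\<Sum>\<^sub>\<infinity>n\<in>{k}. a n * torus_const c (k - n) * twist \<theta> n (k - n))"
    by (rule infsum_cong_neutral) (auto simp: torus_const_def zero_prod_def[symmetric] split: if_splits)
  then show "(a \<otimes>\<^bsub>nc_torus \<theta>\<^esub> torus_const c) k = c * a k"
    by (simp add: torus_mult torus_const_def twist_def zero_prod_def)
qed

lemma torus_const_closed: "torus_const c \<in> carrier (nc_torus \<theta>)"
  by (rule torus_finite_support_closed) (auto simp: torus_const_def)

lemma torus_one_const: "\<one>\<^bsub>nc_torus \<theta>\<^esub> = torus_const 1"
  by (simp add: nc_torus_def torus_const_def)

lemma ring_nc_torus: "ring (nc_torus \<theta>)"
proof (rule ringI)
  show "abelian_group (nc_torus \<theta>)"
  proof (rule abelian_groupI)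
    fix a assume a: "a \<in> carrier (nc_torus \<theta>)"
    show "\<exists>b\<in>carrier (nc_torus \<theta>). b \<oplus>\<^bsub>nc_torus \<theta>\<^esub> a = \<zero>\<^bsub>nc_torus \<theta>\<^esub>"
      by (rule bexI[OF _ torus_scale_closed[OF a, of "-1"]]) (simp add: torus_zero torus_add)
  qed (use torus_finite_support_closed[of "\<lambda>n. 0" \<theta>] torus_add_closed in
      \<open>auto simp: torus_zero add_ac torus_add\<close>)
next
  show "monoid (nc_torus \<theta>)"
    by (rule monoidI) (auto simp: torus_mult_closed torus_mult_assoc torus_one_const
        torus_const_closed torus_const_mult mult_torus_const)
next
  fix a b c assume *: "a \<in> carrier (nc_torus \<theta>)" "b \<in> carrier (nc_torus \<theta>)" "c \<in> carrier (nc_torus \<theta>)"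
  show "(a \<oplus>\<^bsub>nc_torus \<theta>\<^esub> b) \<otimes>\<^bsub>nc_torus \<theta>\<^esub> c
      = (a \<otimes>\<^bsub>nc_torus \<theta>\<^esub> c) \<oplus>\<^bsub>nc_torus \<theta>\<^esub> (b \<otimes>\<^bsub>nc_torus \<theta>\<^esub> c)"
    by (rule ext) (simp add: torus_add torus_mult distrib_right infsum_add torus_mult_summable *)
  show "c \<otimes>\<^bsub>nc_torus \<theta>\<^esub> (a \<oplus>\<^bsub>nc_torus \<theta>\<^esub> b)
      = (c \<otimes>\<^bsub>nc_torus \<theta>\<^esub> a) \<oplus>\<^bsub>nc_torus \<theta>\<^esub> (c \<otimes>\<^bsub>nc_torus \<theta>\<^esub> b)"
    by (rule ext) (simp add: torus_add torus_mult distrib_right distrib_left infsum_add torus_mult_summable *)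
qed

section \<open>The derivation of the noncommutative torus\<close>

lemma torus_delta_eq:
  "torus_delta \<tau> a = (\<lambda>n. 2 * pi * \<i> * (\<tau> * of_int (fst n) + of_int (snd n)) * a n)"
  by (auto simp: torus_delta_def torus_delta1_def torus_delta2_def algebra_simps)

lemma torus_delta_closed:
  assumes "a \<in> carrier (nc_torus \<theta>)"
  shows "torus_delta \<tau> a \<in> carrier (nc_torus \<theta>)"
  unfolding torus_carrier_iff
proof
  fix k
  define D where "D = norm (2 * pi * \<i>) * (norm \<tau> + 1)"
  \<comment> \<open>The multiplier grows linearly in the index, so one additional power of the
    weight pays for it.\<close>
  obtain C where C: "\<And>n. wt n ^ Suc k * norm (a n) \<le> C" using assms unfolding torus_carrier_iff by blast
  have "wt n ^ k * norm (torus_delta \<tau> a n) \<le> D * C" for n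
  proof -
    have "norm (\<tau> * of_int (fst n) + of_int (snd n)) \<le> norm \<tau> * \<bar>of_int (fst n)\<bar> + \<bar>of_int (snd n)\<bar>"
      by (rule order_trans[OF norm_triangle_ineq]) (simp add: norm_mult)
    also have "\<dots> \<le> norm \<tau> * wt n + 1 * wt n"
      by (intro add_mono mult_left_mono) (auto simp: wt_def)
    finally have 1: "norm (\<tau> * of_int (fst n) + of_int (snd n)) \<le> (norm \<tau> + 1) * wt n"
      by (simp add: algebra_simps)
    have "wt n ^ k * norm (torus_delta \<tau> a n)
      = norm (2 * pi * \<i>) * (wt n ^ k * norm (a n)) * norm (\<tau> * of_int (fst n) + of_int (snd n))"
      unfolding torus_delta_eq norm_mult by (simp only: mult_ac)
    also have "\<dots> \<le> norm (2 * pi * \<i>) * (wt n ^ k * norm (a n)) * ((norm \<tau> + 1) * wt n)"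
      using wt_pow_pos[of n k] by (intro mult_left_mono[OF 1] mult_nonneg_nonneg) auto
    also have "\<dots> = D * (wt n ^ Suc k * norm (a n))"
      unfolding D_def power_Suc by (simp only: mult_ac)
    also have "\<dots> \<le> D * C" by (intro mult_left_mono[OF C]) (simp add: D_def)
    finally show ?thesis .
  qed
  then show "\<exists>C. \<forall>n. wt n ^ k * norm (torus_delta \<tau> a n) \<le> C" by blast
qed

lemma torus_delta_add:
  "torus_delta \<tau> (a \<oplus>\<^bsub>nc_torus \<theta>\<^esub> b) = torus_delta \<tau> a \<oplus>\<^bsub>nc_torus \<theta>\<^esub> torus_delta \<tau> b"
  by (rule ext) (simp add: torus_delta_eq torus_add algebra_simps)

text \<open>The derivation is diagonal on monomials with a multiplier \<open>e\<close> that is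
  additive in the index; the Leibniz rule therefore holds term by term in the convolution.\<close>

lemma torus_delta_mult:
  assumes a: "a \<in> carrier (nc_torus \<theta>)" and b: "b \<in> carrier (nc_torus \<theta>)"
  shows "torus_delta \<tau> (a \<otimes>\<^bsub>nc_torus \<theta>\<^esub> b)
    = (torus_delta \<tau> a \<otimes>\<^bsub>nc_torus \<theta>\<^esub> b) \<oplus>\<^bsub>nc_torus \<theta>\<^esub> (a \<otimes>\<^bsub>nc_torus \<theta>\<^esub> torus_delta \<tau> b)"
proof
  fix k
  define e where "e = (\<lambda>n. 2 * pi * \<i> * (\<tau> * of_int (fst n) + of_int (snd n)))"
  have e: "e k = e n + e (k - n)" for n
    by (simp add: e_def fst_diff snd_diff algebra_simps)
  have "torus_delta \<tau> (a \<otimes>\<^bsub>nc_torus \<theta>\<^esub> b) k = (\<Sum>\<^sub>\<infinity>n. e k * (a n * b (k - n) * twist \<theta> n (k - n)))"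
    unfolding torus_delta_eq torus_mult e_def by (rule infsum_cmult_right'[symmetric])
  also have "\<dots> = (\<Sum>\<^sub>\<infinity>n. torus_delta \<tau> a n * b (k - n) * twist \<theta> n (k - n)
      + a n * torus_delta \<tau> b (k - n) * twist \<theta> n (k - n))"
    unfolding torus_delta_eq e_def[symmetric]
    by (intro infsum_cong) (simp add: e_def fst_diff snd_diff algebra_simps)
  also have "\<dots> = ((torus_delta \<tau> a \<otimes>\<^bsub>nc_torus \<theta>\<^esub> b) \<oplus>\<^bsub>nc_torus \<theta>\<^esub> (a \<otimes>\<^bsub>nc_torus \<theta>\<^esub> torus_delta \<tau> b)) k"
    unfolding torus_add torus_mult
    by (rule infsum_add[OF torus_mult_summable[OF torus_delta_closed[OF a] b]
          torus_mult_summable[OF a torus_delta_closed[OF b]]])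
  finally show "torus_delta \<tau> (a \<otimes>\<^bsub>nc_torus \<theta>\<^esub> b) k = \<dots>" .
qed

lemma torus_delta_const: "torus_delta \<tau> (torus_const c) = \<zero>\<^bsub>nc_torus \<theta>\<^esub>"
  by (auto simp: torus_delta_eq torus_const_def torus_zero)

section \<open>Laurent series on the punctured plane\<close>

text \<open>The nonnegative part of the Laurent series is the Cauchy integral of \<open>f\<close> over a large circle,
  rewritten as an integral over the unit circle of the difference quotient of \<open>f\<close>, which does not
  depend on the radius.\<close>

lemma holomorphic_punctured_split:
  assumes f: "f holomorphic_on (-{0})"
  obtains F K where "F holomorphic_on UNIV" "K holomorphic_on UNIV" "K 0 = 0"
    "\<And>z. z \<noteq> 0 \<Longrightarrow> f z = F z + K (inverse z)"
proof -
  define h where "h = (\<lambda>z u. if u = z then deriv f z else (f u - f z) / (u - z))"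
  define I where "I = (\<lambda>z. contour_integral (circlepath 0 1) (h z) / (2 * pi * \<i>))"
  \<comment> \<open>At the origin \<open>f\<close> carries no information, so the difference
    quotient is useless there and the Cauchy integral itself serves as the value.\<close>
  define F where "F = (\<lambda>z. if z = 0 then contour_integral (circlepath 0 1) (\<lambda>u. f u / u) / (2 * pi * \<i>) else f z + I z)"
  have open_punct: "open (-{0::complex})" by (rule open_Compl) simp
  have hh: "h z holomorphic_on -{0}" for z
    unfolding h_def by (rule pole_lemma_open[OF f open_punct])
  have indep: "g contour_integrable_on circlepath 0 R"
    "contour_integral (circlepath 0 R) g = contour_integral (circlepath 0 1) g"
    if g: "g holomorphic_on -{0}" and R: "R > 0" for g :: "complex \<Rightarrow> complex" and R
  proof -
    have g': "g holomorphic_on UNIV - {0}" using g by (simp add: Compl_eq_Diff_UNIV)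
    show "g contour_integrable_on circlepath 0 R"
      by (rule contour_integral_circlepath_eq(1)[OF open_UNIV g' R order_refl]) simp
    show "contour_integral (circlepath 0 R) g = contour_integral (circlepath 0 1) g"
    proof (cases "R \<le> 1")
      case True
      then show ?thesis using contour_integral_circlepath_eq(3)[OF open_UNIV g' R, of 1] by simp
    next
      case False
      then show ?thesis using contour_integral_circlepath_eq(3)[OF open_UNIV g', of 1 R] by simp
    qed
  qed
  \<comment> \<open>Adding back the Cauchy kernel contributes \<open>f w\<close>, so
    \<open>F w\<close> is the Cauchy integral over every circle enclosing \<open>w\<close>, the case
    \<open>w = 0\<close> included. Differentiation under the integral then makes \<open>F\<close>
    entire.\<close>
  have Feq: "((\<lambda>u. f u / (u - w)) has_contour_integral (2 * pi * \<i> * F w)) (circlepath 0 R)"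
    if R: "R > 0" and w: "norm w < R" for R w
  proof (cases "w = 0")
    case True
    have "(\<lambda>u. f u / u) holomorphic_on -{0}" by (intro holomorphic_intros f) auto
    from has_contour_integral_integral[OF indep(1)[OF this R]] show ?thesis
      unfolding True F_def indep(2)[OF \<open>(\<lambda>u. f u / u) holomorphic_on -{0}\<close> R] by simp
  next
    case False
    have 1: "((\<lambda>u. f w / (u - w)) has_contour_integral (2 * pi * \<i> * f w)) (circlepath 0 R)"
      using Cauchy_integral_circlepath_simple[of "\<lambda>u. f w" 0 R w] w by simp
    have 2: "(h w has_contour_integral (2 * pi * \<i> * I w)) (circlepath 0 R)"
      using has_contour_integral_integral[OF indep(1)[OF hh R, of w]]
      unfolding I_def indep(2)[OF hh R, of w] by simp
    have "((\<lambda>u. f w / (u - w) + h w u) has_contour_integral (2 * pi * \<i> * f w + 2 * pi * \<i> * I w)) (circlepath 0 R)"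
      by (rule has_contour_integral_add[OF 1 2])
    then have "((\<lambda>u. f u / (u - w)) has_contour_integral (2 * pi * \<i> * f w + 2 * pi * \<i> * I w)) (circlepath 0 R)"
    proof (rule has_contour_integral_eq)
      fix u assume "u \<in> path_image (circlepath 0 R)"
      then have "u \<noteq> w" using w R by auto
      then show "f w / (u - w) + h w u = f u / (u - w)" by (simp add: h_def flip: add_divide_distrib)
    qed
    then show ?thesis using False by (simp add: F_def distrib_left)
  qed
  have F: "F holomorphic_on UNIV"
  proof -
    have "F field_differentiable (at w)" for w
    proof -
      define R where "R = norm w + 1"
      have R: "R > 0" "norm w < R" by (auto simp: R_def add_nonneg_pos)
      have "((\<lambda>w. 2 * pi * \<i> * F w) has_field_derivative
          (of_nat 1 * contour_integral (circlepath 0 R) (\<lambda>u. f u/(u-w)^(Suc 1)))) (at w)"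
      proof (rule Cauchy_next_derivative_circlepath(2))
        show "continuous_on (path_image (circlepath 0 R)) f"
          by (rule continuous_on_subset[OF holomorphic_on_imp_continuous_on[OF f]]) (use R in auto)
      qed (use Feq[OF R(1)] R in auto)
      from DERIV_cdivide[OF this, of "2 * pi * \<i>"] show ?thesis
        unfolding field_differentiable_def by auto
    qed
    then show ?thesis by (simp add: holomorphic_on_def)
  qed
  \<comment> \<open>The principal part, read in the variable \<open>1/z\<close>. That the value 0 is
    the right one at the origin is the content of the estimate \<open>bound\<close>.\<close>
  define K where "K = (\<lambda>w. if w = 0 then 0 else f (inverse w) - F (inverse w))"
  have Keq: "K w = - I (inverse w)" if "w \<noteq> 0" for w
    using that by (simp add: K_def F_def)
  have K0: "K 0 = 0" by (simp add: K_def)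
  have "K holomorphic_on UNIV"
  proof (rule no_isolated_singularity'[of "{0}"])
    have i: "inverse holomorphic_on -{0::complex}" by (intro holomorphic_intros) auto
    have 1: "(f \<circ> inverse) holomorphic_on -{0}"
      by (rule holomorphic_on_compose_gen[OF i f]) auto
    have 2: "(F \<circ> inverse) holomorphic_on -{0}"
      by (rule holomorphic_on_compose_gen[OF i F]) auto
    have "K holomorphic_on -{0}"
      by (rule holomorphic_transform[OF holomorphic_on_diff[OF 1 2]]) (auto simp: K_def)
    then show "K holomorphic_on UNIV - {0}" by (simp add: Compl_eq_Diff_UNIV)
    have "compact (sphere (0::complex) 1)" by simp
    moreover have "continuous_on (sphere 0 1) f"
      by (rule continuous_on_subset[OF holomorphic_on_imp_continuous_on[OF f]]) auto
    ultimately have "bounded (f ` sphere 0 1)"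
      by (intro compact_imp_bounded compact_continuous_image)
    then obtain B where B: "B > 0" "\<And>u. norm u = 1 \<Longrightarrow> norm (f u) \<le> B"
      by (auto simp: bounded_pos)
    \<comment> \<open>For small \<open>w\<close> the point \<open>z = 1/w\<close> lies outside the
      unit circle, where the kernel \<open>f z / (u - z)\<close> integrates to 0. Hence
      \<open>I z\<close> is the Cauchy integral of \<open>f\<close> over the unit circle at an
      exterior point and is at most \<open>B / (|z| - 1)\<close>, which is at most
      \<open>2 B |w|\<close> once \<open>|z| > 2\<close>.\<close>
    have bound: "norm (K w) \<le> 2 * B * norm w" if w: "norm w < 1/2" for w
    proof (cases "w = 0")
      case False
      define z where "z = inverse w"
      have z: "norm z > 2"
        unfolding z_def norm_inverse using less_imp_inverse_less[OF w] False by simp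
      have *: "((\<lambda>u. f z / (u - z)) has_contour_integral 0) (circlepath 0 1)"
      proof (rule Cauchy_theorem_disc_simple[of _ 0 "norm z"])
        show "(\<lambda>u. f z / (u - z)) holomorphic_on ball 0 (norm z)"
          by (intro holomorphic_intros) auto
      qed (use z in auto)
      have "((\<lambda>u. f z / (u - z) + h z u) has_contour_integral (0 + 2 * pi * \<i> * I z)) (circlepath 0 1)"
        by (rule has_contour_integral_add[OF *])
           (use has_contour_integral_integral[OF indep(1)[OF hh, of 1 z]] in \<open>simp add: I_def\<close>)
      then have "((\<lambda>u. f u / (u - z)) has_contour_integral (2 * pi * \<i> * I z)) (circlepath 0 1)"
        unfolding add_0
      proof (rule has_contour_integral_eq)
        fix u assume "u \<in> path_image (circlepath (0::complex) 1)"
        then have "u \<noteq> z" using z by auto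
        then show "f z / (u - z) + h z u = f u / (u - z)" by (simp add: h_def flip: add_divide_distrib)
      qed
      then have "norm (2 * pi * \<i> * I z) \<le> B / (norm z - 1) * (2 * pi * 1)"
      proof (rule has_contour_integral_bound_circlepath)
        fix u :: complex assume u: "norm (u - 0) = 1"
        have "norm z - 1 \<le> norm (u - z)" using u norm_triangle_ineq3[of u z] by simp
        then show "norm (f u / (u - z)) \<le> B / (norm z - 1)"
          unfolding norm_divide using B(1) B(2)[of u] u z by (intro frac_le) simp_all
      next
        show "0 \<le> B / (norm z - 1)" using B(1) z by simp
      qed simp
      then have "(2 * pi) * norm (I z) \<le> (2 * pi) * (B / (norm z - 1))"
        by (simp add: norm_mult mult.commute)
      then have "norm (I z) \<le> B / (norm z - 1)"
        by (rule mult_left_le_imp_le) simp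
      also have "\<dots> \<le> B / (norm z / 2)" using z B(1) by (intro divide_left_mono mult_pos_pos) linarith+
      also have "\<dots> = 2 * B * norm w" 
        unfolding z_def norm_inverse divide_inverse inverse_mult_distrib inverse_inverse_eq by simp
      finally show ?thesis using Keq[OF False] by (simp add: z_def)
    qed (simp add: K_def)
    have "eventually (\<lambda>w. norm (K w) \<le> 2 * B * norm w) (at 0)"
      unfolding eventually_at
    proof (intro exI[of _ "1/2"] conjI ballI impI)
      fix w :: complex assume "w \<noteq> 0 \<and> dist w 0 < 1/2"
      then have "norm w < 1/2" by simp
      then show "norm (K w) \<le> 2 * B * norm w" by (rule bound)
    qed simp
    moreover have "((\<lambda>w::complex. 2 * B * norm w) \<longlongrightarrow> 0) (at 0)"
      by (rule tendsto_mult_right_zero[OF tendsto_norm_zero[OF tendsto_ident_at]])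
    ultimately have "(K \<longlongrightarrow> 0) (at 0)" by (rule Lim_null_comparison)
    then show "\<And>z. z \<in> {0} \<Longrightarrow> (K \<longlongrightarrow> K z) (at z within UNIV)"
      using K0 by simp
  qed simp_all
  moreover have "f z = F z + K (inverse z)" if "z \<noteq> 0" for z
    using that by (simp add: K_def)
  ultimately show ?thesis using F K0 by (intro that[of F K])
qed

text \<open>The predicate inside the definite description of \<open>laurent_coeffs\<close>, isolated
  so that coefficients can be exhibited first and identified by uniqueness afterwards.\<close>

definition laurent :: "(complex \<Rightarrow> complex) \<Rightarrow> (int \<Rightarrow> complex) \<Rightarrow> bool" where
  "laurent f c \<longleftrightarrow> (\<forall>z\<in>-{0}. ((\<lambda>n. c n * z powi n) has_sum f z) UNIV)"

text \<open>The Taylor series converges at a point of modulus \<open>|z| + 1\<close>, hence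
  absolutely at \<open>z\<close>, which upgrades ordered to unconditional summation.\<close>

lemma entire_has_sum:
  assumes "F holomorphic_on UNIV"
  shows "((\<lambda>n. (deriv ^^ n) F 0 / fact n * z ^ n) has_sum F z) UNIV"
proof (rule norm_summable_imp_has_sum)
  have s: "(\<lambda>n. (deriv ^^ n) F 0 / fact n * w ^ n) sums F w" for w
    using holomorphic_power_series[of F 0 "norm w + 1" w] assms holomorphic_on_subset[of F UNIV]
    by (simp add: add_nonneg_pos)
  then show "(\<lambda>n. (deriv ^^ n) F 0 / fact n * z ^ n) sums F z" .
  have "summable (\<lambda>n. (deriv ^^ n) F 0 / fact n * of_real (norm z + 1) ^ n)"
    using s sums_summable by blast
  then show "summable (\<lambda>n. norm ((deriv ^^ n) F 0 / fact n * z ^ n))"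
    by (rule powser_insidea) (simp del: of_real_add)
qed

lemma has_sum_intI:
  fixes f :: "int \<Rightarrow> 'a::{t2_space,topological_ab_group_add}"
  assumes "((\<lambda>n. f (int n)) has_sum s) UNIV" "((\<lambda>n. f (- int (Suc n))) has_sum t) UNIV"
  shows "(f has_sum (s + t)) UNIV"
proof -
  have "(f has_sum s) (range int)"
    by (subst has_sum_reindex) (use assms in \<open>auto simp: o_def\<close>)
  moreover have "(f has_sum t) (range (\<lambda>n. - int (Suc n)))"
    by (subst has_sum_reindex) (use assms in \<open>auto simp: o_def inj_on_def\<close>)
  moreover have "range int \<inter> range (\<lambda>n. - int (Suc n)) = {}" by auto
  ultimately have "(f has_sum (s + t)) (range int \<union> range (\<lambda>n. - int (Suc n)))"
    by (rule has_sum_Un_disjoint)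
  moreover have "range int \<union> range (\<lambda>n. - int (Suc n)) = UNIV"
  proof (intro equalityI subsetI)
    fix n :: int
    show "n \<in> range int \<union> range (\<lambda>n. - int (Suc n))" by (cases n rule: int_cases) auto
  qed simp
  ultimately show ?thesis by simp
qed

lemma laurentI:
  assumes F: "F holomorphic_on UNIV" and K: "K holomorphic_on UNIV" "K 0 = 0"
    and eq: "\<And>z. z \<noteq> 0 \<Longrightarrow> f z = F z + K (inverse z)"
  shows "laurent f (\<lambda>n. if n \<ge> 0 then (deriv ^^ nat n) F 0 / fact (nat n)
     else (deriv ^^ nat (- n)) K 0 / fact (nat (- n)))"
  unfolding laurent_def
proof
  fix z :: complex assume "z \<in> -{0}"
  then have z: "z \<noteq> 0" by simp
  have "((\<lambda>n. (deriv ^^ Suc n) K 0 / fact (Suc n) * inverse z ^ Suc n) has_sum K (inverse z)) UNIV"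
  proof -
    have "((\<lambda>n. (deriv ^^ n) K 0 / fact n * inverse z ^ n) has_sum K (inverse z)) (range Suc)"
    proof (rule has_sum_cong_neutral[THEN iffD1, OF _ _ _ entire_has_sum[OF K(1)]])
      fix n :: nat assume "n \<in> UNIV - range Suc"
      then have "n = 0" by (cases n) auto
      then show "(deriv ^^ n) K 0 / fact n * inverse z ^ n = 0" using K(2) by simp
    qed auto
    then show ?thesis by (subst (asm) has_sum_reindex) (auto simp: o_def)
  qed
  moreover have "z powi (- int (Suc n)) = inverse z ^ Suc n" for n
    by (simp only: power_int_minus power_int_of_nat power_inverse)
  ultimately show "((\<lambda>n. (if n \<ge> 0 then (deriv ^^ nat n) F 0 / fact (nat n)
     else (deriv ^^ nat (- n)) K 0 / fact (nat (- n))) * z powi n) has_sum f z) UNIV"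
    unfolding eq[OF z] using entire_has_sum[OF F, of z]
    by (intro has_sum_intI) (simp_all add: nat_add_distrib del: funpow.simps fact_Suc power_Suc)
qed

lemma laurent_exists:
  assumes "f holomorphic_on (-{0})" shows "\<exists>c. laurent f c"
proof -
  obtain F K where "F holomorphic_on UNIV" "K holomorphic_on UNIV" "K 0 = 0"
    "\<And>z. z \<noteq> 0 \<Longrightarrow> f z = F z + K (inverse z)"
    using holomorphic_punctured_split[OF assms] by blast
  from laurentI[OF this] show ?thesis by blast
qed

lemma summable_on_sums_has_sum:
  fixes f :: "nat \<Rightarrow> 'a::{t2_space,topological_comm_monoid_add}"
  assumes "f summable_on UNIV" "f sums s" shows "(f has_sum s) UNIV"
proof -
  have *: "(f has_sum infsum f UNIV) UNIV" using assms(1) by (rule has_sum_infsum)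
  then have "f sums infsum f UNIV" by (rule has_sum_imp_sums)
  then have "infsum f UNIV = s" using assms(2) by (rule sums_unique2)
  then show ?thesis using * by simp
qed

lemma powser_zero_unique:
  fixes a :: "nat \<Rightarrow> complex"
  assumes "\<And>z. (\<lambda>n. a n * z ^ n) sums 0" shows "a n = 0"
proof (induction n rule: less_induct)
  case (less m)
  show ?case
  proof (rule ccontr)
    assume m: "a m \<noteq> 0"
    show False
    proof (rule powser_0_nonzero[of 1 0 a "\<lambda>z. 0" m])
      show "m > 0" using m assms[of 0] by (cases m) auto
      fix s :: real assume s: "0 < s" "\<And>z::complex. z \<in> cball 0 s - {0} \<Longrightarrow> 0 \<noteq> (0::complex)"
      have "complex_of_real s \<in> cball 0 s - {0}" using s(1) by auto
      then show False using s(2) by blast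
    qed (use assms m in auto)
  qed
qed

text \<open>The nonnegative part \<open>F\<close> and the negative part \<open>K\<close>, read in
  \<open>1/z\<close>, are entire with \<open>F z = - K (1/z)\<close>. Since \<open>K 0 = 0\<close>,
  the function \<open>F\<close> tends to 0 at infinity and vanishes by Liouville. Then
  \<open>K\<close> vanishes too, and power series have unique coefficients.\<close>

lemma laurent_zero_unique:
  assumes "laurent (\<lambda>z. 0) c" shows "c = (\<lambda>n. 0)"
proof -
  have s: "(\<lambda>n. c n * z powi n) summable_on UNIV" "infsum (\<lambda>n. c n * z powi n) UNIV = 0" if "z \<noteq> 0" for z
    using assms that by (auto simp: laurent_def has_sum_iff)
  have pw: "z powi (- int (Suc n)) = inverse z ^ Suc n" for z :: complex and n
    by (simp only: power_int_minus power_int_of_nat power_inverse)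
  have s1: "(\<lambda>n. c (int n) * z ^ n) summable_on UNIV" if "z \<noteq> 0" for z
  proof -
    have "(\<lambda>n. c n * z powi n) summable_on range int"
      by (rule summable_on_subset_banach[OF s(1)[OF that]]) simp
    then show ?thesis by (subst (asm) summable_on_reindex) (simp_all add: o_def)
  qed
  have s2: "(\<lambda>n. c (- int (Suc n)) * z ^ Suc n) summable_on UNIV" if "z \<noteq> 0" for z
  proof -
    have "(\<lambda>n. c n * inverse z powi n) summable_on range (\<lambda>n. - int (Suc n))"
      by (rule summable_on_subset_banach[OF s(1)]) (use that in simp_all)
    then show ?thesis
      by (subst (asm) summable_on_reindex) (simp_all add: o_def inj_on_def pw del: of_nat_Suc power_Suc)
  qed
  define F where "F = (\<lambda>z. suminf (\<lambda>n. c (int n) * z ^ n))"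
  \<comment> \<open>The leading coefficient 0 shifts the negative part into a power series without
    constant term, which gives \<open>K 0 = 0\<close>.\<close>
  define b where "b = (\<lambda>n. case n of 0 \<Rightarrow> 0 | Suc m \<Rightarrow> c (- int (Suc m)))"
  define K where "K = (\<lambda>z. suminf (\<lambda>n. b n * z ^ n))"
  have Fs: "(\<lambda>n. c (int n) * z ^ n) sums F z" for z
  proof (cases "z = 0")
    case True
    then show ?thesis by (simp add: F_def sums_iff)
  next
    case False
    then show ?thesis unfolding F_def by (intro summable_sums summable_on_imp_summable s1)
  qed
  have Ks: "(\<lambda>n. b n * z ^ n) sums K z" for z
  proof (cases "z = 0")
    case True
    then show ?thesis by (simp add: K_def sums_iff)
  next
    case False
    have "summable (\<lambda>n. b (Suc n) * z ^ Suc n)"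
      using summable_on_imp_summable[OF s2[OF False]] by (simp add: b_def)
    then have "summable (\<lambda>n. b n * z ^ n)" by (subst (asm) summable_Suc_iff)
    then show ?thesis unfolding K_def by (rule summable_sums)
  qed
  have holF: "F holomorphic_on UNIV" and holK: "K holomorphic_on UNIV"
  proof -
    have "F holomorphic_on ball 0 (norm z + 1)" "K holomorphic_on ball 0 (norm z + 1)" for z :: complex
      using power_series_holomorphic[of 0 "norm z + 1" "\<lambda>n. c (int n)" F] Fs
        power_series_holomorphic[of 0 "norm z + 1" b K] Ks by auto
    then have "F field_differentiable (at z)" "K field_differentiable (at z)" for z
      using holomorphic_on_imp_differentiable_at[of _ "ball 0 (norm z + 1)" z]
      by (auto simp: add_nonneg_pos)
    then show "F holomorphic_on UNIV" "K holomorphic_on UNIV" by (auto simp: holomorphic_on_def)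
  qed
  have K0: "K 0 = 0" using Ks[of 0] by (simp add: b_def)
  have FK: "F z = - K (inverse z)" if z: "z \<noteq> 0" for z
  proof -
    have "((\<lambda>n. c (int n) * z ^ n) has_sum F z) UNIV"
      by (rule summable_on_sums_has_sum[OF s1[OF z] Fs])
    moreover have "((\<lambda>n. c (- int (Suc n)) * inverse z ^ Suc n) has_sum K (inverse z)) UNIV"
    proof -
      have "(\<lambda>n. b (Suc n) * inverse z ^ Suc n) sums K (inverse z)"
        by (subst sums_Suc_iff) (use Ks[of "inverse z"] in \<open>simp add: b_def\<close>)
      then have "(\<lambda>n. c (- int (Suc n)) * inverse z ^ Suc n) sums K (inverse z)" by (simp add: b_def)
      moreover have "(\<lambda>n. c (- int (Suc n)) * inverse z ^ Suc n) summable_on UNIV"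
        using s2[of "inverse z"] z by simp
      ultimately show ?thesis
        by (rule summable_on_sums_has_sum[rotated])
    qed
    ultimately have "((\<lambda>n. c n * z powi n) has_sum (F z + K (inverse z))) UNIV"
      by (intro has_sum_intI) (simp_all add: pw del: power_Suc of_nat_Suc)
    moreover have "((\<lambda>n. c n * z powi n) has_sum 0) UNIV"
      using s[OF z] by (simp add: has_sum_iff)
    ultimately show ?thesis using has_sum_unique by (metis eq_neg_iff_add_eq_0)
  qed
  have F0: "F z = 0" for z
  proof (rule Liouville_weak_0[OF holF])
    have "isCont K 0"
      using holK by (meson continuous_on_eq_continuous_at holomorphic_on_imp_continuous_on iso_tuple_UNIV_I open_UNIV)
    from isCont_tendsto_compose[OF this tendsto_inverse_0]
    have "((\<lambda>z. - K (inverse z)) \<longlongrightarrow> - 0) at_infinity"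
      unfolding K0 by (intro tendsto_minus)
    moreover have "eventually (\<lambda>z::complex. - K (inverse z) = F z) at_infinity"
      unfolding eventually_at_infinity
    proof (intro exI[of _ 1] allI impI)
      fix x :: complex assume "1 \<le> norm x"
      then have "x \<noteq> 0" by auto
      then show "- K (inverse x) = F x" using FK[of x] by simp
    qed
    ultimately show "(F \<longlongrightarrow> 0) at_infinity" by (simp add: tendsto_cong)
  qed
  have Kz: "K z = 0" for z
    using FK[of "inverse z"] F0 K0 by (cases "z = 0") auto
  have "c (int n) = 0" for n
  proof -
    have "(\<lambda>n. c (int n) * z ^ n) sums 0" for z using Fs[of z] F0 by simp
    then show ?thesis by (rule powser_zero_unique)
  qed
  moreover have "c (- int (Suc n)) = 0" for n
  proof -
    have "(\<lambda>n. b n * z ^ n) sums 0" for z using Ks[of z] Kz by simp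
    then have "b (Suc n) = 0" by (rule powser_zero_unique)
    then show ?thesis by (simp add: b_def)
  qed
  ultimately have "c n = 0" for n by (cases n rule: int_cases) simp_all
  then show ?thesis by blast
qed


section \<open>Operations on Laurent series\<close>

lemma laurent_add: "laurent f c \<Longrightarrow> laurent g d \<Longrightarrow> laurent (\<lambda>z. f z + g z) (\<lambda>n. c n + d n)"
  by (simp add: laurent_def distrib_right has_sum_add)

lemma laurent_cmult: "laurent f c \<Longrightarrow> laurent (\<lambda>z. k * f z) (\<lambda>n. k * c n)"
  by (simp add: laurent_def mult.assoc has_sum_cmult_right)

lemma laurent_cong: "(\<And>z. z \<noteq> 0 \<Longrightarrow> f z = g z) \<Longrightarrow> laurent f c = laurent g c"
  by (simp add: laurent_def)

lemma laurent_const: "laurent (\<lambda>z. k) (\<lambda>n. if n = 0 then k else 0)"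
  unfolding laurent_def
proof
  fix z :: complex
  show "((\<lambda>n. (if n = 0 then k else 0) * z powi n) has_sum k) UNIV"
    by (rule has_sum_finite_neutralI[of "{0}"]) auto
qed

lemma laurent_unique:
  assumes "laurent f c" "laurent f d" shows "c = d"
proof -
  have "laurent (\<lambda>z. f z + (-1) * f z) (\<lambda>n. c n + (-1) * d n)"
    by (intro laurent_add laurent_cmult assms)
  then have "laurent (\<lambda>z. 0) (\<lambda>n. c n - d n)" by simp
  from fun_cong[OF laurent_zero_unique[OF this]] show ?thesis by auto
qed

lemma laurent_coeffs_eqI: "laurent f c \<Longrightarrow> laurent_coeffs f = c"
  unfolding laurent_coeffs_def laurent_def[symmetric] using laurent_unique by blast

lemma laurent_laurent_coeffs:
  assumes "f holomorphic_on (-{0})" shows "laurent f (laurent_coeffs f)"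
  using laurent_exists[OF assms] laurent_coeffs_eqI by metis

lemma laurent_zero_coeffs:
  assumes "laurent f (\<lambda>n. 0)" "z \<noteq> 0" shows "f z = 0"
  using assms has_sum_unique[OF _ has_sum_0] by (fastforce simp: laurent_def)

lemma entire_euler_sums:
  assumes F: "F holomorphic_on UNIV"
  shows "((\<lambda>n. of_nat n * ((deriv ^^ n) F 0 / fact n) * z ^ n) has_sum (z * deriv F z)) UNIV"
proof -
  have D: "deriv F holomorphic_on UNIV" using F by (rule holomorphic_deriv) simp
  have "((\<lambda>n. z * ((deriv ^^ n) (deriv F) 0 / fact n * z ^ n)) has_sum (z * deriv F z)) UNIV"
    by (intro has_sum_cmult_right entire_has_sum D)
  moreover have "z * ((deriv ^^ n) (deriv F) 0 / fact n * z ^ n)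
      = of_nat (Suc n) * ((deriv ^^ Suc n) F 0 / fact (Suc n)) * z ^ Suc n" for n
  proof -
    have "(deriv ^^ n) (deriv F) = (deriv ^^ Suc n) F" by (simp only: funpow_Suc_right o_apply)
    moreover have "fact (Suc n) = of_nat (Suc n) * (fact n :: complex)" by (rule fact_Suc)
    moreover have "of_nat (Suc n) \<noteq> (0 :: complex)" by (rule of_nat_neq_0)
    ultimately show ?thesis by (simp del: of_nat_Suc funpow.simps fact_Suc)
  qed
  ultimately have "((\<lambda>n. of_nat (Suc n) * ((deriv ^^ Suc n) F 0 / fact (Suc n)) * z ^ Suc n)
      has_sum (z * deriv F z)) UNIV" by simp
  then have "((\<lambda>n. of_nat n * ((deriv ^^ n) F 0 / fact n) * z ^ n) has_sum (z * deriv F z)) (range Suc)"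
    by (subst has_sum_reindex) (simp_all add: o_def del: of_nat_Suc funpow.simps fact_Suc power_Suc)
  then show ?thesis
  proof (rule has_sum_cong_neutral[THEN iffD1, rotated -1])
    fix n :: nat assume "n \<in> UNIV - range Suc"
    then have "n = 0" by (cases n) auto
    then show "of_nat n * ((deriv ^^ n) F 0 / fact n) * z ^ n = 0" by simp
  qed auto
qed

text \<open>The decomposition \<open>f z = F z + K (1/z)\<close> reduces the claim to Taylor series.
  The chain rule turns the Euler derivative of the second summand into minus the Euler derivative of
  \<open>K\<close> at \<open>1/z\<close>, and this sign is that of the negative exponents.\<close>

lemma laurent_euler:
  assumes f: "f holomorphic_on (-{0})" and c: "laurent f c"
  shows "laurent (\<lambda>z. z * deriv f z) (\<lambda>n. of_int n * c n)"
proof -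
  obtain F K where F: "F holomorphic_on UNIV" and K: "K holomorphic_on UNIV" "K 0 = 0"
    and eq: "\<And>z. z \<noteq> 0 \<Longrightarrow> f z = F z + K (inverse z)"
    using holomorphic_punctured_split[OF f] by blast
  have c: "c = (\<lambda>n. if n \<ge> 0 then (deriv ^^ nat n) F 0 / fact (nat n)
     else (deriv ^^ nat (- n)) K 0 / fact (nat (- n)))"
    by (rule laurent_unique[OF c laurentI[OF F K eq]])
  show ?thesis
    unfolding laurent_def
  proof
    fix z :: complex assume "z \<in> -{0}"
    then have z: "z \<noteq> 0" by simp
    have dF: "(F has_field_derivative deriv F z) (at z)"
      using F holomorphic_derivI open_UNIV by blast
    have dK: "(K has_field_derivative deriv K (inverse z)) (at (inverse z))"
      using K holomorphic_derivI open_UNIV by blast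
    have "((\<lambda>z. F z + K (inverse z)) has_field_derivative
        (deriv F z + deriv K (inverse z) * (- (inverse z * 1 * inverse z)))) (at z)"
      by (intro DERIV_add dF DERIV_chain2[where f = K and g = inverse, OF dK] DERIV_inverse' DERIV_ident z)
    then have "(f has_field_derivative
        (deriv F z + deriv K (inverse z) * (- (inverse z * 1 * inverse z)))) (at z)"
      by (rule has_field_derivative_transform_within_open[of _ _ _ "-{0}"]) (use z eq in auto)
    then have d: "z * deriv f z = z * deriv F z + (- (inverse z * deriv K (inverse z)))"
      using z by (simp add: DERIV_imp_deriv field_simps)
    have "((\<lambda>n. of_nat (Suc n) * ((deriv ^^ Suc n) K 0 / fact (Suc n)) * inverse z ^ Suc n)
       has_sum inverse z * deriv K (inverse z)) UNIV"
    proof -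
      have "((\<lambda>n. of_nat n * ((deriv ^^ n) K 0 / fact n) * inverse z ^ n)
          has_sum inverse z * deriv K (inverse z)) (range Suc)"
      proof (rule has_sum_cong_neutral[THEN iffD1, OF _ _ _ entire_euler_sums[OF K(1)]])
        fix n :: nat assume "n \<in> UNIV - range Suc"
        then have "n = 0" by (cases n) auto
        then show "of_nat n * ((deriv ^^ n) K 0 / fact n) * inverse z ^ n = 0" by simp
      qed auto
      then show ?thesis by (subst (asm) has_sum_reindex) (simp_all add: o_def del: of_nat_Suc funpow.simps fact_Suc power_Suc)
    qed
    then have hs: "((\<lambda>n. - (of_nat (Suc n) * ((deriv ^^ Suc n) K 0 / fact (Suc n)) * inverse z ^ Suc n))
       has_sum (- (inverse z * deriv K (inverse z)))) UNIV"
      by (rule has_sum_uminusI)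
    have eqn: "of_int (- int (Suc n)) * c (- int (Suc n)) * z powi (- int (Suc n))
       = - (of_nat (Suc n) * ((deriv ^^ Suc n) K 0 / fact (Suc n)) * inverse z ^ Suc n)" for n
    proof -
      have "z powi (- int (Suc n)) = inverse z ^ Suc n"
        by (simp only: power_int_minus power_int_of_nat power_inverse)
      moreover have "c (- int (Suc n)) = (deriv ^^ Suc n) K 0 / fact (Suc n)"
        unfolding c by (simp add: nat_add_distrib del: funpow.simps fact_Suc)
      moreover have "of_int (- int (Suc n)) = (- of_nat (Suc n) :: complex)"
        by (simp only: of_int_minus of_int_of_nat_eq)
      ultimately show ?thesis by (simp only: mult_minus_left)
    qed
    show "((\<lambda>n. of_int n * c n * z powi n) has_sum (z * deriv f z)) UNIV"
      unfolding d
    proof (rule has_sum_intI)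
      show "((\<lambda>n. of_int (int n) * c (int n) * z powi int n) has_sum (z * deriv F z)) UNIV"
        using entire_euler_sums[OF F, of z] by (simp add: c del: funpow.simps fact_Suc power_Suc)
      show "((\<lambda>n. of_int (- int (Suc n)) * c (- int (Suc n)) * z powi (- int (Suc n)))
          has_sum (- (inverse z * deriv K (inverse z)))) UNIV"
        by (simp only: eqn hs)
    qed
  qed
qed

text \<open>For complex families summability is absolute, so the double family of products is
  summable and may be regrouped along the diagonals \<open>n + m = k\<close>.\<close>

lemma laurent_mult:
  assumes c: "laurent f c" and d: "laurent g d"
  shows "laurent (\<lambda>z. f z * g z) (\<lambda>k. \<Sum>\<^sub>\<infinity>n. c n * d (k - n))"
  unfolding laurent_def
proof
  fix z :: complex assume "z \<in> -{0}"
  then have z: "z \<noteq> 0" by simp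
  have f: "((\<lambda>n. c n * z powi n) has_sum f z) UNIV" and g: "((\<lambda>n. d n * z powi n) has_sum g z) UNIV"
    using c d z by (auto simp: laurent_def)
  have fa: "(\<lambda>n. norm (c n * z powi n)) summable_on UNIV" and ga: "(\<lambda>n. norm (d n * z powi n)) summable_on UNIV"
    using has_sum_imp_summable[OF f] has_sum_imp_summable[OF g]
    by (simp_all add: summable_on_iff_abs_summable_on_complex)
  define S where "S = (\<lambda>(n, m). (c n * z powi n) * (d m * z powi m))"
  have "(\<lambda>x. norm (S x)) summable_on (UNIV \<times> UNIV)"
    by (rule summable_on_SigmaI[where g = "\<lambda>n. norm (c n * z powi n) * infsum (\<lambda>m. norm (d m * z powi m)) UNIV"])
      (use fa ga in \<open>auto simp: S_def norm_mult intro!: has_sum_cmult_right summable_on_cmult_left has_sum_infsum\<close>)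
  then have S: "S summable_on (UNIV \<times> UNIV)" by (rule abs_summable_summable)
  have "infsum S (UNIV \<times> UNIV) = (\<Sum>\<^sub>\<infinity>n. \<Sum>\<^sub>\<infinity>m. S (n, m))"
    by (rule infsum_Sigma_banach[symmetric]) (use S in simp)
  also have "\<dots> = f z * g z"
    using f g by (simp add: S_def infsum_cmult_right' infsum_cmult_left' has_sum_iff)
  finally have S': "(S has_sum (f z * g z)) (UNIV \<times> UNIV)"
    using S by (metis has_sum_infsum)
  have "((\<lambda>(k, n). (c n * d (k - n)) * z powi k) has_sum (f z * g z)) (UNIV \<times> UNIV)"
    by (rule has_sum_reindex_bij_witness[THEN iffD1, OF _ _ _ _ _ refl S',
          of "\<lambda>(k, n). (n, k - n)" "\<lambda>(n, m). (n + m, n)"])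
      (auto simp: S_def power_int_add z)
  then have 1: "((\<lambda>(k, n). (c n * d (k - n)) * z powi k) has_sum (f z * g z)) (SIGMA k:UNIV. UNIV)" by simp
  then have "(\<lambda>n. (c n * d (k - n)) * z powi k) summable_on UNIV" for k
    using summable_on_SigmaD1[OF has_sum_imp_summable[OF 1], of k] by simp
  then have 2: "((\<lambda>n. (c n * d (k - n)) * z powi k) has_sum (\<Sum>\<^sub>\<infinity>n. c n * d (k - n)) * z powi k) UNIV" for k
    by (simp add: has_sum_infsum flip: infsum_cmult_left')
  show "((\<lambda>k. (\<Sum>\<^sub>\<infinity>n. c n * d (k - n)) * z powi k) has_sum (f z * g z)) UNIV"
    by (rule has_sum_SigmaD[OF 1]) (use 2 in simp)
qed

text \<open>Boundedness of the terms at \<open>z = 2^k\<close> and at \<open>z = 2^(-k)\<close>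
  bounds \<open>2^(k |n|) |c n|\<close>, and the Bernoulli-type inequality
  \<open>1 + |n| \<le> 2^|n|\<close> trades this exponential factor for the polynomial
  weight.\<close>

lemma laurent_decay:
  assumes c: "laurent f c"
  shows "\<exists>C. \<forall>n. (1 + \<bar>real_of_int n\<bar>) ^ k * norm (c n) \<le> C"
proof -
  define r :: real where "r = 2 ^ k"
  have r: "r > 0" by (simp add: r_def)
  have bnd: "\<exists>C. \<forall>n. norm (c n * z powi n) \<le> C" if "z \<noteq> 0" for z
  proof -
    have "((\<lambda>n. c n * z powi n) has_sum f z) UNIV" using c that by (auto simp: laurent_def)
    then have "(\<lambda>n. c n * z powi n) summable_on UNIV" by (rule has_sum_imp_summable)
    then have s: "(\<lambda>n. norm (c n * z powi n)) summable_on UNIV"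
      by (simp only: summable_on_iff_abs_summable_on_complex)
    have "norm (c n * z powi n) \<le> (\<Sum>\<^sub>\<infinity>n. norm (c n * z powi n))" for n
      using finite_sum_le_infsum[OF s, of "{n}"] by simp
    then show ?thesis by blast
  qed
  obtain A B where A: "\<And>n. norm (c n * of_real r powi n) \<le> A"
    and B: "\<And>n. norm (c n * of_real (inverse r) powi n) \<le> B"
    using bnd[of "of_real r"] bnd[of "of_real (inverse r)"] r by auto
  have "(1 + \<bar>real_of_int n\<bar>) ^ k * norm (c n) \<le> max A B" for n
  proof -
    define m where "m = nat \<bar>n\<bar>"
    have "(1 + real m) ^ k \<le> (2 ^ m) ^ k"
    proof (rule power_mono)
      have "Suc m \<le> 2 ^ m" by (induction m) auto
      then have "real (Suc m) \<le> real (2 ^ m)" by (simp only: of_nat_le_iff)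
      then show "1 + real m \<le> 2 ^ m" by simp
    qed simp
    also have "\<dots> = r ^ m" by (simp add: r_def mult.commute flip: power_mult)
    finally have 1: "(1 + \<bar>real_of_int n\<bar>) ^ k \<le> r ^ m" by (simp add: m_def)
    have "r ^ m * norm (c n) \<le> max A B"
    proof (cases "n \<ge> 0")
      case True
      then have "n = int m" by (simp add: m_def)
      then show ?thesis using A[of n] r by (simp add: norm_mult norm_power mult.commute)
    next
      case False
      then have "n = - int m" by (simp add: m_def)
      then show ?thesis using B[of n] r
        by (simp add: norm_mult norm_power power_int_minus norm_inverse mult.commute power_inverse)
    qed
    then show ?thesis using mult_right_mono[OF 1, of "norm (c n)"] by simp
  qed
  then show ?thesis by blast
qed

section \<open>The homomorphism from holomorphic functions to the torus\<close>

lemma hol_carrier_iff: "f \<in> carrier hol_ring \<longleftrightarrow> f holomorphic_on (-{0}) \<and> f \<in> extensional (-{0})"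
  by (simp add: hol_ring_def)

lemma hol_mult: "f \<otimes>\<^bsub>hol_ring\<^esub> g = (\<lambda>z\<in>-{0}. f z * g z)"
  and hol_add: "f \<oplus>\<^bsub>hol_ring\<^esub> g = (\<lambda>z\<in>-{0}. f z + g z)"
  and hol_zero: "\<zero>\<^bsub>hol_ring\<^esub> = hol_const 0"
  and hol_one: "\<one>\<^bsub>hol_ring\<^esub> = hol_const 1"
  by (simp_all add: hol_ring_def hol_const_def)

lemma restrict_hol_closed:
  assumes "f holomorphic_on (-{0})" shows "restrict f (-{0}) \<in> carrier hol_ring"
  unfolding hol_carrier_iff using holomorphic_transform[OF assms] by simp

lemma hol_const_closed: "hol_const c \<in> carrier hol_ring"
  unfolding hol_const_def by (rule restrict_hol_closed) simp

lemma hol_mult_closed: "f \<in> carrier hol_ring \<Longrightarrow> g \<in> carrier hol_ring \<Longrightarrow> f \<otimes>\<^bsub>hol_ring\<^esub> g \<in> carrier hol_ring"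
  unfolding hol_mult by (rule restrict_hol_closed) (simp add: hol_carrier_iff holomorphic_on_mult)

lemma hol_add_closed: "f \<in> carrier hol_ring \<Longrightarrow> g \<in> carrier hol_ring \<Longrightarrow> f \<oplus>\<^bsub>hol_ring\<^esub> g \<in> carrier hol_ring"
  unfolding hol_add by (rule restrict_hol_closed) (simp add: hol_carrier_iff holomorphic_on_add)

lemma hol_eqI:
  "\<lbrakk>f \<in> carrier hol_ring; g \<in> carrier hol_ring; \<And>z. z \<noteq> 0 \<Longrightarrow> f z = g z\<rbrakk> \<Longrightarrow> f = g"
  by (rule extensionalityI[of _ "-{0}"]) (auto simp: hol_carrier_iff)

lemma cring_hol_ring: "cring hol_ring"
proof (rule cringI)
  show "abelian_group hol_ring"
  proof (rule abelian_groupI)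
    fix f assume f: "f \<in> carrier hol_ring"
    show "\<exists>g\<in>carrier hol_ring. g \<oplus>\<^bsub>hol_ring\<^esub> f = \<zero>\<^bsub>hol_ring\<^esub>"
      by (rule bexI[OF _ hol_mult_closed[OF hol_const_closed[of "-1"] f]])
        (auto simp: hol_add hol_mult hol_const_def hol_zero)
  qed (auto intro!: hol_eqI hol_add_closed hol_const_closed simp: hol_zero, auto simp: hol_add hol_const_def)
  show "Group.comm_monoid hol_ring"
    by (rule comm_monoidI) (auto intro!: hol_eqI hol_mult_closed hol_const_closed simp: hol_one,
        auto simp: hol_mult hol_const_def)
qed (auto simp: hol_mult hol_add distrib_right)

lemma hol_delta_closed: "f \<in> carrier hol_ring \<Longrightarrow> hol_delta \<tau> f \<in> carrier hol_ring"
  unfolding hol_delta_def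
  by (rule restrict_hol_closed, intro holomorphic_intros holomorphic_deriv) (auto simp: hol_carrier_iff)

lemma psi_closed:
  assumes "f \<in> carrier hol_ring" shows "psi f \<in> carrier (nc_torus \<theta>)"
  unfolding torus_carrier_iff
proof
  fix k
  have "laurent f (laurent_coeffs f)" using assms by (simp add: hol_carrier_iff laurent_laurent_coeffs)
  then obtain C where C: "\<And>n. (1 + \<bar>real_of_int n\<bar>) ^ k * norm (laurent_coeffs f n) \<le> C"
    using laurent_decay by blast
  then have C0: "C \<ge> 0" using order_trans[OF _ C[of 0]] by simp
  have "wt n ^ k * norm (psi f n) \<le> C" for n
    using C[of "fst n"] C0 by (cases n) (auto simp: psi_def wt_def)
  then show "\<exists>C. \<forall>n. wt n ^ k * norm (psi f n) \<le> C" by blast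
qed

lemma psi_eqI: "laurent f c \<Longrightarrow> psi f = (\<lambda>(n1, n2). if n2 = 0 then c n1 else 0)"
  using laurent_coeffs_eqI[of f c] by (auto simp: psi_def)

lemma psi_add:
  assumes "f \<in> carrier hol_ring" "g \<in> carrier hol_ring"
  shows "psi (f \<oplus>\<^bsub>hol_ring\<^esub> g) = psi f \<oplus>\<^bsub>nc_torus \<theta>\<^esub> psi g"
proof -
  have "laurent f (laurent_coeffs f)" "laurent g (laurent_coeffs g)"
    using assms by (simp_all add: hol_carrier_iff laurent_laurent_coeffs)
  from laurent_add[OF this] have "laurent (f \<oplus>\<^bsub>hol_ring\<^esub> g) (\<lambda>n. laurent_coeffs f n + laurent_coeffs g n)"
    by (subst laurent_cong) (simp_all add: hol_add)
  from psi_eqI[OF this] show ?thesis by (auto simp: psi_def torus_add)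
qed

lemma psi_mult:
  assumes "f \<in> carrier hol_ring" "g \<in> carrier hol_ring"
  shows "psi (f \<otimes>\<^bsub>hol_ring\<^esub> g) = psi f \<otimes>\<^bsub>nc_torus \<theta>\<^esub> psi g"
proof -
  have "laurent f (laurent_coeffs f)" "laurent g (laurent_coeffs g)"
    using assms by (simp_all add: hol_carrier_iff laurent_laurent_coeffs)
  from laurent_mult[OF this]
  have l: "laurent (f \<otimes>\<^bsub>hol_ring\<^esub> g) (\<lambda>k. \<Sum>\<^sub>\<infinity>n. laurent_coeffs f n * laurent_coeffs g (k - n))"
    by (subst laurent_cong) (simp_all add: hol_mult)
  show ?thesis
  proof
    fix k :: "int \<times> int"
    \<comment> \<open>Only indices on the line \<open>n2 = 0\<close> contribute, and there the twist
      is 1, so the product is the untwisted convolution of Laurent coefficients.\<close>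
    have "(psi f \<otimes>\<^bsub>nc_torus \<theta>\<^esub> psi g) k
      = (\<Sum>\<^sub>\<infinity>n\<in>range (\<lambda>n. (n, 0)). psi f n * psi g (k - n) * twist \<theta> n (k - n))"
      unfolding torus_mult by (rule infsum_cong_neutral) (auto simp: psi_def)
    also have "\<dots> = (\<Sum>\<^sub>\<infinity>n. psi f (n, 0) * psi g (k - (n, 0)) * twist \<theta> (n, 0) (k - (n, 0)))"
      by (subst infsum_reindex) (auto simp: inj_on_def o_def)
    also have "\<dots> = psi (f \<otimes>\<^bsub>hol_ring\<^esub> g) k"
      unfolding psi_eqI[OF l] by (cases k) (auto simp: psi_def twist_def minus_prod_def)
    finally show "psi (f \<otimes>\<^bsub>hol_ring\<^esub> g) k = (psi f \<otimes>\<^bsub>nc_torus \<theta>\<^esub> psi g) k" by simp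
  qed
qed

lemma psi_const: "psi (hol_const c) = torus_const c"
proof -
  have "laurent (hol_const c) (\<lambda>n. if n = 0 then c else 0)"
    using laurent_const[of c] by (subst laurent_cong) (simp_all add: hol_const_def)
  from psi_eqI[OF this] show ?thesis by (auto simp: torus_const_def)
qed

lemma psi_inj:
  assumes f: "f \<in> carrier hol_ring" and 0: "psi f = \<zero>\<^bsub>nc_torus \<theta>\<^esub>"
  shows "f = \<zero>\<^bsub>hol_ring\<^esub>"
proof -
  have "laurent_coeffs f n = psi f (n, 0)" for n by (simp add: psi_def)
  then have "laurent_coeffs f = (\<lambda>n. 0)" unfolding 0 torus_zero by blast
  then have "laurent f (\<lambda>n. 0)" using laurent_laurent_coeffs f by (metis hol_carrier_iff)
  then show ?thesis
    by (intro hol_eqI f) (simp_all add: hol_zero hol_const_closed laurent_zero_coeffs, simp add: hol_const_def)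
qed

text \<open>Both derivations are diagonal on powers: \<open>\<tau> n\<close> for \<open>z^n\<close>
  and \<open>2 \<pi> i \<tau> n\<close> for \<open>U_1^n\<close>. The discrepancy is absorbed by the
  factor in front of the connection in \<open>psi_obj\<close>.\<close>

lemma psi_delta:
  assumes f: "f \<in> carrier hol_ring"
  shows "torus_delta \<tau> (psi f) = (\<lambda>n. 2 * pi * \<i> * psi (hol_delta \<tau> f) n)"
proof -
  have h: "f holomorphic_on (-{0})" using f by (simp add: hol_carrier_iff)
  from laurent_cmult[OF laurent_euler[OF h laurent_laurent_coeffs[OF h]]]
  have "laurent (hol_delta \<tau> f) (\<lambda>n. \<tau> * (of_int n * laurent_coeffs f n))"
    by (subst laurent_cong) (simp_all add: hol_delta_def mult.assoc)
  from psi_eqI[OF this] show ?thesis by (auto simp: torus_delta_eq psi_def)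
qed

lemma psi_ring_hom: "psi \<in> Ring.ring_hom hol_ring (nc_torus \<theta>)"
  by (rule ring_hom_memI) (simp_all add: psi_closed psi_mult psi_add psi_const hol_one torus_one_const)

section \<open>Tensor products\<close>

lemma hom_finprod_map:
  assumes "comm_monoid G" "comm_monoid H" "f \<in> hom G H" "f \<one>\<^bsub>G\<^esub> = \<one>\<^bsub>H\<^esub>"
    and "finite A" "g \<in> A \<rightarrow> carrier G"
  shows "f (finprod G g A) = finprod H (\<lambda>i. f (g i)) A"
  using assms(5,6)
proof (induction A)
  case empty
  then show ?case using assms by (simp add: comm_monoid.finprod_empty)
next
  case (insert a A)
  then have "(\<lambda>i. f (g i)) \<in> insert a A \<rightarrow> carrier H" using assms(3) by (auto simp: hom_def)
  then show ?case using insert assms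
    by (simp add: comm_monoid.finprod_insert hom_mult comm_monoid.finprod_closed Pi_iff)
qed

lemma hom_pointwise_mult:
  assumes "comm_group H" "f \<in> hom G H" "g \<in> hom G H"
  shows "(\<lambda>x. f x \<otimes>\<^bsub>H\<^esub> g x) \<in> hom G H"
proof -
  interpret comm_group H by fact
  show ?thesis
    using assms(2,3) by (auto simp: hom_def Pi_iff m_ac)
qed

section \<open>The tensor product and its universal property\<close>

locale tensor_product =
  fixes R :: "('r, 'w) ring_scheme" and S :: "('s, 'v) ring_scheme" and h :: "'r \<Rightarrow> 's"
    and M :: "('r, 'm, 'x) module_scheme"
  assumes cringR: "cring R" and ringS: "Ring.ring S" and moduleM: "Module.module R M"
    and hom: "h \<in> Ring.ring_hom R S"
begin

abbreviation "F \<equiv> free_Abelian_group (carrier M \<times> carrier S)"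
abbreviation "N \<equiv> tensor_null R S h M"
abbreviation "T \<equiv> tensor_group R S h M"
abbreviation "t \<equiv> tens R S h M"

definition balanced :: "('g, 'y) monoid_scheme \<Rightarrow> ('m \<Rightarrow> 's \<Rightarrow> 'g) \<Rightarrow> bool" where
  "balanced G \<beta> \<longleftrightarrow>
     (\<forall>x\<in>carrier M. \<forall>a\<in>carrier S. \<beta> x a \<in> carrier G) \<and>
     (\<forall>x\<in>carrier M. \<forall>y\<in>carrier M. \<forall>a\<in>carrier S. \<beta> (x \<oplus>\<^bsub>M\<^esub> y) a = \<beta> x a \<otimes>\<^bsub>G\<^esub> \<beta> y a) \<and>
     (\<forall>x\<in>carrier M. \<forall>a\<in>carrier S. \<forall>b\<in>carrier S. \<beta> x (a \<oplus>\<^bsub>S\<^esub> b) = \<beta> x a \<otimes>\<^bsub>G\<^esub> \<beta> x b) \<and>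
     (\<forall>r\<in>carrier R. \<forall>x\<in>carrier M. \<forall>a\<in>carrier S. \<beta> (r \<odot>\<^bsub>M\<^esub> x) a = \<beta> x (h r \<otimes>\<^bsub>S\<^esub> a))"

lemma balancedI:
  assumes "\<And>x a. \<lbrakk>x \<in> carrier M; a \<in> carrier S\<rbrakk> \<Longrightarrow> \<beta> x a \<in> carrier G"
    and "\<And>x y a. \<lbrakk>x \<in> carrier M; y \<in> carrier M; a \<in> carrier S\<rbrakk> \<Longrightarrow> \<beta> (x \<oplus>\<^bsub>M\<^esub> y) a = \<beta> x a \<otimes>\<^bsub>G\<^esub> \<beta> y a"
    and "\<And>x a b. \<lbrakk>x \<in> carrier M; a \<in> carrier S; b \<in> carrier S\<rbrakk> \<Longrightarrow> \<beta> x (a \<oplus>\<^bsub>S\<^esub> b) = \<beta> x a \<otimes>\<^bsub>G\<^esub> \<beta> x b"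
    and "\<And>r x a. \<lbrakk>r \<in> carrier R; x \<in> carrier M; a \<in> carrier S\<rbrakk> \<Longrightarrow> \<beta> (r \<odot>\<^bsub>M\<^esub> x) a = \<beta> x (h r \<otimes>\<^bsub>S\<^esub> a)"
  shows "balanced G \<beta>"
  using assms unfolding balanced_def by blast

lemma h_closed: "r \<in> carrier R \<Longrightarrow> h r \<in> carrier S"
  using hom by (rule ring_hom_closed)

lemma M_closed [simp]:
  "x \<in> carrier M \<Longrightarrow> y \<in> carrier M \<Longrightarrow> x \<oplus>\<^bsub>M\<^esub> y \<in> carrier M"
  "r \<in> carrier R \<Longrightarrow> x \<in> carrier M \<Longrightarrow> r \<odot>\<^bsub>M\<^esub> x \<in> carrier M"
  using moduleM by (auto simp: Module.module_def module_axioms_def abelian_group_def abelian_monoid.a_closed)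

lemma S_closed [simp]:
  "a \<in> carrier S \<Longrightarrow> b \<in> carrier S \<Longrightarrow> a \<oplus>\<^bsub>S\<^esub> b \<in> carrier S"
  "a \<in> carrier S \<Longrightarrow> b \<in> carrier S \<Longrightarrow> a \<otimes>\<^bsub>S\<^esub> b \<in> carrier S"
  "\<one>\<^bsub>S\<^esub> \<in> carrier S"
proof -
  interpret S: Ring.ring S by (rule ringS)
  show "a \<in> carrier S \<Longrightarrow> b \<in> carrier S \<Longrightarrow> a \<oplus>\<^bsub>S\<^esub> b \<in> carrier S"
    "a \<in> carrier S \<Longrightarrow> b \<in> carrier S \<Longrightarrow> a \<otimes>\<^bsub>S\<^esub> b \<in> carrier S"
    "\<one>\<^bsub>S\<^esub> \<in> carrier S" by simp_all
qed

lemma comm_group_F: "comm_group F" by (rule abelian_free_Abelian_group)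

lemma F_diff: "u \<in> carrier F \<Longrightarrow> v \<in> carrier F \<Longrightarrow> u - v \<in> carrier F"
  using keys_diff[of u v] by auto

lemma relations_subset: "tensor_relations R S h M \<subseteq> carrier F"
  unfolding tensor_relations_def by (auto simp del: carrier_free_Abelian_group_iff intro!: F_diff simp: h_closed)

lemma null_subgroup: "subgroup N F"
  unfolding tensor_null_def
  by (rule group.generate_is_subgroup[OF group_free_Abelian_group relations_subset])

lemma null_normal: "N \<lhd> F"
  using null_subgroup comm_group.normal_iff_subgroup[OF comm_group_F] by blast

lemma comm_group_T: "comm_group T"
  unfolding tensor_group_def by (rule comm_group.abelian_FactGroup[OF comm_group_F null_subgroup])

sublocale T: comm_group T by (rule comm_group_T)

lemma carrier_T: "carrier T = (\<lambda>u. N #>\<^bsub>F\<^esub> u) ` carrier F"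
  unfolding tensor_group_def by (rule carrier_FactGroup)

lemma coset_mult:
  "u \<in> carrier F \<Longrightarrow> v \<in> carrier F \<Longrightarrow> (N #>\<^bsub>F\<^esub> u) \<otimes>\<^bsub>T\<^esub> (N #>\<^bsub>F\<^esub> v) = N #>\<^bsub>F\<^esub> (u + v)"
  using normal.rcos_sum[OF null_normal, of u v] unfolding tensor_group_def by simp

lemma coset_eqI:
  assumes "u \<in> carrier F" "v \<in> carrier F" "u - v \<in> N"
  shows "N #>\<^bsub>F\<^esub> u = N #>\<^bsub>F\<^esub> v"
proof -
  have d: "u - v \<in> carrier F" using assms F_diff by blast
  have "N #>\<^bsub>F\<^esub> u = N #>\<^bsub>F\<^esub> ((u - v) \<otimes>\<^bsub>F\<^esub> v)" by simp
  also have "\<dots> = (N #>\<^bsub>F\<^esub> (u - v)) #>\<^bsub>F\<^esub> v"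
    by (rule group.coset_mult_assoc[symmetric, OF group_free_Abelian_group subgroup.subset[OF null_subgroup] d assms(2)])
  also have "N #>\<^bsub>F\<^esub> (u - v) = N"
    by (rule group.coset_join2[OF group_free_Abelian_group d null_subgroup assms(3)])
  finally show ?thesis .
qed

lemma frag_carrier: "x \<in> carrier M \<Longrightarrow> a \<in> carrier S \<Longrightarrow> frag_of (x, a) \<in> carrier F"
  by simp

lemma t_closed [simp]: "x \<in> carrier M \<Longrightarrow> a \<in> carrier S \<Longrightarrow> t x a \<in> carrier T"
  unfolding tens_def carrier_T by (auto intro: frag_carrier simp del: carrier_free_Abelian_group_iff)

lemma null_relation: "u \<in> tensor_relations R S h M \<Longrightarrow> u \<in> N"
  unfolding tensor_null_def by (rule generate.incl)

lemma F_add: "u \<in> carrier F \<Longrightarrow> v \<in> carrier F \<Longrightarrow> u + v \<in> carrier F"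
  using Poly_Mapping.keys_add[of u v] by auto

lemma t_add_left:
  assumes "x \<in> carrier M" "y \<in> carrier M" "a \<in> carrier S"
  shows "t (x \<oplus>\<^bsub>M\<^esub> y) a = t x a \<otimes>\<^bsub>T\<^esub> t y a"
proof -
  have "frag_of (x \<oplus>\<^bsub>M\<^esub> y, a) - frag_of (x, a) - frag_of (y, a) \<in> N"
    by (rule null_relation) (use assms in \<open>auto simp: tensor_relations_def\<close>)
  then have "frag_of (x \<oplus>\<^bsub>M\<^esub> y, a) - (frag_of (x, a) + frag_of (y, a)) \<in> N"
    by (simp add: algebra_simps)
  then have "N #>\<^bsub>F\<^esub> frag_of (x \<oplus>\<^bsub>M\<^esub> y, a) = N #>\<^bsub>F\<^esub> (frag_of (x, a) + frag_of (y, a))"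
    by (intro coset_eqI F_add frag_carrier assms M_closed)
  then show ?thesis unfolding tens_def by (simp only: coset_mult frag_carrier assms)
qed

lemma t_add_right:
  assumes "x \<in> carrier M" "a \<in> carrier S" "b \<in> carrier S"
  shows "t x (a \<oplus>\<^bsub>S\<^esub> b) = t x a \<otimes>\<^bsub>T\<^esub> t x b"
proof -
  have "frag_of (x, a \<oplus>\<^bsub>S\<^esub> b) - frag_of (x, a) - frag_of (x, b) \<in> N"
    by (rule null_relation) (use assms in \<open>auto simp: tensor_relations_def\<close>)
  then have "frag_of (x, a \<oplus>\<^bsub>S\<^esub> b) - (frag_of (x, a) + frag_of (x, b)) \<in> N"
    by (simp add: algebra_simps)
  then have "N #>\<^bsub>F\<^esub> frag_of (x, a \<oplus>\<^bsub>S\<^esub> b) = N #>\<^bsub>F\<^esub> (frag_of (x, a) + frag_of (x, b))"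
    by (intro coset_eqI F_add frag_carrier assms S_closed)
  then show ?thesis unfolding tens_def by (simp only: coset_mult frag_carrier assms)
qed

lemma t_smult:
  assumes "r \<in> carrier R" "x \<in> carrier M" "a \<in> carrier S"
  shows "t (r \<odot>\<^bsub>M\<^esub> x) a = t x (h r \<otimes>\<^bsub>S\<^esub> a)"
  unfolding tens_def
proof (rule coset_eqI)
  show "frag_of (r \<odot>\<^bsub>M\<^esub> x, a) - frag_of (x, h r \<otimes>\<^bsub>S\<^esub> a) \<in> N"
    by (rule null_relation) (use assms in \<open>auto simp: tensor_relations_def\<close>)
qed (use assms h_closed in auto)

text \<open>Pure tensors generate the group. Closure is demanded under division because the free
  abelian group is built up by differences of generators.\<close>

lemma T_induct:
  assumes u: "u \<in> carrier T"
    and one: "P \<one>\<^bsub>T\<^esub>"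
    and tens: "\<And>x a. \<lbrakk>x \<in> carrier M; a \<in> carrier S\<rbrakk> \<Longrightarrow> P (t x a)"
    and div: "\<And>v w. \<lbrakk>v \<in> carrier T; w \<in> carrier T; P v; P w\<rbrakk> \<Longrightarrow> P (v \<otimes>\<^bsub>T\<^esub> inv\<^bsub>T\<^esub> w)"
  shows "P u"
proof -
  obtain k where k: "k \<in> carrier F" "u = N #>\<^bsub>F\<^esub> k" using u unfolding carrier_T by blast
  have zero: "N #>\<^bsub>F\<^esub> 0 = \<one>\<^bsub>T\<^esub>"
    using group.coset_join2[OF group_free_Abelian_group, of 0, OF _ null_subgroup] subgroup.one_closed[OF null_subgroup]
    by (simp add: tensor_group_def)
  have "P (N #>\<^bsub>F\<^esub> k)"
  proof (rule free_Abelian_group_induct[of k "carrier M \<times> carrier S" "\<lambda>k. P (N #>\<^bsub>F\<^esub> k)"])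
    fix v w assume vw: "Poly_Mapping.keys v \<subseteq> carrier M \<times> carrier S" "Poly_Mapping.keys w \<subseteq> carrier M \<times> carrier S"
      and P: "P (N #>\<^bsub>F\<^esub> v)" "P (N #>\<^bsub>F\<^esub> w)"
    then have c: "v \<in> carrier F" "w \<in> carrier F" by simp_all
    have cT: "N #>\<^bsub>F\<^esub> v \<in> carrier T" "N #>\<^bsub>F\<^esub> w \<in> carrier T" "N #>\<^bsub>F\<^esub> (v - w) \<in> carrier T"
      unfolding carrier_T using c F_diff by blast+
    have "(N #>\<^bsub>F\<^esub> (v - w)) \<otimes>\<^bsub>T\<^esub> (N #>\<^bsub>F\<^esub> w) = N #>\<^bsub>F\<^esub> v"
      by (subst coset_mult[OF F_diff[OF c] c(2)]) simp
    then have "N #>\<^bsub>F\<^esub> (v - w) = (N #>\<^bsub>F\<^esub> v) \<otimes>\<^bsub>T\<^esub> inv\<^bsub>T\<^esub> (N #>\<^bsub>F\<^esub> w)"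
      using cT T.inv_solve_right by metis
    then show "P (N #>\<^bsub>F\<^esub> (v - w))" using div[OF cT(1,2) P] by simp
  qed (use k one tens zero in \<open>auto simp: tens_def\<close>)
  then show ?thesis using k by simp
qed

text \<open>The uniqueness half of the universal property. Identities on the tensor product are
  proved below by checking that both sides are additive and comparing them on pure tensors.\<close>

lemma T_hom_eqI:
  assumes "group G" and f: "f \<in> hom T G" and g: "g \<in> hom T G"
    and eq: "\<And>x a. \<lbrakk>x \<in> carrier M; a \<in> carrier S\<rbrakk> \<Longrightarrow> f (t x a) = g (t x a)"
    and u: "u \<in> carrier T"
  shows "f u = g u"
proof -
  interpret f: group_hom T G f by (simp add: group_hom.intro group_hom_axioms.intro assms T.is_group)
  interpret g: group_hom T G g by (simp add: group_hom.intro group_hom_axioms.intro assms T.is_group)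
  show ?thesis using u by (rule T_induct) (simp_all add: eq)
qed

text \<open>A balanced map extends to the free abelian group and kills the defining relations, so it
  factors through the quotient. Restricting the factorization to the carrier makes it the unique
  extensional solution, which is what the definite description in \<open>tensor_map\<close> asks
  for.\<close>

lemma tensor_map:
  assumes G: "comm_group G" and b: "balanced G \<beta>"
  shows tensor_map_hom: "tensor_map R S h M G \<beta> \<in> hom T G"
    and tensor_map_extensional: "tensor_map R S h M G \<beta> \<in> extensional (carrier T)"
    and tensor_map_tens: "\<And>x a. \<lbrakk>x \<in> carrier M; a \<in> carrier S\<rbrakk> \<Longrightarrow> tensor_map R S h M G \<beta> (t x a) = \<beta> x a"
proof -
  interpret G: comm_group G by fact
  have b1: "\<beta> x a \<in> carrier G" if "x \<in> carrier M" "a \<in> carrier S" for x a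
    using b that unfolding balanced_def by blast
  have "(\<lambda>p. \<beta> (fst p) (snd p)) ` (carrier M \<times> carrier S) \<subseteq> carrier G"
    using b1 by auto
  then obtain k where k: "k \<in> hom F G" "\<And>p. p \<in> carrier M \<times> carrier S \<Longrightarrow> k (frag_of p) = \<beta> (fst p) (snd p)"
    using G.free_Abelian_group_universal by blast
  interpret k: group_hom F G k by (simp add: group_hom.intro group_hom_axioms.intro k)
  have kf: "k (frag_of (x, a)) = \<beta> x a" if "x \<in> carrier M" "a \<in> carrier S" for x a
    using k(2)[of "(x, a)"] that by simp
  have kd: "k (u - v) = k u \<otimes>\<^bsub>G\<^esub> inv\<^bsub>G\<^esub> k v" if "u \<in> carrier F" "v \<in> carrier F" for u v
  proof -
    have "k (u - v) \<otimes>\<^bsub>G\<^esub> k v = k u"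
      using k.hom_mult[OF F_diff[OF that] that(2)] by simp
    then show ?thesis using G.inv_solve_right k.hom_closed that F_diff by metis
  qed
  have "tensor_relations R S h M \<subseteq> kernel F G k"
  proof
    fix u assume u: "u \<in> tensor_relations R S h M"
    then have uF: "u \<in> carrier F" using relations_subset by blast
    have "k u = \<one>\<^bsub>G\<^esub>"
      using u unfolding tensor_relations_def
    proof (elim UnE CollectE exE conjE)
      fix x y a assume *: "u = frag_of (x \<oplus>\<^bsub>M\<^esub> y, a) - frag_of (x, a) - frag_of (y, a)"
        "x \<in> carrier M" "y \<in> carrier M" "a \<in> carrier S"
      have "\<beta> (x \<oplus>\<^bsub>M\<^esub> y) a = \<beta> x a \<otimes>\<^bsub>G\<^esub> \<beta> y a" using b * unfolding balanced_def by blast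
      then show ?thesis
        using * by (simp only: kd F_diff frag_carrier kf M_closed) (simp add: b1 G.m_comm[of "\<beta> x a"] G.m_assoc)
    next
      fix x a c assume *: "u = frag_of (x, a \<oplus>\<^bsub>S\<^esub> c) - frag_of (x, a) - frag_of (x, c)"
        "x \<in> carrier M" "a \<in> carrier S" "c \<in> carrier S"
      have "\<beta> x (a \<oplus>\<^bsub>S\<^esub> c) = \<beta> x a \<otimes>\<^bsub>G\<^esub> \<beta> x c" using b * unfolding balanced_def by blast
      then show ?thesis
        using * by (simp only: kd F_diff frag_carrier kf S_closed) (simp add: b1 G.m_comm[of "\<beta> x a"] G.m_assoc)
    next
      fix r x a assume *: "u = frag_of (r \<odot>\<^bsub>M\<^esub> x, a) - frag_of (x, h r \<otimes>\<^bsub>S\<^esub> a)"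
        "r \<in> carrier R" "x \<in> carrier M" "a \<in> carrier S"
      have "\<beta> (r \<odot>\<^bsub>M\<^esub> x) a = \<beta> x (h r \<otimes>\<^bsub>S\<^esub> a)" using b * unfolding balanced_def by blast
      then show ?thesis
        using * by (simp only: kd F_diff frag_carrier kf S_closed M_closed h_closed) (simp add: b1 h_closed)
    qed
    then show "u \<in> kernel F G k" using uF by (simp add: kernel_def)
  qed
  then have "N \<subseteq> kernel F G k"
    unfolding tensor_null_def by (rule group.generate_subgroup_incl[OF group_free_Abelian_group _ k.subgroup_kernel])
  then obtain g where g: "g \<in> hom (F Mod N) G" "\<And>u. u \<in> carrier F \<Longrightarrow> g (N #>\<^bsub>F\<^esub> u) = k u"
    using k.FactGroup_universal_kernel[OF null_normal] by blast
  define D where "D = restrict g (carrier T)"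
  have gT: "g \<in> hom T G" using g by (simp add: tensor_group_def)
  have D: "D \<in> hom T G" "D \<in> extensional (carrier T)"
    using gT by (auto simp: D_def hom_def Pi_iff)
  have Dt: "\<forall>x\<in>carrier M. \<forall>a\<in>carrier S. D (t x a) = \<beta> x a"
    using g(2)[OF frag_carrier] kf by (simp add: D_def) (simp add: tens_def)
  have "tensor_map R S h M G \<beta> = D"
    unfolding tensor_map_def
  proof (rule the_equality)
    fix E assume E: "E \<in> hom T G \<and> E \<in> extensional (carrier T) \<and> (\<forall>x\<in>carrier M. \<forall>a\<in>carrier S. E (t x a) = \<beta> x a)"
    show "E = D"
      by (rule extensionalityI[of _ "carrier T"], use E D in blast, use D in blast,
          rule T_hom_eqI[of G]) (use E D Dt G.is_group in auto)
  qed (use D Dt in blast)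
  then show "tensor_map R S h M G \<beta> \<in> hom T G" "tensor_map R S h M G \<beta> \<in> extensional (carrier T)"
    "\<And>x a. \<lbrakk>x \<in> carrier M; a \<in> carrier S\<rbrakk> \<Longrightarrow> tensor_map R S h M G \<beta> (t x a) = \<beta> x a"
    using D Dt by blast+
qed

definition sm :: "'s \<Rightarrow> ('m \<times> 's \<Rightarrow>\<^sub>0 int) set \<Rightarrow> ('m \<times> 's \<Rightarrow>\<^sub>0 int) set" where
  "sm b = tensor_map R S h M T (\<lambda>x a. t x (a \<otimes>\<^bsub>S\<^esub> b))"

lemma base_change_simps:
  "carrier (base_change R S h M) = carrier T" "zero (base_change R S h M) = \<one>\<^bsub>T\<^esub>"
  "add (base_change R S h M) = monoid.mult T" "smult (base_change R S h M) = sm"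
  by (auto simp: base_change_def Let_def sm_def)

lemma sm_balanced:
  assumes "b \<in> carrier S" shows "balanced T (\<lambda>x a. t x (a \<otimes>\<^bsub>S\<^esub> b))"
proof -
  interpret S: Ring.ring S by (rule ringS)
  show ?thesis
    by (rule balancedI) (use assms in \<open>simp_all add: t_add_left t_smult h_closed S.l_distr t_add_right S.m_assoc\<close>)
qed

lemmas sm_hom = tensor_map_hom[OF comm_group_T sm_balanced, folded sm_def]
  and sm_tens = tensor_map_tens[OF comm_group_T sm_balanced, folded sm_def]

lemma sm_closed: "b \<in> carrier S \<Longrightarrow> u \<in> carrier T \<Longrightarrow> sm b u \<in> carrier T"
  using sm_hom by (auto simp: hom_def)

lemma sm_mult: "b \<in> carrier S \<Longrightarrow> u \<in> carrier T \<Longrightarrow> v \<in> carrier T \<Longrightarrow> sm b (u \<otimes>\<^bsub>T\<^esub> v) = sm b u \<otimes>\<^bsub>T\<^esub> sm b v"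
  using sm_hom by (auto simp: hom_def)

lemma sm_one: "u \<in> carrier T \<Longrightarrow> sm \<one>\<^bsub>S\<^esub> u = u"
proof -
  interpret S: Ring.ring S by (rule ringS)
  show "u \<in> carrier T \<Longrightarrow> sm \<one>\<^bsub>S\<^esub> u = u"
    by (rule T_hom_eqI[where g = "\<lambda>u. u", OF T.is_group sm_hom]) (auto simp: sm_tens hom_def)
qed

lemma sm_comp: "\<lbrakk>a \<in> carrier S; b \<in> carrier S; u \<in> carrier T\<rbrakk> \<Longrightarrow> sm (a \<otimes>\<^bsub>S\<^esub> b) u = sm b (sm a u)"
proof -
  interpret S: Ring.ring S by (rule ringS)
  show "\<lbrakk>a \<in> carrier S; b \<in> carrier S; u \<in> carrier T\<rbrakk> \<Longrightarrow> sm (a \<otimes>\<^bsub>S\<^esub> b) u = sm b (sm a u)"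
    by (rule T_hom_eqI[where g = "\<lambda>u. sm b (sm a u)", OF T.is_group sm_hom])
      (auto simp: sm_tens sm_closed sm_mult S.m_assoc intro!: homI)
qed

lemma sm_add: "\<lbrakk>a \<in> carrier S; b \<in> carrier S; u \<in> carrier T\<rbrakk> \<Longrightarrow> sm (a \<oplus>\<^bsub>S\<^esub> b) u = sm a u \<otimes>\<^bsub>T\<^esub> sm b u"
proof -
  interpret S: Ring.ring S by (rule ringS)
  show "\<lbrakk>a \<in> carrier S; b \<in> carrier S; u \<in> carrier T\<rbrakk> \<Longrightarrow> sm (a \<oplus>\<^bsub>S\<^esub> b) u = sm a u \<otimes>\<^bsub>T\<^esub> sm b u"
    by (rule T_hom_eqI[where g = "\<lambda>u. sm a u \<otimes>\<^bsub>T\<^esub> sm b u", OF T.is_group sm_hom hom_pointwise_mult[OF comm_group_T sm_hom sm_hom]])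
      (auto simp: sm_tens S.r_distr t_add_right)
qed

text \<open>Stated for every record with these components, so that it covers \<open>psi_obj\<close>,
  which extends the base change by a connection.\<close>

lemma right_moduleI:
  fixes E :: "('s, ('m \<times> 's \<Rightarrow>\<^sub>0 int) set, 'y) module_scheme"
  assumes "carrier E = carrier T" "zero E = \<one>\<^bsub>T\<^esub>" "add E = monoid.mult T" "smult E = sm"
  shows "right_module S E"
proof (intro right_module.intro right_module_axioms.intro)
  show "Ring.ring S" by (rule ringS)
  show "abelian_group E"
  proof (rule abelian_groupI)
    fix u assume "u \<in> carrier E"
    then show "\<exists>v\<in>carrier E. v \<oplus>\<^bsub>E\<^esub> u = \<zero>\<^bsub>E\<^esub>"
      by (intro bexI[of _ "inv\<^bsub>T\<^esub> u"]) (simp_all add: assms)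
  qed (simp_all add: assms T.m_ac)
qed (simp_all add: assms sm_closed sm_add sm_mult sm_comp sm_one)

end

lemma (in abelian_monoid) finsum_shrink:
  assumes "i \<in> A" "finite A" "f i \<in> carrier G" "\<And>j. j \<in> A \<Longrightarrow> j \<noteq> i \<Longrightarrow> f j = \<zero>"
  shows "finsum G f A = f i"
proof -
  have fc: "f j \<in> carrier G" if "j \<in> A" for j
    using assms that by (cases "j = i") simp_all
  have "finsum G f A = finsum G (\<lambda>j. if i = j then f j else \<zero>) A"
    by (intro finsum_cong') (use assms fc in auto)
  also have "\<dots> = f i"
    by (rule add.finprod_singleton) (use assms fc in auto)
  finally show ?thesis .
qed

section \<open>Coordinates in a module with a finite basis\<close>

locale based_module = Module.module R M for R (structure) and M (structure) +
  fixes n :: nat and e :: "nat \<Rightarrow> 'c"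
  assumes basis: "module_basis R M n e"
begin

definition crd :: "'c \<Rightarrow> nat \<Rightarrow> 'a" where
  "crd x = (THE c. c \<in> {..<n} \<rightarrow>\<^sub>E carrier R \<and> x = (\<Oplus>\<^bsub>M\<^esub> j\<in>{..<n}. c j \<odot>\<^bsub>M\<^esub> e j))"

lemma e_closed: "j < n \<Longrightarrow> e j \<in> carrier M"
  using basis unfolding module_basis_def by auto

lemma crd_props:
  assumes "x \<in> carrier M"
  shows "crd x \<in> {..<n} \<rightarrow>\<^sub>E carrier R" "x = (\<Oplus>\<^bsub>M\<^esub> j\<in>{..<n}. crd x j \<odot>\<^bsub>M\<^esub> e j)"
proof -
  have "\<exists>!c. c \<in> {..<n} \<rightarrow>\<^sub>E carrier R \<and> x = (\<Oplus>\<^bsub>M\<^esub> j\<in>{..<n}. c j \<odot>\<^bsub>M\<^esub> e j)"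
    using basis assms unfolding module_basis_def by blast
  from theI'[OF this] show "crd x \<in> {..<n} \<rightarrow>\<^sub>E carrier R"
    "x = (\<Oplus>\<^bsub>M\<^esub> j\<in>{..<n}. crd x j \<odot>\<^bsub>M\<^esub> e j)"
    unfolding crd_def[symmetric] by blast+
qed

lemma crd_closed: "x \<in> carrier M \<Longrightarrow> j < n \<Longrightarrow> crd x j \<in> carrier R"
  using crd_props(1) by (auto simp: PiE_iff)

lemma crd_sum: "x \<in> carrier M \<Longrightarrow> (\<Oplus>\<^bsub>M\<^esub> j\<in>{..<n}. crd x j \<odot>\<^bsub>M\<^esub> e j) = x"
  using crd_props(2) by simp

lemma term_closed: "c \<in> {..<n} \<rightarrow> carrier R \<Longrightarrow> (\<lambda>j. c j \<odot>\<^bsub>M\<^esub> e j) \<in> {..<n} \<rightarrow> carrier M"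
  by (auto intro!: smult_closed e_closed)

lemma sum_closed: "c \<in> {..<n} \<rightarrow> carrier R \<Longrightarrow> (\<Oplus>\<^bsub>M\<^esub> j\<in>{..<n}. c j \<odot>\<^bsub>M\<^esub> e j) \<in> carrier M"
  by (intro M.finsum_closed term_closed)

lemma crd_unique:
  assumes c: "c \<in> {..<n} \<rightarrow> carrier R" and j: "j < n"
  shows "crd (\<Oplus>\<^bsub>M\<^esub> j\<in>{..<n}. c j \<odot>\<^bsub>M\<^esub> e j) j = c j"
proof -
  let ?x = "\<Oplus>\<^bsub>M\<^esub> j\<in>{..<n}. c j \<odot>\<^bsub>M\<^esub> e j"
  have x: "?x \<in> carrier M" by (rule sum_closed[OF c])
  have "restrict c {..<n} \<in> {..<n} \<rightarrow>\<^sub>E carrier R" using c by auto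
  moreover have "?x = (\<Oplus>\<^bsub>M\<^esub> j\<in>{..<n}. restrict c {..<n} j \<odot>\<^bsub>M\<^esub> e j)"
    by (rule M.finsum_cong') (use term_closed[OF c] in auto)
  moreover have "\<exists>!c. c \<in> {..<n} \<rightarrow>\<^sub>E carrier R \<and> ?x = (\<Oplus>\<^bsub>M\<^esub> j\<in>{..<n}. c j \<odot>\<^bsub>M\<^esub> e j)"
    using basis x unfolding module_basis_def by blast
  ultimately have "crd ?x = restrict c {..<n}" using crd_props[OF x] by blast
  then show ?thesis using j by simp
qed

lemma crd_eqI:
  assumes "x = (\<Oplus>\<^bsub>M\<^esub> j\<in>{..<n}. c j \<odot>\<^bsub>M\<^esub> e j)" "c \<in> {..<n} \<rightarrow> carrier R" "j < n"
  shows "crd x j = c j"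
  using crd_unique assms by simp

lemma crd_add:
  assumes "x \<in> carrier M" "y \<in> carrier M" "j < n"
  shows "crd (x \<oplus>\<^bsub>M\<^esub> y) j = crd x j \<oplus> crd y j"
proof (rule crd_eqI[OF _ _ assms(3)])
  have "x \<oplus>\<^bsub>M\<^esub> y = (\<Oplus>\<^bsub>M\<^esub> j\<in>{..<n}. crd x j \<odot>\<^bsub>M\<^esub> e j) \<oplus>\<^bsub>M\<^esub> (\<Oplus>\<^bsub>M\<^esub> j\<in>{..<n}. crd y j \<odot>\<^bsub>M\<^esub> e j)"
    by (simp add: crd_sum assms)
  also have "\<dots> = (\<Oplus>\<^bsub>M\<^esub> j\<in>{..<n}. crd x j \<odot>\<^bsub>M\<^esub> e j \<oplus>\<^bsub>M\<^esub> crd y j \<odot>\<^bsub>M\<^esub> e j)"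
    by (rule M.finsum_addf[symmetric]) (auto intro!: smult_closed crd_closed e_closed assms)
  also have "\<dots> = (\<Oplus>\<^bsub>M\<^esub> j\<in>{..<n}. (crd x j \<oplus> crd y j) \<odot>\<^bsub>M\<^esub> e j)"
    by (rule M.finsum_cong') (auto simp: smult_l_distr crd_closed e_closed assms)
  finally show "x \<oplus>\<^bsub>M\<^esub> y = (\<Oplus>\<^bsub>M\<^esub> j\<in>{..<n}. (crd x j \<oplus> crd y j) \<odot>\<^bsub>M\<^esub> e j)" .
qed (auto intro!: crd_closed assms)

lemma crd_smult:
  assumes "x \<in> carrier M" "r \<in> carrier R" "j < n"
  shows "crd (r \<odot>\<^bsub>M\<^esub> x) j = r \<otimes> crd x j"
proof (rule crd_eqI[OF _ _ assms(3)])
  have "r \<odot>\<^bsub>M\<^esub> x = r \<odot>\<^bsub>M\<^esub> (\<Oplus>\<^bsub>M\<^esub> j\<in>{..<n}. crd x j \<odot>\<^bsub>M\<^esub> e j)"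
    by (simp add: crd_sum assms)
  also have "\<dots> = (\<Oplus>\<^bsub>M\<^esub> j\<in>{..<n}. r \<odot>\<^bsub>M\<^esub> (crd x j \<odot>\<^bsub>M\<^esub> e j))"
    by (rule finsum_smult_ldistr) (auto intro!: smult_closed crd_closed e_closed assms)
  also have "\<dots> = (\<Oplus>\<^bsub>M\<^esub> j\<in>{..<n}. (r \<otimes> crd x j) \<odot>\<^bsub>M\<^esub> e j)"
    by (rule M.finsum_cong') (auto simp: smult_assoc1 crd_closed e_closed assms)
  finally show "r \<odot>\<^bsub>M\<^esub> x = (\<Oplus>\<^bsub>M\<^esub> j\<in>{..<n}. (r \<otimes> crd x j) \<odot>\<^bsub>M\<^esub> e j)" .
qed (auto intro!: crd_closed assms)

lemma crd_eq_imp_eq: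
  assumes "x \<in> carrier M" "y \<in> carrier M" "\<And>j. j < n \<Longrightarrow> crd x j = crd y j"
  shows "x = y"
proof -
  have "(\<Oplus>\<^bsub>M\<^esub> j\<in>{..<n}. crd x j \<odot>\<^bsub>M\<^esub> e j) = (\<Oplus>\<^bsub>M\<^esub> j\<in>{..<n}. crd y j \<odot>\<^bsub>M\<^esub> e j)"
    by (rule M.finsum_cong') (auto intro!: smult_closed crd_closed e_closed assms simp: assms(3))
  then show ?thesis using assms crd_sum by simp
qed

lemma crd_zero: "j < n \<Longrightarrow> crd \<zero>\<^bsub>M\<^esub> j = \<zero>"
  using crd_smult[of "\<zero>\<^bsub>M\<^esub>" "\<zero>" j] crd_closed[of "\<zero>\<^bsub>M\<^esub>" j] smult_l_null[of "\<zero>\<^bsub>M\<^esub>"] by simp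

lemma crd_basis:
  assumes "i < n" "j < n" shows "crd (e i) j = (if i = j then \<one> else \<zero>)"
proof (rule crd_eqI[where c = "\<lambda>j. if i = j then \<one> else \<zero>"])
  have "(\<Oplus>\<^bsub>M\<^esub> j\<in>{..<n}. (if i = j then \<one> else \<zero>) \<odot>\<^bsub>M\<^esub> e j) = (if i = i then \<one> else \<zero>) \<odot>\<^bsub>M\<^esub> e i"
    by (rule M.finsum_shrink) (use assms e_closed smult_l_null in auto)
  then show "e i = (\<Oplus>\<^bsub>M\<^esub> j\<in>{..<n}. (if i = j then \<one> else \<zero>) \<odot>\<^bsub>M\<^esub> e j)"
    using assms e_closed by simp
qed (use assms in auto)

end

context tensor_product
begin

lemma t_zero:
  assumes "a \<in> carrier S" shows "t \<zero>\<^bsub>M\<^esub> a = \<one>\<^bsub>T\<^esub>"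
proof -
  interpret M: Module.module R M by (rule moduleM)
  have "t \<zero>\<^bsub>M\<^esub> a \<otimes>\<^bsub>T\<^esub> t \<zero>\<^bsub>M\<^esub> a = t \<zero>\<^bsub>M\<^esub> a"
    using t_add_left[of "\<zero>\<^bsub>M\<^esub>" "\<zero>\<^bsub>M\<^esub>" a] assms by simp
  then show ?thesis using assms T.l_cancel_one by simp
qed

lemma t_finsum:
  assumes "finite A" "g \<in> A \<rightarrow> carrier M" "a \<in> carrier S"
  shows "t (finsum M g A) a = finprod T (\<lambda>i. t (g i) a) A"
proof -
  interpret M: Module.module R M by (rule moduleM)
  have "t (finprod (add_monoid M) g A) a = finprod T (\<lambda>i. t (g i) a) A"
  proof (rule hom_finprod_map[where f = "\<lambda>x. t x a"])
    show "(\<lambda>x. t x a) \<in> hom (add_monoid M) T"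
      by (rule homI) (use assms t_add_left in auto)
  qed (use assms t_zero M.a_comm_monoid T.comm_monoid_axioms in auto)
  then show ?thesis by (simp add: finsum_def)
qed

end

text \<open>\<open>tensor_map\<close> takes its values in a group written multiplicatively; this
  presents the additive group of \<open>S\<close> as such a target.\<close>

definition addgrp :: "('s, 'v) ring_scheme \<Rightarrow> 's monoid" where
  "addgrp S = \<lparr>carrier = carrier S, monoid.mult = add S, one = zero S\<rparr>"

lemma addgrp_simps [simp]:
  "carrier (addgrp S) = carrier S" "monoid.mult (addgrp S) = add S" "one (addgrp S) = zero S"
  by (simp_all add: addgrp_def)

lemma (in abelian_group) comm_group_addgrp: "comm_group (addgrp G)"
  by (rule comm_groupI) (auto simp: a_ac intro!: bexI[of _ "\<ominus> _"] l_neg)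

section \<open>Base change of a module with a basis\<close>

locale based_tensor = tensor_product R S h M + based_module R M n e
  for R :: "('r, 'w) ring_scheme" and S :: "('s, 'v) ring_scheme" and h :: "'r \<Rightarrow> 's"
    and M :: "('r, 'm, 'x) module_scheme" and n e
begin

text \<open>The coordinates under the identification of the base change of a free module of rank
  \<open>n\<close> with the right module \<open>S^n\<close>.\<close>

definition tcrd :: "nat \<Rightarrow> ('m \<times> 's \<Rightarrow>\<^sub>0 int) set \<Rightarrow> 's" where
  "tcrd i = tensor_map R S h M (addgrp S) (\<lambda>x a. h (crd x i) \<otimes>\<^bsub>S\<^esub> a)"

lemma tcrd_balanced:
  assumes i: "i < n" shows "balanced (addgrp S) (\<lambda>x a. h (crd x i) \<otimes>\<^bsub>S\<^esub> a)"
proof -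
  interpret S: Ring.ring S by (rule ringS)
  show ?thesis
  proof (rule balancedI)
    fix r x a assume *: "r \<in> carrier R" "x \<in> carrier M" "a \<in> carrier S"
    have c: "crd x i \<in> carrier R" using crd_closed[OF *(2) i] .
    \<comment> \<open>Commutativity of \<open>R\<close> puts \<open>r\<close> on the right of the
      coordinate, where \<open>h r\<close> must stand to act on \<open>a\<close> from the
      left.\<close>
    have "h (crd (r \<odot>\<^bsub>M\<^esub> x) i) = h (crd x i \<otimes>\<^bsub>R\<^esub> r)"
      using * c by (simp add: crd_smult i R.m_comm)
    then show "h (crd (r \<odot>\<^bsub>M\<^esub> x) i) \<otimes>\<^bsub>S\<^esub> a = h (crd x i) \<otimes>\<^bsub>S\<^esub> (h r \<otimes>\<^bsub>S\<^esub> a)"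
      using * c by (simp add: ring_hom_mult[OF hom] h_closed S.m_assoc)
  qed (use i in \<open>simp_all add: h_closed crd_closed crd_add ring_hom_add[OF hom] S.l_distr S.r_distr\<close>)
qed

lemma comm_group_add_S: "comm_group (addgrp S)"
proof -
  interpret S: Ring.ring S by (rule ringS)
  show ?thesis by (rule S.comm_group_addgrp)
qed

lemmas tcrd_hom = tensor_map_hom[OF comm_group_add_S tcrd_balanced, folded tcrd_def]
  and tcrd_tens = tensor_map_tens[OF comm_group_add_S tcrd_balanced, folded tcrd_def]

lemma tcrd_closed: "i < n \<Longrightarrow> u \<in> carrier T \<Longrightarrow> tcrd i u \<in> carrier S"
  using tcrd_hom by (auto simp: hom_def)

lemma tcrd_mult: "i < n \<Longrightarrow> u \<in> carrier T \<Longrightarrow> v \<in> carrier T \<Longrightarrow> tcrd i (u \<otimes>\<^bsub>T\<^esub> v) = tcrd i u \<oplus>\<^bsub>S\<^esub> tcrd i v"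
  using tcrd_hom by (auto simp: hom_def)

lemma tcrd_sm:
  assumes i: "i < n" and b: "b \<in> carrier S" and u: "u \<in> carrier T"
  shows "tcrd i (sm b u) = tcrd i u \<otimes>\<^bsub>S\<^esub> b"
proof -
  interpret S: Ring.ring S by (rule ringS)
  show ?thesis
    by (rule T_hom_eqI[of "addgrp S" "\<lambda>u. tcrd i (sm b u)" "\<lambda>u. tcrd i u \<otimes>\<^bsub>S\<^esub> b", OF _ _ _ _ u])
      (auto simp: comm_group.axioms(2)[OF comm_group_add_S] i b sm_closed tcrd_closed sm_mult tcrd_mult S.l_distr sm_tens tcrd_tens
        h_closed crd_closed S.m_assoc intro!: homI)
qed

text \<open>On a pure tensor the coordinates of \<open>x\<close> can be carried back across the
  tensor sign, which reassembles \<open>x\<close> from its basis expansion; additivity in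
  \<open>u\<close> does the rest.\<close>

lemma tensor_expand:
  assumes u: "u \<in> carrier T"
  shows "finprod T (\<lambda>i. t (e i) (tcrd i u)) {..<n} = u"
proof (rule T_hom_eqI[of T "\<lambda>u. finprod T (\<lambda>i. t (e i) (tcrd i u)) {..<n}" "\<lambda>u. u", OF T.is_group _ _ _ u])
  have c: "(\<lambda>i. t (e i) (tcrd i u)) \<in> {..<n} \<rightarrow> carrier T" if "u \<in> carrier T" for u
    using that by (auto intro!: t_closed e_closed tcrd_closed)
  show "(\<lambda>u. finprod T (\<lambda>i. t (e i) (tcrd i u)) {..<n}) \<in> hom T T"
  proof (rule homI)
    fix u v assume uv: "u \<in> carrier T" "v \<in> carrier T"
    have "finprod T (\<lambda>i. t (e i) (tcrd i (u \<otimes>\<^bsub>T\<^esub> v))) {..<n}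
      = finprod T (\<lambda>i. t (e i) (tcrd i u) \<otimes>\<^bsub>T\<^esub> t (e i) (tcrd i v)) {..<n}"
      by (rule T.finprod_cong') (use uv in \<open>auto simp: tcrd_mult t_add_right e_closed tcrd_closed\<close>)
    also have "\<dots> = finprod T (\<lambda>i. t (e i) (tcrd i u)) {..<n} \<otimes>\<^bsub>T\<^esub> finprod T (\<lambda>i. t (e i) (tcrd i v)) {..<n}"
      by (rule T.finprod_multf[OF c c]) (use uv in auto)
    finally show "finprod T (\<lambda>i. t (e i) (tcrd i (u \<otimes>\<^bsub>T\<^esub> v))) {..<n} = \<dots>" .
  qed (use c in auto)
  show "(\<lambda>u. u) \<in> hom T T" by (auto simp: hom_def)
  fix x a assume xa: "x \<in> carrier M" "a \<in> carrier S"
  have "finprod T (\<lambda>i. t (e i) (tcrd i (t x a))) {..<n} = finprod T (\<lambda>i. t (crd x i \<odot>\<^bsub>M\<^esub> e i) a) {..<n}"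
    by (rule T.finprod_cong') (use xa in \<open>auto simp: tcrd_tens t_smult crd_closed e_closed h_closed\<close>)
  also have "\<dots> = t (\<Oplus>\<^bsub>M\<^esub> i\<in>{..<n}. crd x i \<odot>\<^bsub>M\<^esub> e i) a"
    by (rule t_finsum[symmetric]) (use xa in \<open>auto simp: crd_closed e_closed smult_closed\<close>)
  also have "\<dots> = t x a" using xa by (simp add: crd_sum)
  finally show "finprod T (\<lambda>i. t (e i) (tcrd i (t x a))) {..<n} = t x a" .
qed

text \<open>The base change is even free: taking coordinates is the section and recombining them
  with the tensors \<open>e i \<otimes> a\<close> is the retraction.\<close>

lemma fg_projectiveI:
  fixes E :: "('s, ('m \<times> 's \<Rightarrow>\<^sub>0 int) set, 'y) module_scheme"
  assumes E: "carrier E = carrier T" "zero E = \<one>\<^bsub>T\<^esub>" "add E = monoid.mult T" "smult E = sm"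
  shows "fg_projective S E"
  unfolding fg_projective_def
proof (intro exI conjI)
  interpret S: Ring.ring S by (rule ringS)
  define s where "s = (\<lambda>u. \<lambda>i\<in>{..<n}. tcrd i u)"
  define p where "p = (\<lambda>y. finprod T (\<lambda>i. t (e i) (y i)) {..<n})"
  show "module_map S E (free_rmod S n) s"
    unfolding module_map_def additive_map_def s_def
    by (auto simp: E free_rmod_def tcrd_closed tcrd_mult tcrd_sm intro!: restrict_ext)
  have yc: "y i \<in> carrier S" if "y \<in> carrier (free_rmod S n)" "i < n" for y i
    using that by (auto simp: free_rmod_def PiE_iff)
  have ya: "(y \<oplus>\<^bsub>free_rmod S n\<^esub> z) i = y i \<oplus>\<^bsub>S\<^esub> z i" if "i < n" for y z i
    using that by (simp add: free_rmod_def)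
  have ys: "(b \<odot>\<^bsub>free_rmod S n\<^esub> y) i = y i \<otimes>\<^bsub>S\<^esub> b" if "i < n" for y b i
    using that by (simp add: free_rmod_def)
  have c: "(\<lambda>i. t (e i) (y i)) \<in> {..<n} \<rightarrow> carrier T" if "y \<in> carrier (free_rmod S n)" for y
    using yc[OF that] by (simp add: e_closed)
  show "module_map S (free_rmod S n) E p"
    unfolding module_map_def additive_map_def
  proof (intro conjI ballI)
    show "p \<in> carrier (free_rmod S n) \<rightarrow> carrier E"
      unfolding p_def E using c by (auto intro!: T.finprod_closed)
  next
    fix y z assume yz: "y \<in> carrier (free_rmod S n)" "z \<in> carrier (free_rmod S n)"
    have "p (y \<oplus>\<^bsub>free_rmod S n\<^esub> z) = finprod T (\<lambda>i. t (e i) (y i) \<otimes>\<^bsub>T\<^esub> t (e i) (z i)) {..<n}"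
      unfolding p_def by (rule T.finprod_cong') (use yz yc in \<open>simp_all add: ya t_add_right e_closed\<close>)
    also have "\<dots> = p y \<otimes>\<^bsub>T\<^esub> p z"
      unfolding p_def by (rule T.finprod_multf[OF c[OF yz(1)] c[OF yz(2)]])
    finally show "p (y \<oplus>\<^bsub>free_rmod S n\<^esub> z) = p y \<oplus>\<^bsub>E\<^esub> p z" by (simp add: E)
  next
    fix b y assume b: "b \<in> carrier S" and y: "y \<in> carrier (free_rmod S n)"
    have "sm b (p y) = finprod T (\<lambda>i. sm b (t (e i) (y i))) {..<n}"
      unfolding p_def
      by (rule hom_finprod_map[OF T.comm_monoid_axioms T.comm_monoid_axioms sm_hom[OF b]])
        (use c[OF y] hom_one[OF sm_hom[OF b] T.is_group T.is_group] in auto)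
    also have "\<dots> = p (b \<odot>\<^bsub>free_rmod S n\<^esub> y)"
      unfolding p_def by (rule T.finprod_cong') (use b yc[OF y] in \<open>simp_all add: ys sm_tens e_closed\<close>)
    finally show "p (b \<odot>\<^bsub>free_rmod S n\<^esub> y) = b \<odot>\<^bsub>E\<^esub> p y" by (simp add: E)
  qed
  show "\<forall>u\<in>carrier E. p (s u) = u"
  proof
    fix u assume "u \<in> carrier E"
    then have u: "u \<in> carrier T" by (simp add: E)
    have "p (s u) = finprod T (\<lambda>i. t (e i) (tcrd i u)) {..<n}"
      unfolding p_def s_def by (rule T.finprod_cong') (use u in \<open>auto simp: e_closed tcrd_closed\<close>)
    then show "p (s u) = u" using tensor_expand[OF u] by simp
  qed
qed

lemma tens_one_inj:
  assumes inj: "\<And>r. r \<in> carrier R \<Longrightarrow> h r = \<zero>\<^bsub>S\<^esub> \<Longrightarrow> r = \<zero>\<^bsub>R\<^esub>"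
    and xy: "x \<in> carrier M" "y \<in> carrier M" and eq: "t x \<one>\<^bsub>S\<^esub> = t y \<one>\<^bsub>S\<^esub>"
  shows "x = y"
proof (rule crd_eq_imp_eq[OF xy])
  interpret S: Ring.ring S by (rule ringS)
  fix j assume j: "j < n"
  have c: "crd x j \<in> carrier R" "crd y j \<in> carrier R" using j xy crd_closed by auto
  have "tcrd j (t x \<one>\<^bsub>S\<^esub>) = h (crd x j)" "tcrd j (t y \<one>\<^bsub>S\<^esub>) = h (crd y j)"
    using c j xy by (simp_all add: tcrd_tens h_closed)
  then have "h (crd x j) = h (crd y j)" using eq by simp
  moreover have "h (crd x j) = h (crd x j \<ominus>\<^bsub>R\<^esub> crd y j) \<oplus>\<^bsub>S\<^esub> h (crd y j)"
  proof -
    have "crd x j = (crd x j \<ominus>\<^bsub>R\<^esub> crd y j) \<oplus>\<^bsub>R\<^esub> crd y j"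
      using c by (simp add: R.minus_eq R.a_assoc R.l_neg)
    then show ?thesis using ring_hom_add[OF hom, of "crd x j \<ominus>\<^bsub>R\<^esub> crd y j" "crd y j"] c by simp
  qed
  ultimately have "\<zero>\<^bsub>S\<^esub> \<oplus>\<^bsub>S\<^esub> h (crd y j) = h (crd x j \<ominus>\<^bsub>R\<^esub> crd y j) \<oplus>\<^bsub>S\<^esub> h (crd y j)"
    using c h_closed by simp
  then have "h (crd x j \<ominus>\<^bsub>R\<^esub> crd y j) = \<zero>\<^bsub>S\<^esub>"
    using S.add.right_cancel[of "\<zero>\<^bsub>S\<^esub>" "h (crd y j)" "h (crd x j \<ominus>\<^bsub>R\<^esub> crd y j)"] c h_closed by simp
  then have "crd x j \<ominus>\<^bsub>R\<^esub> crd y j = \<zero>\<^bsub>R\<^esub>" using c by (intro inj) auto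
  moreover have "crd x j = (crd x j \<ominus>\<^bsub>R\<^esub> crd y j) \<oplus>\<^bsub>R\<^esub> crd y j"
    using c by (simp add: R.minus_eq R.a_assoc R.l_neg)
  ultimately show "crd x j = crd y j" using c by simp
qed

end

text \<open>In the application \<open>D\<close> and \<open>dR\<close> already contain the factor
  2\<pi>i. With this scaling \<open>h\<close> intertwines \<open>dR\<close> and \<open>dS\<close>
  exactly, which is what the sum of the two operators needs in order to descend.\<close>

locale tensor_connection = tensor_product R S h M
  for R :: "('r, 'w) ring_scheme" and S :: "('s, 'v) ring_scheme" and h :: "'r \<Rightarrow> 's"
    and M :: "('r, 'm, 'x) module_scheme" +
  fixes D :: "'m \<Rightarrow> 'm" and dR :: "'r \<Rightarrow> 'r" and dS :: "'s \<Rightarrow> 's"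
  assumes D_closed: "x \<in> carrier M \<Longrightarrow> D x \<in> carrier M"
    and D_add: "\<lbrakk>x \<in> carrier M; y \<in> carrier M\<rbrakk> \<Longrightarrow> D (x \<oplus>\<^bsub>M\<^esub> y) = D x \<oplus>\<^bsub>M\<^esub> D y"
    and dR_closed: "r \<in> carrier R \<Longrightarrow> dR r \<in> carrier R"
    and D_leibniz: "\<lbrakk>r \<in> carrier R; x \<in> carrier M\<rbrakk> \<Longrightarrow> D (r \<odot>\<^bsub>M\<^esub> x) = (r \<odot>\<^bsub>M\<^esub> D x) \<oplus>\<^bsub>M\<^esub> (dR r \<odot>\<^bsub>M\<^esub> x)"
    and dS_closed: "a \<in> carrier S \<Longrightarrow> dS a \<in> carrier S"
    and dS_add: "\<lbrakk>a \<in> carrier S; b \<in> carrier S\<rbrakk> \<Longrightarrow> dS (a \<oplus>\<^bsub>S\<^esub> b) = dS a \<oplus>\<^bsub>S\<^esub> dS b"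
    and dS_mult: "\<lbrakk>a \<in> carrier S; b \<in> carrier S\<rbrakk> \<Longrightarrow> dS (a \<otimes>\<^bsub>S\<^esub> b) = (dS a \<otimes>\<^bsub>S\<^esub> b) \<oplus>\<^bsub>S\<^esub> (a \<otimes>\<^bsub>S\<^esub> dS b)"
    and dS_h: "r \<in> carrier R \<Longrightarrow> dS (h r) = h (dR r)"
begin

definition nab :: "('m \<times> 's \<Rightarrow>\<^sub>0 int) set \<Rightarrow> ('m \<times> 's \<Rightarrow>\<^sub>0 int) set" where
  "nab = tensor_map R S h M T (\<lambda>x a. t (D x) a \<otimes>\<^bsub>T\<^esub> t x (dS a))"

text \<open>In general neither summand respects the scalar relation alone. Moving \<open>r\<close>
  across the tensor sign produces \<open>t x (h (dR r) \<otimes> a)\<close> from the Leibniz rule of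
  \<open>D\<close> on one side and from that of \<open>dS\<close> on the other.\<close>

lemma nab_balanced: "balanced T (\<lambda>x a. t (D x) a \<otimes>\<^bsub>T\<^esub> t x (dS a))"
proof -
  interpret S: Ring.ring S by (rule ringS)
  show ?thesis
  proof (rule balancedI)
    fix r x a assume *: "r \<in> carrier R" "x \<in> carrier M" "a \<in> carrier S"
    have "t (D (r \<odot>\<^bsub>M\<^esub> x)) a \<otimes>\<^bsub>T\<^esub> t (r \<odot>\<^bsub>M\<^esub> x) (dS a)
      = (t (D x) (h r \<otimes>\<^bsub>S\<^esub> a) \<otimes>\<^bsub>T\<^esub> t x (h (dR r) \<otimes>\<^bsub>S\<^esub> a)) \<otimes>\<^bsub>T\<^esub> t x (h r \<otimes>\<^bsub>S\<^esub> dS a)"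
      using * by (simp add: D_leibniz t_add_left t_smult D_closed dR_closed dS_closed)
    also have "\<dots> = t (D x) (h r \<otimes>\<^bsub>S\<^esub> a) \<otimes>\<^bsub>T\<^esub> t x (dS (h r \<otimes>\<^bsub>S\<^esub> a))"
      using * by (simp add: dS_mult t_add_right dS_h h_closed D_closed dR_closed dS_closed T.m_assoc)
    finally show "t (D (r \<odot>\<^bsub>M\<^esub> x)) a \<otimes>\<^bsub>T\<^esub> t (r \<odot>\<^bsub>M\<^esub> x) (dS a)
      = t (D x) (h r \<otimes>\<^bsub>S\<^esub> a) \<otimes>\<^bsub>T\<^esub> t x (dS (h r \<otimes>\<^bsub>S\<^esub> a))" .
  qed (simp_all add: D_closed D_add dS_closed dS_add t_add_left t_add_right T.m_ac)
qed

lemmas nab_hom = tensor_map_hom[OF comm_group_T nab_balanced, folded nab_def]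
  and nab_tens = tensor_map_tens[OF comm_group_T nab_balanced, folded nab_def]

lemma nab_closed: "u \<in> carrier T \<Longrightarrow> nab u \<in> carrier T"
  using nab_hom by (auto simp: hom_def)

lemma nab_mult: "u \<in> carrier T \<Longrightarrow> v \<in> carrier T \<Longrightarrow> nab (u \<otimes>\<^bsub>T\<^esub> v) = nab u \<otimes>\<^bsub>T\<^esub> nab v"
  using nab_hom by (auto simp: hom_def)

lemma nab_sm:
  assumes b: "b \<in> carrier S" and u: "u \<in> carrier T"
  shows "nab (sm b u) = sm b (nab u) \<otimes>\<^bsub>T\<^esub> sm (dS b) u"
proof (rule T_hom_eqI[of T "\<lambda>u. nab (sm b u)" "\<lambda>u. sm b (nab u) \<otimes>\<^bsub>T\<^esub> sm (dS b) u", OF T.is_group _ _ _ u])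
  show "(\<lambda>u. nab (sm b u)) \<in> hom T T"
    by (auto simp: b sm_closed nab_closed sm_mult nab_mult intro!: homI)
  show "(\<lambda>u. sm b (nab u) \<otimes>\<^bsub>T\<^esub> sm (dS b) u) \<in> hom T T"
    by (auto simp: b dS_closed sm_closed nab_closed sm_mult nab_mult T.m_ac intro!: homI)
  fix x a assume *: "x \<in> carrier M" "a \<in> carrier S"
  show "nab (sm b (t x a)) = sm b (nab (t x a)) \<otimes>\<^bsub>T\<^esub> sm (dS b) (t x a)"
    using * by (simp add: b dS_closed D_closed sm_tens nab_tens sm_mult dS_mult t_add_right T.m_assoc)
qed

text \<open>The Leibniz rule is \<open>nab_sm\<close>; linearity over the constants is its special
  case in which the derivation kills the scalar.\<close>

lemma is_connectionI:
  fixes E :: "('s, ('m \<times> 's \<Rightarrow>\<^sub>0 int) set, 'y) module_scheme"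
  assumes E: "carrier E = carrier T" "zero E = \<one>\<^bsub>T\<^esub>" "add E = monoid.mult T" "smult E = sm"
    and \<iota>: "\<And>c. \<iota> c \<in> carrier S" "\<And>c. dS (\<iota> c) = \<zero>\<^bsub>S\<^esub>"
  shows "is_connection S \<iota> dS E nab"
proof -
  interpret S: Ring.ring S by (rule ringS)
  have z: "sm \<zero>\<^bsub>S\<^esub> u = \<one>\<^bsub>T\<^esub>" if "u \<in> carrier T" for u
    using sm_add[of "\<zero>\<^bsub>S\<^esub>" "\<zero>\<^bsub>S\<^esub>" u] that T.l_cancel_one[of "sm \<zero>\<^bsub>S\<^esub> u" "sm \<zero>\<^bsub>S\<^esub> u"] by (simp add: sm_closed)
  show ?thesis
    unfolding is_connection_def additive_map_def
    by (auto simp: E nab_closed nab_mult nab_sm \<iota> z sm_closed)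
qed

end

section \<open>Functoriality of base change\<close>

definition tmap :: "('r, 'w) ring_scheme \<Rightarrow> ('s, 'v) ring_scheme \<Rightarrow> ('r \<Rightarrow> 's) \<Rightarrow>
    ('r, 'm, 'x) module_scheme \<Rightarrow> ('r, 'n, 'y) module_scheme \<Rightarrow> ('m \<Rightarrow> 'n) \<Rightarrow>
    ('m \<times> 's \<Rightarrow>\<^sub>0 int) set \<Rightarrow> ('n \<times> 's \<Rightarrow>\<^sub>0 int) set" where
  "tmap R S h M N f = tensor_map R S h M (tensor_group R S h N) (\<lambda>x a. tens R S h N (f x) a)"

locale tensor_functor = M: tensor_product R S h M + N: tensor_product R S h N
  for R :: "('r, 'w) ring_scheme" and S :: "('s, 'v) ring_scheme" and h :: "'r \<Rightarrow> 's"
    and M :: "('r, 'm, 'x) module_scheme" and N :: "('r, 'n, 'y) module_scheme" +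
  fixes f :: "'m \<Rightarrow> 'n"
  assumes f: "module_map R M N f"
begin

lemma f_closed: "x \<in> carrier M \<Longrightarrow> f x \<in> carrier N"
  and f_add: "x \<in> carrier M \<Longrightarrow> y \<in> carrier M \<Longrightarrow> f (x \<oplus>\<^bsub>M\<^esub> y) = f x \<oplus>\<^bsub>N\<^esub> f y"
  and f_smult: "r \<in> carrier R \<Longrightarrow> x \<in> carrier M \<Longrightarrow> f (r \<odot>\<^bsub>M\<^esub> x) = r \<odot>\<^bsub>N\<^esub> f x"
  using f by (auto simp: module_map_def additive_map_def)

lemma tmap_balanced: "M.balanced N.T (\<lambda>x a. N.t (f x) a)"
  by (rule M.balancedI) (simp_all add: f_closed f_add f_smult N.t_add_left N.t_add_right N.t_smult)

lemmas tmap_hom = M.tensor_map_hom[OF N.comm_group_T tmap_balanced, folded tmap_def]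
  and tmap_tens = M.tensor_map_tens[OF N.comm_group_T tmap_balanced, folded tmap_def]
  and tmap_extensional = M.tensor_map_extensional[OF N.comm_group_T tmap_balanced, folded tmap_def]

lemma tmap_closed: "u \<in> carrier M.T \<Longrightarrow> tmap R S h M N f u \<in> carrier N.T"
  using tmap_hom by (auto simp: hom_def)

lemma tmap_mult: "u \<in> carrier M.T \<Longrightarrow> v \<in> carrier M.T \<Longrightarrow>
    tmap R S h M N f (u \<otimes>\<^bsub>M.T\<^esub> v) = tmap R S h M N f u \<otimes>\<^bsub>N.T\<^esub> tmap R S h M N f v"
  using tmap_hom by (auto simp: hom_def)

lemma tmap_sm:
  assumes b: "b \<in> carrier S" and u: "u \<in> carrier M.T"
  shows "tmap R S h M N f (M.sm b u) = N.sm b (tmap R S h M N f u)"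
  by (rule M.T_hom_eqI[of N.T "\<lambda>u. tmap R S h M N f (M.sm b u)" "\<lambda>u. N.sm b (tmap R S h M N f u)", OF N.T.is_group _ _ _ u])
    (auto simp: b tmap_closed M.sm_closed N.sm_closed M.sm_mult N.sm_mult tmap_mult M.sm_tens N.sm_tens tmap_tens f_closed intro!: homI)

lemma tmap_nab:
  assumes "tensor_connection R S h M D dR dS" "tensor_connection R S h N D' dR dS"
    and fD: "\<And>x. x \<in> carrier M \<Longrightarrow> f (D x) = D' (f x)" and u: "u \<in> carrier M.T"
  shows "tmap R S h M N f (tensor_connection.nab R S h M D dS u)
    = tensor_connection.nab R S h N D' dS (tmap R S h M N f u)"
proof -
  interpret MC: tensor_connection R S h M D dR dS by fact
  interpret NC: tensor_connection R S h N D' dR dS by fact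
  show ?thesis
    by (rule M.T_hom_eqI[of N.T "\<lambda>u. tmap R S h M N f (MC.nab u)" "\<lambda>u. NC.nab (tmap R S h M N f u)", OF N.T.is_group _ _ _ u])
      (auto simp: tmap_closed MC.nab_closed NC.nab_closed MC.nab_mult NC.nab_mult tmap_mult MC.nab_tens NC.nab_tens
        tmap_tens f_closed fD MC.D_closed MC.dS_closed intro!: homI)
qed

end

section \<open>Everywhere convergent power series\<close>

definition pw :: "(complex \<Rightarrow> complex) \<Rightarrow> (nat \<Rightarrow> complex) \<Rightarrow> bool" where
  "pw f c \<longleftrightarrow> (\<forall>z. (\<lambda>m. c m * z ^ m) sums f z)"

lemma pw_abs_summable:
  assumes "pw f c" shows "summable (\<lambda>m. norm (c m * z ^ m))"
proof -
  have "summable (\<lambda>m. c m * of_real (norm z + 1) ^ m)"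
    using assms sums_summable unfolding pw_def by blast
  then show ?thesis by (rule powser_insidea) (simp del: of_real_add)
qed

lemma pw_entire: "f holomorphic_on UNIV \<Longrightarrow> pw f (\<lambda>m. (deriv ^^ m) f 0 / fact m)"
  unfolding pw_def using entire_has_sum has_sum_imp_sums by blast

lemma pw_holomorphic:
  assumes "pw f c" shows "f holomorphic_on UNIV"
proof -
  have "f field_differentiable (at z)" for z
  proof -
    have "f holomorphic_on ball 0 (norm z + 1)"
      using power_series_holomorphic[of 0 "norm z + 1" c f] assms by (simp add: pw_def)
    then show ?thesis by (rule holomorphic_on_imp_differentiable_at) (auto simp: add_nonneg_pos)
  qed
  then show ?thesis by (simp add: holomorphic_on_def)
qed

lemma pw_add: "pw f c \<Longrightarrow> pw g d \<Longrightarrow> pw (\<lambda>z. f z + g z) (\<lambda>m. c m + d m)"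
  by (simp add: pw_def distrib_right sums_add)

lemma pw_cmult: "pw f c \<Longrightarrow> pw (\<lambda>z. k * f z) (\<lambda>m. k * c m)"
  by (simp add: pw_def mult.assoc sums_mult)

lemma pw_sum: "(\<And>k. k \<in> I \<Longrightarrow> pw (f k) (c k)) \<Longrightarrow> pw (\<lambda>z. \<Sum>k\<in>I. f k z) (\<lambda>m. \<Sum>k\<in>I. c k m)"
  by (simp add: pw_def sum_distrib_right sums_sum)

lemma pw_unique:
  assumes "pw f c" "pw f d" shows "c = d"
proof
  fix m
  have "pw (\<lambda>z. f z + (-1) * f z) (\<lambda>m. c m + (-1) * d m)"
    by (intro pw_add pw_cmult assms)
  then have "c m + (-1) * d m = 0"
    by (intro powser_zero_unique[of "\<lambda>m. c m + (-1) * d m"]) (simp add: pw_def)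
  then show "c m = d m" by simp
qed

lemma pw_euler:
  assumes "pw f c" shows "pw (\<lambda>z. z * deriv f z) (\<lambda>m. of_nat m * c m)"
proof -
  have "c = (\<lambda>m. (deriv ^^ m) f 0 / fact m)"
    by (rule pw_unique[OF assms pw_entire[OF pw_holomorphic[OF assms]]])
  then show ?thesis
    unfolding pw_def using entire_euler_sums[OF pw_holomorphic[OF assms]] has_sum_imp_sums by blast
qed

lemma pw_mult:
  assumes "pw f c" "pw g d" shows "pw (\<lambda>z. f z * g z) (\<lambda>m. \<Sum>l\<le>m. c l * d (m - l))"
  unfolding pw_def
proof
  fix z
  have "(\<lambda>m. \<Sum>l\<le>m. (c l * z ^ l) * (d (m - l) * z ^ (m - l))) sums
      (suminf (\<lambda>m. c m * z ^ m) * suminf (\<lambda>m. d m * z ^ m))"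
    by (rule Cauchy_product_sums) (use pw_abs_summable assms in blast)+
  moreover have "(\<Sum>l\<le>m. (c l * z ^ l) * (d (m - l) * z ^ (m - l))) = (\<Sum>l\<le>m. c l * d (m - l)) * z ^ m" for m
    unfolding sum_distrib_right
  proof (rule sum.cong)
    fix l assume "l \<in> {..m}"
    then have "z ^ m = z ^ l * z ^ (m - l)" by (simp flip: power_add)
    then show "(c l * z ^ l) * (d (m - l) * z ^ (m - l)) = c l * d (m - l) * z ^ m" by simp
  qed simp
  moreover have "suminf (\<lambda>m. c m * z ^ m) = f z" "suminf (\<lambda>m. d m * z ^ m) = g z"
    using assms by (auto simp: pw_def sums_iff)
  ultimately show "(\<lambda>m. (\<Sum>l\<le>m. c l * d (m - l)) * z ^ m) sums (f z * g z)" by simp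
qed

lemma pw_at_0: "pw f c \<Longrightarrow> f 0 = c 0"
  unfolding pw_def by (metis powser_sums_zero_iff)

text \<open>To sum at \<open>z\<close>, use the bound for the radius \<open>2 |z| + 1\<close>: the
  ratio of \<open>|z|\<close> to it is at most one half, which leaves a geometric majorant.\<close>

lemma pwI:
  assumes "\<And>r::real. r > 0 \<Longrightarrow> \<exists>K. \<forall>m. norm (c m) * r ^ m \<le> K"
  shows "pw (\<lambda>z. suminf (\<lambda>m. c m * z ^ m)) c"
  unfolding pw_def
proof
  fix z :: complex
  define r where "r = 2 * norm z + 1"
  have r: "r > 0" "norm z \<le> r / 2" by (auto simp: r_def add_nonneg_pos)
  obtain K where K: "\<And>m. norm (c m) * r ^ m \<le> K" using assms[OF r(1)] by blast
  have "summable (\<lambda>m. c m * z ^ m)"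
  proof (rule summable_comparison_test)
    show "summable (\<lambda>m. K * (1/2) ^ m)" by (intro summable_mult summable_geometric) simp
    have "norm (c m * z ^ m) \<le> K * (1/2) ^ m" for m
    proof -
      have "norm (c m * z ^ m) \<le> norm (c m) * (r / 2) ^ m"
        using r unfolding norm_mult norm_power by (intro mult_left_mono power_mono) auto
      also have "\<dots> = (norm (c m) * r ^ m) * (1/2) ^ m" by (simp add: power_divide)
      also have "\<dots> \<le> K * (1/2) ^ m" by (rule mult_right_mono[OF K]) simp
      finally show ?thesis .
    qed
    then show "\<exists>N. \<forall>n\<ge>N. norm (c n * z ^ n) \<le> K * (1/2) ^ n" by blast
  qed
  then show "(\<lambda>m. c m * z ^ m) sums suminf (\<lambda>m. c m * z ^ m)" by (rule summable_sums)
qed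

section \<open>Sylvester equations with triangular coefficients\<close>

lemma sum_upper_left:
  fixes B :: "nat \<Rightarrow> nat \<Rightarrow> complex"
  assumes "\<And>k. k < n \<Longrightarrow> j < k \<Longrightarrow> B k j = 0" "j < n"
  shows "(\<Sum>k<n. x k * B k j) = (\<Sum>k<j. x k * B k j) + x j * B j j"
proof -
  have "(\<Sum>k<n. x k * B k j) = (\<Sum>k\<in>insert j {..<j}. x k * B k j)"
    by (rule sum.mono_neutral_right) (use assms in auto)
  then show ?thesis by simp
qed

lemma sum_upper_right:
  fixes B :: "nat \<Rightarrow> nat \<Rightarrow> complex"
  assumes "\<And>k. k < i \<Longrightarrow> B i k = 0" "i < n"
  shows "(\<Sum>k<n. B i k * x k) = (\<Sum>k\<in>{i<..<n}. B i k * x k) + B i i * x i"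
proof -
  have "(\<Sum>k<n. B i k * x k) = (\<Sum>k\<in>insert i {i<..<n}. B i k * x k)"
    by (rule sum.mono_neutral_right) (use assms in \<open>auto simp: not_less\<close>)
  then show ?thesis by simp
qed

definition upper :: "nat \<Rightarrow> (nat \<Rightarrow> nat \<Rightarrow> complex) \<Rightarrow> bool" where
  "upper n B \<longleftrightarrow> (\<forall>i<n. \<forall>j<i. B i j = 0)"

text \<open>For upper triangular \<open>B\<close> the equation at position \<open>(i, j)\<close>
  involves, besides the unknown there, only entries further left in row \<open>i\<close> and further
  down in column \<open>j\<close>. Back substitution in this order lowers \<open>j + (n - i)\<close>
  at each call, and the pivot is \<open>c + B j j - B i i\<close>.\<close>

function sy :: "complex \<Rightarrow> (nat \<Rightarrow> nat \<Rightarrow> complex) \<Rightarrow> nat \<Rightarrow> (nat \<Rightarrow> nat \<Rightarrow> complex) \<Rightarrow> nat \<Rightarrow> nat \<Rightarrow> complex" where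
  "sy c B n R i j = (if i < n \<and> j < n then
     (R i j - (\<Sum>k<j. sy c B n R i k * B k j) + (\<Sum>k\<in>{i<..<n}. B i k * sy c B n R k j)) / (c + B j j - B i i)
     else 0)"
  by pat_completeness auto
termination
  by (relation "Wellfounded.measure (\<lambda>(c, B, n, R, i, j). j + (n - i))") auto

declare sy.simps [simp del]

lemma sylvester_solve:
  assumes B: "upper n B" and c: "\<And>i j. i < n \<Longrightarrow> j < n \<Longrightarrow> c + B j j - B i i \<noteq> 0"
  shows "\<exists>X. \<forall>i<n. \<forall>j<n. c * X i j + (\<Sum>k<n. X i k * B k j) - (\<Sum>k<n. B i k * X k j) = R i j"
proof (intro exI[of _ "sy c B n R"] allI impI)
  fix i j assume ij: "i < n" "j < n"
  have 1: "(\<Sum>k<n. sy c B n R i k * B k j) = (\<Sum>k<j. sy c B n R i k * B k j) + sy c B n R i j * B j j"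
    by (rule sum_upper_left) (use B ij in \<open>auto simp: upper_def\<close>)
  have 2: "(\<Sum>k<n. B i k * sy c B n R k j) = (\<Sum>k\<in>{i<..<n}. B i k * sy c B n R k j) + B i i * sy c B n R i j"
    by (rule sum_upper_right) (use B ij in \<open>auto simp: upper_def\<close>)
  have "sy c B n R i j * (c + B j j - B i i) =
      R i j - (\<Sum>k<j. sy c B n R i k * B k j) + (\<Sum>k\<in>{i<..<n}. B i k * sy c B n R k j)"
    using c[OF ij] ij by (subst sy.simps) simp
  then show "c * sy c B n R i j + (\<Sum>k<n. sy c B n R i k * B k j) - (\<Sum>k<n. B i k * sy c B n R k j) = R i j"
    unfolding 1 2 by (simp add: algebra_simps)
qed

text \<open>The same elimination order as for the solution, now with zero right-hand side. The two
  coefficient matrices may have different sizes because they will belong to source and target of a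
  morphism.\<close>

lemma sylvester_unique:
  assumes B: "upper m B" and B': "upper n B'"
    and c: "\<And>i j. i < m \<Longrightarrow> j < n \<Longrightarrow> c + B' j j - B i i \<noteq> 0"
    and eq: "\<And>i j. i < m \<Longrightarrow> j < n \<Longrightarrow> c * X i j + (\<Sum>k<n. X i k * B' k j) - (\<Sum>k<m. B i k * X k j) = 0"
  shows "i < m \<Longrightarrow> j < n \<Longrightarrow> X i j = 0"
proof (induction "j + (m - i)" arbitrary: i j rule: less_induct)
  case less
  note ij = less.prems
  have 1: "(\<Sum>k<n. X i k * B' k j) = (\<Sum>k<j. X i k * B' k j) + X i j * B' j j"
    by (rule sum_upper_left) (use B' ij in \<open>auto simp: upper_def\<close>)
  have 2: "(\<Sum>k<m. B i k * X k j) = (\<Sum>k\<in>{i<..<m}. B i k * X k j) + B i i * X i j"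
    by (rule sum_upper_right) (use B ij in \<open>auto simp: upper_def\<close>)
  have 3: "(\<Sum>k<j. X i k * B' k j) = 0"
    by (rule sum.neutral) (use less in auto)
  have 4: "(\<Sum>k\<in>{i<..<m}. B i k * X k j) = 0"
    by (rule sum.neutral) (use less in auto)
  have "X i j * (c + B' j j - B i i) = 0"
    using eq[OF ij] unfolding 1 2 3 4 by (simp add: algebra_simps)
  then show ?case using c[OF ij] by simp
qed

section \<open>The Frobenius method\<close>

definition msize :: "nat \<Rightarrow> (nat \<Rightarrow> nat \<Rightarrow> complex) \<Rightarrow> real" where
  "msize n X = (\<Sum>i<n. \<Sum>j<n. norm (X i j))"

definition mm :: "nat \<Rightarrow> (nat \<Rightarrow> nat \<Rightarrow> complex) \<Rightarrow> (nat \<Rightarrow> nat \<Rightarrow> complex) \<Rightarrow> nat \<Rightarrow> nat \<Rightarrow> complex" where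
  "mm n X Y = (\<lambda>i j. \<Sum>k<n. X i k * Y k j)"

lemma msize_nonneg: "msize n X \<ge> 0"
  by (simp add: msize_def sum_nonneg)

lemma msize_entry: "i < n \<Longrightarrow> j < n \<Longrightarrow> norm (X i j) \<le> msize n X"
  unfolding msize_def
  by (rule order_trans[OF member_le_sum[of j "{..<n}" "\<lambda>j. norm (X i j)"]
      member_le_sum[of i "{..<n}" "\<lambda>i. \<Sum>j<n. norm (X i j)"]]) (auto intro: sum_nonneg)

text \<open>Replacing the single entry of \<open>Y\<close> by the whole column sum decouples the
  summations.\<close>

lemma msize_mm: "msize n (mm n X Y) \<le> msize n X * msize n Y"
proof -
  have "msize n (mm n X Y) \<le> (\<Sum>i<n. \<Sum>j<n. \<Sum>k<n. norm (X i k) * (\<Sum>l<n. norm (Y l j)))"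
    unfolding msize_def mm_def
  proof (intro sum_mono)
    fix i j assume "i \<in> {..<n}" "j \<in> {..<n}"
    have "norm (\<Sum>k<n. X i k * Y k j) \<le> (\<Sum>k<n. norm (X i k * Y k j))" by (rule norm_sum)
    also have "\<dots> \<le> (\<Sum>k<n. norm (X i k) * (\<Sum>l<n. norm (Y l j)))"
      unfolding norm_mult by (intro sum_mono mult_left_mono member_le_sum) auto
    finally show "norm (\<Sum>k<n. X i k * Y k j) \<le> (\<Sum>k<n. norm (X i k) * (\<Sum>l<n. norm (Y l j)))" .
  qed
  also have "\<dots> = (\<Sum>i<n. \<Sum>k<n. norm (X i k)) * (\<Sum>j<n. \<Sum>l<n. norm (Y l j))"
    unfolding sum_distrib_right[symmetric] sum_distrib_left[symmetric] by simp
  also have "(\<Sum>j<n. \<Sum>l<n. norm (Y l j)) = (\<Sum>l<n. \<Sum>j<n. norm (Y l j))" by (rule sum.swap)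
  finally show ?thesis by (simp add: msize_def)
qed

lemma msize_add: "msize n (\<lambda>i j. X i j + Y i j) \<le> msize n X + msize n Y"
  unfolding msize_def sum.distrib[symmetric] by (intro sum_mono norm_triangle_ineq)

lemma msize_sum: "finite L \<Longrightarrow> msize n (\<lambda>i j. \<Sum>l\<in>L. X l i j) \<le> (\<Sum>l\<in>L. msize n (X l))"
proof (induction L rule: finite_induct)
  case (insert x F)
  have "msize n (\<lambda>i j. \<Sum>l\<in>insert x F. X l i j) = msize n (\<lambda>i j. X x i j + (\<Sum>l\<in>F. X l i j))"
    using insert by simp
  also have "\<dots> \<le> msize n (X x) + msize n (\<lambda>i j. \<Sum>l\<in>F. X l i j)" by (rule msize_add)
  finally show ?case using insert by simp
qed (simp add: msize_def)

lemma msize_uminus: "msize n (\<lambda>i j. - X i j) = msize n X"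
  by (simp add: msize_def)

text \<open>In a linear recursion of the shape \<open>m * p m \<lesssim> \<Sum>l<m. p l * a (m - l)\<close> the sequence \<open>p\<close> is
  dominated by every geometric sequence that dominates \<open>a\<close>.\<close>

lemma recursion_bounded:
  fixes p a :: "nat \<Rightarrow> real" and r t b :: real
  assumes p: "\<And>m. p m \<ge> 0" and a: "\<And>m. a m \<ge> 0" and r: "r > 0" and t: "t > 0"
    and sa: "summable (\<lambda>m. a m * r ^ m)"
    and rec: "\<And>m. m \<ge> 1 \<Longrightarrow> t * of_nat m * p m \<le> (\<Sum>l<m. p l * a (m - l)) + b * p m"
  shows "\<exists>K. \<forall>m. p m * r ^ m \<le> K"
proof -
  define H where "H = suminf (\<lambda>m. a m * r ^ m)"
  \<comment> \<open>Beyond \<open>M\<close> the linear factor \<open>t m - b\<close> exceeds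
    \<open>H + 1\<close>, so the recursion can no longer increase the bound; the finitely many
    earlier values are absorbed in \<open>K\<close>.\<close>
  obtain M :: nat where M: "(H + b + 1) / t < of_nat M" using reals_Archimedean2 by blast
  define K where "K = (\<Sum>m\<le>M. p m * r ^ m)"
  have K: "p m * r ^ m \<le> K" if "m \<le> M" for m
    unfolding K_def using that p r by (intro member_le_sum) auto
  have K0: "K \<ge> 0" unfolding K_def using p r by (intro sum_nonneg) auto
  have "p m * r ^ m \<le> K" for m
  proof (induction m rule: less_induct)
    case (less m)
    show ?case
    proof (cases "m \<le> M")
      case False
      then have m: "m \<ge> 1" "m > M" by auto
      have "(\<Sum>l<m. p l * a (m - l)) * r ^ m = (\<Sum>l<m. (p l * r ^ l) * (a (m - l) * r ^ (m - l)))"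
        unfolding sum_distrib_right
      proof (rule sum.cong)
        fix l assume "l \<in> {..<m}"
        then have "r ^ m = r ^ l * r ^ (m - l)" by (simp flip: power_add)
        then show "p l * a (m - l) * r ^ m = (p l * r ^ l) * (a (m - l) * r ^ (m - l))" by simp
      qed simp
      also have "\<dots> \<le> (\<Sum>l<m. K * (a (m - l) * r ^ (m - l)))"
        using less a r by (intro sum_mono mult_right_mono) auto
      also have "\<dots> = K * (\<Sum>l<m. a (m - l) * r ^ (m - l))" by (simp add: sum_distrib_left)
      also have "(\<Sum>l<m. a (m - l) * r ^ (m - l)) = (\<Sum>l\<in>{1..m}. a l * r ^ l)"
        by (rule sum.reindex_bij_witness[of _ "\<lambda>l. m - l" "\<lambda>l. m - l"]) auto
      also have "\<dots> \<le> H" unfolding H_def using a r by (intro sum_le_suminf sa) auto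
      finally have s: "(\<Sum>l<m. p l * a (m - l)) * r ^ m \<le> K * H" using K0 by (simp add: mult_left_mono)
      have "t * of_nat m * p m * r ^ m \<le> ((\<Sum>l<m. p l * a (m - l)) + b * p m) * r ^ m"
        using rec[OF m(1)] r by (intro mult_right_mono) auto
      then have "(t * of_nat m - b) * (p m * r ^ m) \<le> K * H" using s by (simp add: algebra_simps)
      moreover have "H + 1 \<le> t * of_nat m - b"
      proof -
        have "H + b + 1 < t * of_nat M" using M t by (simp add: divide_simps mult.commute)
        also have "\<dots> \<le> t * of_nat m" using m t by (intro mult_left_mono) auto
        finally show ?thesis by simp
      qed
      then have "(H + 1) * (p m * r ^ m) \<le> (t * of_nat m - b) * (p m * r ^ m)"
        using p r by (intro mult_right_mono) auto
      moreover have H0: "H \<ge> 0" unfolding H_def using a r by (intro suminf_nonneg sa) auto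
      moreover have "K * H \<le> K * (H + 1)" using K0 by (simp add: algebra_simps)
      ultimately have "(H + 1) * (p m * r ^ m) \<le> (H + 1) * K" by (simp only: mult.commute[of K])
      then show ?thesis by (rule mult_left_le_imp_le) (use H0 in simp)
    qed (use K in blast)
  qed
  then show ?thesis by blast
qed

text \<open>The Taylor coefficients of the solution of \<open>\<tau> z P' + P A = A(0) P\<close>
  with \<open>P(0) = 1\<close>. Comparing coefficients of \<open>z^(m+1)\<close> leaves a Sylvester
  equation for the next one, with the earlier coefficients on the right.\<close>

fun frob :: "nat \<Rightarrow> complex \<Rightarrow> (nat \<Rightarrow> nat \<Rightarrow> nat \<Rightarrow> complex) \<Rightarrow> nat \<Rightarrow> nat \<Rightarrow> nat \<Rightarrow> complex" where
  "frob n \<tau> a 0 = (\<lambda>i j. if i = j then 1 else 0)"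
| "frob n \<tau> a (Suc m) = (SOME X. \<forall>i<n. \<forall>j<n.
     \<tau> * of_nat (Suc m) * X i j + (\<Sum>k<n. X i k * a 0 k j) - (\<Sum>k<n. a 0 i k * X k j)
     = - (\<Sum>l\<le>m. mm n (frob n \<tau> a l) (a (Suc m - l)) i j))"

declare frob.simps(2) [simp del]

text \<open>The formal solution converges everywhere because the Euler operator multiplies the
  coefficient of \<open>z^m\<close> by \<open>\<tau> m\<close>, which is the growth that
  \<open>recursion_bounded\<close> exploits for every radius. Solvability of the Sylvester equations
  is a hypothesis, since the lemma is applied both to a triangular system and to its dual.\<close>

lemma frobenius:
  fixes n :: nat
  assumes \<tau>: "\<tau> \<noteq> 0"
    and A: "\<And>i j. i < n \<Longrightarrow> j < n \<Longrightarrow> A i j holomorphic_on UNIV"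
    and B: "\<And>i j. i < n \<Longrightarrow> j < n \<Longrightarrow> B i j = A i j 0"
    and solv: "\<And>m R. m \<ge> 1 \<Longrightarrow> \<exists>X. \<forall>i<n. \<forall>j<n.
      \<tau> * of_nat m * X i j + (\<Sum>k<n. X i k * B k j) - (\<Sum>k<n. B i k * X k j) = R i j"
  obtains P where "\<And>i j. i < n \<Longrightarrow> j < n \<Longrightarrow> P i j holomorphic_on UNIV"
    "\<And>i j. i < n \<Longrightarrow> j < n \<Longrightarrow> P i j 0 = (if i = j then 1 else 0)"
    "\<And>i j z. i < n \<Longrightarrow> j < n \<Longrightarrow> \<tau> * z * deriv (P i j) z + (\<Sum>k<n. P i k z * A k j z) = (\<Sum>k<n. B i k * P k j z)"
proof -
  define a where "a = (\<lambda>m i j. (deriv ^^ m) (A i j) 0 / fact m)"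
  have a0: "a 0 i j = B i j" if "i < n" "j < n" for i j using B[OF that] by (simp add: a_def)
  have pa: "pw (A i j) (\<lambda>m. a m i j)" if "i < n" "j < n" for i j
    unfolding a_def by (rule pw_entire[OF A[OF that]])
  define p where "p = frob n \<tau> a"
  have p0: "p 0 i j = (if i = j then 1 else 0)" for i j by (simp add: p_def)
  have pS: "\<tau> * of_nat m * p m i j + (\<Sum>k<n. p m i k * B k j) - (\<Sum>k<n. B i k * p m k j)
     = - (\<Sum>l<m. mm n (p l) (a (m - l)) i j)" if m: "m \<ge> 1" and ij: "i < n" "j < n" for m i j
  proof -
    obtain m' where m': "m = Suc m'" using m by (cases m) auto
    have "\<exists>X. \<forall>i<n. \<forall>j<n. \<tau> * of_nat (Suc m') * X i j + (\<Sum>k<n. X i k * a 0 k j) - (\<Sum>k<n. a 0 i k * X k j)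
     = - (\<Sum>l\<le>m'. mm n (frob n \<tau> a l) (a (Suc m' - l)) i j)"
      using solv[of "Suc m'" "\<lambda>i j. - (\<Sum>l\<le>m'. mm n (frob n \<tau> a l) (a (Suc m' - l)) i j)"] by (simp add: a0)
    from someI_ex[OF this] show ?thesis
      using ij unfolding p_def m' frob.simps(2)[symmetric] by (simp add: a0 lessThan_Suc_atMost)
  qed
  have bound: "\<exists>K. \<forall>m. norm (p m i j) * r ^ m \<le> K" if ij: "i < n" "j < n" and r: "r > 0" for i j and r :: real
  proof -
    have "\<exists>K. \<forall>m. msize n (p m) * r ^ m \<le> K"
    \<comment> \<open>The two terms of the commutator of \<open>p m\<close> with \<open>B\<close>
      are each at most \<open>msize n B * msize n (p m)\<close>, whence the factor 2.\<close>
    proof (rule recursion_bounded[where a = "\<lambda>m. msize n (a m)" and t = "norm \<tau>" and b = "2 * msize n B"])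
      have "summable (\<lambda>m. norm (a m i j) * r ^ m)" if "i < n" "j < n" for i j
        using pw_abs_summable[OF pa[OF that], of "of_real r"] r by (simp add: norm_mult norm_power)
      then show "summable (\<lambda>m. msize n (a m) * r ^ m)"
        unfolding msize_def sum_distrib_right by (intro summable_sum) auto
    next
      fix m :: nat assume m: "m \<ge> 1"
      define R where "R = (\<lambda>i j. \<Sum>l<m. mm n (p l) (a (m - l)) i j)"
      have "norm \<tau> * of_nat m * msize n (p m) = msize n (\<lambda>i j. \<tau> * of_nat m * p m i j)"
        unfolding msize_def sum_distrib_left by (simp add: norm_mult)
      also have "\<dots> = msize n (\<lambda>i j. (- R i j + - mm n (p m) B i j) + mm n B (p m) i j)"
        unfolding msize_def
      proof (intro sum.cong refl)
        fix i j assume "i \<in> {..<n}" "j \<in> {..<n}"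
        then have "\<tau> * of_nat m * p m i j = (- R i j + - mm n (p m) B i j) + mm n B (p m) i j"
          using pS[OF m, of i j] by (simp add: R_def mm_def algebra_simps)
        then show "norm (\<tau> * of_nat m * p m i j) = norm ((- R i j + - mm n (p m) B i j) + mm n B (p m) i j)" by simp
      qed
      also have "\<dots> \<le> (msize n (\<lambda>i j. - R i j) + msize n (\<lambda>i j. - mm n (p m) B i j)) + msize n (mm n B (p m))"
        by (rule order_trans[OF msize_add add_right_mono[OF msize_add]])
      also have "\<dots> \<le> (\<Sum>l<m. msize n (p l) * msize n (a (m - l))) + (msize n (p m) * msize n B) + msize n B * msize n (p m)"
        unfolding msize_uminus R_def
        by (intro add_mono msize_mm order_trans[OF msize_sum] sum_mono finite_lessThan)
      finally show "norm \<tau> * of_nat m * msize n (p m) \<le> (\<Sum>l<m. msize n (p l) * msize n (a (m - l))) + 2 * msize n B * msize n (p m)"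
        by (simp add: algebra_simps)
    qed (use \<tau> r msize_nonneg in auto)
    then obtain K where "\<And>m. msize n (p m) * r ^ m \<le> K" by blast
    moreover have "norm (p m i j) * r ^ m \<le> msize n (p m) * r ^ m" for m
      using msize_entry[OF ij] r by (intro mult_right_mono) auto
    ultimately show ?thesis by (meson order_trans)
  qed
  define P where "P = (\<lambda>i j z. suminf (\<lambda>m. p m i j * z ^ m))"
  have pP: "pw (P i j) (\<lambda>m. p m i j)" if "i < n" "j < n" for i j
    unfolding P_def by (rule pwI) (rule bound[OF that])
  show ?thesis
  proof (rule that[of P])
    fix i j assume ij: "i < n" "j < n"
    show "P i j holomorphic_on UNIV" by (rule pw_holomorphic[OF pP[OF ij]])
    show "P i j 0 = (if i = j then 1 else 0)" using pw_at_0[OF pP[OF ij]] p0 by simp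
    fix z
    have w1: "pw (\<lambda>z. \<tau> * (z * deriv (P i j) z) + (\<Sum>k<n. P i k z * A k j z))
      (\<lambda>m. \<tau> * (of_nat m * p m i j) + (\<Sum>k<n. \<Sum>l\<le>m. p l i k * a (m - l) k j))"
      by (intro pw_add pw_cmult pw_euler pw_sum pw_mult pP pa ij) (use ij in auto)
    have weq: "(\<lambda>m. \<tau> * (of_nat m * p m i j) + (\<Sum>k<n. \<Sum>l\<le>m. p l i k * a (m - l) k j))
      = (\<lambda>m. \<Sum>k<n. B i k * p m k j)"
    proof
      fix m
      have "(\<Sum>k<n. \<Sum>l\<le>m. p l i k * a (m - l) k j) = (\<Sum>l\<le>m. mm n (p l) (a (m - l)) i j)"
        unfolding mm_def by (rule sum.swap)
      also have "\<dots> = (\<Sum>l<m. mm n (p l) (a (m - l)) i j) + (\<Sum>k<n. p m i k * B k j)"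
        unfolding lessThan_Suc_atMost[symmetric] using ij by (simp add: mm_def a0)
      finally have *: "(\<Sum>k<n. \<Sum>l\<le>m. p l i k * a (m - l) k j)
        = (\<Sum>l<m. mm n (p l) (a (m - l)) i j) + (\<Sum>k<n. p m i k * B k j)" .
      show "\<tau> * (of_nat m * p m i j) + (\<Sum>k<n. \<Sum>l\<le>m. p l i k * a (m - l) k j) = (\<Sum>k<n. B i k * p m k j)"
      proof (cases "m = 0")
        case True
        have "(\<Sum>k<n. p 0 i k * B k j) = B i j"
          using ij unfolding p0 by (subst sum.remove[of _ i]) auto
        moreover have "(\<Sum>k<n. B i k * p 0 k j) = B i j"
          using ij unfolding p0 by (subst sum.remove[of _ j]) auto
        ultimately show ?thesis unfolding * using True by simp
      next
        case False
        then show ?thesis unfolding * using pS[of m i j] ij by (simp add: algebra_simps)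
      qed
    qed
    have w2: "pw (\<lambda>z. \<Sum>k<n. B i k * P k j z) (\<lambda>m. \<Sum>k<n. B i k * p m k j)"
      by (intro pw_sum pw_cmult pP) (use ij in auto)
    have "\<tau> * (z * deriv (P i j) z) + (\<Sum>k<n. P i k z * A k j z) = (\<Sum>k<n. B i k * P k j z)"
      using w1[unfolded weq pw_def] w2[unfolded pw_def] sums_unique2 by blast
    then show "\<tau> * z * deriv (P i j) z + (\<Sum>k<n. P i k z * A k j z) = (\<Sum>k<n. B i k * P k j z)"
      by (simp only: mult.assoc)
  qed
qed

section \<open>Gauge equivalence of connection matrices\<close>

definition mat_eq :: "nat \<Rightarrow> (nat \<Rightarrow> nat \<Rightarrow> complex) \<Rightarrow> (nat \<Rightarrow> nat \<Rightarrow> complex) \<Rightarrow> bool" where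
  "mat_eq n X Y \<longleftrightarrow> (\<forall>i<n. \<forall>j<n. X i j = Y i j)"

definition idmat :: "nat \<Rightarrow> nat \<Rightarrow> complex" where
  "idmat = (\<lambda>i j. if i = j then 1 else 0)"

definition ev :: "(nat \<Rightarrow> nat \<Rightarrow> complex \<Rightarrow> complex) \<Rightarrow> complex \<Rightarrow> nat \<Rightarrow> nat \<Rightarrow> complex" where
  "ev C z = (\<lambda>i j. C i j z)"

definition euler :: "(nat \<Rightarrow> nat \<Rightarrow> complex \<Rightarrow> complex) \<Rightarrow> complex \<Rightarrow> nat \<Rightarrow> nat \<Rightarrow> complex" where
  "euler C z = (\<lambda>i j. z * deriv (C i j) z)"

lemma mat_eq_refl [simp]: "mat_eq n X X"
  and mat_eq_sym: "mat_eq n X Y \<Longrightarrow> mat_eq n Y X"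
  and mat_eq_trans: "mat_eq n X Y \<Longrightarrow> mat_eq n Y Z \<Longrightarrow> mat_eq n X Z"
  by (auto simp: mat_eq_def)

lemma mm_cong: "mat_eq n X X' \<Longrightarrow> mat_eq n Y Y' \<Longrightarrow> mat_eq n (mm n X Y) (mm n X' Y')"
  unfolding mat_eq_def mm_def by (auto intro!: sum.cong)

lemma mm_assoc: "mm n (mm n X Y) Z = mm n X (mm n Y Z)"
proof (rule ext, rule ext)
  fix i j
  have "mm n (mm n X Y) Z i j = (\<Sum>l<n. \<Sum>k<n. X i k * Y k l * Z l j)"
    by (simp add: mm_def sum_distrib_right)
  also have "\<dots> = (\<Sum>k<n. \<Sum>l<n. X i k * Y k l * Z l j)" by (rule sum.swap)
  also have "\<dots> = mm n X (mm n Y Z) i j"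
    by (simp add: mm_def sum_distrib_left mult.assoc)
  finally show "mm n (mm n X Y) Z i j = mm n X (mm n Y Z) i j" .
qed

lemma mm_idm_left: "mat_eq n (mm n idmat X) X"
proof -
  have "(\<Sum>k<n. idmat i k * X k j) = X i j" if "i < n" for i j
    using that by (subst sum.remove[of _ i]) (auto simp: idmat_def)
  then show ?thesis by (simp add: mat_eq_def mm_def)
qed

lemma mm_idm_right: "mat_eq n (mm n X idmat) X"
proof -
  have "(\<Sum>k<n. X i k * idmat k j) = X i j" if "j < n" for i j
    using that by (subst sum.remove[of _ j]) (auto simp: idmat_def)
  then show ?thesis by (simp add: mat_eq_def mm_def)
qed

definition entries_hol :: "nat \<Rightarrow> (nat \<Rightarrow> nat \<Rightarrow> complex \<Rightarrow> complex) \<Rightarrow> complex set \<Rightarrow> bool" where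
  "entries_hol n C U \<longleftrightarrow> (\<forall>i<n. \<forall>j<n. C i j holomorphic_on U)"

text \<open>Writing \<open>\<nabla> e\<^sub>i = \<Sum>\<^sub>j A\<^sub>i\<^sub>j e\<^sub>j\<close>, the matrix \<open>A'\<close> describes \<open>\<nabla>\<close> in the basis
  \<open>e'\<^sub>i = \<Sum>\<^sub>j C\<^sub>i\<^sub>j e\<^sub>j\<close>.\<close>

definition gauge_by :: "nat \<Rightarrow> complex \<Rightarrow> (nat \<Rightarrow> nat \<Rightarrow> complex \<Rightarrow> complex) \<Rightarrow> (nat \<Rightarrow> nat \<Rightarrow> complex \<Rightarrow> complex) \<Rightarrow>
    (nat \<Rightarrow> nat \<Rightarrow> complex \<Rightarrow> complex) \<Rightarrow> (nat \<Rightarrow> nat \<Rightarrow> complex \<Rightarrow> complex) \<Rightarrow> bool" where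
  "gauge_by n \<tau> C D A A' \<longleftrightarrow> entries_hol n C (-{0}) \<and> entries_hol n D (-{0}) \<and>
     (\<forall>z. z \<noteq> 0 \<longrightarrow> mat_eq n (mm n (ev C z) (ev D z)) idmat \<and> mat_eq n (mm n (ev D z) (ev C z)) idmat \<and>
       mat_eq n (\<lambda>i j. \<tau> * euler C z i j + mm n (ev C z) (ev A z) i j) (mm n (ev A' z) (ev C z)))"

definition gauge_equiv :: "nat \<Rightarrow> complex \<Rightarrow> (nat \<Rightarrow> nat \<Rightarrow> complex \<Rightarrow> complex) \<Rightarrow> (nat \<Rightarrow> nat \<Rightarrow> complex \<Rightarrow> complex) \<Rightarrow> bool" where
  "gauge_equiv n \<tau> A A' \<longleftrightarrow> (\<exists>C D. gauge_by n \<tau> C D A A')"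

definition pmm :: "nat \<Rightarrow> (nat \<Rightarrow> nat \<Rightarrow> complex \<Rightarrow> complex) \<Rightarrow> (nat \<Rightarrow> nat \<Rightarrow> complex \<Rightarrow> complex) \<Rightarrow> nat \<Rightarrow> nat \<Rightarrow> complex \<Rightarrow> complex" where
  "pmm n C D = (\<lambda>i j z. \<Sum>k<n. C i k z * D k j z)"

lemma ev_pmm: "ev (pmm n C D) z = mm n (ev C z) (ev D z)"
  by (simp add: ev_def pmm_def mm_def)

lemma pmm_hol: "entries_hol n C U \<Longrightarrow> entries_hol n D U \<Longrightarrow> entries_hol n (pmm n C D) U"
  unfolding entries_hol_def pmm_def by (intro allI impI holomorphic_on_sum holomorphic_on_mult) auto

lemma euler_pmm:
  assumes C: "entries_hol n C U" and D: "entries_hol n D U" and U: "open U" and z: "z \<in> U"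
  shows "mat_eq n (euler (pmm n C D) z) (\<lambda>i j. mm n (euler C z) (ev D z) i j + mm n (ev C z) (euler D z) i j)"
  unfolding mat_eq_def
proof (intro allI impI)
  fix i j assume ij: "i < n" "j < n"
  have "((\<lambda>z. \<Sum>k<n. C i k z * D k j z) has_field_derivative
      (\<Sum>k<n. C i k z * deriv (D k j) z + deriv (C i k) z * D k j z)) (at z)"
  proof (intro DERIV_sum DERIV_mult')
    fix k assume "k \<in> {..<n}"
    then have "C i k holomorphic_on U" "D k j holomorphic_on U"
      using C D ij by (auto simp: entries_hol_def)
    then show "(C i k has_field_derivative deriv (C i k) z) (at z)" "(D k j has_field_derivative deriv (D k j) z) (at z)"
      using holomorphic_derivI[OF _ U z] by blast+
  qed
  then have "deriv (pmm n C D i j) z = (\<Sum>k<n. C i k z * deriv (D k j) z + deriv (C i k) z * D k j z)"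
    unfolding pmm_def by (rule DERIV_imp_deriv)
  then show "euler (pmm n C D) z i j = mm n (euler C z) (ev D z) i j + mm n (ev C z) (euler D z) i j"
    unfolding euler_def mm_def ev_def
    by (simp add: sum_distrib_left sum.distrib distrib_left mult_ac)
qed

lemma open_punctured: "open (-{0::complex})"
  by (rule open_Compl) simp

text \<open>The composite change of basis is \<open>C' C\<close> with inverse \<open>D D'\<close>.
  By the product rule its Euler derivative splits into the parts to which the two given equations
  apply.\<close>

lemma gauge_trans:
  assumes "gauge_equiv n \<tau> A A'" "gauge_equiv n \<tau> A' A''" shows "gauge_equiv n \<tau> A A''"
proof -
  obtain C D C' D' where 1: "gauge_by n \<tau> C D A A'" and 2: "gauge_by n \<tau> C' D' A' A''"
    using assms unfolding gauge_equiv_def by blast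
  have hol: "entries_hol n C (-{0})" "entries_hol n D (-{0})" "entries_hol n C' (-{0})" "entries_hol n D' (-{0})"
    using 1 2 by (auto simp: gauge_by_def)
  have "gauge_by n \<tau> (pmm n C' C) (pmm n D D') A A''"
    unfolding gauge_by_def
  proof (intro conjI allI impI)
    fix z :: complex assume z: "z \<noteq> 0"
    let ?C = "ev C z" and ?C' = "ev C' z" and ?D = "ev D z" and ?D' = "ev D' z"
    have CD: "mat_eq n (mm n ?C ?D) idmat" "mat_eq n (mm n ?D ?C) idmat"
      "mat_eq n (mm n ?C' ?D') idmat" "mat_eq n (mm n ?D' ?C') idmat"
      and e1: "mat_eq n (\<lambda>i j. \<tau> * euler C z i j + mm n ?C (ev A z) i j) (mm n (ev A' z) ?C)"
      and e2: "mat_eq n (\<lambda>i j. \<tau> * euler C' z i j + mm n ?C' (ev A' z) i j) (mm n (ev A'' z) ?C')"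
      using 1 2 z by (auto simp: gauge_by_def)
    have cancel: "mat_eq n (mm n (mm n X Y) (mm n Z W)) idmat"
      if "mat_eq n (mm n Y Z) idmat" "mat_eq n (mm n X W) idmat" for X Y Z W
    proof -
      have eq: "mm n (mm n X Y) (mm n Z W) = mm n X (mm n (mm n Y Z) W)" by (simp add: mm_assoc)
      have step: "mat_eq n (mm n X (mm n (mm n Y Z) W)) (mm n X W)"
        by (intro mm_cong mat_eq_refl mat_eq_trans[OF mm_cong[OF that(1) mat_eq_refl] mm_idm_left])
      show ?thesis unfolding eq by (rule mat_eq_trans[OF step that(2)])
    qed
    show "mat_eq n (mm n (ev (pmm n C' C) z) (ev (pmm n D D') z)) idmat"
      "mat_eq n (mm n (ev (pmm n D D') z) (ev (pmm n C' C) z)) idmat"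
      unfolding ev_pmm by (intro cancel CD)+
    have eu: "mat_eq n (euler (pmm n C' C) z) (\<lambda>i j. mm n (euler C' z) ?C i j + mm n ?C' (euler C z) i j)"
      by (rule euler_pmm[OF hol(3,1) open_punctured]) (use z in simp)
    show "mat_eq n (\<lambda>i j. \<tau> * euler (pmm n C' C) z i j + mm n (ev (pmm n C' C) z) (ev A z) i j)
        (mm n (ev A'' z) (ev (pmm n C' C) z))"
      unfolding mat_eq_def ev_pmm
    proof (intro allI impI)
      fix i j assume ij: "i < n" "j < n"
      have "\<tau> * euler (pmm n C' C) z i j + mm n (mm n ?C' ?C) (ev A z) i j
        = mm n (\<lambda>i j. \<tau> * euler C' z i j) ?C i j + mm n ?C' (\<lambda>i j. \<tau> * euler C z i j + mm n ?C (ev A z) i j) i j"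
        using eu ij unfolding mat_eq_def mm_assoc
        by (simp add: mm_def distrib_left sum.distrib sum_distrib_left mult_ac)
      also have "mm n ?C' (\<lambda>i j. \<tau> * euler C z i j + mm n ?C (ev A z) i j) i j = mm n ?C' (mm n (ev A' z) ?C) i j"
        using mm_cong[OF mat_eq_refl e1] ij by (simp add: mat_eq_def)
      also have "\<dots> = mm n (mm n ?C' (ev A' z)) ?C i j" by (simp add: mm_assoc)
      also have "mm n (\<lambda>i j. \<tau> * euler C' z i j) ?C i j + \<dots>
         = mm n (\<lambda>i j. \<tau> * euler C' z i j + mm n ?C' (ev A' z) i j) ?C i j"
        unfolding mm_def[of n "\<lambda>i j. \<tau> * euler C' z i j"] mm_def[of n "mm n ?C' (ev A' z)"]
          mm_def[of n "\<lambda>i j. \<tau> * euler C' z i j + mm n ?C' (ev A' z) i j"]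
        by (simp add: distrib_right sum.distrib)
      also have "\<dots> = mm n (mm n (ev A'' z) ?C') ?C i j"
        using mm_cong[OF e2 mat_eq_refl] ij by (simp add: mat_eq_def)
      finally show "\<tau> * euler (pmm n C' C) z i j + mm n (mm n ?C' ?C) (ev A z) i j = mm n (ev A'' z) (mm n ?C' ?C) i j"
        by (simp add: mm_assoc)
    qed
  qed (intro pmm_hol hol)+
  then show ?thesis unfolding gauge_equiv_def by blast
qed

lemma euler_const: "euler (\<lambda>i j z. P i j) z = (\<lambda>i j. 0)"
  by (simp add: euler_def)

lemma gauge_const:
  assumes "mat_eq n (mm n P Q) idmat" "mat_eq n (mm n Q P) idmat"
  shows "gauge_equiv n \<tau> A (\<lambda>i j z. mm n (mm n P (ev A z)) Q i j)"
proof -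
  have evc: "ev (\<lambda>i j z. X i j) z = X" for X :: "nat \<Rightarrow> nat \<Rightarrow> complex" and z by (simp add: ev_def)
  have "mat_eq n (mm n (mm n (mm n P (ev A z)) Q) P) (mm n P (ev A z))" for z
    unfolding mm_assoc[of n _ Q P]
    by (rule mat_eq_trans[OF mm_cong[OF mat_eq_refl assms(2)] mm_idm_right])
  then have "gauge_by n \<tau> (\<lambda>i j z. P i j) (\<lambda>i j z. Q i j) A (\<lambda>i j z. mm n (mm n P (ev A z)) Q i j)"
    using assms unfolding gauge_by_def evc euler_const ev_def[of "\<lambda>i j z. mm n (mm n P (ev A z)) Q i j"]
    by (auto simp: entries_hol_def intro: mat_eq_sym)
  then show ?thesis unfolding gauge_equiv_def by blast
qed

section \<open>Triangular leading terms\<close>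

text \<open>The exponents of the singularity when the leading matrix is triangular. It is a list
  because a shear acts on the first one.\<close>

definition dlist :: "nat \<Rightarrow> (nat \<Rightarrow> nat \<Rightarrow> complex \<Rightarrow> complex) \<Rightarrow> complex list" where
  "dlist n A = map (\<lambda>i. A i i 0) [0..<n]"

text \<open>The passage to the matrix type for which characteristic polynomials and the Schur
  decomposition are available.\<close>

definition mat0 :: "nat \<Rightarrow> (nat \<Rightarrow> nat \<Rightarrow> complex) \<Rightarrow> complex mat" where
  "mat0 n X = mat n n (\<lambda>(i, j). X i j)"

lemma mat0_mult: "mat0 n X * mat0 n Y = mat0 n (mm n X Y)"
  by (rule eq_matI) (auto simp: mat0_def mm_def scalar_prod_def atLeast0LessThan)

lemma mat0_idm: "mat0 n idmat = 1\<^sub>m n"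
  by (rule eq_matI) (auto simp: mat0_def idmat_def)

lemma mat0_eq_iff: "mat0 n X = mat0 n Y \<longleftrightarrow> mat_eq n X Y"
  by (auto simp: mat0_def mat_eq_def mat_eq_iff)

lemma mat0_carrier: "mat0 n X \<in> carrier_mat n n" by (simp add: mat0_def)

lemma mat0_surj: "Y \<in> carrier_mat n n \<Longrightarrow> mat0 n (\<lambda>i j. Y $$ (i, j)) = Y"
  by (rule eq_matI) (auto simp: mat0_def)

lemma mm_left_right_inverse:
  "mat_eq n (mm n X Y) idmat \<Longrightarrow> mat_eq n (mm n Y X) idmat"
  using mat_mult_left_right_inverse[OF mat0_carrier mat0_carrier, of n X Y]
  by (simp add: mat0_mult mat0_eq_iff flip: mat0_idm)

text \<open>A constant change of basis triangularizes the leading matrix. The order of the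
  eigenvalues on the diagonal can be prescribed, so any exponent can be brought to the
  front.\<close>

lemma gauge_schur:
  assumes A: "entries_hol n A UNIV"
    and es: "char_poly (mat0 n (ev A 0)) = (\<Prod>a\<leftarrow>es. [:- a, 1:])"
  obtains A' where "entries_hol n A' UNIV" "gauge_equiv n \<tau> A A'" "upper n (ev A' 0)" "dlist n A' = es"
proof -
  obtain B P Q where sd: "schur_decomposition (mat0 n (ev A 0)) es = (B, P, Q)" by (cases "schur_decomposition (mat0 n (ev A 0)) es") auto
  from schur_decomposition[OF mat0_carrier es sd]
  have w: "similar_mat_wit (mat0 n (ev A 0)) B P Q" and ut: "upper_triangular B" and dg: "diag_mat B = es" by auto
  note wd = similar_mat_witD2[OF mat0_carrier w]
  define p q b where "p = (\<lambda>i j. P $$ (i, j))" and "q = (\<lambda>i j. Q $$ (i, j))" and "b = (\<lambda>i j. B $$ (i, j))"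
  have pqb: "P = mat0 n p" "Q = mat0 n q" "B = mat0 n b"
    unfolding p_def q_def b_def using wd mat0_surj by metis+
  have pq: "mat_eq n (mm n p q) idmat" "mat_eq n (mm n q p) idmat"
    and a: "mat_eq n (ev A 0) (mm n (mm n p b) q)"
    using wd(1-3) by (simp_all add: pqb mat0_mult mat0_eq_iff flip: mat0_idm)
  \<comment> \<open>The decomposition reads \<open>A(0) = p b q\<close> with \<open>q\<close>
    inverse to \<open>p\<close>, so the new basis is given by \<open>q\<close>.\<close>
  define A' where "A' = (\<lambda>i j z. mm n (mm n q (ev A z)) p i j)"
  have 1: "mat_eq n (mm n (mm n q (ev A 0)) p) (mm n (mm n q (mm n (mm n p b) q)) p)"
    by (intro mm_cong a mat_eq_refl)
  have 2: "mm n (mm n q (mm n (mm n p b) q)) p = mm n (mm n (mm n q p) b) (mm n q p)" by (simp add: mm_assoc)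
  have 3: "mat_eq n (mm n (mm n (mm n q p) b) (mm n q p)) b"
    by (rule mat_eq_trans[OF mm_cong[OF mat_eq_trans[OF mm_cong[OF pq(2) mat_eq_refl] mm_idm_left] pq(2)] mm_idm_right])
  have A'0: "mat_eq n (ev A' 0) b"
    using mat_eq_trans[OF 1[unfolded 2] 3] by (simp add: ev_def A'_def)
  show ?thesis
  proof (rule that[of A'])
    show "entries_hol n A' UNIV"
      using A unfolding A'_def entries_hol_def mm_def ev_def
      by (intro allI impI holomorphic_on_sum holomorphic_on_mult holomorphic_on_const) auto
    show "gauge_equiv n \<tau> A A'" unfolding A'_def by (rule gauge_const[OF pq(2,1)])
    show "upper n (ev A' 0)" using A'0 ut wd(5) by (auto simp: upper_def mat_eq_def b_def upper_triangular_def)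
    show "dlist n A' = es"
      using A'0 wd(5) unfolding dg[symmetric] diag_mat_def dlist_def by (auto simp: mat_eq_def b_def ev_def)
  qed
qed

lemma char_poly_upper:
  assumes "upper n (ev A 0)"
  shows "char_poly (mat0 n (ev A 0)) = (\<Prod>a\<leftarrow>dlist n A. [:- a, 1:])"
proof -
  have "upper_triangular (mat0 n (ev A 0))" using assms by (auto simp: upper_def mat0_def)
  moreover have "diag_mat (mat0 n (ev A 0)) = dlist n A"
    by (auto simp: diag_mat_def mat0_def dlist_def ev_def)
  ultimately show ?thesis using char_poly_upper_triangular[OF mat0_carrier] by metis
qed

text \<open>Multiplying \<open>e\<^sub>0\<close> by \<open>z\<close> moves its exponent by \<open>\<tau>\<close>; as the other basis vectors span an invariant
  subspace at \<open>z = 0\<close>, the new connection matrix is again holomorphic, and it is triangular if the new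
  vector is put last.\<close>

lemma gauge_shear:
  assumes A: "entries_hol n A UNIV" and up: "upper n (ev A 0)" and n: "n > 0"
  obtains A' where "entries_hol n A' UNIV" "gauge_equiv n \<tau> A A'" "upper n (ev A' 0)"
    "dlist n A' = tl (dlist n A) @ [hd (dlist n A) + \<tau>]"
proof -
  obtain m where m: "n = Suc m" using n by (cases n) auto
  \<comment> \<open>Division by \<open>z\<close> of a function vanishing at 0, with the derivative
    as value at the removable singularity.\<close>
  define dv where "dv = (\<lambda>f z. if z = 0 then deriv f 0 else f z / z :: complex)"
  have dv_hol: "dv f holomorphic_on UNIV" if "f holomorphic_on UNIV" "f 0 = 0" for f
    by (rule holomorphic_transform[OF pole_lemma_open[OF that(1) open_UNIV, of 0]]) (simp add: dv_def that(2))
  \<comment> \<open>The matrix in the basis \<open>e_1, ..., e_m, z e_0\<close>. Only the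
    coefficients of \<open>e_0\<close> in the other rows are divided by \<open>z\<close>, and they
    vanish at 0 by triangularity; the last row is multiplied by \<open>z\<close>, apart from its
    diagonal entry, which gains \<tau> from the Leibniz rule.\<close>
  define A' where "A' = (\<lambda>i j. if i < m then (if j < m then A (Suc i) (Suc j) else dv (A (Suc i) 0))
     else (if j < m then (\<lambda>z. z * A 0 (Suc j) z) else (\<lambda>z. \<tau> + A 0 0 z)))"
  define C where "C = (\<lambda>i j. if i < m then (if j = Suc i then (\<lambda>z. 1) else (\<lambda>z. 0)) else (if j = 0 then (\<lambda>z. z) else (\<lambda>z. 0 :: complex)))"
  define D where "D = (\<lambda>i j. if i = 0 then (if j = m then inverse else (\<lambda>z. 0)) else (if Suc j = i then (\<lambda>z. 1) else (\<lambda>z. 0 :: complex)))"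
  have A0: "A i j 0 = 0" if "i < n" "j < i" for i j using up that by (simp add: upper_def ev_def)
  have hA': "entries_hol n A' UNIV"
    unfolding entries_hol_def
  proof (intro allI impI)
    fix i j assume ij: "i < n" "j < n"
    have h: "A i j holomorphic_on UNIV" if "i < n" "j < n" for i j using A that by (simp add: entries_hol_def)
    show "A' i j holomorphic_on UNIV"
      using ij unfolding A'_def m
      by (auto intro!: dv_hol h A0 holomorphic_intros simp: m)
  qed
  have Cleft: "mm n (ev C z) X i j = (if i < m then X (Suc i) j else z * X 0 j)" if "i < n" for X i j z
  proof (cases "i < m")
    case True
    have "(\<Sum>k<n. C i k z * X k j) = (\<Sum>k\<in>{Suc i}. C i k z * X k j)"
      by (rule sum.mono_neutral_right) (use True m in \<open>auto simp: C_def\<close>)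
    then show ?thesis using True by (simp add: mm_def ev_def C_def)
  next
    case False
    have "(\<Sum>k<n. C i k z * X k j) = (\<Sum>k\<in>{0}. C i k z * X k j)"
      by (rule sum.mono_neutral_right) (use False m in \<open>auto simp: C_def\<close>)
    then show ?thesis using False by (simp add: mm_def ev_def C_def)
  qed
  have Cright: "mm n X (ev C z) i j = (case j of 0 \<Rightarrow> X i m * z | Suc j' \<Rightarrow> X i j')" if "j < n" for X i j z
  proof (cases j)
    case 0
    have "(\<Sum>k<n. X i k * C k j z) = (\<Sum>k\<in>{m}. X i k * C k j z)"
      by (rule sum.mono_neutral_right) (use 0 m in \<open>auto simp: C_def\<close>)
    then show ?thesis using 0 by (simp add: mm_def ev_def C_def)
  next
    case (Suc j')
    have "(\<Sum>k<n. X i k * C k j z) = (\<Sum>k\<in>{j'}. X i k * C k j z)"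
      by (rule sum.mono_neutral_right) (use Suc m that in \<open>auto simp: C_def\<close>)
    then show ?thesis using Suc that m by (simp add: mm_def ev_def C_def)
  qed
  have "gauge_by n \<tau> C D A A'"
    unfolding gauge_by_def
  proof (intro conjI allI impI)
    show "entries_hol n C (-{0})" unfolding entries_hol_def C_def by (auto intro!: holomorphic_intros)
    show "entries_hol n D (-{0})" unfolding entries_hol_def D_def by (auto intro!: holomorphic_intros)
    fix z :: complex assume z: "z \<noteq> 0"
    show CD: "mat_eq n (mm n (ev C z) (ev D z)) idmat"
      unfolding mat_eq_def
    proof (intro allI impI)
      fix i j assume ij: "i < n" "j < n"
      show "mm n (ev C z) (ev D z) i j = idmat i j"
        unfolding Cleft[OF ij(1)] using z m ij by (auto simp: ev_def D_def idmat_def)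
    qed
    show "mat_eq n (mm n (ev D z) (ev C z)) idmat" by (rule mm_left_right_inverse[OF CD])
    show "mat_eq n (\<lambda>i j. \<tau> * euler C z i j + mm n (ev C z) (ev A z) i j) (mm n (ev A' z) (ev C z))"
      unfolding mat_eq_def
    proof (intro allI impI)
      fix i j assume ij: "i < n" "j < n"
      have e: "euler C z i j = (if i < m then 0 else if j = 0 then z else 0)"
        by (auto simp: euler_def C_def)
      show "\<tau> * euler C z i j + mm n (ev C z) (ev A z) i j = mm n (ev A' z) (ev C z) i j"
        unfolding Cleft[OF ij(1)] Cright[OF ij(2)] e
        using ij z m by (auto simp: ev_def A'_def dv_def algebra_simps split: nat.split)
    qed
  qed
  then have g: "gauge_equiv n \<tau> A A'" unfolding gauge_equiv_def by blast
  show ?thesis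
  proof (rule that[OF hA' g])
    show "upper n (ev A' 0)"
      unfolding upper_def ev_def A'_def using A0 m by auto
    show "dlist n A' = tl (dlist n A) @ [hd (dlist n A) + \<tau>]"
    proof (rule nth_equalityI)
      fix i assume "i < length (dlist n A')"
      then have i: "i < n" by (simp add: dlist_def)
      have "hd (dlist n A) = A 0 0 0" by (simp add: dlist_def m upt_conv_Cons del: upt_Suc)
      then show "dlist n A' ! i = (tl (dlist n A) @ [hd (dlist n A) + \<tau>]) ! i"
        using i m by (auto simp: dlist_def A'_def nth_append nth_tl simp del: upt_Suc)
    qed (simp add: dlist_def m)
  qed
qed

text \<open>Scaling the whole basis by \<open>z^(-K)\<close> lowers every exponent by
  \<open>K \<tau>\<close>. Shears only raise exponents, so all of them are first pushed below the
  strip.\<close>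

lemma gauge_scale:
  fixes K :: nat
  shows "gauge_equiv n \<tau> A (\<lambda>i j z. A i j z - (if i = j then \<tau> * of_nat K else 0))"
proof -
  define C where "C = (\<lambda>(i::nat) j. if i = j then (\<lambda>z. inverse z ^ K) else (\<lambda>z. 0 :: complex))"
  define D where "D = (\<lambda>(i::nat) j. if i = j then (\<lambda>z. z ^ K) else (\<lambda>z. 0 :: complex))"
  define A' where "A' = (\<lambda>(i::nat) j z. A i j z - (if i = j then \<tau> * of_nat K else (0::complex)))"
  have Cleft: "mm n (ev C z) X i j = inverse z ^ K * X i j" if "i < n" for X i j z
  proof -
    have "(\<Sum>k<n. C i k z * X k j) = (\<Sum>k\<in>{i}. C i k z * X k j)"
      by (rule sum.mono_neutral_right) (use that in \<open>auto simp: C_def\<close>)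
    then show ?thesis by (simp add: mm_def ev_def C_def)
  qed
  have Cright: "mm n X (ev C z) i j = X i j * inverse z ^ K" if "j < n" for X i j z
  proof -
    have "(\<Sum>k<n. X i k * C k j z) = (\<Sum>k\<in>{j}. X i k * C k j z)"
      by (rule sum.mono_neutral_right) (use that in \<open>auto simp: C_def\<close>)
    then show ?thesis by (simp add: mm_def ev_def C_def)
  qed
  have "gauge_by n \<tau> C D A A'"
    unfolding gauge_by_def
  proof (intro conjI allI impI)
    show "entries_hol n C (-{0})" unfolding entries_hol_def C_def by (auto intro!: holomorphic_intros)
    show "entries_hol n D (-{0})" unfolding entries_hol_def D_def by (auto intro!: holomorphic_intros)
    fix z :: complex assume z: "z \<noteq> 0"
    show CD: "mat_eq n (mm n (ev C z) (ev D z)) idmat"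
      unfolding mat_eq_def
    proof (intro allI impI)
      fix i j assume ij: "i < n" "j < n"
      show "mm n (ev C z) (ev D z) i j = idmat i j"
        unfolding Cleft[OF ij(1)] using z by (simp add: ev_def D_def idmat_def flip: power_mult_distrib)
    qed
    show "mat_eq n (mm n (ev D z) (ev C z)) idmat" by (rule mm_left_right_inverse[OF CD])
    have d: "z * deriv (\<lambda>z. inverse z ^ K) z = - of_nat K * inverse z ^ K"
    proof -
      have "((\<lambda>z. inverse z ^ K) has_field_derivative (of_nat K * ((- (inverse z * 1 * inverse z)) * inverse z ^ (K - Suc 0)))) (at z)"
        by (intro DERIV_power DERIV_inverse' DERIV_ident z)
      then have "deriv (\<lambda>z. inverse z ^ K) z = of_nat K * ((- (inverse z * 1 * inverse z)) * inverse z ^ (K - Suc 0))"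
        by (rule DERIV_imp_deriv)
      then show ?thesis using z by (cases K) (simp_all add: field_simps)
    qed
    show "mat_eq n (\<lambda>i j. \<tau> * euler C z i j + mm n (ev C z) (ev A z) i j) (mm n (ev A' z) (ev C z))"
      unfolding mat_eq_def
    proof (intro allI impI)
      fix i j assume ij: "i < n" "j < n"
      have e: "euler C z i j = (if i = j then - of_nat K * inverse z ^ K else 0)"
        using d by (auto simp: euler_def C_def)
      show "\<tau> * euler C z i j + mm n (ev C z) (ev A z) i j = mm n (ev A' z) (ev C z) i j"
        unfolding Cleft[OF ij(1)] Cright[OF ij(2)] e
        unfolding ev_def A'_def by (simp add: algebra_simps)
    qed
  qed
  then show ?thesis unfolding gauge_equiv_def A'_def by blast
qed

text \<open>Two numbers of the same strip index do not differ by a nonzero integral multiple of \<open>\<tau>\<close>,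
  which is the non-resonance condition of the Frobenius method.\<close>

definition strip_index :: "complex \<Rightarrow> complex \<Rightarrow> int" where
  "strip_index \<tau> a = \<lfloor>Re (a / \<tau>)\<rfloor>"

lemma strip_index_shift: "\<tau> \<noteq> 0 \<Longrightarrow> strip_index \<tau> (a + \<tau>) = strip_index \<tau> a + 1"
  by (simp add: strip_index_def add_divide_distrib)

lemma strip_index_shift_nat: "\<tau> \<noteq> 0 \<Longrightarrow> strip_index \<tau> (a - \<tau> * of_nat K) = strip_index \<tau> a - int K"
  using floor_diff_of_int[of "Re (a / \<tau>)" "int K"] by (simp add: strip_index_def diff_divide_distrib)

text \<open>As long as some exponent lies below the strip, it is moved to the front by a new
  triangularization and raised by one shear. This lowers the total distance to the strip, on which
  the induction runs.\<close>

lemma gauge_normalize: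
  assumes \<tau>: "\<tau> \<noteq> 0"
  shows "\<lbrakk>entries_hol n A UNIV; upper n (ev A 0); \<forall>a\<in>set (dlist n A). strip_index \<tau> a \<le> 0\<rbrakk> \<Longrightarrow>
    \<exists>A'. entries_hol n A' UNIV \<and> gauge_equiv n \<tau> A A' \<and> upper n (ev A' 0) \<and> (\<forall>a\<in>set (dlist n A'). strip_index \<tau> a = 0)"
proof (induction "sum_list (map (\<lambda>a. nat (- strip_index \<tau> a)) (dlist n A))" arbitrary: A rule: less_induct)
  case less
  show ?case
  proof (cases "\<forall>a\<in>set (dlist n A). strip_index \<tau> a = 0")
    case True
    \<comment> \<open>Scaling by \<open>z^0\<close> gives reflexivity.\<close>
    have "gauge_equiv n \<tau> A (\<lambda>i j z. A i j z - (if i = j then \<tau> * of_nat 0 else 0))" by (rule gauge_scale)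
    then have "gauge_equiv n \<tau> A A" by (simp cong: if_cong)
    then show ?thesis using less True by blast
  next
    case False
    then obtain a where a: "a \<in> set (dlist n A)" "strip_index \<tau> a < 0" using less.prems(3) by force
    \<comment> \<open>The characteristic polynomial depends only on the multiset of exponents, so
      the triangular form may be rebuilt with \<open>a\<close> as first diagonal entry.\<close>
    define es where "es = a # remove1 a (dlist n A)"
    have mset: "mset es = mset (dlist n A)" using a by (simp add: es_def)
    have cp: "char_poly (mat0 n (ev A 0)) = (\<Prod>a\<leftarrow>es. [:- a, 1:])"
      unfolding char_poly_upper[OF less.prems(2)]
      using arg_cong[OF mset, of "\<lambda>M. prod_mset (image_mset (\<lambda>a. [:- a, 1:]) M)"]
      by (simp add: prod_mset_prod_list flip: mset_map)
    obtain A1 where A1: "entries_hol n A1 UNIV" "gauge_equiv n \<tau> A A1" "upper n (ev A1 0)" "dlist n A1 = es"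
      using gauge_schur[OF less.prems(1) cp, of \<tau>] by blast
    have n: "n > 0" using a by (cases n) (auto simp: dlist_def)
    obtain A2 where A2: "entries_hol n A2 UNIV" "gauge_equiv n \<tau> A1 A2" "upper n (ev A2 0)"
      "dlist n A2 = tl (dlist n A1) @ [hd (dlist n A1) + \<tau>]"
      using gauge_shear[OF A1(1,3) n, of \<tau>] by blast
    have d2: "dlist n A2 = remove1 a (dlist n A) @ [a + \<tau>]" using A2(4) A1(4) by (simp add: es_def)
    have "sum_list (map (\<lambda>a. nat (- strip_index \<tau> a)) (dlist n A)) = sum_list (map (\<lambda>a. nat (- strip_index \<tau> a)) es)"
      using arg_cong[OF mset, of "\<lambda>M. sum_mset (image_mset (\<lambda>a. nat (- strip_index \<tau> a)) M)"]
      by (simp add: sum_mset_sum_list flip: mset_map)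
    then have "sum_list (map (\<lambda>a. nat (- strip_index \<tau> a)) (dlist n A2)) < sum_list (map (\<lambda>a. nat (- strip_index \<tau> a)) (dlist n A))"
      unfolding d2 es_def using a(2) by (simp add: strip_index_shift \<tau>)
    moreover have "\<forall>b\<in>set (dlist n A2). strip_index \<tau> b \<le> 0"
      unfolding d2 using less.prems(3) a(2) set_remove1_subset[of a "dlist n A"] by (auto simp: strip_index_shift \<tau>)
    ultimately obtain A' where "entries_hol n A' UNIV" "gauge_equiv n \<tau> A2 A'" "upper n (ev A' 0)" "\<forall>a\<in>set (dlist n A'). strip_index \<tau> a = 0"
      using less.hyps[of A2] A2 by blast
    then show ?thesis using gauge_trans A1(2) A2(2) by blast
  qed
qed

lemma frobenius_ex:
  fixes n :: nat
  assumes "\<tau> \<noteq> 0" "entries_hol n A UNIV" "\<And>i j. i < n \<Longrightarrow> j < n \<Longrightarrow> B i j = A i j 0"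
    and "\<And>m R. m \<ge> 1 \<Longrightarrow> \<exists>X. \<forall>i<n. \<forall>j<n.
      \<tau> * of_nat m * X i j + (\<Sum>k<n. X i k * B k j) - (\<Sum>k<n. B i k * X k j) = R i j"
  shows "\<exists>P. \<forall>i<n. \<forall>j<n. P i j holomorphic_on UNIV \<and> P i j 0 = (if i = j then 1 else 0) \<and>
    (\<forall>z. \<tau> * z * deriv (P i j) z + (\<Sum>k<n. P i k z * A k j z) = (\<Sum>k<n. B i k * P k j z))"
proof -
  have A: "A i j holomorphic_on UNIV" if "i < n" "j < n" for i j using assms(2) that by (simp add: entries_hol_def)
  show ?thesis by (rule frobenius[of \<tau> n A B, OF assms(1) A assms(3,4)]) blast+
qed

text \<open>For normalized exponents all Sylvester operators with factor \<open>\<tau> m\<close>,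
  \<open>m \<ge> 1\<close>, are invertible, so the Frobenius series \<open>P\<close> transforms the
  connection into the constant matrix of its leading term. That \<open>P\<close> is invertible at
  every point is not read off from its determinant: a second series \<open>Q\<close>, solving the
  dual equation, turns out to be its inverse.\<close>

theorem gauge_constant:
  assumes \<tau>: "\<tau> \<noteq> 0" and A: "entries_hol n A UNIV"
  obtains B where "upper n B" "\<And>i. i < n \<Longrightarrow> strip_index \<tau> (B i i) = 0" "gauge_equiv n \<tau> A (\<lambda>i j z. B i j)"
proof -
  obtain es where cp: "char_poly (mat0 n (ev A 0)) = (\<Prod>a\<leftarrow>es. [:- a, 1:])"
    using char_poly_factorized[OF mat0_carrier] by blast
  obtain A1 where A1: "entries_hol n A1 UNIV" "gauge_equiv n \<tau> A A1" "upper n (ev A1 0)" "dlist n A1 = es"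
    using gauge_schur[OF A cp, of \<tau>] by blast
  \<comment> \<open>Any common upper bound of the strip indices serves; the sum of their positive
    parts is one.\<close>
  define K where "K = (\<Sum>a\<leftarrow>dlist n A1. nat (strip_index \<tau> a))"
  define A2 where "A2 = (\<lambda>i j z. A1 i j z - (if i = j then \<tau> * of_nat K else 0))"
  have g2: "gauge_equiv n \<tau> A1 A2" unfolding A2_def by (rule gauge_scale)
  have h2: "entries_hol n A2 UNIV"
    using A1(1) unfolding A2_def entries_hol_def by (auto intro!: holomorphic_intros)
  have u2: "upper n (ev A2 0)" using A1(3) by (auto simp: upper_def ev_def A2_def)
  have "\<forall>a\<in>set (dlist n A2). strip_index \<tau> a \<le> 0"
  proof
    fix a assume "a \<in> set (dlist n A2)"
    then obtain i where i: "i < n" "a = A1 i i 0 - \<tau> * of_nat K" by (auto simp: dlist_def A2_def)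
    have "nat (strip_index \<tau> (A1 i i 0)) \<le> K"
      unfolding K_def by (rule member_le_sum_list) (use i in \<open>auto simp: dlist_def\<close>)
    then show "strip_index \<tau> a \<le> 0" unfolding i(2) strip_index_shift_nat[OF \<tau>] by simp
  qed
  then obtain A3 where A3: "entries_hol n A3 UNIV" "gauge_equiv n \<tau> A2 A3" "upper n (ev A3 0)"
    "\<forall>a\<in>set (dlist n A3). strip_index \<tau> a = 0"
    using gauge_normalize[OF \<tau> h2 u2] by blast
  define B where "B = ev A3 0"
  have diag: "strip_index \<tau> (B i i) = 0" if "i < n" for i
    using A3(4) that by (auto simp: B_def ev_def dlist_def)
  have nz: "\<tau> * of_nat m + B j j - B i i \<noteq> 0" if "m \<ge> 1" "i < n" "j < n" for m i j
  proof
    assume "\<tau> * of_nat m + B j j - B i i = 0"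
    then have "B i i = B j j + \<tau> * of_nat m" by (simp add: algebra_simps)
    then have "strip_index \<tau> (B j j) = strip_index \<tau> (B i i) - int m"
      using strip_index_shift_nat[OF \<tau>, of "B i i" m] by simp
    then show False using diag that by simp
  qed
  have upB: "upper n B" using A3(3) by (simp add: B_def)
  have "\<exists>X. \<forall>i<n. \<forall>j<n. \<tau> * of_nat m * X i j + (\<Sum>k<n. X i k * B k j) - (\<Sum>k<n. B i k * X k j) = R i j"
    if "m \<ge> 1" for m R
    by (rule sylvester_solve[OF upB nz[OF that]])
  then have "\<exists>P. \<forall>i<n. \<forall>j<n. P i j holomorphic_on UNIV \<and> P i j 0 = (if i = j then 1 else 0) \<and>
    (\<forall>z. \<tau> * z * deriv (P i j) z + (\<Sum>k<n. P i k z * A3 k j z) = (\<Sum>k<n. B i k * P k j z))"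
    by (intro frobenius_ex \<tau> A3(1)) (auto simp: B_def ev_def)
  then obtain P where P: "\<And>i j. i < n \<Longrightarrow> j < n \<Longrightarrow> P i j holomorphic_on UNIV"
    "\<And>i j. i < n \<Longrightarrow> j < n \<Longrightarrow> P i j 0 = (if i = j then 1 else 0)"
    "\<And>i j z. i < n \<Longrightarrow> j < n \<Longrightarrow> \<tau> * z * deriv (P i j) z + (\<Sum>k<n. P i k z * A3 k j z) = (\<Sum>k<n. B i k * P k j z)"
    by blast
  \<comment> \<open>The Sylvester equation for minus the transposed matrix is the transpose of the
    previous one, so the same non-resonance solves it. The transposed series will satisfy
    \<open>\<tau> z Q' = A3 Q - Q B\<close>.\<close>
  have "\<exists>X. \<forall>i<n. \<forall>j<n. \<tau> * of_nat m * X i j + (\<Sum>k<n. X i k * (- B j k)) - (\<Sum>k<n. (- B k i) * X k j) = R i j"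
    if m1: "m \<ge> 1" for m R
  proof -
    obtain X where X: "\<forall>i<n. \<forall>j<n. \<tau> * of_nat m * X i j + (\<Sum>k<n. X i k * B k j) - (\<Sum>k<n. B i k * X k j) = R j i"
      using sylvester_solve[OF upB nz[OF m1], of "\<lambda>i j. R j i"] by blast
    show ?thesis
      by (rule exI[of _ "\<lambda>i j. X j i"]) (use X in \<open>simp add: sum_negf mult.commute algebra_simps\<close>)
  qed
  then have "\<exists>P. \<forall>i<n. \<forall>j<n. P i j holomorphic_on UNIV \<and> P i j 0 = (if i = j then 1 else 0) \<and>
    (\<forall>z. \<tau> * z * deriv (P i j) z + (\<Sum>k<n. P i k z * (- A3 j k z)) = (\<Sum>k<n. (- B k i) * P k j z))"
    by (intro frobenius_ex[of \<tau> n "\<lambda>i j z. - A3 j i z" "\<lambda>i j. - B j i"] \<tau>)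
      (use A3(1) in \<open>auto simp: entries_hol_def B_def ev_def holomorphic_on_minus\<close>)
  then obtain Q' where Q': "\<And>i j. i < n \<Longrightarrow> j < n \<Longrightarrow> Q' i j holomorphic_on UNIV"
    "\<And>i j. i < n \<Longrightarrow> j < n \<Longrightarrow> Q' i j 0 = (if i = j then 1 else 0)"
    "\<And>i j z. i < n \<Longrightarrow> j < n \<Longrightarrow> \<tau> * z * deriv (Q' i j) z + (\<Sum>k<n. Q' i k z * (- A3 j k z)) = (\<Sum>k<n. (- B k i) * Q' k j z)"
    by blast
  define Q where "Q = (\<lambda>i j. Q' j i)"
  have hP: "entries_hol n P UNIV" and hQ: "entries_hol n Q UNIV" using P(1) Q'(1) by (auto simp: entries_hol_def Q_def)
  have eP: "mat_eq n (\<lambda>i j. \<tau> * euler P z i j) (\<lambda>i j. mm n B (ev P z) i j - mm n (ev P z) (ev A3 z) i j)" for z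
    unfolding mat_eq_def
  proof (intro allI impI)
    fix i j assume "i < n" "j < n"
    then show "\<tau> * euler P z i j = mm n B (ev P z) i j - mm n (ev P z) (ev A3 z) i j"
      using P(3)[of i j z] by (simp add: euler_def mm_def ev_def eq_diff_eq mult_ac)
  qed
  have eQ: "mat_eq n (\<lambda>i j. \<tau> * euler Q z i j) (\<lambda>i j. mm n (ev A3 z) (ev Q z) i j - mm n (ev Q z) B i j)" for z
    unfolding mat_eq_def
  proof (intro allI impI)
    fix i j assume "i < n" "j < n"
    then show "\<tau> * euler Q z i j = mm n (ev A3 z) (ev Q z) i j - mm n (ev Q z) B i j"
      using Q'(3)[of j i z] by (simp add: euler_def mm_def ev_def Q_def sum_negf algebra_simps mult_ac)
  qed
  \<comment> \<open>In the derivative of the product \<open>P Q\<close> the terms with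
    \<open>A3\<close> cancel, leaving \<open>\<tau> z W' = B W - W B\<close>. Its Taylor
    coefficients solve homogeneous Sylvester equations, so all but the constant one vanish and
    \<open>W\<close> equals its value at 0, the identity.\<close>
  define W where "W = pmm n P Q"
  have hW: "entries_hol n W UNIV" unfolding W_def by (rule pmm_hol[OF hP hQ])
  have eW: "\<tau> * euler W z i j = mm n B (ev W z) i j - mm n (ev W z) B i j" if ij: "i < n" "j < n" for i j z
  proof -
    have "\<tau> * euler W z i j = \<tau> * (mm n (euler P z) (ev Q z) i j + mm n (ev P z) (euler Q z) i j)"
      using euler_pmm[OF hP hQ open_UNIV, of z] ij by (simp add: W_def mat_eq_def)
    also have "\<dots> = mm n (\<lambda>i j. \<tau> * euler P z i j) (ev Q z) i j + mm n (ev P z) (\<lambda>i j. \<tau> * euler Q z i j) i j"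
      by (simp add: mm_def sum_distrib_left distrib_left mult_ac)
    also have "mm n (\<lambda>i j. \<tau> * euler P z i j) (ev Q z) i j = mm n (\<lambda>i j. mm n B (ev P z) i j - mm n (ev P z) (ev A3 z) i j) (ev Q z) i j"
      using mm_cong[OF eP mat_eq_refl] ij by (simp add: mat_eq_def)
    also have "\<dots> = mm n (mm n B (ev P z)) (ev Q z) i j - mm n (mm n (ev P z) (ev A3 z)) (ev Q z) i j"
      unfolding mm_def[of n _ "ev Q z"] by (simp add: left_diff_distrib sum_subtractf)
    also have "mm n (ev P z) (\<lambda>i j. \<tau> * euler Q z i j) i j = mm n (ev P z) (\<lambda>i j. mm n (ev A3 z) (ev Q z) i j - mm n (ev Q z) B i j) i j"
      using mm_cong[OF mat_eq_refl eQ] ij by (simp add: mat_eq_def)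
    also have "\<dots> = mm n (ev P z) (mm n (ev A3 z) (ev Q z)) i j - mm n (ev P z) (mm n (ev Q z) B) i j"
      unfolding mm_def[of n "ev P z"] by (simp add: right_diff_distrib sum_subtractf)
    finally show ?thesis by (simp add: W_def ev_pmm mm_assoc)
  qed
  define w where "w = (\<lambda>m i j. (deriv ^^ m) (W i j) 0 / fact m)"
  have pW: "pw (W i j) (\<lambda>m. w m i j)" if "i < n" "j < n" for i j
    unfolding w_def by (rule pw_entire) (use hW that in \<open>simp add: entries_hol_def\<close>)
  have rel: "\<tau> * of_nat m * w m i j + (\<Sum>k<n. w m i k * B k j) - (\<Sum>k<n. B i k * w m k j) = 0" if ij: "i < n" "j < n" for m i j
  proof -
    have 1: "pw (\<lambda>z. \<tau> * (z * deriv (W i j) z)) (\<lambda>m. \<tau> * (of_nat m * w m i j))"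
      by (intro pw_cmult pw_euler pW ij)
    have 2: "pw (\<lambda>z. (\<Sum>k<n. B i k * W k j z) + (\<Sum>k<n. (- B k j) * W i k z)) (\<lambda>m. (\<Sum>k<n. B i k * w m k j) + (\<Sum>k<n. (- B k j) * w m i k))"
      by (intro pw_add pw_sum pw_cmult pW) (use ij in auto)
    have "(\<lambda>z. \<tau> * (z * deriv (W i j) z)) = (\<lambda>z. (\<Sum>k<n. B i k * W k j z) + (\<Sum>k<n. (- B k j) * W i k z))"
      using eW[OF ij] by (simp add: euler_def mm_def ev_def sum_negf mult.commute)
    from fun_cong[OF pw_unique[OF 1[unfolded this] 2], of m] show ?thesis
      by (simp add: sum_negf algebra_simps)
  qed
  have wz: "w m i j = 0" if "m \<ge> 1" "i < n" "j < n" for m i j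
    by (rule sylvester_unique[OF upB upB nz[OF that(1)] rel that(2,3)]) auto
  have W1: "W i j z = (if i = j then 1 else 0)" if ij: "i < n" "j < n" for i j z
  proof -
    have "(\<lambda>m. w m i j * z ^ m) sums w 0 i j"
      using sums_finite[of "{0}" "\<lambda>m. w m i j * z ^ m"] wz ij by auto
    then have "W i j z = w 0 i j" using pW[OF ij] sums_unique2 unfolding pw_def by blast
    also have "\<dots> = W i j 0" using pw_at_0[OF pW[OF ij]] by simp
    also have "\<dots> = (\<Sum>k<n. (if i = k then 1 else 0) * (if j = k then 1 else 0))"
      using ij by (simp add: W_def pmm_def Q_def P(2) Q'(2))
    also have "\<dots> = (if i = j then 1 else 0)"
      using ij by (subst sum.remove[of _ i]) auto
    finally show ?thesis .
  qed
  have PQ: "mat_eq n (mm n (ev P z) (ev Q z)) idmat" for z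
    using W1 by (simp add: mat_eq_def idmat_def W_def flip: ev_pmm) (simp add: ev_def)
  have "gauge_by n \<tau> P Q A3 (\<lambda>i j z. B i j)"
    unfolding gauge_by_def
  proof (intro conjI allI impI)
    show "entries_hol n P (-{0})" "entries_hol n Q (-{0})"
      using hP hQ holomorphic_on_subset unfolding entries_hol_def by blast+
    fix z :: complex
    show "mat_eq n (mm n (ev P z) (ev Q z)) idmat" by (rule PQ)
    then show "mat_eq n (mm n (ev Q z) (ev P z)) idmat" by (rule mm_left_right_inverse)
    show "mat_eq n (\<lambda>i j. \<tau> * euler P z i j + mm n (ev P z) (ev A3 z) i j) (mm n (ev (\<lambda>i j z. B i j) z) (ev P z))"
      using eP[of z] by (simp add: mat_eq_def ev_def)
  qed
  then have "gauge_equiv n \<tau> A3 (\<lambda>i j z. B i j)" unfolding gauge_equiv_def by blast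
  then show ?thesis using that[OF upB diag] gauge_trans A1(2) g2 A3(2) by blast
qed

section \<open>Rank normal form\<close>

text \<open>A right inverse suffices here, as it is two-sided by
  \<open>mm_left_right_inverse\<close>.\<close>

definition inv_mat :: "nat \<Rightarrow> (nat \<Rightarrow> nat \<Rightarrow> complex) \<Rightarrow> bool" where
  "inv_mat n P \<longleftrightarrow> (\<exists>P'. mat_eq n (mm n P P') idmat)"

lemma inv_mat_mm:
  assumes "inv_mat n P" "inv_mat n Q" shows "inv_mat n (mm n P Q)"
proof -
  obtain P' Q' where PQ: "mat_eq n (mm n P P') idmat" "mat_eq n (mm n Q Q') idmat"
    using assms unfolding inv_mat_def by blast
  have "mm n (mm n P Q) (mm n Q' P') = mm n P (mm n (mm n Q Q') P')" by (simp add: mm_assoc)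
  moreover have "mat_eq n (mm n P (mm n (mm n Q Q') P')) (mm n P P')"
    by (intro mm_cong mat_eq_refl mat_eq_trans[OF mm_cong[OF PQ(2) mat_eq_refl] mm_idm_left])
  ultimately have "mat_eq n (mm n (mm n P Q) (mm n Q' P')) idmat"
    using mat_eq_trans[OF _ PQ(1)] by simp
  then show ?thesis unfolding inv_mat_def by blast
qed

lemma inv_mat_idmat: "inv_mat n idmat"
  unfolding inv_mat_def using mm_idm_left by blast

lemma inv_mat_transpose:
  assumes "inv_mat n P" shows "inv_mat n (\<lambda>i j. P j i)"
proof -
  obtain P' where "mat_eq n (mm n P P') idmat" using assms unfolding inv_mat_def by blast
  then have "mat_eq n (mm n P' P) idmat" by (rule mm_left_right_inverse)
  then have "mat_eq n (mm n (\<lambda>i j. P j i) (\<lambda>i j. P' j i)) idmat"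
    by (auto simp: mat_eq_def mm_def idmat_def mult.commute)
  then show ?thesis unfolding inv_mat_def by blast
qed

lemma inv_mat_swap:
  assumes "a < n" "b < n"
  shows "inv_mat n (\<lambda>i j. if j = Transposition.transpose a b i then 1 else 0)"
proof -
  let ?t = "Transposition.transpose a b"
  have t: "?t i < n" if "i < n" for i using assms that by (simp add: Transposition.transpose_def)
  have "(\<Sum>k<n. (if k = ?t i then 1 else 0) * (if j = ?t k then 1 else 0)) = (if i = j then 1 else (0::complex))"
    if "i < n" "j < n" for i j
    using t[OF that(1)] by (subst sum.remove[of _ "?t i"]) auto
  then have "mat_eq n (mm n (\<lambda>i j. if j = ?t i then 1 else 0) (\<lambda>i j. if j = ?t i then 1 else 0)) idmat"
    by (simp add: mat_eq_def mm_def idmat_def)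
  then show ?thesis unfolding inv_mat_def by blast
qed

text \<open>The matrix is the identity minus a column vector \<open>v\<close> times the
  \<open>r\<close>-th unit row. Its inverse has the same shape, with vector
  \<open>- v / (1 - v r)\<close> as in the Sherman-Morrison formula.\<close>

lemma inv_mat_rowop:
  assumes r: "r < n" and v: "v r \<noteq> 1"
  shows "inv_mat n (\<lambda>i j. (if i = j then 1 else 0) - (if j = r then v i else 0))"
proof -
  define u where "u = (\<lambda>i. - v i / (1 - v r))"
  have vu: "v i + u i = v i * u r" for i using v by (simp add: u_def divide_simps) (simp add: algebra_simps)
  have "(\<Sum>k<n. ((if i = k then 1 else 0) - (if k = r then v i else 0)) * ((if k = j then 1 else 0) - (if j = r then u k else 0)))
      = (if i = j then 1 else 0)" if "i < n" "j < n" for i j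
  proof -
    have "(\<Sum>k<n. ((if i = k then 1 else 0) - (if k = r then v i else 0)) * ((if k = j then 1 else 0) - (if j = r then u k else 0)))
      = (\<Sum>k<n. if i = k then (if k = j then 1 else 0) - (if j = r then u k else 0) else 0)
        - (\<Sum>k<n. if k = r then v i * ((if k = j then 1 else 0) - (if j = r then u k else 0)) else 0)"
      unfolding sum_subtractf[symmetric] by (intro sum.cong refl) (auto simp: algebra_simps)
    also have "\<dots> = ((if i = j then 1 else 0) - (if j = r then u i else 0)) - v i * ((if r = j then 1 else 0) - (if j = r then u r else 0))"
      using that r by (simp add: sum.delta)
    also have "\<dots> = (if i = j then 1 else 0)" using vu[of i] by (auto simp: algebra_simps)
    finally show ?thesis .
  qed
  then have "mat_eq n (mm n (\<lambda>i j. (if i = j then 1 else 0) - (if j = r then v i else 0)) (\<lambda>i j. (if i = j then 1 else 0) - (if j = r then u i else 0))) idmat"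
    by (simp add: mat_eq_def mm_def idmat_def)
  then show ?thesis unfolding inv_mat_def by blast
qed

definition mequiv :: "nat \<Rightarrow> nat \<Rightarrow> (nat \<Rightarrow> nat \<Rightarrow> complex) \<Rightarrow> (nat \<Rightarrow> nat \<Rightarrow> complex) \<Rightarrow> bool" where
  "mequiv n m G H \<longleftrightarrow> (\<exists>P Q. inv_mat n P \<and> inv_mat m Q \<and>
     (\<forall>i<n. \<forall>j<m. H i j = (\<Sum>k<n. \<Sum>l<m. P i k * G k l * Q l j)))"

lemma mequiv_row:
  assumes "mequiv n m G H" "inv_mat n E" "\<And>i j. i < n \<Longrightarrow> j < m \<Longrightarrow> H' i j = (\<Sum>k<n. E i k * H k j)"
  shows "mequiv n m G H'"
proof -
  obtain P Q where PQ: "inv_mat n P" "inv_mat m Q" "\<forall>i<n. \<forall>j<m. H i j = (\<Sum>k<n. \<Sum>l<m. P i k * G k l * Q l j)"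
    using assms(1) unfolding mequiv_def by blast
  have "H' i j = (\<Sum>k<n. \<Sum>l<m. mm n E P i k * G k l * Q l j)" if "i < n" "j < m" for i j
  proof -
    have "H' i j = (\<Sum>k'<n. \<Sum>k<n. E i k' * P k' k * (\<Sum>l<m. G k l * Q l j))"
      using that PQ(3) by (simp add: assms(3) sum_distrib_left mult.assoc)
    also have "\<dots> = (\<Sum>k<n. \<Sum>k'<n. E i k' * P k' k * (\<Sum>l<m. G k l * Q l j))" by (rule sum.swap)
    also have "\<dots> = (\<Sum>k<n. mm n E P i k * (\<Sum>l<m. G k l * Q l j))" by (simp add: mm_def sum_distrib_right)
    finally show ?thesis by (simp add: sum_distrib_left mult.assoc)
  qed
  then show ?thesis unfolding mequiv_def using inv_mat_mm[OF assms(2) PQ(1)] PQ(2) by blast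
qed

lemma mequiv_col:
  assumes "mequiv n m G H" "inv_mat m E" "\<And>i j. i < n \<Longrightarrow> j < m \<Longrightarrow> H' i j = (\<Sum>l<m. H i l * E l j)"
  shows "mequiv n m G H'"
proof -
  obtain P Q where PQ: "inv_mat n P" "inv_mat m Q" "\<forall>i<n. \<forall>j<m. H i j = (\<Sum>k<n. \<Sum>l<m. P i k * G k l * Q l j)"
    using assms(1) unfolding mequiv_def by blast
  have "H' i j = (\<Sum>k<n. \<Sum>l<m. P i k * G k l * mm m Q E l j)" if "i < n" "j < m" for i j
  proof -
    have "H' i j = (\<Sum>l'<m. \<Sum>k<n. \<Sum>l<m. P i k * G k l * (Q l l' * E l' j))"
      using that PQ(3) by (simp add: assms(3) sum_distrib_right mult.assoc)
    also have "\<dots> = (\<Sum>k<n. \<Sum>l'<m. \<Sum>l<m. P i k * G k l * (Q l l' * E l' j))" by (rule sum.swap)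
    also have "\<dots> = (\<Sum>k<n. \<Sum>l<m. \<Sum>l'<m. P i k * G k l * (Q l l' * E l' j))"
      by (intro sum.cong refl sum.swap)
    finally show ?thesis by (simp add: mm_def sum_distrib_left)
  qed
  then show ?thesis unfolding mequiv_def using inv_mat_mm[OF PQ(2) assms(2)] PQ(1) by blast
qed

lemma mequiv_refl: "mequiv n m G G"
proof -
  have "(\<Sum>k<n. \<Sum>l<m. idmat i k * G k l * idmat l j) = G i j" if "i < n" "j < m" for i j
  proof -
    have "(\<Sum>k<n. \<Sum>l<m. idmat i k * G k l * idmat l j) = (\<Sum>k<n. idmat i k * (\<Sum>l<m. G k l * idmat l j))"
      by (simp add: sum_distrib_left mult.assoc)
    also have "\<dots> = (\<Sum>l<m. G i l * idmat l j)"
      using that by (subst sum.remove[of _ i]) (auto simp: idmat_def)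
    also have "\<dots> = G i j" using that by (subst sum.remove[of _ j]) (auto simp: idmat_def)
    finally show ?thesis .
  qed
  then show ?thesis unfolding mequiv_def by (intro exI[of _ idmat]) (simp add: inv_mat_idmat)
qed

text \<open>The invariant of the elimination; the block of rows and columns from \<open>r\<close> on
  is left free.\<close>

definition normal_upto :: "nat \<Rightarrow> nat \<Rightarrow> nat \<Rightarrow> (nat \<Rightarrow> nat \<Rightarrow> complex) \<Rightarrow> bool" where
  "normal_upto n m r H \<longleftrightarrow> (\<forall>i<n. \<forall>j<m. i < r \<or> j < r \<longrightarrow> H i j = (if i = j then 1 else 0))"

text \<open>Gaussian elimination with full pivoting: the nonzero entry is swapped to position
  \<open>(r, r)\<close>, one row operation normalizes it and clears its column, and one column
  operation clears its row.\<close>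

lemma rank_step:
  assumes G: "mequiv n m G H" and S: "normal_upto n m r H"
    and pq: "r \<le> p" "p < n" "r \<le> q" "q < m" "H p q \<noteq> 0"
  shows "\<exists>H'. mequiv n m G H' \<and> normal_upto n m (Suc r) H'"
proof -
  have r: "r < n" "r < m" using pq by auto
  let ?s = "Transposition.transpose r p" and ?t = "Transposition.transpose r q"
  have st: "?s i < n" "?t j < m" if "i < n" "j < m" for i j
    using r pq that by (auto simp: Transposition.transpose_def)
  have S: "H i j = (if i = j then 1 else 0)" if "i < n" "j < m" "i < r \<or> j < r" for i j
    by (rule S[unfolded normal_upto_def, rule_format, OF that])
  define H0 where "H0 = (\<lambda>i j. H (?s i) j)"
  have G0: "mequiv n m G H0"
    by (rule mequiv_row[OF G inv_mat_swap[OF r(1) pq(2)]]) (use st in \<open>simp add: H0_def if_distrib[of "\<lambda>x. x * _"] sum.delta cong: if_cong\<close>)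
  define H1 where "H1 = (\<lambda>i j. H0 i (?t j))"
  have G1: "mequiv n m G H1"
  proof (rule mequiv_col[OF G0 inv_mat_transpose[OF inv_mat_swap[OF r(2) pq(4)]]])
    fix i j assume "i < n" "j < m"
    then show "H1 i j = (\<Sum>l<m. H0 i l * (if l = ?t j then 1 else 0))"
      using st[of i j] by (simp add: H1_def if_distrib[of "\<lambda>x. _ * x"] sum.delta cong: if_cong)
  qed
  define h where "h = H1 r r"
  have h: "h \<noteq> 0" using pq(5) by (simp add: h_def H1_def H0_def)
  have S1: "H1 i j = (if i = j then 1 else 0)" if "i < n" "j < m" "i < r \<or> j < r" for i j
  proof -
    have "?s i < r \<longleftrightarrow> i < r" "?t j < r \<longleftrightarrow> j < r" "i < r \<Longrightarrow> ?s i = i" "j < r \<Longrightarrow> ?t j = j"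
      using pq by (auto simp: Transposition.transpose_def)
    then show ?thesis using that S[of "?s i" "?t j"] st[OF that(1,2)] unfolding H1_def H0_def by auto
  qed
  \<comment> \<open>Both tasks of the row operation in one vector: the value at \<open>r\<close>
    divides the pivot row by \<open>h\<close>, and the other values clear the pivot column.\<close>
  define v where "v = (\<lambda>i. if i = r then 1 - 1 / h else H1 i r / h)"
  define H2 where "H2 = (\<lambda>i j. H1 i j - v i * H1 r j)"
  have "v r \<noteq> 1" using h by (simp add: v_def)
  have G2: "mequiv n m G H2"
  proof (rule mequiv_row[OF G1 inv_mat_rowop[of r n v, OF r(1) \<open>v r \<noteq> 1\<close>]])
    fix i j assume "i < n" "j < m"
    then show "H2 i j = (\<Sum>k<n. ((if i = k then 1 else 0) - (if k = r then v i else 0)) * H1 k j)"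
      using r by (simp add: H2_def left_diff_distrib sum_subtractf if_distrib[of "\<lambda>x. x * _"] sum.delta cong: if_cong)
  qed
  have S2: "H2 i j = (if i = j then 1 else 0)" if "i < n" "j < m" "i < r \<or> j < r \<or> j = r" for i j
  proof (cases "j < r")
    case True
    then show ?thesis using S1[of r j] S1[of i j] that r by (simp add: H2_def)
  next
    case False
    show ?thesis
    proof (cases "i < r")
      case True
      then show ?thesis using S1[of i r] S1[of i j] that r by (simp add: H2_def v_def)
    next
      case f2: False
      then have "j = r" using False that by simp
      then show ?thesis using h by (simp add: H2_def v_def flip: h_def) (simp add: algebra_simps)
    qed
  qed
  define w where "w = (\<lambda>j. if j = r then 0 else H2 r j)"
  define H3 where "H3 = (\<lambda>i j. H2 i j - H2 i r * w j)"
  have "w r \<noteq> 1" by (simp add: w_def)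
  have G3: "mequiv n m G H3"
  proof (rule mequiv_col[OF G2 inv_mat_transpose[OF inv_mat_rowop[of r m w, OF r(2) \<open>w r \<noteq> 1\<close>]]])
    fix i j assume "i < n" "j < m"
    then show "H3 i j = (\<Sum>l<m. H2 i l * ((if j = l then 1 else 0) - (if l = r then w j else 0)))"
      using r by (simp add: H3_def right_diff_distrib sum_subtractf if_distrib[of "\<lambda>x. _ * x"] sum.delta cong: if_cong)
  qed
  have "H3 i j = (if i = j then 1 else 0)" if ij: "i < n" "j < m" "i < Suc r \<or> j < Suc r" for i j
  proof -
    have H2r: "H2 i r = (if i = r then 1 else 0)" using S2[of i r] ij r by simp
    have wr: "j \<le> r \<Longrightarrow> w j = 0" using S2[of r j] ij r by (auto simp: w_def)
    consider "j \<le> r" | "i < r" "r < j" | "i = r" "r < j" using ij(3) by atomize_elim auto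
    then show ?thesis
    proof cases
      case 1
      then have "j < r \<or> j = r" by linarith
      then show ?thesis using S2[of i j] ij(1,2) wr[OF 1] by (simp add: H3_def)
    next
      case 2
      then show ?thesis using S2[of i j] ij H2r by (simp add: H3_def)
    next
      case 3
      then show ?thesis using H2r by (simp add: H3_def w_def)
    qed
  qed
  then show ?thesis using G3 unfolding normal_upto_def by blast
qed

text \<open>Take the largest \<open>r\<close> that the elimination can reach; a nonzero entry in the
  remaining block would allow one more step.\<close>

lemma rank_normal_form:
  "\<exists>r P Q. r \<le> n \<and> r \<le> m \<and> inv_mat n P \<and> inv_mat m Q \<and>
     (\<forall>i<n. \<forall>j<m. (\<Sum>k<n. \<Sum>l<m. P i k * G k l * Q l j) = (if i = j \<and> i < r then 1 else 0))"
proof -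
  define good where "good = (\<lambda>r. r \<le> n \<and> r \<le> m \<and> (\<exists>H. mequiv n m G H \<and> normal_upto n m r H))"
  have "good 0" unfolding good_def normal_upto_def using mequiv_refl by auto
  moreover have "\<forall>r. good r \<longrightarrow> r \<le> n" by (simp add: good_def)
  ultimately obtain r where r: "good r" and max: "\<And>r'. good r' \<Longrightarrow> r' \<le> r"
    using Nat.ex_has_greatest_nat[of good 0 n] by blast
  then obtain H where H: "r \<le> n" "r \<le> m" "mequiv n m G H" "normal_upto n m r H" unfolding good_def by blast
  have zero: "H p q = 0" if "r \<le> p" "p < n" "r \<le> q" "q < m" for p q
  proof (rule ccontr)
    assume "H p q \<noteq> 0"
    from rank_step[OF H(3,4) that this] have "good (Suc r)" unfolding good_def using that by auto
    then show False using max by fastforce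
  qed
  obtain P Q where PQ: "inv_mat n P" "inv_mat m Q" "\<forall>i<n. \<forall>j<m. H i j = (\<Sum>k<n. \<Sum>l<m. P i k * G k l * Q l j)"
    using H(3) unfolding mequiv_def by blast
  have "(\<Sum>k<n. \<Sum>l<m. P i k * G k l * Q l j) = (if i = j \<and> i < r then 1 else 0)" if "i < n" "j < m" for i j
  proof (cases "i < r \<or> j < r")
    case True
    then show ?thesis using PQ(3) H(4) that unfolding normal_upto_def by auto
  next
    case False
    then show ?thesis using PQ(3) zero[of i j] that by auto
  qed
  then show ?thesis using H(1,2) PQ(1,2) by blast
qed

section \<open>Free modules over the ring of holomorphic functions\<close>

interpretation hol: cring hol_ring by (rule cring_hol_ring)

lemma hol_finsum_apply:
  assumes "finite A" "f \<in> A \<rightarrow> carrier hol_ring" "z \<noteq> 0"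
  shows "finsum hol_ring f A z = (\<Sum>i\<in>A. f i z)"
  using assms(1,2)
proof (induction A rule: finite_induct)
  case empty
  then show ?case using assms(3) by (simp add: hol_zero hol_const_def)
next
  case (insert a A)
  then have "finsum hol_ring f (insert a A) = f a \<oplus>\<^bsub>hol_ring\<^esub> finsum hol_ring f A"
    by (intro hol.finsum_insert) auto
  then show ?case using insert assms(3) by (simp add: hol_add)
qed

lemma hol_mult_apply: "z \<noteq> 0 \<Longrightarrow> (f \<otimes>\<^bsub>hol_ring\<^esub> g) z = f z * g z"
  and hol_add_apply: "z \<noteq> 0 \<Longrightarrow> (f \<oplus>\<^bsub>hol_ring\<^esub> g) z = f z + g z"
  and hol_const_apply: "z \<noteq> 0 \<Longrightarrow> hol_const c z = c"
  and hol_delta_apply: "z \<noteq> 0 \<Longrightarrow> hol_delta \<tau> f z = \<tau> * z * deriv f z"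
  by (simp_all add: hol_mult hol_add hol_const_def hol_delta_def)

lemma additive_map_zero:
  assumes "abelian_group M" "abelian_group N" "additive_map M N f"
  shows "f \<zero>\<^bsub>M\<^esub> = \<zero>\<^bsub>N\<^esub>"
proof -
  interpret M: abelian_group M by fact
  interpret N: abelian_group N by fact
  have c: "f \<zero>\<^bsub>M\<^esub> \<in> carrier N" using assms(3) by (auto simp: additive_map_def)
  have "f \<zero>\<^bsub>M\<^esub> = f (\<zero>\<^bsub>M\<^esub> \<oplus>\<^bsub>M\<^esub> \<zero>\<^bsub>M\<^esub>)" by simp
  also have "\<dots> = f \<zero>\<^bsub>M\<^esub> \<oplus>\<^bsub>N\<^esub> f \<zero>\<^bsub>M\<^esub>" using assms(3) by (simp add: additive_map_def del: M.l_zero M.r_zero)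
  finally have "f \<zero>\<^bsub>M\<^esub> \<oplus>\<^bsub>N\<^esub> f \<zero>\<^bsub>M\<^esub> = f \<zero>\<^bsub>M\<^esub>" by (rule sym)
  then show ?thesis using N.add.l_cancel_one[OF c c] by simp
qed

lemma additive_map_finsum:
  assumes "abelian_group M" "abelian_group N" "additive_map M N f" "finite A" "g \<in> A \<rightarrow> carrier M"
  shows "f (finsum M g A) = finsum N (\<lambda>i. f (g i)) A"
proof -
  interpret M: abelian_group M by fact
  interpret N: abelian_group N by fact
  have "f (finprod (add_monoid M) g A) = finprod (add_monoid N) (\<lambda>i. f (g i)) A"
    by (rule hom_finprod_map[OF M.a_comm_monoid N.a_comm_monoid])
      (use assms additive_map_zero[OF assms(1-3)] in \<open>auto simp: additive_map_def hom_def\<close>)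
  then show ?thesis by (simp add: finsum_def)
qed

locale hol_module = based_module hol_ring M n e for M (structure) and n e
begin

lemma crd_add_apply:
  assumes "x \<in> carrier M" "y \<in> carrier M" "j < n" "z \<noteq> 0"
  shows "crd (x \<oplus>\<^bsub>M\<^esub> y) j z = crd x j z + crd y j z"
  using assms by (simp add: crd_add hol_add_apply)

lemma crd_smult_apply:
  assumes "x \<in> carrier M" "f \<in> carrier hol_ring" "j < n" "z \<noteq> 0"
  shows "crd (f \<odot>\<^bsub>M\<^esub> x) j z = f z * crd x j z"
  using assms by (simp add: crd_smult hol_mult_apply)

lemma crd_basis_apply: "i < n \<Longrightarrow> j < n \<Longrightarrow> z \<noteq> 0 \<Longrightarrow> crd (e i) j z = (if i = j then 1 else 0)"
  by (simp add: crd_basis hol_zero hol_one hol_const_apply)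

lemma crd_zero_apply: "j < n \<Longrightarrow> z \<noteq> 0 \<Longrightarrow> crd \<zero>\<^bsub>M\<^esub> j z = 0"
  by (simp add: crd_zero hol_zero hol_const_apply)

lemma crd_finsum_apply:
  assumes "finite A" "v \<in> A \<rightarrow> carrier M" "j < n" "z \<noteq> 0"
  shows "crd (finsum M v A) j z = (\<Sum>i\<in>A. crd (v i) j z)"
  using assms(1,2)
proof (induction A rule: finite_induct)
  case empty
  then show ?case using assms(3,4) by (simp add: crd_zero_apply)
next
  case (insert a A)
  then have "finsum M v (insert a A) = v a \<oplus>\<^bsub>M\<^esub> finsum M v A"
    by (intro M.finsum_insert) auto
  then show ?case using insert assms(3,4) by (simp add: crd_add_apply)
qed

lemma crd_lincomb_apply:
  assumes "finite A" "v \<in> A \<rightarrow> carrier M" "c \<in> A \<rightarrow> carrier hol_ring" "j < n" "z \<noteq> 0"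
  shows "crd (\<Oplus>\<^bsub>M\<^esub>i\<in>A. c i \<odot>\<^bsub>M\<^esub> v i) j z = (\<Sum>i\<in>A. c i z * crd (v i) j z)"
proof -
  have "crd (\<Oplus>\<^bsub>M\<^esub>i\<in>A. c i \<odot>\<^bsub>M\<^esub> v i) j z = (\<Sum>i\<in>A. crd (c i \<odot>\<^bsub>M\<^esub> v i) j z)"
    by (rule crd_finsum_apply) (use assms in \<open>auto intro!: smult_closed\<close>)
  also have "\<dots> = (\<Sum>i\<in>A. c i z * crd (v i) j z)"
    by (intro sum.cong refl crd_smult_apply) (use assms in auto)
  finally show ?thesis .
qed

text \<open>Equality of vectors becomes equality of complex numbers at every nonzero point, where
  matrices of functions are ordinary matrices.\<close>

lemma eq_by_crd:
  assumes "x \<in> carrier M" "y \<in> carrier M" "\<And>j z. j < n \<Longrightarrow> z \<noteq> 0 \<Longrightarrow> crd x j z = crd y j z"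
  shows "x = y"
  by (rule crd_eq_imp_eq) (use assms in \<open>auto intro!: hol_eqI crd_closed\<close>)

text \<open>The coordinate row in the new basis must be the old row times \<open>D\<close>:
  multiplying by \<open>C\<close> recovers the old row, and conversely any row of new coordinates is
  recovered from the old row by \<open>D\<close>.\<close>

lemma change_of_basis:
  assumes C: "\<And>i j. i < n \<Longrightarrow> j < n \<Longrightarrow> C i j \<in> carrier hol_ring"
    and D: "\<And>i j. i < n \<Longrightarrow> j < n \<Longrightarrow> D i j \<in> carrier hol_ring"
    and CD: "\<And>z. z \<noteq> 0 \<Longrightarrow> mat_eq n (mm n (ev C z) (ev D z)) idmat"
  shows "module_basis hol_ring M n (\<lambda>i. \<Oplus>\<^bsub>M\<^esub>j\<in>{..<n}. C i j \<odot>\<^bsub>M\<^esub> e j)"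
  unfolding module_basis_def
proof (intro conjI ballI)
  define e' where "e' = (\<lambda>i. \<Oplus>\<^bsub>M\<^esub>j\<in>{..<n}. C i j \<odot>\<^bsub>M\<^esub> e j)"
  have e'_eq: "(\<Oplus>\<^bsub>M\<^esub>j\<in>{..<n}. C i j \<odot>\<^bsub>M\<^esub> e j) = e' i" for i by (simp add: e'_def)
  have e': "e' i \<in> carrier M" if "i < n" for i
    unfolding e'_def by (rule sum_closed) (use C that in auto)
  show "(\<lambda>i. \<Oplus>\<^bsub>M\<^esub>j\<in>{..<n}. C i j \<odot>\<^bsub>M\<^esub> e j) \<in> {..<n} \<rightarrow> carrier M"
    unfolding e'_def[symmetric] using e' by auto
  have DC: "mat_eq n (mm n (ev D z) (ev C z)) idmat" if "z \<noteq> 0" for z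
    by (rule mm_left_right_inverse[OF CD[OF that]])
  have ce': "crd (e' i) j z = C i j z" if "i < n" "j < n" "z \<noteq> 0" for i j z
    unfolding e'_def by (subst crd_unique) (use C that in auto)
  have cl: "crd (\<Oplus>\<^bsub>M\<^esub>i\<in>{..<n}. c i \<odot>\<^bsub>M\<^esub> e' i) j z = (\<Sum>i<n. c i z * C i j z)"
    if "c \<in> {..<n} \<rightarrow> carrier hol_ring" "j < n" "z \<noteq> 0" for c j z
    by (subst crd_lincomb_apply) (use that e' in \<open>auto simp: ce'\<close>)
  fix x assume x: "x \<in> carrier M"
  define d where "d = (\<lambda>i\<in>{..<n}. \<Oplus>\<^bsub>hol_ring\<^esub>k\<in>{..<n}. crd x k \<otimes>\<^bsub>hol_ring\<^esub> D k i)"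
  have d: "d \<in> {..<n} \<rightarrow>\<^sub>E carrier hol_ring"
    using crd_closed[OF x] D by (auto simp: d_def intro!: hol.finsum_closed)
  have dz: "d i z = (\<Sum>k<n. crd x k z * D k i z)" if "i < n" "z \<noteq> 0" for i z
    unfolding d_def using that crd_closed[OF x] D by (simp add: hol_finsum_apply Pi_iff hol_mult_apply)
  show "\<exists>!c. c \<in> {..<n} \<rightarrow>\<^sub>E carrier hol_ring \<and> x = (\<Oplus>\<^bsub>M\<^esub>j\<in>{..<n}. c j \<odot>\<^bsub>M\<^esub> (\<Oplus>\<^bsub>M\<^esub>k\<in>{..<n}. C j k \<odot>\<^bsub>M\<^esub> e k))"
    unfolding e'_eq
  proof (rule ex1I[of _ d])
    show "d \<in> {..<n} \<rightarrow>\<^sub>E carrier hol_ring \<and> x = (\<Oplus>\<^bsub>M\<^esub>j\<in>{..<n}. d j \<odot>\<^bsub>M\<^esub> e' j)"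
    proof (intro conjI d eq_by_crd x)
      show "(\<Oplus>\<^bsub>M\<^esub>j\<in>{..<n}. d j \<odot>\<^bsub>M\<^esub> e' j) \<in> carrier M"
        by (intro M.finsum_closed) (use d e' in \<open>auto intro!: smult_closed\<close>)
      fix j z assume jz: "j < n" "z \<noteq> (0::complex)"
      \<comment> \<open>A row vector is encoded as a matrix all of whose rows are equal, so that
        associativity of \<open>mm\<close> applies; row 0 reads the result.\<close>
      have "(\<Sum>i<n. d i z * C i j z) = mm n (mm n (\<lambda>i k. crd x k z) (ev D z)) (ev C z) 0 j"
        using jz by (simp add: dz mm_def ev_def)
      also have "\<dots> = mm n (\<lambda>i k. crd x k z) (mm n (ev D z) (ev C z)) 0 j" by (simp add: mm_assoc)
      also have "\<dots> = mm n (\<lambda>i k. crd x k z) idmat 0 j"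
        using DC[OF jz(2)] jz(1) unfolding mm_def[of n "\<lambda>i k. crd x k z"] mat_eq_def by (intro sum.cong) auto
      also have "\<dots> = crd x j z"
        using jz(1) unfolding mm_def by (subst sum.remove[of _ j]) (auto simp: idmat_def)
      finally show "crd x j z = crd (\<Oplus>\<^bsub>M\<^esub>j\<in>{..<n}. d j \<odot>\<^bsub>M\<^esub> e' j) j z"
        using d jz by (subst cl) auto
    qed
  next
    fix c assume c: "c \<in> {..<n} \<rightarrow>\<^sub>E carrier hol_ring \<and> x = (\<Oplus>\<^bsub>M\<^esub>j\<in>{..<n}. c j \<odot>\<^bsub>M\<^esub> e' j)"
    show "c = d"
    proof (rule extensionalityI[of _ "{..<n}"])
      fix i assume i: "i \<in> {..<n}"
      show "c i = d i"
      proof (rule hol_eqI)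
        fix z :: complex assume z: "z \<noteq> 0"
        have cx: "crd x k z = (\<Sum>l<n. c l z * C l k z)" if "k < n" for k
          using c that z cl[of c k z] by auto
        have "d i z = mm n (mm n (\<lambda>i k. c k z) (ev C z)) (ev D z) 0 i"
          using i z by (simp add: dz cx mm_def ev_def)
        also have "\<dots> = mm n (\<lambda>i k. c k z) (mm n (ev C z) (ev D z)) 0 i" by (simp add: mm_assoc)
        also have "\<dots> = mm n (\<lambda>i k. c k z) idmat 0 i"
          using CD[OF z] i unfolding mm_def[of n "\<lambda>i k. c k z"] mat_eq_def by (intro sum.cong) auto
        also have "\<dots> = c i z"
          using i unfolding mm_def by (subst sum.remove[of _ i]) (auto simp: idmat_def)
        finally show "c i z = d i z" by simp
      qed (use c d i in auto)
    qed (use c d in \<open>auto simp: PiE_def\<close>)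
  qed
qed

text \<open>On coordinate rows a connection acts as the Euler operator plus right multiplication by
  its matrix. This turns statements about connections into systems of differential
  equations.\<close>

lemma crd_nabla:
  assumes D: "is_connection hol_ring hol_const (hol_delta \<tau>) M D"
    and x: "x \<in> carrier M" and j: "j < n" and z: "z \<noteq> 0"
  shows "crd (D x) j z = \<tau> * z * deriv (crd x j) z + (\<Sum>k<n. crd x k z * crd (D (e k)) j z)"
proof -
  have ad: "additive_map M M D"
    and lb: "\<And>f x. f \<in> carrier hol_ring \<Longrightarrow> x \<in> carrier M \<Longrightarrow> D (f \<odot>\<^bsub>M\<^esub> x) = (f \<odot>\<^bsub>M\<^esub> D x) \<oplus>\<^bsub>M\<^esub> (hol_delta \<tau> f \<odot>\<^bsub>M\<^esub> x)"
    using D by (auto simp: is_connection_def)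
  have Dc: "D x \<in> carrier M" if "x \<in> carrier M" for x using ad that by (auto simp: additive_map_def)
  have tc: "(\<lambda>k. crd x k \<odot>\<^bsub>M\<^esub> e k) \<in> {..<n} \<rightarrow> carrier M"
    by (rule term_closed) (use crd_closed[OF x] in auto)
  have "D x = D (\<Oplus>\<^bsub>M\<^esub>k\<in>{..<n}. crd x k \<odot>\<^bsub>M\<^esub> e k)" by (simp add: crd_sum x)
  also have "\<dots> = (\<Oplus>\<^bsub>M\<^esub>k\<in>{..<n}. D (crd x k \<odot>\<^bsub>M\<^esub> e k))"
    by (rule additive_map_finsum[OF M.abelian_group_axioms M.abelian_group_axioms ad _ tc]) simp
  finally have "crd (D x) j z = (\<Sum>k<n. crd (D (crd x k \<odot>\<^bsub>M\<^esub> e k)) j z)"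
    using crd_finsum_apply[of "{..<n}" "\<lambda>k. D (crd x k \<odot>\<^bsub>M\<^esub> e k)" j z] tc Dc j z by auto
  also have "\<dots> = (\<Sum>k<n. crd x k z * crd (D (e k)) j z + (if k = j then \<tau> * z * deriv (crd x k) z else 0))"
  proof (intro sum.cong refl)
    fix k assume k: "k \<in> {..<n}"
    then show "crd (D (crd x k \<odot>\<^bsub>M\<^esub> e k)) j z = crd x k z * crd (D (e k)) j z + (if k = j then \<tau> * z * deriv (crd x k) z else 0)"
      using x j z by (simp add: lb crd_closed e_closed Dc smult_closed hol_delta_closed crd_add_apply crd_smult_apply crd_basis_apply hol_delta_apply)
  qed
  also have "\<dots> = \<tau> * z * deriv (crd x j) z + (\<Sum>k<n. crd x k z * crd (D (e k)) j z)"
    using j by (simp add: sum.distrib)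
  finally show ?thesis .
qed

text \<open>Carries a gauge transformation of matrices over to a basis of the module. The entries of
  \<open>P\<close> are restricted because ring elements have a prescribed value outside the
  punctured plane.\<close>

lemma gauge_basis:
  assumes D: "is_connection hol_ring hol_const (hol_delta \<tau>) M D"
    and A: "\<And>i j z. i < n \<Longrightarrow> j < n \<Longrightarrow> z \<noteq> 0 \<Longrightarrow> crd (D (e i)) j z = A i j z"
    and PQ: "gauge_by n \<tau> P Q A (\<lambda>i j z. B i j)"
    and e'_eq: "e' = (\<lambda>i. \<Oplus>\<^bsub>M\<^esub>j\<in>{..<n}. restrict (P i j) (-{0}) \<odot>\<^bsub>M\<^esub> e j)"
  shows "module_basis hol_ring M n e'"
    "\<And>i. i < n \<Longrightarrow> D (e' i) = (\<Oplus>\<^bsub>M\<^esub>j\<in>{..<n}. hol_const (B i j) \<odot>\<^bsub>M\<^esub> e' j)"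
    "\<And>i j z. i < n \<Longrightarrow> j < n \<Longrightarrow> z \<noteq> 0 \<Longrightarrow> crd (e' i) j z = P i j z"
proof -
  define C where "C = (\<lambda>i j. restrict (P i j) (-{0}))"
  define C' where "C' = (\<lambda>i j. restrict (Q i j) (-{0}))"
  have C: "C i j \<in> carrier hol_ring" "C' i j \<in> carrier hol_ring" if "i < n" "j < n" for i j
    unfolding C_def C'_def using PQ that by (auto intro!: restrict_hol_closed simp: gauge_by_def entries_hol_def)
  have evC: "ev C z = ev P z" "ev C' z = ev Q z" if "z \<noteq> 0" for z using that by (auto simp: ev_def C_def C'_def)
  have e'_def: "e' = (\<lambda>i. \<Oplus>\<^bsub>M\<^esub>j\<in>{..<n}. C i j \<odot>\<^bsub>M\<^esub> e j)" by (simp add: e'_eq C_def)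
  show b: "module_basis hol_ring M n e'"
    unfolding e'_def by (rule change_of_basis[of C C']) (use C PQ in \<open>auto simp: evC gauge_by_def\<close>)
  have e': "e' i \<in> carrier M" if "i < n" for i
    unfolding e'_def by (rule sum_closed) (use C that in auto)
  have ce': "crd (e' i) j = C i j" if "i < n" "j < n" for i j
    unfolding e'_def by (subst crd_unique) (use C that in auto)
  have Dc: "D x \<in> carrier M" if "x \<in> carrier M" for x
    using D that by (auto simp: is_connection_def additive_map_def)
  show "crd (e' i) j z = P i j z" if "i < n" "j < n" "z \<noteq> 0" for i j z
    using that by (simp add: ce' C_def)
  show "D (e' i) = (\<Oplus>\<^bsub>M\<^esub>j\<in>{..<n}. hol_const (B i j) \<odot>\<^bsub>M\<^esub> e' j)" if i: "i < n" for i
  proof (rule eq_by_crd)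
    show "D (e' i) \<in> carrier M" by (intro Dc e' i)
    show "(\<Oplus>\<^bsub>M\<^esub>j\<in>{..<n}. hol_const (B i j) \<odot>\<^bsub>M\<^esub> e' j) \<in> carrier M"
      by (intro M.finsum_closed) (use e' in \<open>auto intro!: smult_closed hol_const_closed\<close>)
    fix j z assume jz: "j < n" "z \<noteq> (0::complex)"
    \<comment> \<open>Restriction changes the function only at 0, and \<open>z\<close> has a
      neighbourhood avoiding 0.\<close>
    have dC: "deriv (C i j) z = deriv (P i j) z"
    proof (rule deriv_cong_ev)
      have "\<forall>\<^sub>F w in nhds z. w \<in> -{0}" using jz(2) open_punctured by (intro eventually_nhds_in_open) auto
      then show "\<forall>\<^sub>F w in nhds z. C i j w = P i j w" by eventually_elim (simp add: C_def)
    qed simp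
    have "crd (D (e' i)) j z = \<tau> * z * deriv (C i j) z + (\<Sum>k<n. C i k z * A k j z)"
      using crd_nabla[OF D e'[OF i] jz] i jz by (simp add: ce' A)
    also have "\<dots> = \<tau> * euler P z i j + mm n (ev P z) (ev A z) i j"
      unfolding dC using jz by (simp add: euler_def mm_def ev_def C_def mult.assoc)
    also have "\<dots> = mm n B (ev P z) i j"
    proof -
      have "mat_eq n (\<lambda>i j. \<tau> * euler P z i j + mm n (ev P z) (ev A z) i j) (mm n (ev (\<lambda>i j z. B i j) z) (ev P z))"
        using PQ jz(2) by (simp add: gauge_by_def)
      then show ?thesis using i jz by (simp add: mat_eq_def ev_def)
    qed
    also have "\<dots> = (\<Sum>k<n. hol_const (B i k) z * crd (e' k) j z)"
      using jz by (simp add: mm_def ev_def ce' hol_const_apply C_def)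
    finally show "crd (D (e' i)) j z = crd (\<Oplus>\<^bsub>M\<^esub>j\<in>{..<n}. hol_const (B i j) \<odot>\<^bsub>M\<^esub> e' j) j z"
      using jz e' by (subst crd_lincomb_apply) (auto simp: hol_const_closed)
  qed
qed

end

section \<open>Objects of the source category\<close>

text \<open>Regular singularity makes the connection matrix holomorphic at 0: if
  \<open>f z / z\<close> has a limit then \<open>f\<close> tends to 0, and if it has a simple pole
  then \<open>f\<close> is holomorphic near 0 up to its value there. Either way the singularity of
  \<open>f\<close> is removable.\<close>

lemma simple_pole_extend:
  assumes f: "f \<in> carrier hol_ring" and p: "at_most_simple_pole (\<lambda>z. inverse z * f z) 0"
  shows "\<exists>g. g holomorphic_on UNIV \<and> (\<forall>z. z \<noteq> 0 \<longrightarrow> g z = f z)"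
proof -
  have fh: "f holomorphic_on -{0}" using f by (simp add: hol_carrier_iff)
  have "\<exists>l. (f \<longlongrightarrow> l) (at 0)"
    using p unfolding at_most_simple_pole_def
  proof (elim conjE disjE exE)
    fix c assume c: "((\<lambda>z. inverse z * f z) \<longlongrightarrow> c) (at 0)"
    have "((\<lambda>z. z * (inverse z * f z)) \<longlongrightarrow> 0 * c) (at 0)" by (intro tendsto_mult c tendsto_ident_at)
    moreover have "\<forall>\<^sub>F z in at 0. z * (inverse z * f z) = f z"
      by (auto simp: eventually_at intro!: exI[of _ 1])
    ultimately show ?thesis using tendsto_cong[of "\<lambda>z. z * (inverse z * f z)" f] by blast
  next
    assume pole: "is_pole (\<lambda>z. inverse z * f z) 0" and ord: "zorder (\<lambda>z. inverse z * f z) 0 = - 1"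
    have "(\<lambda>z. inverse z * f z) holomorphic_on UNIV - {0}"
      using fh by (auto intro!: holomorphic_intros simp: Compl_eq_Diff_UNIV)
    \<comment> \<open>The exponent \<open>nat (- (- 1))\<close> is 1, so multiplying by
      \<open>w\<close> identifies \<open>f\<close> with the holomorphic factor \<open>h\<close> near
      0.\<close>
    from zorder_exist_pole[OF this open_UNIV UNIV_I pole] obtain h r where
      h: "r > 0" "h holomorphic_on cball 0 r" "\<And>w. w \<in> cball 0 r - {0} \<Longrightarrow> inverse w * f w = h w / (w - 0) ^ nat (- (- 1))"
      unfolding ord by blast
    have "h holomorphic_on ball 0 r" by (rule holomorphic_on_subset[OF h(2)]) auto
    then have "isCont h 0"
      using h(1) continuous_on_eq_continuous_at[OF open_ball] holomorphic_on_imp_continuous_on by force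
    then have "(h \<longlongrightarrow> h 0) (at 0)" by (simp add: isCont_def)
    moreover have "\<forall>\<^sub>F z in at 0. h z = f z"
      unfolding eventually_at
    proof (intro exI[of _ r] conjI ballI impI h(1))
      fix w :: complex assume "w \<noteq> 0 \<and> dist w 0 < r"
      then show "h w = f w" using h(3)[of w] by (simp add: field_simps)
    qed
    ultimately show ?thesis using tendsto_cong[of h f] by blast
  qed
  then obtain l where l: "(f \<longlongrightarrow> l) (at 0)" by blast
  define g where "g = (\<lambda>z. if z = 0 then l else f z)"
  have "g holomorphic_on UNIV"
  proof (rule no_isolated_singularity'[of "{0}"])
    have "\<forall>\<^sub>F z in at 0. f z = g z" by (auto simp: g_def eventually_at intro!: exI[of _ 1])
    then have "(g \<longlongrightarrow> l) (at 0)" using l tendsto_cong[of f g] by blast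
    then show "\<And>z. z \<in> {0} \<Longrightarrow> (g \<longlongrightarrow> g z) (at z within UNIV)" by (simp add: g_def)
    have "g holomorphic_on -{0}" by (rule holomorphic_transform[OF fh]) (simp add: g_def)
    then show "g holomorphic_on UNIV - {0}" by (simp add: Compl_eq_Diff_UNIV)
  qed simp_all
  then show ?thesis by (intro exI[of _ g]) (simp add: g_def)
qed

text \<open>Used for the constant connection matrices of kernels and cokernels. For
  \<open>c = 0\<close> there is no pole and the limit alternative of the definition applies.\<close>

lemma at_most_simple_pole_const: "at_most_simple_pole (\<lambda>z. inverse z * hol_const c z) 0"
proof (cases "c = 0")
  case True
  have ev: "\<forall>\<^sub>F z in at 0. 0 = inverse z * hol_const c z"
    by (auto simp: eventually_at True hol_const_apply intro!: exI[of _ 1])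
  have "((\<lambda>z. inverse z * hol_const c z) \<longlongrightarrow> 0) (at 0)"
    using tendsto_cong[OF ev, of 0] by simp
  moreover have "isolated_singularity_at (\<lambda>z. inverse z * hol_const c z) 0"
    unfolding isolated_singularity_at_def
  proof (intro exI[of _ 1] conjI)
    have "(\<lambda>z. inverse z * hol_const c z) holomorphic_on ball 0 1 - {0}"
      by (rule holomorphic_transform[of "\<lambda>z. 0"]) (auto simp: True hol_const_apply)
    then show "(\<lambda>z. inverse z * hol_const c z) analytic_on ball 0 1 - {0}"
      by (subst analytic_on_open) auto
  qed simp
  ultimately show ?thesis unfolding at_most_simple_pole_def by blast
next
  case False
  have ev: "\<forall>\<^sub>F z in at 0. c / (z - 0) ^ 1 = inverse z * hol_const c z"
    by (auto simp: eventually_at hol_const_apply divide_inverse mult.commute intro!: exI[of _ 1])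
  have "isolated_singularity_at (\<lambda>z. inverse z * hol_const c z) 0"
    unfolding isolated_singularity_at_def
  proof (intro exI[of _ 1] conjI)
    have "(\<lambda>z. inverse z * hol_const c z) holomorphic_on ball 0 1 - {0}"
      by (rule holomorphic_transform[of "\<lambda>z. inverse z * c"]) (auto simp: hol_const_apply intro!: holomorphic_intros)
    then show "(\<lambda>z. inverse z * hol_const c z) analytic_on ball 0 1 - {0}"
      by (subst analytic_on_open) auto
  qed simp
  moreover have "is_pole (\<lambda>z. inverse z * hol_const c z) 0"
  proof -
    have "is_pole (\<lambda>z. c / (z - 0) ^ 1) 0"
      by (rule is_pole_basic[of "\<lambda>z. c" UNIV]) (use False in auto)
    then show ?thesis using is_pole_cong[OF ev refl] by simp
  qed
  moreover have "zorder (\<lambda>z. inverse z * hol_const c z) 0 = - 1"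
  proof (rule zorder_eqI[of UNIV 0 "\<lambda>z. c"])
    fix w :: complex assume "w \<in> UNIV" "w \<noteq> 0"
    then show "inverse w * hol_const c w = c * (w - 0) powi - 1"
      by (simp add: hol_const_apply power_int_minus)
  qed (use False in auto)
  ultimately show ?thesis unfolding at_most_simple_pole_def by blast
qed

text \<open>A free module needs no relations: the presentation has \<open>k = 0\<close>, and the
  only element of \<open>R^0\<close> goes to the zero row.\<close>

lemma finitely_presentable_basis:
  assumes M: "Module.module R M" and b: "module_basis R M n e"
  shows "finitely_presentable R M"
proof -
  interpret based_module R M n e using M b by (simp add: based_module_def based_module_axioms_def)
  define u where "u = (\<lambda>x::nat \<Rightarrow> 'a. \<lambda>i\<in>{..<n}. \<zero>\<^bsub>R\<^esub>)"
  define p where "p = (\<lambda>c. \<Oplus>\<^bsub>M\<^esub>j\<in>{..<n}. c j \<odot>\<^bsub>M\<^esub> e j)"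
  have cc: "c \<in> {..<n} \<rightarrow> carrier R" if "c \<in> carrier (free_rmod R n)" for c
    using that by (auto simp: free_rmod_def)
  have crdp: "crd (p c) j = c j" if "c \<in> carrier (free_rmod R n)" "j < n" for c j
    unfolding p_def by (rule crd_unique[OF cc[OF that(1)] that(2)])
  have pc: "p c \<in> carrier M" if "c \<in> carrier (free_rmod R n)" for c
    unfolding p_def by (rule sum_closed[OF cc[OF that]])
  have ac: "c \<oplus>\<^bsub>free_rmod R n\<^esub> d \<in> carrier (free_rmod R n)" "\<And>j. j < n \<Longrightarrow> (c \<oplus>\<^bsub>free_rmod R n\<^esub> d) j = c j \<oplus>\<^bsub>R\<^esub> d j"
    if "c \<in> carrier (free_rmod R n)" "d \<in> carrier (free_rmod R n)" for c d
    using that by (auto simp: free_rmod_def PiE_iff)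
  have sc: "r \<odot>\<^bsub>free_rmod R n\<^esub> c \<in> carrier (free_rmod R n)" "\<And>j. j < n \<Longrightarrow> (r \<odot>\<^bsub>free_rmod R n\<^esub> c) j = c j \<otimes>\<^bsub>R\<^esub> r"
    if "c \<in> carrier (free_rmod R n)" "r \<in> carrier R" for c r
    using that by (auto simp: free_rmod_def PiE_iff)
  have cr: "c j \<in> carrier R" if "c \<in> carrier (free_rmod R n)" "j < n" for c j
    using cc[OF that(1)] that(2) by auto
  have u: "module_map R (free_rmod R 0) (free_rmod R n) u"
    unfolding module_map_def additive_map_def u_def by (auto simp: free_rmod_def intro!: restrict_ext)
  have p: "module_map R (free_rmod R n) M p"
    unfolding module_map_def additive_map_def
  proof (intro conjI ballI)
    show "p \<in> carrier (free_rmod R n) \<rightarrow> carrier M" using pc by auto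
    fix c assume c: "c \<in> carrier (free_rmod R n)"
    show "p (c \<oplus>\<^bsub>free_rmod R n\<^esub> d) = p c \<oplus>\<^bsub>M\<^esub> p d" if d: "d \<in> carrier (free_rmod R n)" for d
      by (rule crd_eq_imp_eq) (simp_all add: c d pc ac crdp crd_add)
    show "p (r \<odot>\<^bsub>free_rmod R n\<^esub> c) = r \<odot>\<^bsub>M\<^esub> p c" if r: "r \<in> carrier R" for r
      by (rule crd_eq_imp_eq) (simp_all add: c r pc sc crdp crd_smult cr R.m_comm)
  qed
  have im: "p ` carrier (free_rmod R n) = carrier M"
  proof
    show "carrier M \<subseteq> p ` carrier (free_rmod R n)"
    proof
      fix x assume x: "x \<in> carrier M"
      have "crd x \<in> carrier (free_rmod R n)" using crd_props(1)[OF x] by (simp add: free_rmod_def)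
      moreover have "p (crd x) = x" by (simp add: p_def crd_sum x)
      ultimately show "x \<in> p ` carrier (free_rmod R n)" by force
    qed
  qed (use pc in auto)
  define z where "z = (\<lambda>i\<in>{..<n}. \<zero>\<^bsub>R\<^esub>)"
  have z: "z \<in> carrier (free_rmod R n)" by (simp add: free_rmod_def z_def)
  have "carrier (free_rmod R 0) \<noteq> {}" by (simp add: free_rmod_def)
  moreover have "u x = z" for x by (simp add: u_def z_def)
  ultimately have uim: "u ` carrier (free_rmod R 0) = {z}" by auto
  have pz: "p z = \<zero>\<^bsub>M\<^esub>"
    by (rule crd_eq_imp_eq) (simp_all add: pc z crdp crd_zero, simp add: z_def)
  have "x = z" if x: "x \<in> carrier (free_rmod R n)" and px: "p x = \<zero>\<^bsub>M\<^esub>" for x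
  proof (rule extensionalityI[of _ "{..<n}"])
    fix j assume "j \<in> {..<n}"
    then show "x j = z j" using crdp[OF x, of j] px by (simp add: crd_zero z_def)
  next
    show "x \<in> extensional {..<n}" using x by (simp add: free_rmod_def PiE_iff)
    show "z \<in> extensional {..<n}" using z by (simp add: free_rmod_def PiE_iff)
  qed
  then have ker: "u ` carrier (free_rmod R 0) = {x \<in> carrier (free_rmod R n). p x = \<zero>\<^bsub>M\<^esub>}"
    unfolding uim using z pz by blast
  show ?thesis unfolding finitely_presentable_def using u p im ker by blast
qed

definition const_basis :: "(complex \<Rightarrow> complex, 'm, 'x) module_scheme \<Rightarrow> ('m \<Rightarrow> 'm) \<Rightarrow> nat \<Rightarrow>
    (nat \<Rightarrow> 'm) \<Rightarrow> (nat \<Rightarrow> nat \<Rightarrow> complex) \<Rightarrow> bool" where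
  "const_basis M D n e B \<longleftrightarrow> module_basis hol_ring M n e \<and>
     (\<forall>i<n. D (e i) = (\<Oplus>\<^bsub>M\<^esub>j\<in>{..<n}. hol_const (B i j) \<odot>\<^bsub>M\<^esub> e j))"

lemma B_objectD:
  assumes "M \<in> B_objects q \<tau>"
  shows "Module.module hol_ring M" "bij_betw (sigma M) (carrier M) (carrier M)" "additive_map M M (sigma M)"
    "\<And>f x. f \<in> carrier hol_ring \<Longrightarrow> x \<in> carrier M \<Longrightarrow> sigma M (f \<odot>\<^bsub>M\<^esub> x) = hol_alpha q f \<odot>\<^bsub>M\<^esub> sigma M x"
    "is_connection hol_ring hol_const (hol_delta \<tau>) M (nabla M)"
    "\<And>x. x \<in> carrier M \<Longrightarrow> nabla M (sigma M x) = sigma M (nabla M x)"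
    "regular_singular M (nabla M)"
  using assms by (auto simp: B_objects_def)

lemma hol_moduleI:
  "Module.module hol_ring M \<Longrightarrow> module_basis hol_ring M n e \<Longrightarrow> hol_module M n e"
  by (simp add: hol_module_def based_module_def based_module_axioms_def)

text \<open>The connection matrix first has to be extended over 0, where the Frobenius method works;
  the resulting change of basis is then used on the punctured plane only.\<close>

lemma B_object_const_basis:
  assumes M: "M \<in> B_objects q \<tau>" and \<tau>: "\<tau> \<noteq> 0"
  shows "\<exists>n e B. const_basis M (nabla M) n e B \<and> upper n B \<and> (\<forall>i<n. strip_index \<tau> (B i i) = 0)"
proof -
  obtain n e A where b: "module_basis hol_ring M n e"
    and A: "\<And>i j. i < n \<Longrightarrow> j < n \<Longrightarrow> A i j \<in> carrier hol_ring \<and> at_most_simple_pole (\<lambda>z. inverse z * A i j z) 0"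
    and D: "\<And>i. i < n \<Longrightarrow> nabla M (e i) = (\<Oplus>\<^bsub>M\<^esub>j\<in>{..<n}. A i j \<odot>\<^bsub>M\<^esub> e j)"
    using B_objectD(7)[OF M] unfolding regular_singular_def by blast
  interpret hol_module M n e by (rule hol_moduleI[OF B_objectD(1)[OF M] b])
  define E where "E = (\<lambda>i j. SOME g. g holomorphic_on UNIV \<and> (\<forall>z. z \<noteq> 0 \<longrightarrow> g z = A i j z))"
  have E: "E i j holomorphic_on UNIV \<and> (\<forall>z. z \<noteq> 0 \<longrightarrow> E i j z = A i j z)" if "i < n" "j < n" for i j
    unfolding E_def using someI_ex[OF simple_pole_extend[of "A i j"]] A[OF that] by blast
  have "entries_hol n E UNIV" using E by (simp add: entries_hol_def)
  then obtain B where B: "upper n B" "\<And>i. i < n \<Longrightarrow> strip_index \<tau> (B i i) = 0" "gauge_equiv n \<tau> E (\<lambda>i j z. B i j)"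
    using gauge_constant[OF \<tau>] by blast
  then obtain P Q where PQ: "gauge_by n \<tau> P Q E (\<lambda>i j z. B i j)" unfolding gauge_equiv_def by blast
  have "crd (nabla M (e i)) j z = E i j z" if "i < n" "j < n" "z \<noteq> 0" for i j z
    using that A E by (simp add: D crd_unique Pi_iff)
  from gauge_basis(1,2)[OF B_objectD(5)[OF M] this PQ refl]
  have "const_basis M (nabla M) n (\<lambda>i. \<Oplus>\<^bsub>M\<^esub>j\<in>{..<n}. restrict (P i j) (-{0}) \<odot>\<^bsub>M\<^esub> e j) B"
    unfolding const_basis_def by blast
  then show ?thesis using B by blast
qed

lemma const_basis_crd:
  assumes M: "Module.module hol_ring M" and b: "const_basis M D n e B" and ij: "i < n" "j < n" "z \<noteq> 0"
  shows "based_module.crd hol_ring M n e (D (e i)) j z = B i j"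
proof -
  interpret hol_module M n e using M b by (intro hol_moduleI) (simp_all add: const_basis_def)
  show ?thesis
    using b ij by (simp add: const_basis_def crd_unique Pi_iff hol_const_closed hol_const_apply)
qed

lemma const_basis_change:
  assumes M: "Module.module hol_ring M" and D: "is_connection hol_ring hol_const (hol_delta \<tau>) M D"
    and b: "const_basis M D n e B" and P: "inv_mat n P"
    and e': "e' = (\<lambda>i. \<Oplus>\<^bsub>M\<^esub>j\<in>{..<n}. hol_const (P i j) \<odot>\<^bsub>M\<^esub> e j)"
  shows "\<exists>B'. const_basis M D n e' B'"
proof -
  interpret hol_module M n e using M b by (intro hol_moduleI) (simp_all add: const_basis_def)
  obtain P' where P': "mat_eq n (mm n P P') idmat" using P unfolding inv_mat_def by blast
  have P'': "mat_eq n (mm n P' P) idmat" by (rule mm_left_right_inverse[OF P'])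
  define B' where "B' = mm n (mm n P B) P'"
  have B'P: "mat_eq n (mm n P B) (mm n B' P)"
    unfolding B'_def mm_assoc[of n _ P' P]
    by (rule mat_eq_sym[OF mat_eq_trans[OF mm_cong[OF mat_eq_refl P''] mm_idm_right]])
  have evc: "ev (\<lambda>i j z. X i j) z = X" for X :: "nat \<Rightarrow> nat \<Rightarrow> complex" and z by (simp add: ev_def)
  have g: "gauge_by n \<tau> (\<lambda>i j z. P i j) (\<lambda>i j z. P' i j) (\<lambda>i j z. B i j) (\<lambda>i j z. B' i j)"
    using P' P'' B'P unfolding gauge_by_def evc euler_const by (simp add: entries_hol_def)
  have e'': "e' = (\<lambda>i. \<Oplus>\<^bsub>M\<^esub>j\<in>{..<n}. restrict (\<lambda>z. P i j) (-{0}) \<odot>\<^bsub>M\<^esub> e j)"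
    unfolding e' hol_const_def ..
  show ?thesis
    using gauge_basis(1,2)[OF D const_basis_crd[OF M b] g e''] unfolding const_basis_def by blast
qed

text \<open>Compatibility with the connections says that the matrix \<open>F\<close> of
  \<open>g\<close> satisfies \<open>\<tau> z F' + F B' = B F\<close>. The Laurent coefficient of
  index \<open>l\<close> therefore solves a homogeneous Sylvester equation with factor
  \<open>\<tau> l\<close>, and it vanishes for \<open>l \<noteq> 0\<close>.\<close>

lemma module_map_const:
  assumes M: "Module.module hol_ring M" and N: "Module.module hol_ring N" and \<tau>: "\<tau> \<noteq> 0"
    and D: "is_connection hol_ring hol_const (hol_delta \<tau>) M D"
    and D': "is_connection hol_ring hol_const (hol_delta \<tau>) N D'"
    and b: "const_basis M D n e B" and b': "const_basis N D' m e' B'"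
    and up: "upper n B" "upper m B'"
    and st: "\<And>i. i < n \<Longrightarrow> strip_index \<tau> (B i i) = 0" "\<And>i. i < m \<Longrightarrow> strip_index \<tau> (B' i i) = 0"
    and g: "module_map hol_ring M N g" and gD: "\<And>x. x \<in> carrier M \<Longrightarrow> g (D x) = D' (g x)"
  shows "\<exists>G. \<forall>i<n. \<forall>j<m. \<forall>z. z \<noteq> 0 \<longrightarrow> based_module.crd hol_ring N m e' (g (e i)) j z = G i j"
proof -
  interpret M: hol_module M n e using M b by (intro hol_moduleI) (simp_all add: const_basis_def)
  interpret N: hol_module N m e' using N b' by (intro hol_moduleI) (simp_all add: const_basis_def)
  have ga: "additive_map M N g" and gs: "\<And>r x. r \<in> carrier hol_ring \<Longrightarrow> x \<in> carrier M \<Longrightarrow> g (r \<odot>\<^bsub>M\<^esub> x) = r \<odot>\<^bsub>N\<^esub> g x"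
    and gc: "\<And>x. x \<in> carrier M \<Longrightarrow> g x \<in> carrier N"
    using g by (auto simp: module_map_def additive_map_def)
  define F where "F = (\<lambda>i j. N.crd (g (e i)) j)"
  have F: "F i j \<in> carrier hol_ring" if "i < n" "j < m" for i j
    unfolding F_def using that by (intro N.crd_closed gc M.e_closed)
  have ode: "\<tau> * z * deriv (F i j) z + (\<Sum>k<m. F i k z * B' k j) = (\<Sum>k<n. B i k * F k j z)"
    if ij: "i < n" "j < m" and z: "z \<noteq> 0" for i j z
  proof -
    have "g (D (e i)) = g (\<Oplus>\<^bsub>M\<^esub>k\<in>{..<n}. hol_const (B i k) \<odot>\<^bsub>M\<^esub> e k)"
      using b ij by (simp add: const_basis_def)
    also have "\<dots> = (\<Oplus>\<^bsub>N\<^esub>k\<in>{..<n}. g (hol_const (B i k) \<odot>\<^bsub>M\<^esub> e k))"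
      by (rule additive_map_finsum[OF M.M.abelian_group_axioms N.M.abelian_group_axioms ga])
        (auto intro!: M.smult_closed M.e_closed hol_const_closed)
    also have "\<dots> = (\<Oplus>\<^bsub>N\<^esub>k\<in>{..<n}. hol_const (B i k) \<odot>\<^bsub>N\<^esub> g (e k))"
      by (rule N.M.finsum_cong') (auto simp: gs hol_const_closed M.e_closed intro!: N.smult_closed gc)
    finally have "N.crd (D' (g (e i))) j z = (\<Sum>k<n. hol_const (B i k) z * N.crd (g (e k)) j z)"
      using ij z by (simp add: gD[symmetric] M.e_closed) (subst N.crd_lincomb_apply, auto simp: hol_const_closed intro!: gc M.e_closed)
    moreover have "N.crd (D' (g (e i))) j z = \<tau> * z * deriv (F i j) z + (\<Sum>k<m. F i k z * B' k j)"
      unfolding F_def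
      by (subst N.crd_nabla[OF D' _ ij(2) z]) (use ij z in \<open>auto intro!: gc M.e_closed simp: const_basis_crd[OF N b']\<close>)
    ultimately show ?thesis using z by (simp add: hol_const_apply F_def)
  qed
  define c where "c = (\<lambda>i j. laurent_coeffs (F i j))"
  have hF: "F i j holomorphic_on -{0}" if "i < n" "j < m" for i j using F[OF that] by (simp add: hol_carrier_iff)
  have lc: "laurent (F i j) (c i j)" if "i < n" "j < m" for i j
    unfolding c_def by (rule laurent_laurent_coeffs[OF hF[OF that]])
  have lsum: "laurent (\<lambda>z. \<Sum>k\<in>I. f k z) (\<lambda>l. \<Sum>k\<in>I. d k l)" if "finite I" "\<And>k. k \<in> I \<Longrightarrow> laurent (f k) (d k)" for I and f d :: "nat \<Rightarrow> _"
    using that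
  proof (induction I rule: finite_induct)
    case empty
    then show ?case using laurent_const[of 0] by (simp cong: if_cong)
  next
    case (insert k I)
    then show ?case using laurent_add[of "f k" "d k"] by simp
  qed
  have rel: "\<tau> * of_int l * c i j l + (\<Sum>k<m. c i k l * B' k j) - (\<Sum>k<n. B i k * c k j l) = 0"
    if ij: "i < n" "j < m" for i j l
  proof -
    have 1: "laurent (\<lambda>z. \<tau> * (z * deriv (F i j) z) + (\<Sum>k<m. B' k j * F i k z))
       (\<lambda>l. \<tau> * (of_int l * c i j l) + (\<Sum>k<m. B' k j * c i k l))"
      by (intro laurent_add laurent_cmult laurent_euler hF lc ij lsum finite_lessThan) (use ij in auto)
    have 2: "laurent (\<lambda>z. \<Sum>k<n. B i k * F k j z) (\<lambda>l. \<Sum>k<n. B i k * c k j l)"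
      by (intro laurent_cmult lc ij lsum finite_lessThan) (use ij in auto)
    have "laurent (\<lambda>z. \<Sum>k<n. B i k * F k j z) (\<lambda>l. \<tau> * (of_int l * c i j l) + (\<Sum>k<m. B' k j * c i k l))"
    proof (rule laurent_cong[THEN iffD1, OF _ 1])
      fix z :: complex assume z: "z \<noteq> 0"
      have "(\<Sum>k<m. B' k j * F i k z) = (\<Sum>k<m. F i k z * B' k j)" by (simp only: mult.commute)
      then show "\<tau> * (z * deriv (F i j) z) + (\<Sum>k<m. B' k j * F i k z) = (\<Sum>k<n. B i k * F k j z)"
        using ode[OF ij z] by (simp only: mult.assoc)
    qed
    from fun_cong[OF laurent_unique[OF this 2], of l] show ?thesis by (simp add: algebra_simps)
  qed
  \<comment> \<open>Here the diagonals belong to two different objects, and \<open>l\<close> may be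
    negative; the common strip index of all exponents excludes both signs.\<close>
  have nz: "\<tau> * of_int l + B' j j - B i i \<noteq> 0" if "l \<noteq> 0" "i < n" "j < m" for l i j
  proof
    assume "\<tau> * of_int l + B' j j - B i i = 0"
    then have "B i i / \<tau> = (B' j j + \<tau> * of_int l) / \<tau>" by (simp add: algebra_simps)
    then have "Re (B i i / \<tau>) = Re (B' j j / \<tau>) + of_int l"
      using \<tau> by (simp add: add_divide_distrib)
    then have "strip_index \<tau> (B i i) = strip_index \<tau> (B' j j) + l" by (simp add: strip_index_def)
    then show False using st that by simp
  qed
  have cz: "c i j l = 0" if "l \<noteq> 0" "i < n" "j < m" for i j l
    by (rule sylvester_unique[of n B m B' "\<tau> * of_int l" "\<lambda>i j. c i j l", OF up nz[OF that(1)] rel that(2,3)])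
  have "F i j z = c i j 0" if ij: "i < n" "j < m" and z: "z \<noteq> 0" for i j z
  proof -
    have "((\<lambda>l. c i j l * z powi l) has_sum F i j z) UNIV" using lc[OF ij] z by (simp add: laurent_def)
    moreover have "((\<lambda>l. c i j l * z powi l) has_sum c i j 0) UNIV"
      by (rule has_sum_finite_neutralI[of "{0}"]) (use cz ij in auto)
    ultimately show ?thesis by (rule has_sum_unique)
  qed
  then show ?thesis unfolding F_def by (intro exI[of _ "\<lambda>i j. c i j 0"]) simp
qed

text \<open>The bases are changed by \<open>P\<close> in the source and by the inverse of
  \<open>Q\<close> in the target, where \<open>P G Q\<close> is the rank normal form of the constant
  matrix \<open>G\<close>. As \<open>P\<close> and \<open>Q\<close> are constant, the connection
  matrices stay constant.\<close>

lemma adapted_bases: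
  assumes X: "X \<in> B_objects q \<tau>" and Y: "Y \<in> B_objects q \<tau>" and \<tau>: "\<tau> \<noteq> 0"
    and g: "module_map hol_ring X Y g" and gD: "\<And>x. x \<in> carrier X \<Longrightarrow> g (nabla X x) = nabla Y (g x)"
  obtains n m r e e' B B' where "r \<le> n" "r \<le> m" "const_basis X (nabla X) n e B" "const_basis Y (nabla Y) m e' B'"
    "\<And>i. i < n \<Longrightarrow> g (e i) = (if i < r then e' i else \<zero>\<^bsub>Y\<^esub>)"
proof -
  obtain n f A where f: "const_basis X (nabla X) n f A" "upper n A" "\<And>i. i < n \<Longrightarrow> strip_index \<tau> (A i i) = 0"
    using B_object_const_basis[OF X \<tau>] by blast
  obtain m f' A' where f': "const_basis Y (nabla Y) m f' A'" "upper m A'" "\<And>i. i < m \<Longrightarrow> strip_index \<tau> (A' i i) = 0"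
    using B_object_const_basis[OF Y \<tau>] by blast
  note Xm = B_objectD(1)[OF X] and Ym = B_objectD(1)[OF Y]
  interpret X: hol_module X n f using f Xm by (intro hol_moduleI) (simp_all add: const_basis_def)
  interpret Y: hol_module Y m f' using f' Ym by (intro hol_moduleI) (simp_all add: const_basis_def)
  have ga: "additive_map X Y g" and gs: "\<And>r x. r \<in> carrier hol_ring \<Longrightarrow> x \<in> carrier X \<Longrightarrow> g (r \<odot>\<^bsub>X\<^esub> x) = r \<odot>\<^bsub>Y\<^esub> g x"
    and gc: "\<And>x. x \<in> carrier X \<Longrightarrow> g x \<in> carrier Y"
    using g by (auto simp: module_map_def additive_map_def)
  obtain G where G: "\<And>i j z. i < n \<Longrightarrow> j < m \<Longrightarrow> z \<noteq> 0 \<Longrightarrow> Y.crd (g (f i)) j z = G i j"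
    using module_map_const[OF Xm Ym \<tau> B_objectD(5)[OF X] B_objectD(5)[OF Y] f(1) f'(1) f(2) f'(2) f(3) f'(3) g gD] by blast
  obtain r P Q where r: "r \<le> n" "r \<le> m" and PQ: "inv_mat n P" "inv_mat m Q"
    and PGQ: "\<And>i j. i < n \<Longrightarrow> j < m \<Longrightarrow> (\<Sum>k<n. \<Sum>l<m. P i k * G k l * Q l j) = (if i = j \<and> i < r then 1 else 0)"
    using rank_normal_form[of n m G] by blast
  obtain Q' where Q': "mat_eq m (mm m Q Q') idmat" using PQ(2) unfolding inv_mat_def by blast
  have "inv_mat m Q'" using mm_left_right_inverse[OF Q'] unfolding inv_mat_def by blast
  define e where "e = (\<lambda>i. \<Oplus>\<^bsub>X\<^esub>j\<in>{..<n}. hol_const (P i j) \<odot>\<^bsub>X\<^esub> f j)"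
  define e' where "e' = (\<lambda>i. \<Oplus>\<^bsub>Y\<^esub>j\<in>{..<m}. hol_const (Q' i j) \<odot>\<^bsub>Y\<^esub> f' j)"
  obtain B where B: "const_basis X (nabla X) n e B"
    using const_basis_change[OF Xm B_objectD(5)[OF X] f(1) PQ(1) e_def] by blast
  obtain B' where B': "const_basis Y (nabla Y) m e' B'"
    using const_basis_change[OF Ym B_objectD(5)[OF Y] f'(1) \<open>inv_mat m Q'\<close> e'_def] by blast
  have ec: "e i \<in> carrier X" for i
    unfolding e_def by (rule X.sum_closed) (simp add: hol_const_closed)
  have e'c: "e' i \<in> carrier Y" for i
    unfolding e'_def by (rule Y.sum_closed) (simp add: hol_const_closed)
  have ce': "Y.crd (e' i) j z = Q' i j" if "j < m" "z \<noteq> 0" for i j z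
    unfolding e'_def using that by (subst Y.crd_unique) (simp_all add: hol_const_closed hol_const_apply)
  have ge: "Y.crd (g (e i)) l z = (\<Sum>k<n. P i k * G k l)" if l: "l < m" "z \<noteq> 0" for i l z
  proof -
    have "g (e i) = (\<Oplus>\<^bsub>Y\<^esub>k\<in>{..<n}. g (hol_const (P i k) \<odot>\<^bsub>X\<^esub> f k))"
      unfolding e_def
      by (rule additive_map_finsum[OF X.M.abelian_group_axioms Y.M.abelian_group_axioms ga])
        (auto intro!: X.smult_closed X.e_closed hol_const_closed)
    also have "\<dots> = (\<Oplus>\<^bsub>Y\<^esub>k\<in>{..<n}. hol_const (P i k) \<odot>\<^bsub>Y\<^esub> g (f k))"
      by (rule Y.M.finsum_cong') (auto simp: gs hol_const_closed X.e_closed intro!: Y.smult_closed gc)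
    finally show ?thesis
      using l by (simp, subst Y.crd_lincomb_apply) (auto simp: hol_const_closed G hol_const_apply intro!: gc X.e_closed)
  qed
  \<comment> \<open>Insert \<open>Q Q'\<close> after \<open>P G\<close>: the normal form
    \<open>P G Q\<close> then selects row \<open>i\<close> of \<open>Q'\<close>, which holds the
    coordinates of \<open>e' i\<close>, or gives 0 when \<open>i \<ge> r\<close>.\<close>
  have PG: "(\<Sum>k<n. P i k * G k l) = (if i < r then Q' i l else 0)" if i: "i < n" and l: "l < m" for i l
  proof -
    have "(\<Sum>k<n. P i k * G k l) = mm m (\<lambda>i l. \<Sum>k<n. P i k * G k l) idmat i l"
      using mm_idm_right[of m "\<lambda>i l. \<Sum>k<n. P i k * G k l"] l unfolding mm_def
      by (subst sum.remove[of _ l]) (auto simp: idmat_def)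
    also have "\<dots> = mm m (\<lambda>i l. \<Sum>k<n. P i k * G k l) (mm m Q Q') i l"
      using Q' l unfolding mm_def[of m "\<lambda>i l. \<Sum>k<n. P i k * G k l"] mat_eq_def by (intro sum.cong) auto
    also have "\<dots> = mm m (mm m (\<lambda>i l. \<Sum>k<n. P i k * G k l) Q) Q' i l" by (simp add: mm_assoc)
    also have "\<dots> = (\<Sum>j<m. (if i = j \<and> i < r then 1 else 0) * Q' j l)"
    proof -
      have "mm m (\<lambda>i l. \<Sum>k<n. P i k * G k l) Q i j = (if i = j \<and> i < r then 1 else 0)" if "j < m" for j
        unfolding PGQ[OF i that, symmetric] mm_def sum_distrib_right by (rule sum.swap)
      then show ?thesis unfolding mm_def[of m "mm m (\<lambda>i l. \<Sum>k<n. P i k * G k l) Q"] by (intro sum.cong) auto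
    qed
    also have "\<dots> = (if i < r then Q' i l else 0)"
    proof (cases "i < r")
      case True
      then show ?thesis using r by (subst sum.remove[of _ i]) auto
    qed simp
    finally show ?thesis .
  qed
  have "g (e i) = (if i < r then e' i else \<zero>\<^bsub>Y\<^esub>)" if "i < n" for i
    by (rule Y.eq_by_crd) (use that gc ec e'c in \<open>auto simp: ge PG ce' Y.crd_zero_apply\<close>)
  then show ?thesis using that[OF r B B'] by blast
qed

section \<open>Kernels and cokernels\<close>

lemma additive_map_closed: "additive_map M N f \<Longrightarrow> x \<in> carrier M \<Longrightarrow> f x \<in> carrier N"
  and additive_map_add: "additive_map M N f \<Longrightarrow> x \<in> carrier M \<Longrightarrow> y \<in> carrier M \<Longrightarrow> f (x \<oplus>\<^bsub>M\<^esub> y) = f x \<oplus>\<^bsub>N\<^esub> f y"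
  by (auto simp: additive_map_def)

lemma additive_map_minus:
  assumes M: "abelian_group M" and N: "abelian_group N" and f: "additive_map M N f" and x: "x \<in> carrier M"
  shows "f (\<ominus>\<^bsub>M\<^esub> x) = \<ominus>\<^bsub>N\<^esub> f x"
proof -
  interpret M: abelian_group M by fact
  interpret N: abelian_group N by fact
  have "f (\<ominus>\<^bsub>M\<^esub> x) \<oplus>\<^bsub>N\<^esub> f x = f (\<ominus>\<^bsub>M\<^esub> x \<oplus>\<^bsub>M\<^esub> x)"
    using x by (intro additive_map_add[OF f, symmetric]) auto
  also have "\<dots> = \<zero>\<^bsub>N\<^esub>" using x additive_map_zero[OF M N f] by (simp add: M.l_neg)
  finally show ?thesis
    using additive_map_closed[OF f] x by (intro N.minus_equality[symmetric]) auto
qed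

lemma additive_map_inj_onI:
  assumes M: "abelian_group M" and N: "abelian_group N" and f: "additive_map M N f"
    and ker: "\<And>x. x \<in> carrier M \<Longrightarrow> f x = \<zero>\<^bsub>N\<^esub> \<Longrightarrow> x = \<zero>\<^bsub>M\<^esub>"
  shows "inj_on f (carrier M)"
proof (rule inj_onI)
  interpret M: abelian_group M by fact
  interpret N: abelian_group N by fact
  fix x y assume xy: "x \<in> carrier M" "y \<in> carrier M" "f x = f y"
  have "f (x \<oplus>\<^bsub>M\<^esub> \<ominus>\<^bsub>M\<^esub> y) = f y \<oplus>\<^bsub>N\<^esub> \<ominus>\<^bsub>N\<^esub> f y"
    using xy additive_map_add[OF f, of x "\<ominus>\<^bsub>M\<^esub> y"] additive_map_minus[OF M N f] by simp
  also have "\<dots> = \<zero>\<^bsub>N\<^esub>" using xy additive_map_closed[OF f] by (intro N.r_neg) auto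
  finally have "x \<oplus>\<^bsub>M\<^esub> \<ominus>\<^bsub>M\<^esub> y = \<zero>\<^bsub>M\<^esub>" using xy by (intro ker) auto
  then show "x = y" using xy M.minus_equality[of x "\<ominus>\<^bsub>M\<^esub> y"] by simp
qed

lemma hol_alpha_closed:
  assumes "f \<in> carrier hol_ring" "q \<noteq> 0" shows "hol_alpha q f \<in> carrier hol_ring"
proof -
  have m: "(\<lambda>z. q * z) holomorphic_on -{0}" by (intro holomorphic_intros)
  have "f \<circ> (\<lambda>z. q * z) holomorphic_on -{0}"
    by (rule holomorphic_on_compose_gen[OF m, of f "-{0}"]) (use assms in \<open>auto simp: hol_carrier_iff\<close>)
  then show ?thesis unfolding hol_alpha_def o_def by (rule restrict_hol_closed)
qed

text \<open>The module \<open>trunc_obj\<close> below is the span of the last \<open>n - r\<close> basis vectors, with \<open>\<nabla>\<close> and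
  \<open>\<sigma>\<close> followed by the projection along the first \<open>r\<close>. In bases adapted to a morphism of rank \<open>r\<close> it
  is the kernel when formed in the source and the cokernel when formed in the target.\<close>

locale const_object =
  fixes q \<tau> :: complex and M :: "'m B_object" and n :: nat and e :: "nat \<Rightarrow> 'm"
    and B :: "nat \<Rightarrow> nat \<Rightarrow> complex" and r :: nat
  assumes M_obj: "M \<in> B_objects q \<tau>" and q: "q \<noteq> 0" and cb: "const_basis M (nabla M) n e B" and rn: "r \<le> n"

sublocale const_object \<subseteq> hol_module M n e
  using hol_moduleI B_objectD(1)[OF M_obj] cb by (auto simp: const_basis_def)

context const_object
begin

lemma nabla_additive: "additive_map M M (nabla M)"
  and nabla_leibniz: "f \<in> carrier hol_ring \<Longrightarrow> x \<in> carrier M \<Longrightarrow>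
    nabla M (f \<odot>\<^bsub>M\<^esub> x) = (f \<odot>\<^bsub>M\<^esub> nabla M x) \<oplus>\<^bsub>M\<^esub> (hol_delta \<tau> f \<odot>\<^bsub>M\<^esub> x)"
  and nabla_const: "x \<in> carrier M \<Longrightarrow> nabla M (hol_const c \<odot>\<^bsub>M\<^esub> x) = hol_const c \<odot>\<^bsub>M\<^esub> nabla M x"
  using B_objectD(5)[OF M_obj] by (auto simp: is_connection_def)

lemma nabla_closed: "x \<in> carrier M \<Longrightarrow> nabla M x \<in> carrier M"
  by (rule additive_map_closed[OF nabla_additive])

lemma sigma_closed: "x \<in> carrier M \<Longrightarrow> sigma M x \<in> carrier M"
  by (rule additive_map_closed[OF B_objectD(3)[OF M_obj]])

definition trunc :: "'m set" where
  "trunc = {x \<in> carrier M. \<forall>j<r. \<forall>z. z \<noteq> 0 \<longrightarrow> crd x j z = 0}"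

definition proj :: "'m \<Rightarrow> 'm" where
  "proj x = (\<Oplus>\<^bsub>M\<^esub>j\<in>{r..<n}. crd x j \<odot>\<^bsub>M\<^esub> e j)"

definition rest :: "'m \<Rightarrow> 'm" where
  "rest x = (\<Oplus>\<^bsub>M\<^esub>j\<in>{..<r}. crd x j \<odot>\<^bsub>M\<^esub> e j)"

lemma partial_sum:
  assumes x: "x \<in> carrier M" and A: "A \<subseteq> {..<n}"
  shows "(\<Oplus>\<^bsub>M\<^esub>j\<in>A. crd x j \<odot>\<^bsub>M\<^esub> e j) \<in> carrier M"
    "j < n \<Longrightarrow> z \<noteq> 0 \<Longrightarrow> crd (\<Oplus>\<^bsub>M\<^esub>j\<in>A. crd x j \<odot>\<^bsub>M\<^esub> e j) j z = (if j \<in> A then crd x j z else 0)"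
proof -
  have fin: "finite A" using A finite_subset by blast
  show "(\<Oplus>\<^bsub>M\<^esub>j\<in>A. crd x j \<odot>\<^bsub>M\<^esub> e j) \<in> carrier M"
    by (intro M.finsum_closed) (use x A in \<open>auto intro!: smult_closed crd_closed e_closed\<close>)
  assume jz: "j < n" "z \<noteq> 0"
  have "crd (\<Oplus>\<^bsub>M\<^esub>j\<in>A. crd x j \<odot>\<^bsub>M\<^esub> e j) j z = (\<Sum>i\<in>A. crd x i z * crd (e i) j z)"
    by (rule crd_lincomb_apply) (use fin x A jz in \<open>auto intro!: crd_closed e_closed\<close>)
  also have "\<dots> = (\<Sum>i\<in>A. if i = j then crd x j z else 0)"
    by (intro sum.cong refl) (use A jz in \<open>auto simp: crd_basis_apply subset_iff\<close>)
  also have "\<dots> = (if j \<in> A then crd x j z else 0)" using fin by simp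
  finally show "crd (\<Oplus>\<^bsub>M\<^esub>j\<in>A. crd x j \<odot>\<^bsub>M\<^esub> e j) j z = (if j \<in> A then crd x j z else 0)" .
qed

lemma proj_closed: "x \<in> carrier M \<Longrightarrow> proj x \<in> carrier M"
  and rest_closed: "x \<in> carrier M \<Longrightarrow> rest x \<in> carrier M"
  unfolding proj_def rest_def using rn by (auto intro!: partial_sum(1))

lemma crd_proj: "x \<in> carrier M \<Longrightarrow> j < n \<Longrightarrow> z \<noteq> 0 \<Longrightarrow> crd (proj x) j z = (if r \<le> j then crd x j z else 0)"
  unfolding proj_def by (subst partial_sum(2)) auto

lemma crd_rest: "x \<in> carrier M \<Longrightarrow> j < n \<Longrightarrow> z \<noteq> 0 \<Longrightarrow> crd (rest x) j z = (if j < r then crd x j z else 0)"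
  unfolding rest_def using rn by (subst partial_sum(2)) auto

lemma trunc_carrier: "x \<in> trunc \<Longrightarrow> x \<in> carrier M"
  and trunc_crd: "x \<in> trunc \<Longrightarrow> j < r \<Longrightarrow> z \<noteq> 0 \<Longrightarrow> crd x j z = 0"
  by (auto simp: trunc_def)

lemma proj_trunc: "x \<in> carrier M \<Longrightarrow> proj x \<in> trunc"
  using rn by (auto simp: trunc_def proj_closed crd_proj)

lemma proj_id: "x \<in> trunc \<Longrightarrow> proj x = x"
  by (rule eq_by_crd) (auto simp: trunc_carrier proj_closed crd_proj trunc_crd)

lemma proj_rest: "x \<in> carrier M \<Longrightarrow> x = proj x \<oplus>\<^bsub>M\<^esub> rest x"
  by (rule eq_by_crd) (auto simp: proj_closed rest_closed crd_proj crd_rest crd_add_apply)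

lemma proj_add: "x \<in> carrier M \<Longrightarrow> y \<in> carrier M \<Longrightarrow> proj (x \<oplus>\<^bsub>M\<^esub> y) = proj x \<oplus>\<^bsub>M\<^esub> proj y"
  by (rule eq_by_crd) (auto simp: proj_closed crd_proj crd_add_apply)

lemma proj_smult: "f \<in> carrier hol_ring \<Longrightarrow> x \<in> carrier M \<Longrightarrow> proj (f \<odot>\<^bsub>M\<^esub> x) = f \<odot>\<^bsub>M\<^esub> proj x"
  by (rule eq_by_crd) (auto simp: proj_closed crd_proj crd_smult_apply smult_closed)

lemma trunc_add: "x \<in> trunc \<Longrightarrow> y \<in> trunc \<Longrightarrow> x \<oplus>\<^bsub>M\<^esub> y \<in> trunc"
  using rn by (auto simp: trunc_def crd_add_apply)

lemma trunc_smult: "f \<in> carrier hol_ring \<Longrightarrow> x \<in> trunc \<Longrightarrow> f \<odot>\<^bsub>M\<^esub> x \<in> trunc"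
  using rn by (auto simp: trunc_def crd_smult_apply smult_closed)

lemma trunc_zero: "\<zero>\<^bsub>M\<^esub> \<in> trunc"
  using rn by (auto simp: trunc_def crd_zero_apply)

definition trunc_obj :: "'m B_object" where
  "trunc_obj = M\<lparr>carrier := trunc, nabla := (\<lambda>x. proj (nabla M x)), sigma := (\<lambda>x. proj (sigma M x))\<rparr>"

lemma trunc_obj_simps [simp]:
  "carrier trunc_obj = trunc" "add trunc_obj = add M" "zero trunc_obj = zero M" "smult trunc_obj = smult M"
  "nabla trunc_obj = (\<lambda>x. proj (nabla M x))" "sigma trunc_obj = (\<lambda>x. proj (sigma M x))"
  by (simp_all add: trunc_obj_def)

lemma abelian_group_trunc: "abelian_group trunc_obj"
proof (rule abelian_groupI)
  fix x assume "x \<in> carrier trunc_obj"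
  then have x: "x \<in> trunc" by simp
  have "\<ominus>\<^bsub>M\<^esub> x \<in> trunc"
  proof -
    have "\<ominus>\<^bsub>M\<^esub> x = (\<ominus>\<^bsub>hol_ring\<^esub> \<one>\<^bsub>hol_ring\<^esub>) \<odot>\<^bsub>M\<^esub> x"
      using trunc_carrier[OF x] by (simp add: smult_l_minus)
    then show ?thesis using x by (simp add: trunc_smult)
  qed
  then show "\<exists>y\<in>carrier trunc_obj. y \<oplus>\<^bsub>trunc_obj\<^esub> x = \<zero>\<^bsub>trunc_obj\<^esub>"
    by (intro bexI[of _ "\<ominus>\<^bsub>M\<^esub> x"]) (use trunc_carrier[OF x] in \<open>simp_all add: M.l_neg\<close>)
qed (auto simp: trunc_zero trunc_add trunc_carrier M.a_ac)

lemma module_trunc: "Module.module hol_ring trunc_obj"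
  by (rule moduleI[OF cring_hol_ring abelian_group_trunc])
    (auto simp: trunc_smult trunc_carrier smult_l_distr smult_r_distr smult_assoc1)

lemma finsum_trunc:
  assumes "finite A" "f \<in> A \<rightarrow> trunc" shows "finsum trunc_obj f A = finsum M f A"
  using assms
proof (induction A rule: finite_induct)
  case (insert a A)
  interpret T: abelian_group trunc_obj by (rule abelian_group_trunc)
  have "finsum trunc_obj f (insert a A) = f a \<oplus>\<^bsub>trunc_obj\<^esub> finsum trunc_obj f A"
    using insert by (intro T.finsum_insert) auto
  moreover have "finsum M f (insert a A) = f a \<oplus>\<^bsub>M\<^esub> finsum M f A"
    using insert trunc_carrier by (intro M.finsum_insert) auto
  ultimately show ?case using insert by simp
next
  case empty
  interpret T: abelian_group trunc_obj by (rule abelian_group_trunc)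
  show ?case by simp
qed

lemma e_trunc: "i < n - r \<Longrightarrow> e (r + i) \<in> trunc"
  using rn by (auto simp: trunc_def e_closed crd_basis_apply)

lemma crd_trunc_sum:
  assumes c: "c \<in> {..<n - r} \<rightarrow> carrier hol_ring"
  shows "(\<Oplus>\<^bsub>trunc_obj\<^esub>j\<in>{..<n - r}. c j \<odot>\<^bsub>trunc_obj\<^esub> e (r + j)) \<in> trunc"
    "j < n \<Longrightarrow> z \<noteq> 0 \<Longrightarrow> crd (\<Oplus>\<^bsub>trunc_obj\<^esub>j\<in>{..<n - r}. c j \<odot>\<^bsub>trunc_obj\<^esub> e (r + j)) j z = (if r \<le> j then c (j - r) z else 0)"
proof -
  interpret T: abelian_group trunc_obj by (rule abelian_group_trunc)
  have tr: "(\<lambda>j. c j \<odot>\<^bsub>M\<^esub> e (r + j)) \<in> {..<n - r} \<rightarrow> trunc"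
    using c by (auto intro!: trunc_smult e_trunc)
  show "(\<Oplus>\<^bsub>trunc_obj\<^esub>j\<in>{..<n - r}. c j \<odot>\<^bsub>trunc_obj\<^esub> e (r + j)) \<in> trunc"
    using T.finsum_closed[of "\<lambda>j. c j \<odot>\<^bsub>M\<^esub> e (r + j)" "{..<n - r}"] tr by simp
  assume jz: "j < n" "z \<noteq> 0"
  have "crd (\<Oplus>\<^bsub>trunc_obj\<^esub>j\<in>{..<n - r}. c j \<odot>\<^bsub>trunc_obj\<^esub> e (r + j)) j z
      = (\<Sum>i<n - r. c i z * crd (e (r + i)) j z)"
    using finsum_trunc[OF _ tr] crd_lincomb_apply[of "{..<n - r}" "\<lambda>j. e (r + j)" c j z] c jz e_trunc trunc_carrier by auto
  also have "\<dots> = (\<Sum>i<n - r. if r + i = j then c i z else 0)"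
    using jz by (intro sum.cong refl) (auto simp: crd_basis_apply)
  also have "\<dots> = (\<Sum>i<n - r. if r \<le> j \<and> i = j - r then c (j - r) z else 0)"
    by (intro sum.cong refl) auto
  also have "\<dots> = (if r \<le> j then c (j - r) z else 0)"
    using jz by auto
  finally show "crd (\<Oplus>\<^bsub>trunc_obj\<^esub>j\<in>{..<n - r}. c j \<odot>\<^bsub>trunc_obj\<^esub> e (r + j)) j z = (if r \<le> j then c (j - r) z else 0)" .
qed

lemma basis_trunc: "module_basis hol_ring trunc_obj (n - r) (\<lambda>i. e (r + i))"
  unfolding module_basis_def
proof (intro conjI ballI)
  show "(\<lambda>i. e (r + i)) \<in> {..<n - r} \<rightarrow> carrier trunc_obj" using e_trunc by simp
  fix x assume "x \<in> carrier trunc_obj"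
  then have x: "x \<in> trunc" by simp
  define d where "d = (\<lambda>i\<in>{..<n - r}. crd x (r + i))"
  have d: "d \<in> {..<n - r} \<rightarrow>\<^sub>E carrier hol_ring"
    using trunc_carrier[OF x] by (auto simp: d_def intro!: crd_closed)
  show "\<exists>!c. c \<in> {..<n - r} \<rightarrow>\<^sub>E carrier hol_ring \<and> x = (\<Oplus>\<^bsub>trunc_obj\<^esub>j\<in>{..<n - r}. c j \<odot>\<^bsub>trunc_obj\<^esub> e (r + j))"
  proof (rule ex1I[of _ d])
    have d': "d \<in> {..<n - r} \<rightarrow> carrier hol_ring" using d by auto
    have "x = (\<Oplus>\<^bsub>trunc_obj\<^esub>j\<in>{..<n - r}. d j \<odot>\<^bsub>trunc_obj\<^esub> e (r + j))"
      by (rule eq_by_crd) (use x d' in \<open>auto simp del: trunc_obj_simps simp: trunc_carrier crd_trunc_sum trunc_crd, auto simp: d_def\<close>)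
    then show "d \<in> {..<n - r} \<rightarrow>\<^sub>E carrier hol_ring \<and> x = (\<Oplus>\<^bsub>trunc_obj\<^esub>j\<in>{..<n - r}. d j \<odot>\<^bsub>trunc_obj\<^esub> e (r + j))"
      using d by blast
    fix c assume c: "c \<in> {..<n - r} \<rightarrow>\<^sub>E carrier hol_ring \<and> x = (\<Oplus>\<^bsub>trunc_obj\<^esub>j\<in>{..<n - r}. c j \<odot>\<^bsub>trunc_obj\<^esub> e (r + j))"
    then have c': "c \<in> {..<n - r} \<rightarrow> carrier hol_ring" by auto
    show "c = d"
    proof (rule extensionalityI[of _ "{..<n - r}"])
      fix i assume i: "i \<in> {..<n - r}"
      show "c i = d i"
      proof (rule hol_eqI)
        fix z :: complex assume z: "z \<noteq> 0"
        have "crd x (r + i) z = c i z" using crd_trunc_sum(2)[OF c', of "r + i" z] c i z by auto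
        then show "c i z = d i z" using i by (simp add: d_def)
      qed (use c' d' i in auto)
    qed (use c d in \<open>auto simp: PiE_def\<close>)
  qed
qed

text \<open>For an arbitrary basis the compressed operators need neither commute nor be bijective,
  so both facts are assumed and verified separately for kernel and cokernel. The Leibniz rule
  survives because the projection is linear over the ring and fixes \<open>trunc\<close>; the
  connection matrix is the lower right block of \<open>B\<close>.\<close>

lemma trunc_obj_in_B:
  assumes bij: "bij_betw (\<lambda>x. proj (sigma M x)) trunc trunc"
    and comm: "\<And>x. x \<in> trunc \<Longrightarrow> proj (nabla M (proj (sigma M x))) = proj (sigma M (proj (nabla M x)))"
  shows "trunc_obj \<in> B_objects q \<tau>"
  unfolding B_objects_def
proof (intro CollectI conjI)
  show "Module.module hol_ring trunc_obj" by (rule module_trunc)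
  show "finitely_presentable hol_ring trunc_obj" by (rule finitely_presentable_basis[OF module_trunc basis_trunc])
  show "bij_betw (sigma trunc_obj) (carrier trunc_obj) (carrier trunc_obj)" using bij by simp
  show "additive_map trunc_obj trunc_obj (sigma trunc_obj)"
    unfolding additive_map_def
    by (auto simp: trunc_carrier sigma_closed proj_trunc proj_add additive_map_add[OF B_objectD(3)[OF M_obj]])
  show "\<forall>f\<in>carrier hol_ring. \<forall>x\<in>carrier trunc_obj. sigma trunc_obj (f \<odot>\<^bsub>trunc_obj\<^esub> x) = hol_alpha q f \<odot>\<^bsub>trunc_obj\<^esub> sigma trunc_obj x"
    by (auto simp: trunc_carrier sigma_closed B_objectD(4)[OF M_obj] proj_smult hol_alpha_closed q)
  show "is_connection hol_ring hol_const (hol_delta \<tau>) trunc_obj (nabla trunc_obj)"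
    unfolding is_connection_def
  proof (intro conjI allI ballI)
    show "additive_map trunc_obj trunc_obj (nabla trunc_obj)"
      unfolding additive_map_def
      by (auto simp: trunc_carrier nabla_closed proj_trunc proj_add additive_map_add[OF nabla_additive])
    show "nabla trunc_obj (hol_const c \<odot>\<^bsub>trunc_obj\<^esub> x) = hol_const c \<odot>\<^bsub>trunc_obj\<^esub> nabla trunc_obj x"
      if "x \<in> carrier trunc_obj" for c x
      using that by (simp add: trunc_carrier nabla_const nabla_closed proj_smult hol_const_closed)
    show "nabla trunc_obj (f \<odot>\<^bsub>trunc_obj\<^esub> x)
        = (f \<odot>\<^bsub>trunc_obj\<^esub> nabla trunc_obj x) \<oplus>\<^bsub>trunc_obj\<^esub> (hol_delta \<tau> f \<odot>\<^bsub>trunc_obj\<^esub> x)"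
      if "f \<in> carrier hol_ring" "x \<in> carrier trunc_obj" for f x
      using that
      by (simp add: trunc_carrier nabla_closed nabla_leibniz proj_add proj_smult smult_closed hol_delta_closed proj_id)
  qed
  show "\<forall>x\<in>carrier trunc_obj. nabla trunc_obj (sigma trunc_obj x) = sigma trunc_obj (nabla trunc_obj x)"
    using comm by simp
  show "regular_singular trunc_obj (nabla trunc_obj)"
    unfolding regular_singular_def
  proof (intro exI conjI allI impI)
    show "module_basis hol_ring trunc_obj (n - r) (\<lambda>i. e (r + i))" by (rule basis_trunc)
    fix i j
    show "hol_const (B (r + i) (r + j)) \<in> carrier hol_ring" by (rule hol_const_closed)
    show "at_most_simple_pole (\<lambda>z. inverse z * hol_const (B (r + i) (r + j)) z) 0" by (rule at_most_simple_pole_const)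
  next
    fix i assume i: "i < n - r"
    have c: "(\<lambda>j. hol_const (B (r + i) (r + j))) \<in> {..<n - r} \<rightarrow> carrier hol_ring" by (simp add: hol_const_closed)
    have "proj (nabla M (e (r + i))) = (\<Oplus>\<^bsub>trunc_obj\<^esub>j\<in>{..<n - r}. hol_const (B (r + i) (r + j)) \<odot>\<^bsub>trunc_obj\<^esub> e (r + j))"
    proof (rule eq_by_crd)
      show "proj (nabla M (e (r + i))) \<in> carrier M" using i by (simp add: proj_closed nabla_closed e_closed)
      show "(\<Oplus>\<^bsub>trunc_obj\<^esub>j\<in>{..<n - r}. hol_const (B (r + i) (r + j)) \<odot>\<^bsub>trunc_obj\<^esub> e (r + j)) \<in> carrier M"
        by (rule trunc_carrier[OF crd_trunc_sum(1)[OF c]])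
      fix j z assume jz: "j < n" "z \<noteq> (0::complex)"
      have "crd (nabla M (e (r + i))) j z = B (r + i) j"
        by (rule const_basis_crd[OF B_objectD(1)[OF M_obj] cb]) (use i jz in auto)
      then show "crd (proj (nabla M (e (r + i)))) j z
        = crd (\<Oplus>\<^bsub>trunc_obj\<^esub>j\<in>{..<n - r}. hol_const (B (r + i) (r + j)) \<odot>\<^bsub>trunc_obj\<^esub> e (r + j)) j z"
        unfolding crd_trunc_sum(2)[OF c jz] using i jz by (simp add: crd_proj nabla_closed e_closed hol_const_apply)
    qed
    then show "nabla trunc_obj (e (r + i)) = (\<Oplus>\<^bsub>trunc_obj\<^esub>j\<in>{..<n - r}. hol_const (B (r + i) (r + j)) \<odot>\<^bsub>trunc_obj\<^esub> e (r + j))"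
      by simp
  qed
qed

end

text \<open>The morphism condition of \<open>B_cat\<close> without extensionality, so that plain
  functions such as the identity and \<open>proj\<close> qualify.\<close>

definition B_morphism :: "'m B_object \<Rightarrow> 'm B_object \<Rightarrow> ('m \<Rightarrow> 'm) \<Rightarrow> bool" where
  "B_morphism M N f \<longleftrightarrow> module_map hol_ring M N f \<and>
     (\<forall>x\<in>carrier M. f (sigma M x) = sigma N (f x)) \<and> (\<forall>x\<in>carrier M. f (nabla M x) = nabla N (f x))"

section \<open>Kernel and cokernel of a morphism in adapted bases\<close>

locale B_adapted =
  X: const_object q \<tau> X n e B r + Y: const_object q \<tau> Y m e' B' r
  for q \<tau> and X :: "'m B_object" and n e B r and Y :: "'m B_object" and m e' B' +
  fixes g assumes g: "B_morphism X Y g"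
    and ge: "\<And>i. i < n \<Longrightarrow> g (e i) = (if i < r then e' i else \<zero>\<^bsub>Y\<^esub>)"
begin

lemma g_additive: "additive_map X Y g"
  and g_smult: "f \<in> carrier hol_ring \<Longrightarrow> x \<in> carrier X \<Longrightarrow> g (f \<odot>\<^bsub>X\<^esub> x) = f \<odot>\<^bsub>Y\<^esub> g x"
  and g_closed: "x \<in> carrier X \<Longrightarrow> g x \<in> carrier Y"
  and g_sigma: "x \<in> carrier X \<Longrightarrow> g (sigma X x) = sigma Y (g x)"
  and g_nabla: "x \<in> carrier X \<Longrightarrow> g (nabla X x) = nabla Y (g x)"
  using g by (auto simp: B_morphism_def module_map_def additive_map_def)

lemma crd_g:
  assumes x: "x \<in> carrier X" and j: "j < m" and z: "z \<noteq> 0"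
  shows "Y.crd (g x) j z = (if j < r then X.crd x j z else 0)"
proof -
  have "g x = g (\<Oplus>\<^bsub>X\<^esub>i\<in>{..<n}. X.crd x i \<odot>\<^bsub>X\<^esub> e i)" by (simp add: X.crd_sum x)
  also have "\<dots> = (\<Oplus>\<^bsub>Y\<^esub>i\<in>{..<n}. g (X.crd x i \<odot>\<^bsub>X\<^esub> e i))"
    by (rule additive_map_finsum[OF X.M.abelian_group_axioms Y.M.abelian_group_axioms g_additive])
      (use x in \<open>auto intro!: X.smult_closed X.e_closed X.crd_closed\<close>)
  also have "\<dots> = (\<Oplus>\<^bsub>Y\<^esub>i\<in>{..<n}. X.crd x i \<odot>\<^bsub>Y\<^esub> g (e i))"
    by (rule Y.M.finsum_cong') (use x in \<open>auto simp: g_smult X.crd_closed X.e_closed intro!: Y.smult_closed g_closed\<close>)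
  finally have "Y.crd (g x) j z = (\<Sum>i<n. X.crd x i z * Y.crd (g (e i)) j z)"
    using j z x by (simp, subst Y.crd_lincomb_apply) (auto intro!: g_closed X.e_closed X.crd_closed)
  also have "\<dots> = (\<Sum>i<n. if i = j then (if j < r then X.crd x j z else 0) else 0)"
    using j z Y.rn by (intro sum.cong refl) (auto simp: ge Y.crd_basis_apply Y.crd_zero_apply)
  also have "\<dots> = (if j < r then X.crd x j z else 0)" using X.rn by auto
  finally show ?thesis .
qed

lemma kernel_eq: "X.trunc = {x \<in> carrier X. g x = \<zero>\<^bsub>Y\<^esub>}"
proof (intro equalityI subsetI)
  fix x assume x: "x \<in> X.trunc"
  have "g x = \<zero>\<^bsub>Y\<^esub>"
    by (rule Y.eq_by_crd) (use X.trunc_carrier[OF x] X.trunc_crd[OF x] in \<open>auto simp: g_closed crd_g Y.crd_zero_apply\<close>)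
  then show "x \<in> {x \<in> carrier X. g x = \<zero>\<^bsub>Y\<^esub>}" using X.trunc_carrier[OF x] by simp
next
  fix x assume x: "x \<in> {x \<in> carrier X. g x = \<zero>\<^bsub>Y\<^esub>}"
  have "X.crd x j z = 0" if "j < r" "z \<noteq> 0" for j z
    using crd_g[of x j z] x that Y.rn by (simp add: Y.crd_zero_apply)
  then show "x \<in> X.trunc" using x by (simp add: X.trunc_def)
qed

lemma image_iff: "y \<in> g ` carrier X \<longleftrightarrow> y \<in> carrier Y \<and> (\<forall>j<m. r \<le> j \<longrightarrow> (\<forall>z. z \<noteq> 0 \<longrightarrow> Y.crd y j z = 0))"
proof
  assume "y \<in> g ` carrier X"
  then show "y \<in> carrier Y \<and> (\<forall>j<m. r \<le> j \<longrightarrow> (\<forall>z. z \<noteq> 0 \<longrightarrow> Y.crd y j z = 0))"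
    by (auto simp: g_closed crd_g)
next
  assume y: "y \<in> carrier Y \<and> (\<forall>j<m. r \<le> j \<longrightarrow> (\<forall>z. z \<noteq> 0 \<longrightarrow> Y.crd y j z = 0))"
  define c where "c = (\<lambda>j. if j < r then Y.crd y j else \<zero>\<^bsub>hol_ring\<^esub>)"
  define x where "x = (\<Oplus>\<^bsub>X\<^esub>j\<in>{..<n}. c j \<odot>\<^bsub>X\<^esub> e j)"
  have c: "c \<in> {..<n} \<rightarrow> carrier hol_ring" using y Y.rn by (auto simp: c_def intro!: Y.crd_closed)
  have x: "x \<in> carrier X" unfolding x_def by (rule X.sum_closed[OF c])
  have cx: "X.crd x j = c j" if "j < n" for j unfolding x_def by (rule X.crd_unique[OF c that])
  have "Y.crd (g x) j z = Y.crd y j z" if "j < m" "z \<noteq> 0" for j z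
    using crd_g[OF x that] cx[of j] y that X.rn by (cases "j < r") (auto simp: c_def)
  then have "g x = y" using x y by (intro Y.eq_by_crd) (auto simp: g_closed)
  then show "y \<in> g ` carrier X" using x by blast
qed

text \<open>The kernel is stable under both operators, so compression changes nothing on it. For
  surjectivity of \<sigma> on the kernel, a preimage \<open>x\<close> of a kernel element has
  \<open>sigma Y (g x) = 0\<close>, and injectivity of \<sigma> on the target puts \<open>x\<close>
  into the kernel.\<close>

lemma kernel_obj: "X.trunc_obj \<in> B_objects q \<tau>"
  "\<And>x. x \<in> X.trunc \<Longrightarrow> nabla X.trunc_obj x = nabla X x"
  "\<And>x. x \<in> X.trunc \<Longrightarrow> sigma X.trunc_obj x = sigma X x"
proof -
  have D: "nabla X x \<in> X.trunc" if "x \<in> X.trunc" for x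
    using that additive_map_zero[OF Y.M.abelian_group_axioms Y.M.abelian_group_axioms Y.nabla_additive]
    unfolding kernel_eq by (simp add: X.nabla_closed g_nabla)
  have s0: "sigma Y \<zero>\<^bsub>Y\<^esub> = \<zero>\<^bsub>Y\<^esub>"
    by (rule additive_map_zero[OF Y.M.abelian_group_axioms Y.M.abelian_group_axioms B_objectD(3)[OF Y.M_obj]])
  have S: "sigma X x \<in> X.trunc" if "x \<in> X.trunc" for x
    using that s0 unfolding kernel_eq by (simp add: X.sigma_closed g_sigma)
  have pS: "X.proj (sigma X x) = sigma X x" and pD: "X.proj (nabla X x) = nabla X x" if "x \<in> X.trunc" for x
    using X.proj_id S D that by auto
  show "nabla X.trunc_obj x = nabla X x" "sigma X.trunc_obj x = sigma X x" if "x \<in> X.trunc" for x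
    using pS pD that by auto
  have "bij_betw (\<lambda>x. X.proj (sigma X x)) X.trunc X.trunc"
    unfolding bij_betw_def
  proof
    show "inj_on (\<lambda>x. X.proj (sigma X x)) X.trunc"
    proof (rule inj_onI)
      fix x y assume "x \<in> X.trunc" "y \<in> X.trunc" "X.proj (sigma X x) = X.proj (sigma X y)"
      then show "x = y"
        using B_objectD(2)[OF X.M_obj] X.trunc_carrier pS by (auto simp: bij_betw_def inj_on_def)
    qed
    show "(\<lambda>x. X.proj (sigma X x)) ` X.trunc = X.trunc"
    proof (intro equalityI subsetI)
      fix y assume y: "y \<in> X.trunc"
      then have "y \<in> sigma X ` carrier X"
        using B_objectD(2)[OF X.M_obj] X.trunc_carrier[OF y] by (auto simp: bij_betw_def)
      then obtain x where x: "x \<in> carrier X" "y = sigma X x" by blast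
      have "sigma Y (g x) = sigma Y \<zero>\<^bsub>Y\<^esub>" using y x s0 unfolding kernel_eq by (simp add: g_sigma)
      then have "g x = \<zero>\<^bsub>Y\<^esub>"
        using B_objectD(2)[OF Y.M_obj] g_closed[OF x(1)] by (auto simp: bij_betw_def inj_on_def)
      then have "x \<in> X.trunc" using x unfolding kernel_eq by simp
      then show "y \<in> (\<lambda>x. X.proj (sigma X x)) ` X.trunc" using x pS by (intro image_eqI[of _ _ x]) auto
    qed (use S pS in auto)
  qed
  moreover have "X.proj (nabla X (X.proj (sigma X x))) = X.proj (sigma X (X.proj (nabla X x)))" if "x \<in> X.trunc" for x
    using that S D by (simp add: pS pD B_objectD(6)[OF X.M_obj] X.trunc_carrier)
  ultimately show "X.trunc_obj \<in> B_objects q \<tau>" by (rule X.trunc_obj_in_B)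
qed

lemma proj_zero_iff: "y \<in> carrier Y \<Longrightarrow> Y.proj y = \<zero>\<^bsub>Y\<^esub> \<longleftrightarrow> y \<in> g ` carrier X"
proof
  assume y: "y \<in> carrier Y" "Y.proj y = \<zero>\<^bsub>Y\<^esub>"
  have "Y.crd y j z = 0" if "j < m" "r \<le> j" "z \<noteq> 0" for j z
    using Y.crd_proj[OF y(1) that(1,3)] that y(2) by (simp add: Y.crd_zero_apply)
  then show "y \<in> g ` carrier X" using y by (simp add: image_iff)
next
  assume y: "y \<in> carrier Y" "y \<in> g ` carrier X"
  show "Y.proj y = \<zero>\<^bsub>Y\<^esub>"
    by (rule Y.eq_by_crd) (use y in \<open>auto simp: Y.proj_closed Y.crd_proj Y.crd_zero_apply image_iff\<close>)
qed

lemma rest_image: "y \<in> carrier Y \<Longrightarrow> Y.rest y \<in> g ` carrier X"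
  by (auto simp: image_iff Y.rest_closed Y.crd_rest)

text \<open>The difference between \<open>y\<close> and its projection lies in the image of
  \<open>g\<close>. The image is stable under \<sigma> and killed by the projection, so the
  compressed operator is the one induced on the quotient by the image.\<close>

lemma proj_sigma_proj: "y \<in> carrier Y \<Longrightarrow> Y.proj (sigma Y (Y.proj y)) = Y.proj (sigma Y y)"
proof -
  assume y: "y \<in> carrier Y"
  have im: "sigma Y (Y.rest y) \<in> g ` carrier X"
    using rest_image[OF y] by (auto simp: g_sigma[symmetric] X.sigma_closed)
  have "sigma Y y = sigma Y (Y.proj y) \<oplus>\<^bsub>Y\<^esub> sigma Y (Y.rest y)"
    using Y.proj_rest[OF y] additive_map_add[OF B_objectD(3)[OF Y.M_obj] Y.proj_closed[OF y] Y.rest_closed[OF y]] by simp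
  then have "Y.proj (sigma Y y) = Y.proj (sigma Y (Y.proj y)) \<oplus>\<^bsub>Y\<^esub> Y.proj (sigma Y (Y.rest y))"
    using y by (simp add: Y.proj_add Y.sigma_closed Y.proj_closed Y.rest_closed)
  also have "Y.proj (sigma Y (Y.rest y)) = \<zero>\<^bsub>Y\<^esub>"
    using im y proj_zero_iff Y.sigma_closed Y.rest_closed by blast
  finally show ?thesis using y by (simp add: Y.proj_closed Y.sigma_closed)
qed

lemma proj_nabla_proj: "y \<in> carrier Y \<Longrightarrow> Y.proj (nabla Y (Y.proj y)) = Y.proj (nabla Y y)"
proof -
  assume y: "y \<in> carrier Y"
  have im: "nabla Y (Y.rest y) \<in> g ` carrier X"
    using rest_image[OF y] by (auto simp: g_nabla[symmetric] X.nabla_closed)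
  have "nabla Y y = nabla Y (Y.proj y) \<oplus>\<^bsub>Y\<^esub> nabla Y (Y.rest y)"
    using Y.proj_rest[OF y] additive_map_add[OF Y.nabla_additive Y.proj_closed[OF y] Y.rest_closed[OF y]] by simp
  then have "Y.proj (nabla Y y) = Y.proj (nabla Y (Y.proj y)) \<oplus>\<^bsub>Y\<^esub> Y.proj (nabla Y (Y.rest y))"
    using y by (simp add: Y.proj_add Y.nabla_closed Y.proj_closed Y.rest_closed)
  also have "Y.proj (nabla Y (Y.rest y)) = \<zero>\<^bsub>Y\<^esub>"
    using im y proj_zero_iff Y.nabla_closed Y.rest_closed by blast
  finally show ?thesis using y by (simp add: Y.proj_closed Y.nabla_closed)
qed

text \<open>For injectivity, let \<open>sigma Y x\<close> lie in the image, say equal to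
  \<open>g w\<close>. As \<sigma> is onto in the source, \<open>w = sigma X v\<close>; then
  \<open>x = g v\<close> by injectivity of \<sigma> in the target, so \<open>x\<close> projects to
  0. Commutation and surjectivity descend from the target.\<close>

lemma cokernel_obj: "Y.trunc_obj \<in> B_objects q \<tau>"
proof (rule Y.trunc_obj_in_B)
  show "Y.proj (nabla Y (Y.proj (sigma Y x))) = Y.proj (sigma Y (Y.proj (nabla Y x)))" if "x \<in> Y.trunc" for x
    using Y.trunc_carrier[OF that]
    by (simp add: proj_nabla_proj proj_sigma_proj Y.sigma_closed Y.nabla_closed B_objectD(6)[OF Y.M_obj])
  have ad: "additive_map Y.trunc_obj Y.trunc_obj (\<lambda>x. Y.proj (sigma Y x))"
    unfolding additive_map_def
    by (auto simp: Y.trunc_carrier Y.sigma_closed Y.proj_trunc Y.proj_add additive_map_add[OF B_objectD(3)[OF Y.M_obj]])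
  show "bij_betw (\<lambda>x. Y.proj (sigma Y x)) Y.trunc Y.trunc"
    unfolding bij_betw_def
  proof
    have "inj_on (\<lambda>x. Y.proj (sigma Y x)) (carrier Y.trunc_obj)"
    proof (rule additive_map_inj_onI[OF Y.abelian_group_trunc Y.abelian_group_trunc ad])
      fix x assume "x \<in> carrier Y.trunc_obj" "Y.proj (sigma Y x) = \<zero>\<^bsub>Y.trunc_obj\<^esub>"
      then have x: "x \<in> Y.trunc" "Y.proj (sigma Y x) = \<zero>\<^bsub>Y\<^esub>" by auto
      then have "sigma Y x \<in> g ` carrier X"
        using proj_zero_iff Y.sigma_closed Y.trunc_carrier by blast
      then obtain w where w: "w \<in> carrier X" "sigma Y x = g w" by blast
      moreover have "w \<in> sigma X ` carrier X" using w B_objectD(2)[OF X.M_obj] by (simp add: bij_betw_def)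
      ultimately obtain v where v: "v \<in> carrier X" "sigma Y x = sigma Y (g v)" by (auto simp: g_sigma)
      then have "x = g v"
        using B_objectD(2)[OF Y.M_obj] Y.trunc_carrier[OF x(1)] g_closed[OF v(1)] by (auto simp: bij_betw_def inj_on_def)
      then have "Y.proj x = \<zero>\<^bsub>Y\<^esub>" using v proj_zero_iff Y.trunc_carrier[OF x(1)] by blast
      then show "x = \<zero>\<^bsub>Y.trunc_obj\<^esub>" using Y.proj_id[OF x(1)] by simp
    qed
    then show "inj_on (\<lambda>x. Y.proj (sigma Y x)) Y.trunc" by simp
    show "(\<lambda>x. Y.proj (sigma Y x)) ` Y.trunc = Y.trunc"
    proof (intro equalityI subsetI)
      fix y assume y: "y \<in> Y.trunc"
      then have "y \<in> sigma Y ` carrier Y"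
        using B_objectD(2)[OF Y.M_obj] Y.trunc_carrier[OF y] by (auto simp: bij_betw_def)
      then obtain x where x: "x \<in> carrier Y" "y = sigma Y x" by blast
      have "Y.proj (sigma Y (Y.proj x)) = y" using x y by (simp add: proj_sigma_proj Y.proj_id)
      then show "y \<in> (\<lambda>x. Y.proj (sigma Y x)) ` Y.trunc" using Y.proj_trunc[OF x(1)] by blast
    qed (auto simp: Y.trunc_carrier Y.sigma_closed Y.proj_trunc)
  qed
qed

end

lemma kernel_cokernel_objects:
  fixes X Y :: "'m B_object"
  assumes X: "X \<in> B_objects q \<tau>" and Y: "Y \<in> B_objects q \<tau>" and \<tau>: "\<tau> \<noteq> 0" and q: "q \<noteq> 0"
    and g: "B_morphism X Y g"
  shows "\<exists>K\<in>B_objects q \<tau>. carrier K = {x \<in> carrier X. g x = \<zero>\<^bsub>Y\<^esub>} \<and> zero K = zero X \<and> B_morphism K X (\<lambda>x. x)"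
    and "\<exists>C\<in>B_objects q \<tau>. \<exists>p. B_morphism Y C p \<and> (\<forall>y\<in>carrier Y. p y = \<zero>\<^bsub>C\<^esub> \<longleftrightarrow> y \<in> g ` carrier X)"
proof -
  obtain n m r e e' B B' where a: "r \<le> n" "r \<le> m" "const_basis X (nabla X) n e B" "const_basis Y (nabla Y) m e' B'"
    "\<And>i. i < n \<Longrightarrow> g (e i) = (if i < r then e' i else \<zero>\<^bsub>Y\<^esub>)"
    by (rule adapted_bases[OF X Y \<tau>, of g]) (use g in \<open>simp_all add: B_morphism_def\<close>)
  interpret B_adapted q \<tau> X n e B r Y m e' B' g
    using X Y q g a by (intro B_adapted.intro const_object.intro B_adapted_axioms.intro) auto
  show "\<exists>K\<in>B_objects q \<tau>. carrier K = {x \<in> carrier X. g x = \<zero>\<^bsub>Y\<^esub>} \<and> zero K = zero X \<and> B_morphism K X (\<lambda>x. x)"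
  proof (rule bexI[OF _ kernel_obj(1)], intro conjI)
    show "carrier X.trunc_obj = {x \<in> carrier X. g x = \<zero>\<^bsub>Y\<^esub>}" using kernel_eq by simp
    show "B_morphism X.trunc_obj X (\<lambda>x. x)"
      unfolding B_morphism_def module_map_def additive_map_def
      using kernel_obj(2,3) by (auto simp: X.trunc_carrier)
  qed simp
  show "\<exists>C\<in>B_objects q \<tau>. \<exists>p. B_morphism Y C p \<and> (\<forall>y\<in>carrier Y. p y = \<zero>\<^bsub>C\<^esub> \<longleftrightarrow> y \<in> g ` carrier X)"
  proof (rule bexI[OF _ cokernel_obj], rule exI[of _ Y.proj], intro conjI ballI)
    show "B_morphism Y Y.trunc_obj Y.proj"
      unfolding B_morphism_def module_map_def additive_map_def
      by (auto simp: Y.proj_trunc Y.proj_add Y.proj_smult proj_sigma_proj proj_nabla_proj)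
    show "Y.proj y = \<zero>\<^bsub>Y.trunc_obj\<^esub> \<longleftrightarrow> y \<in> g ` carrier X" if "y \<in> carrier Y" for y
      using proj_zero_iff[OF that] by simp
  qed
qed

section \<open>Abelian groups with operators\<close>

lemma is_kernelD:
  "is_kernel C X Y Z f g \<Longrightarrow> W \<in> obj C \<Longrightarrow> h \<in> mor C W Y \<Longrightarrow> cmp C W Y Z g h = zerom C W Z \<Longrightarrow>
    \<exists>!k. k \<in> mor C W X \<and> cmp C W X Y f k = h"
  by (simp add: is_kernel_def)

lemma is_cokernelD:
  "is_cokernel C X Y Z f g \<Longrightarrow> W \<in> obj C \<Longrightarrow> h \<in> mor C Y W \<Longrightarrow> cmp C X Y W h f = zerom C X W \<Longrightarrow>
    \<exists>!k. k \<in> mor C Z W \<and> cmp C Y Z W k g = h"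
  by (simp add: is_cokernel_def)

lemma ex1_eqI: "\<exists>!x. P x \<Longrightarrow> P a \<Longrightarrow> P b \<Longrightarrow> a = b"
  by blast

text \<open>A common frame for both categories: scalar multiplications, connections and \<sigma> are
  all additive operators, and a morphism is an additive map commuting with them. Preadditivity and
  the comparison of categorical with set-theoretic exactness then need only one proof.\<close>

locale operator_category =
  fixes Ob :: "('m, 'x) ring_scheme set" and Op :: "(('m, 'x) ring_scheme \<Rightarrow> 'm \<Rightarrow> 'm) set"
  assumes grp: "X \<in> Ob \<Longrightarrow> abelian_group X"
    and op: "X \<in> Ob \<Longrightarrow> d \<in> Op \<Longrightarrow> additive_map X X (d X)"
begin

definition equivariant :: "('m, 'x) ring_scheme \<Rightarrow> ('m, 'x) ring_scheme \<Rightarrow> ('m \<Rightarrow> 'm) \<Rightarrow> bool" where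
  "equivariant X Y f \<longleftrightarrow> additive_map X Y f \<and> (\<forall>d\<in>Op. \<forall>x\<in>carrier X. f (d X x) = d Y (f x))"

abbreviation "C \<equiv> concrete_precat Ob equivariant"

lemma cat_simps [simp]:
  "obj C = Ob" "idm C X = (\<lambda>x\<in>carrier X. x)" "cmp C X Y Z g f = compose (carrier X) g f"
  "zerom C X Y = (\<lambda>x\<in>carrier X. \<zero>\<^bsub>Y\<^esub>)" "addm C X Y f g = (\<lambda>x\<in>carrier X. f x \<oplus>\<^bsub>Y\<^esub> g x)"
  by (simp_all add: concrete_precat_def)

lemma mor_iff: "f \<in> mor C X Y \<longleftrightarrow> f \<in> extensional (carrier X) \<and> equivariant X Y f"
  by (simp add: concrete_precat_def)

lemma op_closed: "X \<in> Ob \<Longrightarrow> d \<in> Op \<Longrightarrow> x \<in> carrier X \<Longrightarrow> d X x \<in> carrier X"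
  using additive_map_closed[OF op] .

lemma op_add: "X \<in> Ob \<Longrightarrow> d \<in> Op \<Longrightarrow> x \<in> carrier X \<Longrightarrow> y \<in> carrier X \<Longrightarrow> d X (x \<oplus>\<^bsub>X\<^esub> y) = d X x \<oplus>\<^bsub>X\<^esub> d X y"
  using additive_map_add[OF op] .

lemma op_zero: "X \<in> Ob \<Longrightarrow> d \<in> Op \<Longrightarrow> d X \<zero>\<^bsub>X\<^esub> = \<zero>\<^bsub>X\<^esub>"
  using additive_map_zero[OF grp grp op] .

lemma add_closed: "X \<in> Ob \<Longrightarrow> x \<in> carrier X \<Longrightarrow> y \<in> carrier X \<Longrightarrow> x \<oplus>\<^bsub>X\<^esub> y \<in> carrier X"
  by (rule abelian_monoid.a_closed[OF abelian_group.axioms(1)[OF grp]])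

lemma zero_closed: "X \<in> Ob \<Longrightarrow> \<zero>\<^bsub>X\<^esub> \<in> carrier X"
  by (rule abelian_monoid.zero_closed[OF abelian_group.axioms(1)[OF grp]])

lemma zero_add: "X \<in> Ob \<Longrightarrow> x \<in> carrier X \<Longrightarrow> \<zero>\<^bsub>X\<^esub> \<oplus>\<^bsub>X\<^esub> x = x"
  by (rule abelian_monoid.l_zero[OF abelian_group.axioms(1)[OF grp]])

lemma equivariantD:
  assumes "equivariant X Y f"
  shows "additive_map X Y f" "x \<in> carrier X \<Longrightarrow> f x \<in> carrier Y"
    "x \<in> carrier X \<Longrightarrow> y \<in> carrier X \<Longrightarrow> f (x \<oplus>\<^bsub>X\<^esub> y) = f x \<oplus>\<^bsub>Y\<^esub> f y"
    "d \<in> Op \<Longrightarrow> x \<in> carrier X \<Longrightarrow> f (d X x) = d Y (f x)"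
  using assms by (auto simp: equivariant_def additive_map_def)

lemma morI:
  assumes "X \<in> Ob" "f \<in> extensional (carrier X)" "\<And>x. x \<in> carrier X \<Longrightarrow> f x \<in> carrier Y"
    "\<And>x y. x \<in> carrier X \<Longrightarrow> y \<in> carrier X \<Longrightarrow> f (x \<oplus>\<^bsub>X\<^esub> y) = f x \<oplus>\<^bsub>Y\<^esub> f y"
    "\<And>d x. d \<in> Op \<Longrightarrow> x \<in> carrier X \<Longrightarrow> f (d X x) = d Y (f x)"
  shows "f \<in> mor C X Y"
  using assms by (auto simp: mor_iff equivariant_def additive_map_def)

lemma restrict_mor:
  assumes "X \<in> Ob" "equivariant X Y f" shows "restrict f (carrier X) \<in> mor C X Y"
  by (rule morI[OF assms(1)]) (auto simp: equivariantD[OF assms(2)] add_closed[OF assms(1)] op_closed[OF assms(1)])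

lemma morD: "f \<in> mor C X Y \<Longrightarrow> f \<in> extensional (carrier X)"
  "f \<in> mor C X Y \<Longrightarrow> equivariant X Y f"
  "f \<in> mor C X Y \<Longrightarrow> x \<in> carrier X \<Longrightarrow> f x \<in> carrier Y"
  "f \<in> mor C X Y \<Longrightarrow> x \<in> carrier X \<Longrightarrow> y \<in> carrier X \<Longrightarrow> f (x \<oplus>\<^bsub>X\<^esub> y) = f x \<oplus>\<^bsub>Y\<^esub> f y"
  "f \<in> mor C X Y \<Longrightarrow> d \<in> Op \<Longrightarrow> x \<in> carrier X \<Longrightarrow> f (d X x) = d Y (f x)"
  using equivariantD by (auto simp: mor_iff)

lemma mor_zero: "X \<in> Ob \<Longrightarrow> Y \<in> Ob \<Longrightarrow> f \<in> mor C X Y \<Longrightarrow> f \<zero>\<^bsub>X\<^esub> = \<zero>\<^bsub>Y\<^esub>"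
  using additive_map_zero[OF grp grp] equivariantD(1) morD(2) by blast

lemma zero_mor: "X \<in> Ob \<Longrightarrow> Y \<in> Ob \<Longrightarrow> (\<lambda>x\<in>carrier X. \<zero>\<^bsub>Y\<^esub>) \<in> mor C X Y"
  by (rule morI) (auto simp: zero_closed zero_add op_zero add_closed op_closed)

lemma comp_mor: "X \<in> Ob \<Longrightarrow> f \<in> mor C X Y \<Longrightarrow> g \<in> mor C Y Z \<Longrightarrow> compose (carrier X) g f \<in> mor C X Z"
  by (rule morI) (auto simp: compose_def morD add_closed op_closed)

lemma mor_eqI: "f \<in> mor C X Y \<Longrightarrow> g \<in> mor C X Y \<Longrightarrow> (\<And>x. x \<in> carrier X \<Longrightarrow> f x = g x) \<Longrightarrow> f = g"
  using extensionalityI[of f "carrier X" g] morD(1) by blast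

lemma sum_mor:
  assumes X: "X \<in> Ob" and Y: "Y \<in> Ob" and f: "f \<in> mor C X Y" and g: "g \<in> mor C X Y"
  shows "(\<lambda>x\<in>carrier X. f x \<oplus>\<^bsub>Y\<^esub> g x) \<in> mor C X Y"
proof (rule morI[OF X])
  interpret Y: abelian_group Y by (rule grp[OF Y])
  show "(\<lambda>x\<in>carrier X. f x \<oplus>\<^bsub>Y\<^esub> g x) (x \<oplus>\<^bsub>X\<^esub> y)
      = (\<lambda>x\<in>carrier X. f x \<oplus>\<^bsub>Y\<^esub> g x) x \<oplus>\<^bsub>Y\<^esub> (\<lambda>x\<in>carrier X. f x \<oplus>\<^bsub>Y\<^esub> g x) y"
    if "x \<in> carrier X" "y \<in> carrier X" for x y
    using that by (simp add: X add_closed morD[OF f] morD[OF g] Y.a_ac)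
qed (auto simp: X Y add_closed op_closed op_add morD[OF f] morD[OF g])

lemma mor_comm_group:
  assumes X: "X \<in> Ob" and Y: "Y \<in> Ob" shows "comm_group (mor_group C X Y)"
proof -
  interpret Y: abelian_group Y by (rule grp[OF Y])
  show ?thesis
  proof (rule comm_groupI)
    fix f assume "f \<in> carrier (mor_group C X Y)"
    then have f: "f \<in> mor C X Y" by (simp add: mor_group_def)
    have o: "\<ominus>\<^bsub>Y\<^esub> d Y y = d Y (\<ominus>\<^bsub>Y\<^esub> y)" if "d \<in> Op" "y \<in> carrier Y" for d y
      using additive_map_minus[OF grp[OF Y] grp[OF Y] op[OF Y that(1)] that(2)] by simp
    have "(\<lambda>x\<in>carrier X. \<ominus>\<^bsub>Y\<^esub> f x) \<in> mor C X Y"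
      by (rule morI[OF X]) (auto simp: X add_closed op_closed morD[OF f] Y.minus_add o)
    then show "\<exists>g\<in>carrier (mor_group C X Y). g \<otimes>\<^bsub>mor_group C X Y\<^esub> f = \<one>\<^bsub>mor_group C X Y\<^esub>"
      by (intro bexI[of _ "\<lambda>x\<in>carrier X. \<ominus>\<^bsub>Y\<^esub> f x"])
        (auto simp: mor_group_def morD[OF f] Y.l_neg intro!: restrict_ext)
  next
    fix f assume "f \<in> carrier (mor_group C X Y)"
    then have f: "f \<in> mor C X Y" by (simp add: mor_group_def)
    show "\<one>\<^bsub>mor_group C X Y\<^esub> \<otimes>\<^bsub>mor_group C X Y\<^esub> f = f"
      unfolding mor_group_def
      using mor_eqI[OF sum_mor[OF X Y zero_mor[OF X Y] f] f] by (simp add: morD[OF f])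
  qed (auto simp: mor_group_def sum_mor zero_mor X Y morD Y.a_ac intro!: restrict_ext)
qed

lemma preadditive: "preadditive_category C"
proof (rule preadditive_category.intro, unfold cat_simps)
  show "(\<lambda>x\<in>carrier X. x) \<in> mor C X X" if "X \<in> Ob" for X
    using that by (intro morI) (auto simp: add_closed op_closed)
next
  fix X Y f assume "X \<in> Ob" "Y \<in> Ob" "f \<in> mor C X Y"
  then show "compose (carrier X) f (\<lambda>x\<in>carrier X. x) = f"
    using morD(1)[of f X Y] by (auto simp: compose_def fun_eq_iff extensional_def)
next
  fix X Y f assume f: "f \<in> mor C X Y"
  show "compose (carrier X) (\<lambda>y\<in>carrier Y. y) f = f"
    using morD(1,3)[OF f] by (auto simp: compose_def fun_eq_iff extensional_def)
next
  fix W X Y Z f g h assume "f \<in> mor C W X" "g \<in> mor C X Y" "h \<in> mor C Y Z"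
  then show "compose (carrier W) h (compose (carrier W) g f) = compose (carrier W) (compose (carrier X) h g) f"
    by (auto simp: compose_def fun_eq_iff morD)
next
  fix X Y Z :: "('m, 'x) ring_scheme" and f g g' assume "f \<in> mor C X Y"
  then show "compose (carrier X) (\<lambda>x\<in>carrier Y. g x \<oplus>\<^bsub>Z\<^esub> g' x) f
      = (\<lambda>x\<in>carrier X. compose (carrier X) g f x \<oplus>\<^bsub>Z\<^esub> compose (carrier X) g' f x)"
    by (auto simp: compose_def fun_eq_iff morD)
next
  fix X Y Z f f' g assume "f \<in> mor C X Y" "f' \<in> mor C X Y" "g \<in> mor C Y Z"
  then show "compose (carrier X) g (\<lambda>x\<in>carrier X. f x \<oplus>\<^bsub>Y\<^esub> f' x)
      = (\<lambda>x\<in>carrier X. compose (carrier X) g f x \<oplus>\<^bsub>Z\<^esub> compose (carrier X) g f' x)"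
    by (auto simp: compose_def fun_eq_iff morD)
next
  fix X Y Z f g assume "X \<in> Ob" "f \<in> mor C X Y" "g \<in> mor C Y Z"
  then show "compose (carrier X) g f \<in> mor C X Z" by (rule comp_mor)
next
  fix X Y assume "X \<in> Ob" "Y \<in> Ob"
  then show "comm_group (mor_group C X Y)" by (rule mor_comm_group)
qed

text \<open>The factorizations required by the universal properties exist as functions, by
  injectivity of \<open>f\<close> and surjectivity of \<open>g\<close>. They are morphisms because
  the equations to be checked can be tested after \<open>f\<close> or on elements
  \<open>g y\<close>.\<close>

lemma short_exactI:
  assumes X: "X \<in> Ob" and Y: "Y \<in> Ob" and Z: "Z \<in> Ob" and f: "f \<in> mor C X Y" and g: "g \<in> mor C Y Z"
    and inj: "inj_on f (carrier X)" and img: "f ` carrier X = {y \<in> carrier Y. g y = \<zero>\<^bsub>Z\<^esub>}"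
    and surj: "g ` carrier Y = carrier Z"
  shows "short_exact C X Y Z f g"
  unfolding short_exact_def
proof (intro conjI)
  have gf0: "g (f x) = \<zero>\<^bsub>Z\<^esub>" if "x \<in> carrier X" for x using that img by blast
  then have gf: "cmp C X Y Z g f = zerom C X Z" by (auto simp: compose_def fun_eq_iff)
  show "is_kernel C X Y Z f g"
    unfolding is_kernel_def
  proof (intro conjI f g gf ballI impI)
    fix W h assume "W \<in> obj C" and h: "h \<in> mor C W Y" and gh: "cmp C W Y Z g h = zerom C W Z"
    then have W: "W \<in> Ob" by simp
    have "g (h w) = \<zero>\<^bsub>Z\<^esub>" if "w \<in> carrier W" for w
      using gh that by (auto simp: compose_def dest!: fun_cong[of _ _ w])
    then have him: "h w \<in> f ` carrier X" if "w \<in> carrier W" for w using that img morD(3)[OF h] by blast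
    define k where "k = (\<lambda>w\<in>carrier W. inv_into (carrier X) f (h w))"
    have kX: "k w \<in> carrier X" and fk: "f (k w) = h w" if "w \<in> carrier W" for w
      using him[OF that] that by (auto simp: k_def inv_into_into f_inv_into_f)
    have uniq: "k w = x" if "w \<in> carrier W" "x \<in> carrier X" "f x = h w" for w x
      using inj fk[OF that(1)] kX[OF that(1)] that by (auto simp: inj_on_def)
    have "k \<in> mor C W X"
    proof (rule morI[OF W])
      show "k (v \<oplus>\<^bsub>W\<^esub> w) = k v \<oplus>\<^bsub>X\<^esub> k w" if "v \<in> carrier W" "w \<in> carrier W" for v w
        using that by (intro uniq) (auto simp: X W add_closed kX morD[OF f] morD[OF h] fk)
      show "k (d W w) = d X (k w)" if "d \<in> Op" "w \<in> carrier W" for d w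
        using that by (intro uniq) (auto simp: X W op_closed kX morD[OF f] morD[OF h] fk)
      show "k \<in> extensional (carrier W)" by (simp add: k_def)
    qed (rule kX)
    moreover have "cmp C W X Y f k = h"
      using morD(1)[OF h] fk by (auto simp: compose_def fun_eq_iff extensional_def)
    moreover have "k' = k" if k': "k' \<in> mor C W X" "cmp C W X Y f k' = h" for k'
    proof (rule mor_eqI[OF k'(1) \<open>k \<in> mor C W X\<close>])
      fix w assume w: "w \<in> carrier W"
      have "f (k' w) = h w" using fun_cong[OF k'(2), of w] w by (simp add: compose_def)
      then show "k' w = k w" using uniq[OF w morD(3)[OF k'(1) w]] by simp
    qed
    ultimately show "\<exists>!k. k \<in> mor C W X \<and> cmp C W X Y f k = h" by blast
  qed
  show "is_cokernel C X Y Z f g"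
    unfolding is_cokernel_def
  proof (intro conjI f g gf ballI impI)
    fix W h assume "W \<in> obj C" and h: "h \<in> mor C Y W" and hf: "cmp C X Y W h f = zerom C X W"
    then have W: "W \<in> Ob" by simp
    interpret Y: abelian_group Y by (rule grp[OF Y])
    interpret Z: abelian_group Z by (rule grp[OF Z])
    interpret W: abelian_group W by (rule grp[OF W])
    have hf0: "h (f x) = \<zero>\<^bsub>W\<^esub>" if "x \<in> carrier X" for x
      using hf that by (auto simp: compose_def dest!: fun_cong[of _ _ x])
    have wd: "h y = h y'" if y: "y \<in> carrier Y" "y' \<in> carrier Y" and eq: "g y = g y'" for y y'
    proof -
      have gm: "additive_map Y Z g" and hm: "additive_map Y W h"
        using morD(2)[OF g] morD(2)[OF h] equivariantD(1) by blast+
      have "g (y \<oplus>\<^bsub>Y\<^esub> \<ominus>\<^bsub>Y\<^esub> y') = \<zero>\<^bsub>Z\<^esub>"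
        using y eq by (simp add: morD[OF g] additive_map_minus[OF grp[OF Y] grp[OF Z] gm] Z.r_neg)
      then have "y \<oplus>\<^bsub>Y\<^esub> \<ominus>\<^bsub>Y\<^esub> y' \<in> f ` carrier X" using img y by simp
      then have "h (y \<oplus>\<^bsub>Y\<^esub> \<ominus>\<^bsub>Y\<^esub> y') = \<zero>\<^bsub>W\<^esub>" using hf0 by auto
      then have "h y \<oplus>\<^bsub>W\<^esub> \<ominus>\<^bsub>W\<^esub> h y' = \<zero>\<^bsub>W\<^esub>"
        using y by (simp add: morD[OF h] additive_map_minus[OF grp[OF Y] grp[OF W] hm])
      then show ?thesis
        using y W.minus_equality[of "h y" "\<ominus>\<^bsub>W\<^esub> h y'"] by (simp add: morD[OF h])
    qed
    define k where "k = (\<lambda>z\<in>carrier Z. h (inv_into (carrier Y) g z))"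
    have kg: "k (g y) = h y" if "y \<in> carrier Y" for y
    proof -
      have gy: "g y \<in> g ` carrier Y" using that by blast
      then have "h (inv_into (carrier Y) g (g y)) = h y"
        using that by (intro wd inv_into_into f_inv_into_f) auto
      then show ?thesis using morD(3)[OF g that] by (simp add: k_def)
    qed
    have "k \<in> mor C Z W"
    proof (rule morI[OF Z])
      show "k \<in> extensional (carrier Z)" by (simp add: k_def)
      show "k z \<in> carrier W" if "z \<in> carrier Z" for z
        using that kg morD(3)[OF h] by (auto simp: surj[symmetric])
      fix z assume "z \<in> carrier Z"
      then obtain y where y: "y \<in> carrier Y" "z = g y" using surj by blast
      show "k (d Z z) = d W (k z)" if "d \<in> Op" for d
        using that y kg[of "d Y y"] by (simp add: Y op_closed morD[OF g] morD[OF h] kg)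
      fix z' assume "z' \<in> carrier Z"
      then obtain y' where y': "y' \<in> carrier Y" "z' = g y'" using surj by blast
      show "k (z \<oplus>\<^bsub>Z\<^esub> z') = k z \<oplus>\<^bsub>W\<^esub> k z'"
        using y y' kg[of "y \<oplus>\<^bsub>Y\<^esub> y'"] by (simp add: morD[OF g] morD[OF h] kg)
    qed
    moreover have "cmp C Y Z W k g = h"
      using morD(1)[OF h] kg by (auto simp: compose_def fun_eq_iff extensional_def)
    moreover have "k' = k" if k': "k' \<in> mor C Z W" "cmp C Y Z W k' g = h" for k'
    proof (rule mor_eqI[OF k'(1) \<open>k \<in> mor C Z W\<close>])
      fix z assume "z \<in> carrier Z"
      then obtain y where y: "y \<in> carrier Y" "z = g y" using surj by blast
      have "k' (g y) = h y" using fun_cong[OF k'(2), of y] y by (simp add: compose_def)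
      then show "k' z = k z" using kg y by simp
    qed
    ultimately show "\<exists>!k. k \<in> mor C Z W \<and> cmp C Y Z W k g = h" by blast
  qed
qed (simp_all add: X Y Z)

text \<open>Each claim tests a universal property against one object. On the kernel of
  \<open>f\<close>, the inclusion and the zero map have the same composite with \<open>f\<close> and
  hence agree. The inclusion of the kernel of \<open>g\<close> factors through \<open>f\<close>. The
  quotient map of the cokernel of \<open>g\<close> and the zero map have the same composite with
  \<open>g\<close> and hence agree.\<close>

lemma short_exactD:
  assumes se: "short_exact C X Y Z f g"
    and ker: "\<And>X Y h. X \<in> Ob \<Longrightarrow> Y \<in> Ob \<Longrightarrow> equivariant X Y h \<Longrightarrow>
      \<exists>K\<in>Ob. carrier K = {x \<in> carrier X. h x = \<zero>\<^bsub>Y\<^esub>} \<and> equivariant K X (\<lambda>x. x)"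
    and coker: "\<And>X Y h. X \<in> Ob \<Longrightarrow> Y \<in> Ob \<Longrightarrow> equivariant X Y h \<Longrightarrow>
      \<exists>K\<in>Ob. \<exists>p. equivariant Y K p \<and> (\<forall>y\<in>carrier Y. p y = \<zero>\<^bsub>K\<^esub> \<longleftrightarrow> y \<in> h ` carrier X)"
  shows "inj_on f (carrier X)" "f ` carrier X = {y \<in> carrier Y. g y = \<zero>\<^bsub>Z\<^esub>}" "g ` carrier Y = carrier Z"
proof -
  have X: "X \<in> Ob" and Y: "Y \<in> Ob" and Z: "Z \<in> Ob" and k: "is_kernel C X Y Z f g" and c: "is_cokernel C X Y Z f g"
    using se unfolding short_exact_def by simp_all
  have f: "f \<in> mor C X Y" and g: "g \<in> mor C Y Z" and gf: "compose (carrier X) g f = (\<lambda>x\<in>carrier X. \<zero>\<^bsub>Z\<^esub>)"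
    using k unfolding is_kernel_def cat_simps by blast+
  show "inj_on f (carrier X)"
  proof (rule additive_map_inj_onI[OF grp[OF X] grp[OF Y] equivariantD(1)[OF morD(2)[OF f]]])
    fix x assume x: "x \<in> carrier X" "f x = \<zero>\<^bsub>Y\<^esub>"
    obtain K where K: "K \<in> Ob" "carrier K = {x \<in> carrier X. f x = \<zero>\<^bsub>Y\<^esub>}" "equivariant K X (\<lambda>x. x)"
      using ker[OF X Y morD(2)[OF f]] by blast
    define i where "i = restrict (\<lambda>x. x) (carrier K)"
    define o1 where "o1 = (\<lambda>x\<in>carrier K. \<zero>\<^bsub>X\<^esub>)"
    define h where "h = (\<lambda>x\<in>carrier K. \<zero>\<^bsub>Y\<^esub>)"
    have i: "i \<in> mor C K X" unfolding i_def by (rule restrict_mor[OF K(1,3)])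
    have o1: "o1 \<in> mor C K X" unfolding o1_def by (rule zero_mor[OF K(1) X])
    have h: "h \<in> mor C K Y" unfolding h_def by (rule zero_mor[OF K(1) Y])
    have "cmp C K Y Z g h = zerom C K Z"
      by (auto simp: compose_def fun_eq_iff h_def mor_zero[OF Y Z g])
    then have ex: "\<exists>!k. k \<in> mor C K X \<and> cmp C K X Y f k = h"
      by (intro is_kernelD[OF k _ h]) (simp_all add: K(1))
    have "cmp C K X Y f i = h" using K(2) by (auto simp: compose_def fun_eq_iff h_def i_def)
    moreover have "cmp C K X Y f o1 = h" by (auto simp: compose_def fun_eq_iff h_def o1_def mor_zero[OF X Y f])
    ultimately have "i = o1" using i o1 by - (rule ex1_eqI[OF ex], (rule conjI, assumption, assumption)+)
    then have "i x = o1 x" by simp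
    then show "x = \<zero>\<^bsub>X\<^esub>" using x K(2) by (simp add: i_def o1_def)
  qed
  show "f ` carrier X = {y \<in> carrier Y. g y = \<zero>\<^bsub>Z\<^esub>}"
  proof (intro equalityI subsetI)
    fix y assume "y \<in> f ` carrier X"
    then obtain x where x: "x \<in> carrier X" "y = f x" by blast
    then show "y \<in> {y \<in> carrier Y. g y = \<zero>\<^bsub>Z\<^esub>}"
      using fun_cong[OF gf, of x] morD(3)[OF f] by (simp add: compose_def)
  next
    fix y assume y: "y \<in> {y \<in> carrier Y. g y = \<zero>\<^bsub>Z\<^esub>}"
    obtain K where K: "K \<in> Ob" "carrier K = {y \<in> carrier Y. g y = \<zero>\<^bsub>Z\<^esub>}" "equivariant K Y (\<lambda>x. x)"
      using ker[OF Y Z morD(2)[OF g]] by blast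
    define i where "i = restrict (\<lambda>x. x) (carrier K)"
    have i: "i \<in> mor C K Y" unfolding i_def by (rule restrict_mor[OF K(1,3)])
    have "cmp C K Y Z g i = zerom C K Z" using K(2) by (auto simp: compose_def fun_eq_iff i_def)
    then have "\<exists>!u. u \<in> mor C K X \<and> cmp C K X Y f u = i"
      by (intro is_kernelD[OF k _ i]) (simp_all add: K(1))
    then obtain u where u: "u \<in> mor C K X" "cmp C K X Y f u = i" by (elim ex1E conjE) (rule that)
    have yK: "y \<in> carrier K" using y K(2) by simp
    have "f (u y) = y" using fun_cong[OF u(2), of y] yK by (simp add: compose_def i_def)
    then show "y \<in> f ` carrier X" using morD(3)[OF u(1) yK] by force
  qed
  show "g ` carrier Y = carrier Z"
  proof (intro equalityI subsetI)
    fix z assume z: "z \<in> carrier Z"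
    obtain K p where K: "K \<in> Ob" "equivariant Z K p" "\<And>z. z \<in> carrier Z \<Longrightarrow> p z = \<zero>\<^bsub>K\<^esub> \<longleftrightarrow> z \<in> g ` carrier Y"
      using coker[OF Y Z morD(2)[OF g]] by blast
    define p' where "p' = restrict p (carrier Z)"
    define o1 where "o1 = (\<lambda>x\<in>carrier Z. \<zero>\<^bsub>K\<^esub>)"
    define h where "h = (\<lambda>x\<in>carrier Y. \<zero>\<^bsub>K\<^esub>)"
    have p': "p' \<in> mor C Z K" unfolding p'_def by (rule restrict_mor[OF Z K(2)])
    have o1: "o1 \<in> mor C Z K" unfolding o1_def by (rule zero_mor[OF Z K(1)])
    have h: "h \<in> mor C Y K" unfolding h_def by (rule zero_mor[OF Y K(1)])
    have "cmp C X Y K h f = zerom C X K" by (auto simp: compose_def fun_eq_iff h_def morD(3)[OF f])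
    then have ex: "\<exists>!k. k \<in> mor C Z K \<and> cmp C Y Z K k g = h"
      by (intro is_cokernelD[OF c _ h]) (simp_all add: K(1))
    have "cmp C Y Z K p' g = h" using K(3) by (auto simp: compose_def fun_eq_iff h_def p'_def morD(3)[OF g])
    moreover have "cmp C Y Z K o1 g = h" by (auto simp: compose_def fun_eq_iff h_def o1_def morD(3)[OF g])
    ultimately have "p' = o1" using p' o1 by - (rule ex1_eqI[OF ex], (rule conjI, assumption, assumption)+)
    then have "p' z = o1 z" by simp
    then show "z \<in> g ` carrier Y" using z K(3) by (simp add: p'_def o1_def)
  qed (use morD(3)[OF g] in auto)
qed

end

section \<open>Exactness of base change on split sequences\<close>

lemma module_map_props:
  assumes "module_map R M N f"
  shows "additive_map M N f" "x \<in> carrier M \<Longrightarrow> f x \<in> carrier N"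
    "x \<in> carrier M \<Longrightarrow> y \<in> carrier M \<Longrightarrow> f (x \<oplus>\<^bsub>M\<^esub> y) = f x \<oplus>\<^bsub>N\<^esub> f y"
    "r \<in> carrier R \<Longrightarrow> x \<in> carrier M \<Longrightarrow> f (r \<odot>\<^bsub>M\<^esub> x) = r \<odot>\<^bsub>N\<^esub> f x"
  using assms by (auto simp: module_map_def additive_map_def)

lemma module_map_comp:
  assumes "module_map R M N f" "module_map R N P g" shows "module_map R M P (\<lambda>x. g (f x))"
  using module_map_props[OF assms(1)] module_map_props[OF assms(2)] by (auto simp: module_map_def additive_map_def)

lemma module_map_id: "module_map R M M (\<lambda>x. x)"
  by (auto simp: module_map_def additive_map_def)

lemma tmap_comp:
  assumes f: "tensor_functor R S h M N f" and g: "tensor_functor R S h N P g" and k: "tensor_functor R S h M P k"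
    and eq: "\<And>x. x \<in> carrier M \<Longrightarrow> k x = g (f x)" and u: "u \<in> carrier (tensor_group R S h M)"
  shows "tmap R S h M P k u = tmap R S h N P g (tmap R S h M N f u)"
proof -
  interpret f: tensor_functor R S h M N f by fact
  interpret g: tensor_functor R S h N P g by fact
  interpret k: tensor_functor R S h M P k by fact
  show ?thesis
    by (rule f.M.T_hom_eqI[of g.N.T "tmap R S h M P k" "\<lambda>u. tmap R S h N P g (tmap R S h M N f u)", OF g.N.T.is_group k.tmap_hom _ _ u])
      (auto simp: f.tmap_closed f.tmap_mult g.tmap_closed g.tmap_mult f.tmap_tens g.tmap_tens k.tmap_tens f.f_closed eq intro!: homI)
qed

lemma tmap_id:
  assumes k: "tensor_functor R S h M M k" and eq: "\<And>x. x \<in> carrier M \<Longrightarrow> k x = x" and u: "u \<in> carrier (tensor_group R S h M)"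
  shows "tmap R S h M M k u = u"
proof -
  interpret k: tensor_functor R S h M M k by fact
  show ?thesis
    by (rule k.M.T_hom_eqI[of k.M.T "tmap R S h M M k" "\<lambda>u. u", OF k.M.T.is_group k.tmap_hom _ _ u])
      (auto simp: k.tmap_tens eq intro!: homI)
qed

lemma tmap_add:
  assumes f: "tensor_functor R S h M N f" and g: "tensor_functor R S h M N g" and k: "tensor_functor R S h M N k"
    and eq: "\<And>x. x \<in> carrier M \<Longrightarrow> k x = f x \<oplus>\<^bsub>N\<^esub> g x" and u: "u \<in> carrier (tensor_group R S h M)"
  shows "tmap R S h M N k u = tmap R S h M N f u \<otimes>\<^bsub>tensor_group R S h N\<^esub> tmap R S h M N g u"
proof -
  interpret f: tensor_functor R S h M N f by fact
  interpret g: tensor_functor R S h M N g by fact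
  interpret k: tensor_functor R S h M N k by fact
  show ?thesis
    by (rule f.M.T_hom_eqI[of f.N.T "tmap R S h M N k", OF f.N.T.is_group k.tmap_hom
          hom_pointwise_mult[OF f.N.comm_group_T f.tmap_hom g.tmap_hom] _ u])
      (simp add: f.tmap_tens g.tmap_tens k.tmap_tens eq f.f_closed g.f_closed f.N.t_add_left)
qed

lemma tmap_zero:
  assumes k: "tensor_functor R S h M N k" and eq: "\<And>x. x \<in> carrier M \<Longrightarrow> k x = \<zero>\<^bsub>N\<^esub>" and u: "u \<in> carrier (tensor_group R S h M)"
  shows "tmap R S h M N k u = \<one>\<^bsub>tensor_group R S h N\<^esub>"
proof -
  interpret k: tensor_functor R S h M N k by fact
  show ?thesis
    by (rule k.M.T_hom_eqI[of k.N.T "tmap R S h M N k" "\<lambda>u. \<one>\<^bsub>k.N.T\<^esub>", OF k.N.T.is_group k.tmap_hom _ _ u])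
      (auto simp: k.tmap_tens eq k.N.t_zero intro!: homI)
qed

text \<open>A split sequence is described by the identities \<open>r f = 1\<close>,
  \<open>g s = 1\<close>, \<open>g f = 0\<close> and \<open>f r + s g = 1\<close>. An additive
  functor preserves them, and they imply exactness again.\<close>

lemma tensor_split_exact:
  assumes tp: "tensor_product R S h X" "tensor_product R S h Y" "tensor_product R S h Z"
    and f: "module_map R X Y f" and g: "module_map R Y Z g" and r: "module_map R Y X r" and s: "module_map R Z Y s"
    and rf: "\<And>x. x \<in> carrier X \<Longrightarrow> r (f x) = x" and gs: "\<And>z. z \<in> carrier Z \<Longrightarrow> g (s z) = z"
    and gf: "\<And>x. x \<in> carrier X \<Longrightarrow> g (f x) = \<zero>\<^bsub>Z\<^esub>" and split: "\<And>y. y \<in> carrier Y \<Longrightarrow> y = f (r y) \<oplus>\<^bsub>Y\<^esub> s (g y)"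
  shows "inj_on (tmap R S h X Y f) (carrier (tensor_group R S h X))"
    "tmap R S h X Y f ` carrier (tensor_group R S h X) = {u \<in> carrier (tensor_group R S h Y). tmap R S h Y Z g u = \<one>\<^bsub>tensor_group R S h Z\<^esub>}"
    "tmap R S h Y Z g ` carrier (tensor_group R S h Y) = carrier (tensor_group R S h Z)"
proof -
  note mc = module_map_comp and mi = module_map_id
  note tf = tensor_functor.intro[OF _ _ tensor_functor_axioms.intro]
  interpret f: tensor_functor R S h X Y f by (rule tf[OF tp(1,2) f])
  interpret g: tensor_functor R S h Y Z g by (rule tf[OF tp(2,3) g])
  interpret r: tensor_functor R S h Y X r by (rule tf[OF tp(2,1) r])
  interpret s: tensor_functor R S h Z Y s by (rule tf[OF tp(3,2) s])
  let ?f = "tmap R S h X Y f" and ?g = "tmap R S h Y Z g" and ?r = "tmap R S h Y X r" and ?s = "tmap R S h Z Y s"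
  have trf: "?r (?f u) = u" if u: "u \<in> carrier f.M.T" for u
    using tmap_comp[OF tf[OF tp(1,2) f] tf[OF tp(2,1) r] tf[OF tp(1,1) mi], of u] u rf
      tmap_id[OF tf[OF tp(1,1) mi] _ u] by simp
  have tgs: "?g (?s u) = u" if u: "u \<in> carrier g.N.T" for u
    using tmap_comp[OF tf[OF tp(3,2) s] tf[OF tp(2,3) g] tf[OF tp(3,3) mi], of u] u gs
      tmap_id[OF tf[OF tp(3,3) mi] _ u] by simp
  have tgf: "?g (?f u) = \<one>\<^bsub>g.N.T\<^esub>" if u: "u \<in> carrier f.M.T" for u
    using tmap_comp[OF tf[OF tp(1,2) f] tf[OF tp(2,3) g] tf[OF tp(1,3) mc[OF f g]], of u] u
      tmap_zero[OF tf[OF tp(1,3) mc[OF f g]] gf u] by simp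
  have tsp: "u = ?f (?r u) \<otimes>\<^bsub>f.N.T\<^esub> ?s (?g u)" if u: "u \<in> carrier f.N.T" for u
    using tmap_add[OF tf[OF tp(2,2) mc[OF r f]] tf[OF tp(2,2) mc[OF g s]] tf[OF tp(2,2) mi] split u]
      tmap_comp[OF tf[OF tp(2,1) r] tf[OF tp(1,2) f] tf[OF tp(2,2) mc[OF r f]] refl u]
      tmap_comp[OF tf[OF tp(2,3) g] tf[OF tp(3,2) s] tf[OF tp(2,2) mc[OF g s]] refl u]
      tmap_id[OF tf[OF tp(2,2) mi] refl u] by simp
  show "inj_on ?f (carrier f.M.T)" by (rule inj_on_inverseI[of _ ?r]) (rule trf)
  have s1: "?s \<one>\<^bsub>g.N.T\<^esub> = \<one>\<^bsub>f.N.T\<^esub>" by (rule hom_one[OF s.tmap_hom g.N.T.is_group f.N.T.is_group])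
  show "?f ` carrier f.M.T = {u \<in> carrier f.N.T. ?g u = \<one>\<^bsub>g.N.T\<^esub>}"
  proof (intro equalityI subsetI)
    fix u assume "u \<in> {u \<in> carrier f.N.T. ?g u = \<one>\<^bsub>g.N.T\<^esub>}"
    then have u: "u \<in> carrier f.N.T" "?g u = \<one>\<^bsub>g.N.T\<^esub>" by auto
    have "u = ?f (?r u)" using tsp[OF u(1)] u s1 by (simp add: f.tmap_closed r.tmap_closed)
    then show "u \<in> ?f ` carrier f.M.T" using r.tmap_closed[OF u(1)] by blast
  qed (auto simp: tgf f.tmap_closed)
  show "?g ` carrier f.N.T = carrier g.N.T"
  proof (intro equalityI subsetI)
    fix u assume u: "u \<in> carrier g.N.T"
    show "u \<in> ?g ` carrier f.N.T"
      by (rule image_eqI[of _ _ "?s u"]) (simp_all add: u tgs s.tmap_closed)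
  qed (auto simp: g.tmap_closed)
qed

text \<open>Lifting the basis vectors of \<open>Z\<close> along \<open>g\<close> and extending
  linearly gives \<open>s\<close>. What remains of \<open>y\<close> after subtracting
  \<open>s (g y)\<close> is killed by \<open>g\<close>, hence comes from a unique element of
  \<open>X\<close>, which defines \<open>r\<close>.\<close>

lemma free_quotient_splits:
  assumes X: "Module.module R X" and Y: "Module.module R Y" and Z: "Module.module R Z" and b: "module_basis R Z n e"
    and f: "module_map R X Y f" and g: "module_map R Y Z g"
    and inj: "inj_on f (carrier X)" and img: "f ` carrier X = {y \<in> carrier Y. g y = \<zero>\<^bsub>Z\<^esub>}"
    and surj: "g ` carrier Y = carrier Z"
  obtains r s where "module_map R Y X r" "module_map R Z Y s" "\<And>x. x \<in> carrier X \<Longrightarrow> r (f x) = x"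
    "\<And>z. z \<in> carrier Z \<Longrightarrow> g (s z) = z" "\<And>y. y \<in> carrier Y \<Longrightarrow> y = f (r y) \<oplus>\<^bsub>Y\<^esub> s (g y)"
proof -
  interpret X: Module.module R X by fact
  interpret Y: Module.module R Y by fact
  interpret Z: based_module R Z n e using Z b by (simp add: based_module_def based_module_axioms_def)
  note f = module_map_props[OF f] and g = module_map_props[OF g]
  define l where "l = (\<lambda>i. inv_into (carrier Y) g (e i))"
  have l: "l i \<in> carrier Y" "g (l i) = e i" if "i < n" for i
    using surj Z.e_closed[OF that] by (auto simp: l_def inv_into_into f_inv_into_f)
  define s where "s = (\<lambda>z. \<Oplus>\<^bsub>Y\<^esub>i\<in>{..<n}. Z.crd z i \<odot>\<^bsub>Y\<^esub> l i)"
  have sc: "s z \<in> carrier Y" if "z \<in> carrier Z" for z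
    unfolding s_def by (rule Y.M.finsum_closed) (use that l Z.crd_closed in auto)
  have s: "module_map R Z Y s"
    unfolding module_map_def additive_map_def
  proof (intro conjI ballI Pi_I)
    fix z w assume z: "z \<in> carrier Z" and w: "w \<in> carrier Z"
    have "s (z \<oplus>\<^bsub>Z\<^esub> w) = (\<Oplus>\<^bsub>Y\<^esub>i\<in>{..<n}. Z.crd z i \<odot>\<^bsub>Y\<^esub> l i \<oplus>\<^bsub>Y\<^esub> Z.crd w i \<odot>\<^bsub>Y\<^esub> l i)"
      unfolding s_def
      by (rule Y.M.finsum_cong') (use z w l Z.crd_closed in \<open>auto simp: Z.crd_add Y.smult_l_distr\<close>)
    also have "\<dots> = s z \<oplus>\<^bsub>Y\<^esub> s w"
      unfolding s_def by (rule Y.M.finsum_addf) (use z w l Z.crd_closed in auto)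
    finally show "s (z \<oplus>\<^bsub>Z\<^esub> w) = s z \<oplus>\<^bsub>Y\<^esub> s w" .
  next
    fix a z assume a: "a \<in> carrier R" and z: "z \<in> carrier Z"
    have "s (a \<odot>\<^bsub>Z\<^esub> z) = (\<Oplus>\<^bsub>Y\<^esub>i\<in>{..<n}. a \<odot>\<^bsub>Y\<^esub> (Z.crd z i \<odot>\<^bsub>Y\<^esub> l i))"
      unfolding s_def
      by (rule Y.M.finsum_cong') (use a z l Z.crd_closed in \<open>auto simp: Z.crd_smult Y.smult_assoc1\<close>)
    also have "\<dots> = a \<odot>\<^bsub>Y\<^esub> s z"
      unfolding s_def by (rule Y.finsum_smult_ldistr[symmetric]) (use a z l Z.crd_closed in auto)
    finally show "s (a \<odot>\<^bsub>Z\<^esub> z) = a \<odot>\<^bsub>Y\<^esub> s z" .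
  qed (rule sc)
  note sm = module_map_props[OF s]
  have gs: "g (s z) = z" if z: "z \<in> carrier Z" for z
  proof -
    have "g (s z) = (\<Oplus>\<^bsub>Z\<^esub>i\<in>{..<n}. g (Z.crd z i \<odot>\<^bsub>Y\<^esub> l i))"
      unfolding s_def
      by (rule additive_map_finsum[OF Y.abelian_group_axioms Z.M.abelian_group_axioms g(1)]) (use z l Z.crd_closed in auto)
    also have "\<dots> = (\<Oplus>\<^bsub>Z\<^esub>i\<in>{..<n}. Z.crd z i \<odot>\<^bsub>Z\<^esub> e i)"
      by (rule Z.M.finsum_cong') (use z l Z.crd_closed Z.e_closed in \<open>auto simp: g(4)\<close>)
    also have "\<dots> = z" by (rule Z.crd_sum[OF z])
    finally show ?thesis .
  qed
  define p where "p = (\<lambda>y. y \<oplus>\<^bsub>Y\<^esub> \<ominus>\<^bsub>Y\<^esub> s (g y))"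
  define r where "r = (\<lambda>y. inv_into (carrier X) f (p y))"
  have pc: "p y \<in> carrier Y" if "y \<in> carrier Y" for y using that by (simp add: p_def g sm)
  have gp: "g (p y) = \<zero>\<^bsub>Z\<^esub>" if "y \<in> carrier Y" for y
    using that additive_map_minus[OF Y.abelian_group_axioms Z.M.abelian_group_axioms g(1)]
    by (simp add: p_def g(2,3) sm(2) gs Z.M.r_neg)
  have pf: "p y \<in> f ` carrier X" if "y \<in> carrier Y" for y using pc gp img that by blast
  have rc: "r y \<in> carrier X" and fr: "f (r y) = p y" if "y \<in> carrier Y" for y
    unfolding r_def using pf[OF that] by (auto simp: inv_into_into f_inv_into_f)
  \<comment> \<open>Linearity of \<open>r\<close> follows from this uniqueness: the expected value
    only has to be mapped by \<open>f\<close> to the right element.\<close>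
  have ri: "r y = x" if "y \<in> carrier Y" "x \<in> carrier X" "f x = p y" for x y
    using inj fr[OF that(1)] rc[OF that(1)] that by (auto simp: inj_on_def)
  have r: "module_map R Y X r"
    unfolding module_map_def additive_map_def
  proof (intro conjI ballI Pi_I)
    fix y w assume y: "y \<in> carrier Y" and w: "w \<in> carrier Y"
    show "r (y \<oplus>\<^bsub>Y\<^esub> w) = r y \<oplus>\<^bsub>X\<^esub> r w"
      by (rule ri) (use y w in \<open>simp_all add: rc f(3) fr, simp add: p_def g(2,3) sm(2,3) Y.minus_add Y.M.a_ac\<close>)
  next
    fix a y assume a: "a \<in> carrier R" and y: "y \<in> carrier Y"
    show "r (a \<odot>\<^bsub>Y\<^esub> y) = a \<odot>\<^bsub>X\<^esub> r y"
      by (rule ri) (use a y in \<open>simp_all add: rc f(4) fr, simp add: p_def g(2,4) sm(2,4) Y.smult_r_distr Y.smult_r_minus\<close>)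
  qed (rule rc)
  have gf: "g (f x) = \<zero>\<^bsub>Z\<^esub>" if "x \<in> carrier X" for x using img that by blast
  have s0: "s \<zero>\<^bsub>Z\<^esub> = \<zero>\<^bsub>Y\<^esub>" by (rule additive_map_zero[OF Z.M.abelian_group_axioms Y.abelian_group_axioms sm(1)])
  have rf: "r (f x) = x" if "x \<in> carrier X" for x
    by (rule ri) (use that in \<open>simp_all add: f(2) p_def gf s0\<close>)
  have sp: "y = f (r y) \<oplus>\<^bsub>Y\<^esub> s (g y)" if "y \<in> carrier Y" for y
    using that by (simp add: fr p_def g(2) sm(2) Y.a_assoc Y.l_neg)
  show thesis by (rule that[OF r s rf gs sp])
qed

section \<open>The base change functor\<close>

lemma module_smult_additive:
  assumes "Module.module R M" "r \<in> carrier R" shows "additive_map M M (smult M r)"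
proof -
  interpret Module.module R M by fact
  show ?thesis using assms(2) by (auto simp: additive_map_def smult_r_distr)
qed

section \<open>The two categories as groups with operators\<close>

definition B_ops :: "('m B_object \<Rightarrow> 'm \<Rightarrow> 'm) set" where
  "B_ops = {nabla, sigma} \<union> (\<lambda>r M. smult M r) ` carrier hol_ring"

definition Vect_ops :: "real \<Rightarrow> ('e Vect_object \<Rightarrow> 'e \<Rightarrow> 'e) set" where
  "Vect_ops \<theta> = {nabla} \<union> (\<lambda>r M. smult M r) ` carrier (nc_torus \<theta>)"

lemma B_operator_category: "operator_category (B_objects q \<tau>) B_ops"
proof (rule operator_category.intro)
  fix X :: "'m B_object" assume X: "X \<in> B_objects q \<tau>"
  interpret Module.module hol_ring X by (rule B_objectD(1)[OF X])
  show "abelian_group X" by (rule abelian_group_axioms)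
  fix d :: "'m B_object \<Rightarrow> 'm \<Rightarrow> 'm" assume "d \<in> B_ops"
  then show "additive_map X X (d X)"
    using B_objectD(3,5)[OF X] module_smult_additive[OF B_objectD(1)[OF X]]
    by (auto simp: B_ops_def is_connection_def)
qed

interpretation B: operator_category "B_objects q \<tau>" B_ops for q \<tau> by (rule B_operator_category)

lemma B_equivariant_iff: "operator_category.equivariant B_ops X Y f \<longleftrightarrow> B_morphism X Y f"
  unfolding B.equivariant_def B_morphism_def module_map_def by (auto simp: B_ops_def)

lemma B_cat_eq: "B_cat q \<tau> = concrete_precat (B_objects q \<tau>) (operator_category.equivariant B_ops)"
  unfolding B_cat_def by (rule arg_cong[where f = "concrete_precat _"], intro ext)
    (simp add: B_equivariant_iff B_morphism_def)

lemma Vect_objectD: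
  assumes "E \<in> Vect_objects \<theta> \<tau>"
  shows "right_module (nc_torus \<theta>) E" "is_connection (nc_torus \<theta>) torus_const (torus_delta \<tau>) E (nabla E)"
  using assms by (auto simp: Vect_objects_def)

lemma Vect_operator_category: "operator_category (Vect_objects \<theta> \<tau>) (Vect_ops \<theta>)"
proof (rule operator_category.intro)
  fix X :: "'m Vect_object" assume X: "X \<in> Vect_objects \<theta> \<tau>"
  interpret right_module "nc_torus \<theta>" X by (rule Vect_objectD[OF X])
  show "abelian_group X" by (rule M.abelian_group_axioms)
  fix d :: "'m Vect_object \<Rightarrow> 'm \<Rightarrow> 'm" assume "d \<in> Vect_ops \<theta>"
  then show "additive_map X X (d X)"
    using Vect_objectD(2)[OF X] by (auto simp: Vect_ops_def is_connection_def additive_map_def rsmult_closed rsmult_r_distr)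
qed

interpretation Vect: operator_category "Vect_objects \<theta> \<tau>" "Vect_ops \<theta>" for \<theta> \<tau> by (rule Vect_operator_category)

lemma Vect_equivariant_iff: "operator_category.equivariant (Vect_ops \<theta>) X Y f \<longleftrightarrow>
    module_map (nc_torus \<theta>) X Y f \<and> (\<forall>x\<in>carrier X. f (nabla X x) = nabla Y (f x))"
  unfolding Vect.equivariant_def module_map_def by (auto simp: Vect_ops_def)

lemma Vect_cat_eq: "Vect_cat \<theta> \<tau> = concrete_precat (Vect_objects \<theta> \<tau>) (operator_category.equivariant (Vect_ops \<theta>))"
  unfolding Vect_cat_def by (rule arg_cong[where f = "concrete_precat _"], intro ext) (simp add: Vect_equivariant_iff)

lemma B_short_exact:
  fixes X Y Z :: "'m B_object"
  assumes \<tau>: "\<tau> \<noteq> 0" and q: "q \<noteq> 0" and se: "short_exact (B_cat q \<tau>) X Y Z f g"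
  shows "inj_on f (carrier X)" "f ` carrier X = {y \<in> carrier Y. g y = \<zero>\<^bsub>Z\<^esub>}" "g ` carrier Y = carrier Z"
proof -
  have k: "\<exists>K\<in>B_objects q \<tau>. carrier K = {x \<in> carrier X. h x = \<zero>\<^bsub>Y\<^esub>} \<and> operator_category.equivariant B_ops K X (\<lambda>x. x)"
    if "X \<in> B_objects q \<tau>" "Y \<in> B_objects q \<tau>" "operator_category.equivariant B_ops X Y h" for X Y :: "'m B_object" and h
    using kernel_cokernel_objects(1)[OF that(1,2) \<tau> q that(3)[unfolded B_equivariant_iff]] unfolding B_equivariant_iff by blast
  have c: "\<exists>K\<in>B_objects q \<tau>. \<exists>p. operator_category.equivariant B_ops Y K p \<and> (\<forall>y\<in>carrier Y. p y = \<zero>\<^bsub>K\<^esub> \<longleftrightarrow> y \<in> h ` carrier X)"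
    if "X \<in> B_objects q \<tau>" "Y \<in> B_objects q \<tau>" "operator_category.equivariant B_ops X Y h" for X Y :: "'m B_object" and h
    using kernel_cokernel_objects(2)[OF that(1,2) \<tau> q that(3)[unfolded B_equivariant_iff]] unfolding B_equivariant_iff .
  note D = B.short_exactD[OF se[unfolded B_cat_eq] k c]
  show "inj_on f (carrier X)" "f ` carrier X = {y \<in> carrier Y. g y = \<zero>\<^bsub>Z\<^esub>}" "g ` carrier Y = carrier Z"
    by (rule D; assumption)+
qed

section \<open>Base change along the homomorphism into the torus\<close>

lemma tensor_product_psi: "Module.module hol_ring M \<Longrightarrow> tensor_product hol_ring (nc_torus \<theta>) psi M"
  by (intro tensor_product.intro cring_hol_ring ring_nc_torus psi_ring_hom)

lemma tensor_functor_psi: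
  assumes "Module.module hol_ring M" "Module.module hol_ring N" "module_map hol_ring M N f"
  shows "tensor_functor hol_ring (nc_torus \<theta>) psi M N f"
  by (intro tensor_functor.intro tensor_functor_axioms.intro tensor_product_psi assms)

text \<open>Scaled by 2\<pi>i, the connection obeys the Leibniz rule for the equally scaled
  derivation of the holomorphic functions, and \<open>psi_delta\<close> says that \<open>psi\<close>
  carries this derivation to \<open>torus_delta\<close>.\<close>

lemma tensor_connection_psi:
  assumes M: "M \<in> B_objects q \<tau>"
  shows "tensor_connection hol_ring (nc_torus \<theta>) psi M (\<lambda>x. hol_const (2 * pi * \<i>) \<odot>\<^bsub>M\<^esub> nabla M x)
    (\<lambda>r. hol_const (2 * pi * \<i>) \<otimes>\<^bsub>hol_ring\<^esub> hol_delta \<tau> r) (torus_delta \<tau>)"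
proof (intro tensor_connection.intro tensor_product_psi tensor_connection_axioms.intro)
  show Mm: "Module.module hol_ring M" by (rule B_objectD(1)[OF M])
  interpret Module.module hol_ring M by (rule Mm)
  have nc: "nabla M x \<in> carrier M" and na: "nabla M (x \<oplus>\<^bsub>M\<^esub> y) = nabla M x \<oplus>\<^bsub>M\<^esub> nabla M y"
    and nl: "r \<in> carrier hol_ring \<Longrightarrow> nabla M (r \<odot>\<^bsub>M\<^esub> x) = (r \<odot>\<^bsub>M\<^esub> nabla M x) \<oplus>\<^bsub>M\<^esub> (hol_delta \<tau> r \<odot>\<^bsub>M\<^esub> x)"
    if "x \<in> carrier M" "y \<in> carrier M" for x y r
    using B_objectD(5)[OF M] that by (auto simp: is_connection_def additive_map_def)
  let ?c = "hol_const (2 * pi * \<i>)"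
  have c: "?c \<in> carrier hol_ring" by (rule hol_const_closed)
  show "?c \<odot>\<^bsub>M\<^esub> nabla M x \<in> carrier M" if "x \<in> carrier M" for x
    using that c nc by simp
  show "?c \<odot>\<^bsub>M\<^esub> nabla M (x \<oplus>\<^bsub>M\<^esub> y) = ?c \<odot>\<^bsub>M\<^esub> nabla M x \<oplus>\<^bsub>M\<^esub> ?c \<odot>\<^bsub>M\<^esub> nabla M y"
    if "x \<in> carrier M" "y \<in> carrier M" for x y
    using that c nc by (simp add: na smult_r_distr)
  show "?c \<otimes>\<^bsub>hol_ring\<^esub> hol_delta \<tau> r \<in> carrier hol_ring" if "r \<in> carrier hol_ring" for r
    using that c by (simp add: hol_delta_closed)
  show "?c \<odot>\<^bsub>M\<^esub> nabla M (r \<odot>\<^bsub>M\<^esub> x) = (r \<odot>\<^bsub>M\<^esub> (?c \<odot>\<^bsub>M\<^esub> nabla M x)) \<oplus>\<^bsub>M\<^esub> ((?c \<otimes>\<^bsub>hol_ring\<^esub> hol_delta \<tau> r) \<odot>\<^bsub>M\<^esub> x)"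
    if r: "r \<in> carrier hol_ring" and x: "x \<in> carrier M" for r x
  proof -
    have "?c \<odot>\<^bsub>M\<^esub> (r \<odot>\<^bsub>M\<^esub> nabla M x) = r \<odot>\<^bsub>M\<^esub> (?c \<odot>\<^bsub>M\<^esub> nabla M x)"
      using r x c nc hol.m_comm[OF c r] by (simp add: smult_assoc1[symmetric])
    then show ?thesis using r x c nc hol_delta_closed[OF r] nl[OF x x r] by (simp add: smult_r_distr smult_assoc1)
  qed
  show "torus_delta \<tau> (psi r) = psi (?c \<otimes>\<^bsub>hol_ring\<^esub> hol_delta \<tau> r)" if "r \<in> carrier hol_ring" for r
    using psi_delta[OF that] psi_mult[OF c hol_delta_closed[OF that]] by (simp add: psi_const torus_const_mult)
qed (auto simp: torus_delta_closed torus_delta_add torus_delta_mult)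

lemma psi_obj_simps:
  assumes "Module.module hol_ring M"
  shows "carrier (psi_obj \<theta> \<tau> M) = carrier (tensor_group hol_ring (nc_torus \<theta>) psi M)"
    "zero (psi_obj \<theta> \<tau> M) = \<one>\<^bsub>tensor_group hol_ring (nc_torus \<theta>) psi M\<^esub>"
    "add (psi_obj \<theta> \<tau> M) = monoid.mult (tensor_group hol_ring (nc_torus \<theta>) psi M)"
    "smult (psi_obj \<theta> \<tau> M) = tensor_product.sm hol_ring (nc_torus \<theta>) psi M"
  using tensor_product.base_change_simps[OF tensor_product_psi[OF assms]]
  by (simp_all add: psi_obj_def Let_def module.extend_def conn_module.fields_def)

lemma nabla_psi_obj:
  assumes "M \<in> B_objects q \<tau>"
  shows "nabla (psi_obj \<theta> \<tau> M)
    = tensor_connection.nab hol_ring (nc_torus \<theta>) psi M (\<lambda>x. hol_const (2 * pi * \<i>) \<odot>\<^bsub>M\<^esub> nabla M x) (torus_delta \<tau>)"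
  unfolding tensor_connection.nab_def[OF tensor_connection_psi[OF assms]]
  by (simp add: psi_obj_def Let_def module.extend_def conn_module.fields_def)

lemma psi_mor_eq: "psi_mor \<theta> M N f = tmap hol_ring (nc_torus \<theta>) psi M N f"
  unfolding psi_mor_def tmap_def ..

lemma psi_obj_in_Vect:
  assumes M: "M \<in> B_objects q \<tau>"
  shows "psi_obj \<theta> \<tau> M \<in> Vect_objects \<theta> \<tau>"
proof -
  interpret tensor_connection hol_ring "nc_torus \<theta>" psi M "\<lambda>x. hol_const (2 * pi * \<i>) \<odot>\<^bsub>M\<^esub> nabla M x"
    "\<lambda>r. hol_const (2 * pi * \<i>) \<otimes>\<^bsub>hol_ring\<^esub> hol_delta \<tau> r" "torus_delta \<tau>"
    by (rule tensor_connection_psi[OF M])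
  note E = psi_obj_simps[OF B_objectD(1)[OF M], of \<theta> \<tau>]
  obtain n e where b: "module_basis hol_ring M n e"
    using B_objectD(7)[OF M] unfolding regular_singular_def by blast
  interpret based_tensor hol_ring "nc_torus \<theta>" psi M n e
    using B_objectD(1)[OF M] b
    by (intro based_tensor.intro tensor_product_axioms based_module.intro based_module_axioms.intro)
  have "fg_projective (nc_torus \<theta>) (psi_obj \<theta> \<tau> M)" by (rule fg_projectiveI[OF E])
  moreover have "right_module (nc_torus \<theta>) (psi_obj \<theta> \<tau> M)" by (rule right_moduleI[OF E])
  moreover have "is_connection (nc_torus \<theta>) torus_const (torus_delta \<tau>) (psi_obj \<theta> \<tau> M) (nabla (psi_obj \<theta> \<tau> M))"
    unfolding nabla_psi_obj[OF M] by (rule is_connectionI[OF E torus_const_closed torus_delta_const])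
  ultimately show ?thesis unfolding Vect_objects_def by blast
qed

lemma psi_mor_in_Vect:
  assumes M: "M \<in> B_objects q \<tau>" and N: "N \<in> B_objects q \<tau>" and fB: "B_morphism M N f"
  shows "psi_mor \<theta> M N f \<in> mor (Vect_cat \<theta> \<tau>) (psi_obj \<theta> \<tau> M) (psi_obj \<theta> \<tau> N)"
proof -
  have fm: "module_map hol_ring M N f" using fB by (simp add: B_morphism_def)
  interpret tensor_functor hol_ring "nc_torus \<theta>" psi M N f
    by (rule tensor_functor_psi[OF B_objectD(1)[OF M] B_objectD(1)[OF N] fm])
  have nM: "nabla M x \<in> carrier M" if "x \<in> carrier M" for x
    using B_objectD(5)[OF M] that by (auto simp: is_connection_def additive_map_def)
  have fD: "f (hol_const (2 * pi * \<i>) \<odot>\<^bsub>M\<^esub> nabla M x) = hol_const (2 * pi * \<i>) \<odot>\<^bsub>N\<^esub> nabla N (f x)" if "x \<in> carrier M" for x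
  proof -
    have "f (nabla M x) = nabla N (f x)" using fB that unfolding B_morphism_def by blast
    then show ?thesis using that by (simp add: f_smult nM hol_const_closed)
  qed
  show ?thesis
    unfolding Vect_cat_eq Vect.mor_iff Vect_equivariant_iff module_map_def additive_map_def psi_mor_eq
      nabla_psi_obj[OF M] nabla_psi_obj[OF N] psi_obj_simps[OF B_objectD(1)[OF M]] psi_obj_simps[OF B_objectD(1)[OF N]]
    using tmap_extensional tmap_nab[OF tensor_connection_psi[OF M] tensor_connection_psi[OF N] fD]
    by (auto simp: tmap_closed tmap_mult tmap_sm)
qed

lemma psi_additive_functor:
  "additive_functor (B_cat q \<tau> :: ('m B_object, 'm \<Rightarrow> 'm) precat) (Vect_cat \<theta> \<tau>) (psi_obj \<theta> \<tau>) (psi_mor \<theta>)"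
proof (intro additive_functor.intro additive_functor_axioms.intro)
  show "preadditive_category (B_cat q \<tau> :: ('m B_object, 'm \<Rightarrow> 'm) precat)" unfolding B_cat_eq by (rule B.preadditive)
  show "preadditive_category (Vect_cat \<theta> \<tau> :: ('m psi_carrier Vect_object, 'm psi_carrier \<Rightarrow> 'm psi_carrier) precat)"
    unfolding Vect_cat_eq by (rule Vect.preadditive)
  fix X :: "'m B_object" assume "X \<in> obj (B_cat q \<tau>)"
  then have X: "X \<in> B_objects q \<tau>" by (simp add: B_cat_eq)
  note Xm = B_objectD(1)[OF X]
  \<comment> \<open>Identities and composites in the category are restricted functions; they remain
    linear because the carrier is closed under the module operations.\<close>
  have e: "module_map hol_ring A A' (restrict h (carrier A))"
    if "Module.module hol_ring A" "module_map hol_ring A A' h" for A A' :: "'m B_object" and h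
  proof -
    interpret Module.module hol_ring A by fact
    show ?thesis using that(2) by (auto simp: module_map_def additive_map_def)
  qed
  show "psi_obj \<theta> \<tau> X \<in> obj (Vect_cat \<theta> \<tau>)" using psi_obj_in_Vect[OF X] by (simp add: Vect_cat_eq)
  show "psi_mor \<theta> X X (idm (B_cat q \<tau>) X) = idm (Vect_cat \<theta> \<tau>) (psi_obj \<theta> \<tau> X)"
  proof -
    have t: "tensor_functor hol_ring (nc_torus \<theta>) psi X X (restrict (\<lambda>x. x) (carrier X))"
      by (rule tensor_functor_psi[OF Xm Xm e[OF Xm module_map_id]])
    show ?thesis
      unfolding psi_mor_eq B_cat_eq Vect_cat_eq B.cat_simps Vect.cat_simps psi_obj_simps[OF Xm]
      by (rule extensionalityI[OF tensor_functor.tmap_extensional[OF t] restrict_extensional])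
        (simp only: restrict_apply' tmap_id[OF t])
  qed
  fix Y :: "'m B_object" assume "Y \<in> obj (B_cat q \<tau>)"
  then have Y: "Y \<in> B_objects q \<tau>" by (simp add: B_cat_eq)
  note Ym = B_objectD(1)[OF Y]
  fix f assume f: "f \<in> mor (B_cat q \<tau>) X Y"
  then have f': "B_morphism X Y f" by (simp add: B_cat_eq B.mor_iff B_equivariant_iff)
  then have fm: "module_map hol_ring X Y f" by (simp add: B_morphism_def)
  show "psi_mor \<theta> X Y f \<in> mor (Vect_cat \<theta> \<tau>) (psi_obj \<theta> \<tau> X) (psi_obj \<theta> \<tau> Y)" by (rule psi_mor_in_Vect[OF X Y f'])
  note tf = tensor_functor_psi[OF Xm Ym fm, of \<theta>]
  show "psi_mor \<theta> X Y (addm (B_cat q \<tau>) X Y f g) = addm (Vect_cat \<theta> \<tau>) (psi_obj \<theta> \<tau> X) (psi_obj \<theta> \<tau> Y) (psi_mor \<theta> X Y f) (psi_mor \<theta> X Y g)"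
    if g: "g \<in> mor (B_cat q \<tau>) X Y" for g
  proof -
    have gm: "module_map hol_ring X Y g" using g by (simp add: B_cat_eq B.mor_iff B_equivariant_iff B_morphism_def)
    have "addm (B_cat q \<tau>) X Y f g \<in> mor (B_cat q \<tau>) X Y"
      using B.sum_mor[OF X Y f[unfolded B_cat_eq] g[unfolded B_cat_eq]] by (simp add: B_cat_eq)
    then have am: "module_map hol_ring X Y (addm (B_cat q \<tau>) X Y f g)"
      by (simp only: B_cat_eq B.mor_iff B_equivariant_iff B_morphism_def)
    have adx: "addm (B_cat q \<tau>) X Y f g x = f x \<oplus>\<^bsub>Y\<^esub> g x" if "x \<in> carrier X" for x
      using that by (simp add: B_cat_eq)
    note ta = tensor_functor_psi[OF Xm Ym am, of \<theta>] and tg = tensor_functor_psi[OF Xm Ym gm, of \<theta>]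
    show ?thesis
      unfolding psi_mor_eq Vect_cat_eq Vect.cat_simps psi_obj_simps[OF Xm] psi_obj_simps[OF Ym]
      by (rule extensionalityI[OF tensor_functor.tmap_extensional[OF ta] restrict_extensional])
        (simp only: restrict_apply' tmap_add[OF tf tg ta] adx)
  qed
  fix Z :: "'m B_object" assume "Z \<in> obj (B_cat q \<tau>)"
  then have Z: "Z \<in> B_objects q \<tau>" by (simp add: B_cat_eq)
  note Zm = B_objectD(1)[OF Z]
  fix g assume g: "g \<in> mor (B_cat q \<tau>) Y Z"
  then have gm: "module_map hol_ring Y Z g" by (simp add: B_cat_eq B.mor_iff B_equivariant_iff B_morphism_def)
  have km: "module_map hol_ring X Z (compose (carrier X) g f)"
    using e[OF Xm module_map_comp[OF fm gm]] by (simp add: compose_def)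
  note tg = tensor_functor_psi[OF Ym Zm gm, of \<theta>] and tk = tensor_functor_psi[OF Xm Zm km, of \<theta>]
  show "psi_mor \<theta> X Z (cmp (B_cat q \<tau>) X Y Z g f)
      = cmp (Vect_cat \<theta> \<tau>) (psi_obj \<theta> \<tau> X) (psi_obj \<theta> \<tau> Y) (psi_obj \<theta> \<tau> Z) (psi_mor \<theta> Y Z g) (psi_mor \<theta> X Y f)"
    unfolding psi_mor_eq B_cat_eq B.cat_simps Vect_cat_eq Vect.cat_simps psi_obj_simps[OF Xm]
    by (rule extensionalityI[OF tensor_functor.tmap_extensional[OF tk] compose_extensional])
      (simp only: compose_eq tmap_comp[OF tf tg tk])
qed

lemma psi_preserves_short_exact:
  fixes X Y Z :: "'m B_object"
  assumes \<tau>: "\<tau> \<noteq> 0" and q: "q \<noteq> 0" and se: "short_exact (B_cat q \<tau>) X Y Z f g"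
  shows "short_exact (Vect_cat \<theta> \<tau>) (psi_obj \<theta> \<tau> X) (psi_obj \<theta> \<tau> Y) (psi_obj \<theta> \<tau> Z) (psi_mor \<theta> X Y f) (psi_mor \<theta> Y Z g)"
proof -
  have X: "X \<in> B_objects q \<tau>" and Y: "Y \<in> B_objects q \<tau>" and Z: "Z \<in> B_objects q \<tau>"
    and f: "B_morphism X Y f" and g: "B_morphism Y Z g"
    using se by (simp_all add: short_exact_def is_kernel_def B_cat_eq B.mor_iff B_equivariant_iff)
  note m = B_objectD(1)[OF X] B_objectD(1)[OF Y] B_objectD(1)[OF Z]
  have fm: "module_map hol_ring X Y f" and gm: "module_map hol_ring Y Z g" using f g by (simp_all add: B_morphism_def)
  note ex = B_short_exact[OF \<tau> q se]
  obtain n e where b: "module_basis hol_ring Z n e"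
    using B_objectD(7)[OF Z] unfolding regular_singular_def by blast
  obtain r s where rs: "module_map hol_ring Y X r" "module_map hol_ring Z Y s" "\<And>x. x \<in> carrier X \<Longrightarrow> r (f x) = x"
    "\<And>z. z \<in> carrier Z \<Longrightarrow> g (s z) = z" "\<And>y. y \<in> carrier Y \<Longrightarrow> y = f (r y) \<oplus>\<^bsub>Y\<^esub> s (g y)"
    by (rule free_quotient_splits[OF m b fm gm ex]) (rule that)
  have gf: "g (f x) = \<zero>\<^bsub>Z\<^esub>" if "x \<in> carrier X" for x using ex(2) that by blast
  note tex = tensor_split_exact[OF tensor_product_psi[OF m(1)] tensor_product_psi[OF m(2)] tensor_product_psi[OF m(3)] fm gm rs(1,2,3,4) gf rs(5)]
  show ?thesis
    unfolding Vect_cat_eq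
  proof (rule Vect.short_exactI[OF psi_obj_in_Vect[OF X] psi_obj_in_Vect[OF Y] psi_obj_in_Vect[OF Z]
        psi_mor_in_Vect[OF X Y f, unfolded Vect_cat_eq] psi_mor_in_Vect[OF Y Z g, unfolded Vect_cat_eq]];
      unfold psi_mor_eq psi_obj_simps[OF m(1)] psi_obj_simps[OF m(2)] psi_obj_simps[OF m(3)])
    show "inj_on (tmap hol_ring (nc_torus \<theta>) psi X Y f) (carrier (tensor_group hol_ring (nc_torus \<theta>) psi X))"
      by (rule tex(1))
  qed (rule tex(2) tex(3); assumption?)+
qed

lemma psi_faithful: "faithful_functor (B_cat q \<tau> :: ('m B_object, 'm \<Rightarrow> 'm) precat) (psi_mor \<theta>)"
  unfolding faithful_functor_def
proof (intro ballI inj_onI)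
  fix X Y :: "'m B_object" and f g
  assume "X \<in> obj (B_cat q \<tau>)" "Y \<in> obj (B_cat q \<tau>)" and f: "f \<in> mor (B_cat q \<tau>) X Y" and g: "g \<in> mor (B_cat q \<tau>) X Y"
    and eq: "psi_mor \<theta> X Y f = psi_mor \<theta> X Y g"
  then have X: "X \<in> B_objects q \<tau>" and Y: "Y \<in> B_objects q \<tau>" by (simp_all add: B_cat_eq)
  note Xm = B_objectD(1)[OF X] and Ym = B_objectD(1)[OF Y]
  have fm: "module_map hol_ring X Y f" and gm: "module_map hol_ring X Y g"
    using f g by (simp_all add: B_cat_eq B.mor_iff B_equivariant_iff B_morphism_def)
  interpret f: tensor_functor hol_ring "nc_torus \<theta>" psi X Y f by (rule tensor_functor_psi[OF Xm Ym fm])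
  interpret g: tensor_functor hol_ring "nc_torus \<theta>" psi X Y g by (rule tensor_functor_psi[OF Xm Ym gm])
  obtain n e where b: "module_basis hol_ring Y n e"
    using B_objectD(7)[OF Y] unfolding regular_singular_def by blast
  interpret b: based_tensor hol_ring "nc_torus \<theta>" psi Y n e
    using Ym b by (intro based_tensor.intro f.N.tensor_product_axioms based_module.intro based_module_axioms.intro)
  interpret A: Ring.ring "nc_torus \<theta>" by (rule ring_nc_torus)
  show "f = g"
  proof (rule B.mor_eqI[OF f[unfolded B_cat_eq] g[unfolded B_cat_eq]])
    fix x assume x: "x \<in> carrier X"
    show "f x = g x"
    proof (rule b.tens_one_inj[OF psi_inj])
      \<comment> \<open>The two base-changed maps are compared on the pure tensor of
        \<open>x\<close> with the unit, and the target has a basis, so \<open>tens_one_inj\<close>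
        recovers the values.\<close>
      have "f.N.t (f x) \<one>\<^bsub>nc_torus \<theta>\<^esub> = psi_mor \<theta> X Y f (f.M.t x \<one>\<^bsub>nc_torus \<theta>\<^esub>)"
        using x by (simp add: psi_mor_eq f.tmap_tens)
      also have "\<dots> = f.N.t (g x) \<one>\<^bsub>nc_torus \<theta>\<^esub>"
        unfolding eq using x by (simp add: psi_mor_eq g.tmap_tens)
      finally show "f.N.t (f x) \<one>\<^bsub>nc_torus \<theta>\<^esub> = f.N.t (g x) \<one>\<^bsub>nc_torus \<theta>\<^esub>" .
    qed (use x f.f_closed g.f_closed in auto)
  qed
qed

theorem corollary10:
  fixes \<theta> :: real and q \<tau> :: complex
  assumes "\<theta> \<notin> \<rat>"
    and "q = exp (2 * pi * \<i> * \<theta>)"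
    and "Im \<tau> < 0"
  shows "exact_functor (B_cat q \<tau> :: ('m B_object, 'm \<Rightarrow> 'm) precat)
           (Vect_cat \<theta> \<tau>) (psi_obj \<theta> \<tau>) (psi_mor \<theta>) \<and>
         faithful_functor (B_cat q \<tau> :: ('m B_object, 'm \<Rightarrow> 'm) precat) (psi_mor \<theta>)"
proof -
  have "\<tau> \<noteq> 0" "q \<noteq> 0" using assms by auto
  then show ?thesis
    unfolding exact_functor_def using psi_additive_functor psi_preserves_short_exact psi_faithful by blast
qed

end
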